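(* Let $A\to M$ be a Lie algebroid, let $\nabla$ be a torsion-free homogeneous covariant derivative on (the total space of) $A^*$, and let $B\in\Gamma^\infty(\Lambda^2A^* )$ be $\mathrm{d}_A$-closed. Define bidifferential operators on $A^*$ recursively by $$C_1:=\tfrac{\mathrm i}{2}\{\cdot,\cdot\}_{KKS},\qquad C_2:=-\tfrac14\bigl(H_\nabla[C_1,C_1]\bigr)^+ +\mathrm{hkr}(B^{\mathrm{ver}}),\qquad C_r:=-\tfrac12 H_\nabla\Bigl(\sum_{\ell=1}^{r-1}[C_\ell,C_{r-\ell}]\Bigr)\quad (r\ge 3).$$ Then $\star_{(\nabla,B)}:=\mu_0+\sum_{r=1}^\infty\hbar^rC_r$ is a homogeneous star product on $A^*$.
   Context: $C^\infty(X)$ denotes smooth complex-valued functions and $\mu_0$ the pointwise product. A star product on a manifold $X$ is an associative $\mathbb C[[\hbar]]$-bilinear product $\star=\mu_0+\sum_{r\ge1}\hbar^rC_r$ on $C^\infty(X)[[\hbar]]$ with $C_r$ bidifferential operators and $f\star1=f=1\star f$. Hochschild complex: for $n\ge0$, $HC^n_{\mathrm{diff}}(X)$ is the space of $(n+1)$-ary polydifferential operators on $C^\infty(X)$ that vanish if one argument is constant; $HC^{-1}_{\mathrm{diff}}(X)=C^\infty(X)$. For $D$ of degree $|D|$ and $E$ of degree $|E|$, $D\circ E(f_0,\dots)=\sum_{i=0}^{|D|}(-1)^{i|E|}D(f_0,\dots,f_{i-1},E(f_i,\dots,f_{i+|E|}),f_{i+|E|+1},\dots)$ and $[D,E]=(-1)^{|D||E|}\bigl(D\circ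 E-(-1)^{|D||E|}E\circ D\bigr)$; the differential is $\partial=[\mu_0,\cdot]$. For a bidifferential operator, $D^+(f,g)=D(f,g)+D(g,f)$. The map $\mathrm{hkr}$ sends multivector fields to polydifferential operators: $\mathrm{hkr}(X_0\wedge\dots\wedge X_k)(f_0,\dots,f_k)=\frac1{(k+1)!}\sum_{\sigma\in S_{k+1}}\mathrm{sign}(\sigma)X_{\sigma(0)}(f_0)\cdots X_{\sigma(k)}(f_k)$. Homogeneity: on a vector bundle $E$, the Euler vector field $\mathcal E$ is the generator of $e\mapsto \mathrm e^te$. A polydifferential operator $D$ is homogeneous of degree $k$ if $[\mathcal L_{\mathcal E},D]=kD$; a multivector field $X$ is if $\mathcal L_{\mathcal E}X=kX$. A star product is homogeneous if each $C_r$ is homogeneous of degree $-r$. A covariant derivative $\nabla$ on $TE$ is homogeneous if $\mathcal L_{\mathcal E}(\nabla_XY)=\nabla_{\mathcal L_{\mathcal E}X}Y+\nabla_X(\mathcal L_{\mathcal E}Y)$ for all vector fields $X,Y$ on $E$. For a torsion-free homogeneous $\nabla$, $\mathrm{hkr}^{-1}_\nabla\colon HC^\bullet_{\mathrm{diff}}(E)\to\mathfrak X^{\bullet+1}(E)$ and $H_\nabla\colon HC^\bullet_{\mathrm{diff}}(E)\to HC^{\bullet-1}_{\mathrm{diff}}(E)$ denote the linear maps furnished by the Hochschild–Kostant–Rosenberg theorem: they satisfy $\mathrm{hkr}^{-1}_\nabla\circ\mathrm{hkr}=\mathrm{id}$ and $\partial H_\nabla+H_\nabla\partial=\mathrm{id}-\mathrm{hkr}\circ\mathrm{hkr}_\nabla^{-1}$,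 and preserve the degrees of homogeneity. Lie algebroid: $A\to M$ with anchor $\rho_A$ and bracket $[\cdot,\cdot]_A$. Forms (sections of $\Lambda^kA^*$) are complex-valued, and $\mathrm d_A$ is the Lie algebroid differential $(\mathrm d_A\alpha)(s_1,\dots,s_{k+1})=\sum_i(-1)^{i+1}\rho_A(s_i)\alpha(\dots,\widehat{s_i},\dots)+\sum_{i<j}(-1)^{i+j}\alpha([s_i,s_j]_A,\dots,\widehat{s_i},\dots,\widehat{s_j},\dots)$. With $\mathrm{pr}\colon A^*\to M$ and $\mathcal J(s)(\xi)=\xi(s)$ for $s\in\Gamma^\infty(A)$, the linear Poisson bracket on $A^*$ is determined by $\{\mathrm{pr}^*f,\mathrm{pr}^*g\}_{KKS}=0$, $\{\mathcal J(s),\mathcal J(t)\}_{KKS}=-\mathcal J([s,t]_A)$, $\{\mathrm{pr}^*f,\mathcal J(s)\}_{KKS}=\mathrm{pr}^*(\rho_A(s)f)$. For $\alpha\in\Gamma^\infty(A^* )$, $\alpha^{\mathrm{ver}}$ is the vertical vector field on $A^*$, $\alpha^{\mathrm{ver}}(\xi)=\frac{d}{dt}|_{t=0}(\xi+t\alpha)$, extended (complex-linearly and) multiplicatively to $\Lambda^\bullet$ with $(fB)^{\mathrm{ver}}=\mathrm{pr}^*f\,B^{\mathrm{ver}}$. *)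

theory Defs
  imports
    "HOL-Analysis.Analysis"
    "HOL-Combinatorics.Permutations"
    "HOL-Computational_Algebra.Formal_Power_Series"
    "HOL-Library.Function_Algebras"
begin

text \<open>Throughout, \<open>0\<close>, \<open>+\<close>, \<open>-\<close>, \<open>*\<close> and finite sums of functions (and of operators between
  function spaces) are the pointwise ones of \<open>Function_Algebras\<close>.\<close>


section \<open>Smooth manifolds\<close>

subsection \<open>Smooth functions on open subsets of Euclidean space\<close>

text \<open>\<open>Euclidean_space n\<close> consists of the \<open>y :: nat \<Rightarrow> real\<close> with \<open>y i = 0\<close> for \<open>i \<ge> n\<close>; the case
  \<open>n = 0\<close> is a one-point space, so that zero-dimensional manifolds are included.\<close>

primrec Ck_on :: "nat \<Rightarrow> nat \<Rightarrow> (nat \<Rightarrow> real) set \<Rightarrow> ((nat \<Rightarrow> real) \<Rightarrow> 'b::real_normed_vector) \<Rightarrow> bool"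
where
  "Ck_on n 0 V f \<longleftrightarrow> continuous_map (subtopology (Euclidean_space n) V) euclidean f"
| "Ck_on n (Suc k) V f \<longleftrightarrow>
     continuous_map (subtopology (Euclidean_space n) V) euclidean f \<and>
     (\<forall>i<n. \<exists>g. Ck_on n k V g \<and>
        (\<forall>y\<in>V. ((\<lambda>t. f (y(i := t))) has_vector_derivative g y) (at (y i))))"

definition C_infinity_on :: "nat \<Rightarrow> (nat \<Rightarrow> real) set \<Rightarrow> ((nat \<Rightarrow> real) \<Rightarrow> 'b::real_normed_vector) \<Rightarrow> bool"
  where "C_infinity_on n V f \<longleftrightarrow> (\<forall>k. Ck_on n k V f)"

subsection \<open>Manifolds\<close>

type_synonym 'p chart = "'p set \<times> ('p \<Rightarrow> nat \<Rightarrow> real)"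

record 'p mfd =
  pts :: "'p set"
  mdim :: nat
  atlas :: "'p chart set"

definition mfd_topology :: "'p mfd \<Rightarrow> 'p topology"
  where "mfd_topology X = topology_generated_by
    {W. \<exists>(U, \<phi>)\<in>atlas X. W \<subseteq> U \<and> openin (Euclidean_space (mdim X)) (\<phi> ` W)}"

definition smooth_manifold :: "'p mfd \<Rightarrow> bool"
  where "smooth_manifold X \<longleftrightarrow>
    (\<Union>(U, \<phi>)\<in>atlas X. U) = pts X \<and>
    (\<forall>(U, \<phi>)\<in>atlas X. inj_on \<phi> U \<and> openin (Euclidean_space (mdim X)) (\<phi> ` U)) \<and>
    (\<forall>(U, \<phi>)\<in>atlas X. \<forall>(V, \<psi>)\<in>atlas X.
       openin (Euclidean_space (mdim X)) (\<phi> ` (U \<inter> V)) \<and>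
       (\<forall>i<mdim X. C_infinity_on (mdim X) (\<phi> ` (U \<inter> V)) (\<lambda>y. \<psi> (inv_into U \<phi> y) i))) \<and>
    Hausdorff_space (mfd_topology X) \<and>
    second_countable (mfd_topology X)"

definition smooth_on :: "'p mfd \<Rightarrow> 'p set \<Rightarrow> ('p \<Rightarrow> 'b::real_normed_vector) \<Rightarrow> bool"
  where "smooth_on X W f \<longleftrightarrow>
    (\<forall>(U, \<phi>)\<in>atlas X. C_infinity_on (mdim X) (\<phi> ` (U \<inter> W)) (\<lambda>y. f (inv_into U \<phi> y)))"

text \<open>Smooth functions are extended by \<open>0\<close> outside the manifold, so that equality of HOL functions is
  equality on the manifold. The codomain is \<^typ>\<open>real\<close> or \<^typ>\<open>complex\<close>.\<close>

definition Cinf :: "'p mfd \<Rightarrow> ('p \<Rightarrow> 'b::real_normed_vector) set"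
  where "Cinf X = {f. smooth_on X (pts X) f \<and> (\<forall>p. p \<notin> pts X \<longrightarrow> f p = 0)}"

definition const_fun :: "'p mfd \<Rightarrow> 'b::zero \<Rightarrow> 'p \<Rightarrow> 'b"
  where "const_fun X c = (\<lambda>p. if p \<in> pts X then c else 0)"

definition scal :: "'b::times \<Rightarrow> ('p \<Rightarrow> 'b) \<Rightarrow> 'p \<Rightarrow> 'b"
  where "scal c f = (\<lambda>p. c * f p)"

subsection \<open>Real vector fields and covariant derivatives\<close>

text \<open>Vector fields are identified with the derivations of the algebra of smooth functions.\<close>

type_synonym 'p vfield = "('p \<Rightarrow> real) \<Rightarrow> ('p \<Rightarrow> real)"

definition vector_fields :: "'p mfd \<Rightarrow> 'p vfield set"
  where "vector_fields X = {V.
    (\<forall>f\<in>Cinf X. V f \<in> Cinf X) \<and> (\<forall>f. f \<notin> Cinf X \<longrightarrow> V f = 0) \<and>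
    (\<forall>f\<in>Cinf X. \<forall>g\<in>Cinf X. \<forall>c. V (f + g) = V f + V g \<and> V (scal c f) = scal c (V f) \<and>
       V (f * g) = f * V g + g * V f)}"

definition vf_bracket :: "'p vfield \<Rightarrow> 'p vfield \<Rightarrow> 'p vfield"
  where "vf_bracket V W = (\<lambda>f. V (W f) - W (V f))"

type_synonym 'p connection = "'p vfield \<Rightarrow> 'p vfield \<Rightarrow> 'p vfield"

definition covariant_derivative :: "'p mfd \<Rightarrow> 'p connection \<Rightarrow> bool"
  where "covariant_derivative X nabla \<longleftrightarrow>
    (\<forall>V\<in>vector_fields X. \<forall>W\<in>vector_fields X. nabla V W \<in> vector_fields X \<and>
      (\<forall>V'\<in>vector_fields X. nabla (V + V') W = nabla V W + nabla V' W) \<and>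
      (\<forall>W'\<in>vector_fields X. nabla V (W + W') = nabla V W + nabla V W') \<and>
      (\<forall>f\<in>Cinf X. nabla (\<lambda>h. f * V h) W = (\<lambda>h. f * nabla V W h) \<and>
                  nabla V (\<lambda>h. f * W h) = (\<lambda>h. V f * W h + f * nabla V W h)))"

definition torsion_free :: "'p mfd \<Rightarrow> 'p connection \<Rightarrow> bool"
  where "torsion_free X nabla \<longleftrightarrow>
    (\<forall>V\<in>vector_fields X. \<forall>W\<in>vector_fields X. nabla V W - nabla W V = vf_bracket V W)"


section \<open>Polydifferential operators and the Hochschild complex\<close>

text \<open>An \<open>a\<close>-ary operator takes the list of its \<open>a\<close> arguments and is \<open>0\<close> on all lists that are not
  argument lists. A \<open>0\<close>-ary operator is thus a function, sitting at the empty list.\<close>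

type_synonym 'p oper = "('p \<Rightarrow> complex) list \<Rightarrow> 'p \<Rightarrow> complex"

definition args :: "'p mfd \<Rightarrow> nat \<Rightarrow> ('p \<Rightarrow> complex) list set"
  where "args X a = {fs. length fs = a \<and> set fs \<subseteq> Cinf X}"

definition scale_op :: "complex \<Rightarrow> 'p oper \<Rightarrow> 'p oper"
  where "scale_op c D = (\<lambda>fs p. c * D fs p)"

definition multilinear_ops :: "'p mfd \<Rightarrow> nat \<Rightarrow> 'p oper set"
  where "multilinear_ops X a = {D.
    (\<forall>fs\<in>args X a. D fs \<in> Cinf X) \<and> (\<forall>fs. fs \<notin> args X a \<longrightarrow> D fs = 0) \<and>
    (\<forall>fs\<in>args X a. \<forall>j<a. \<forall>f\<in>Cinf X. \<forall>g\<in>Cinf X. \<forall>c.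
       D (fs[j := f + g]) = D (fs[j := f]) + D (fs[j := g]) \<and>
       D (fs[j := scal c f]) = scal c (D (fs[j := f])))}"

text \<open>Polydifferential operators in the algebraic sense: the operator \<open>D\<close> has order at most \<open>N\<close> in
  its \<open>j\<close>-th argument iff every \<open>N + 1\<close>-fold iterated commutator in the \<open>j\<close>-th slot with
  multiplications by smooth functions vanishes.\<close>

definition mult_commutator :: "nat \<Rightarrow> ('p \<Rightarrow> complex) \<Rightarrow> 'p oper \<Rightarrow> 'p oper"
  where "mult_commutator j g D = (\<lambda>fs. g * D fs - D (fs[j := g * fs ! j]))"

definition polydiff_ops :: "'p mfd \<Rightarrow> nat \<Rightarrow> 'p oper set"
  where "polydiff_ops X a = {D \<in> multilinear_ops X a.
    \<exists>N. \<forall>j<a. \<forall>gs\<in>args X (N + 1). \<forall>fs\<in>args X a. foldr (mult_commutator j) gs D fs = 0}"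

text \<open>The degree \<open>k\<close> of a cochain is one less than its arity; there is nothing below degree \<open>-1\<close>.\<close>

definition HC :: "'p mfd \<Rightarrow> int \<Rightarrow> 'p oper set"
  where "HC X k = (if k < -1 then {0} else
    {D \<in> polydiff_ops X (nat (k + 1)).
       \<forall>fs. (\<exists>f\<in>set fs. \<exists>c. f = const_fun X c) \<longrightarrow> D fs = 0})"

definition mu0 :: "'p mfd \<Rightarrow> 'p oper"
  where "mu0 X = (\<lambda>fs. if fs \<in> args X 2 then fs ! 0 * fs ! 1 else 0)"

text \<open>In \<open>gcomp d e D E\<close> and \<open>gbracket d e D E\<close>, \<open>d\<close> and \<open>e\<close> are the degrees of \<open>D\<close> and \<open>E\<close>.\<close>

definition gcomp :: "int \<Rightarrow> int \<Rightarrow> 'p oper \<Rightarrow> 'p oper \<Rightarrow> 'p oper"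
  where "gcomp d e D E = (\<lambda>fs. if int (length fs) = d + e + 1
    then (\<Sum>i<nat (d + 1). scal ((-1) powi (int i * e))
       (D (take i fs @ [E (take (nat (e + 1)) (drop i fs))] @ drop (i + nat (e + 1)) fs)))
    else 0)"

definition gbracket :: "int \<Rightarrow> int \<Rightarrow> 'p oper \<Rightarrow> 'p oper \<Rightarrow> 'p oper"
  where "gbracket d e D E = scale_op ((-1) powi (d * e))
    (gcomp d e D E - scale_op ((-1) powi (d * e)) (gcomp e d E D))"

definition hochschild_diff :: "'p mfd \<Rightarrow> int \<Rightarrow> 'p oper \<Rightarrow> 'p oper"
  where "hochschild_diff X k D = gbracket 1 k (mu0 X) D"

definition sym_plus :: "'p oper \<Rightarrow> 'p oper"
  where "sym_plus D = (\<lambda>fs. D fs + D (rev fs))"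

subsection \<open>Multivector fields\<close>

text \<open>Complex \<open>k\<close>-vector fields are identified with the alternating \<open>k\<close>-derivations of the algebra of
  smooth complex-valued functions (so \<open>0\<close>-vector fields are functions) in such a way that
  \<open>X\<^sub>1 \<and> \<dots> \<and> X\<^sub>k\<close> becomes the determinant \<open>wedge\<close> below.\<close>

definition multivector_fields :: "'p mfd \<Rightarrow> int \<Rightarrow> 'p oper set"
  where "multivector_fields X k = (if k < 0 then {0} else
    {P \<in> multilinear_ops X (nat k).
       (\<forall>fs\<in>args X (nat k). \<forall>j<nat k. \<forall>f\<in>Cinf X. \<forall>g\<in>Cinf X.
          P (fs[j := f * g]) = f * P (fs[j := g]) + g * P (fs[j := f])) \<and>
       (\<forall>fs\<in>args X (nat k). \<forall>i<nat k. \<forall>j<nat k. i \<noteq> j \<and> fs ! i = fs ! j \<longrightarrow> P fs = 0)})"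

definition wedge :: "'p mfd \<Rightarrow> (('p \<Rightarrow> complex) \<Rightarrow> ('p \<Rightarrow> complex)) list \<Rightarrow> 'p oper"
  where "wedge X Vs = (\<lambda>fs. if fs \<in> args X (length Vs)
    then (\<lambda>p. \<Sum>\<sigma> | \<sigma> permutes {..<length Vs}.
            of_int (sign \<sigma>) * (\<Prod>i<length Vs. (Vs ! \<sigma> i) (fs ! i) p))
    else 0)"

definition hkr :: "'p oper \<Rightarrow> 'p oper"
  where "hkr P = (\<lambda>fs. scal (1 / fact (length fs)) (P fs))"

lemma hkr_wedge:
  assumes "fs \<in> args X (k + 1)" and "length Vs = k + 1"
  shows "hkr (wedge X Vs) fs p =
    1 / fact (k + 1) * (\<Sum>\<sigma> | \<sigma> permutes {..<k + 1}.
      of_int (sign \<sigma>) * (\<Prod>i<k + 1. (Vs ! \<sigma> i) (fs ! i) p))"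
  using assms by (simp add: hkr_def wedge_def scal_def args_def)

definition poisson_structure :: "'p mfd \<Rightarrow> 'p oper \<Rightarrow> bool"
  where "poisson_structure X P \<longleftrightarrow> P \<in> multivector_fields X 2 \<and>
    (\<forall>f\<in>Cinf X. \<forall>g\<in>Cinf X. \<forall>h\<in>Cinf X.
       P [f, P [g, h]] + P [g, P [h, f]] + P [h, P [f, g]] = 0)"


section \<open>Star products\<close>

text \<open>A formal series \<open>\<Sum>\<^sub>r \<hbar>\<^sup>r f\<^sub>r\<close> of smooth functions is stored pointwise as a complex power series.\<close>

definition hcoeff :: "('p \<Rightarrow> complex fps) \<Rightarrow> nat \<Rightarrow> 'p \<Rightarrow> complex"
  where "hcoeff F r = (\<lambda>p. fps_nth (F p) r)"

definition formal_functions :: "'p mfd \<Rightarrow> ('p \<Rightarrow> complex fps) set"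
  where "formal_functions X = {F. \<forall>r. hcoeff F r \<in> Cinf X}"

text \<open>The product \<open>\<Sum>\<^sub>r \<hbar>\<^sup>r C\<^sub>r\<close>.\<close>

definition formal_product ::
  "(nat \<Rightarrow> 'p oper) \<Rightarrow> ('p \<Rightarrow> complex fps) \<Rightarrow> ('p \<Rightarrow> complex fps) \<Rightarrow> 'p \<Rightarrow> complex fps"
  where "formal_product C F G = (\<lambda>p. Abs_fps (\<lambda>n.
    \<Sum>r\<le>n. \<Sum>i\<le>n - r. C r [hcoeff F i, hcoeff G (n - r - i)] p))"

definition star_product :: "'p mfd \<Rightarrow> (nat \<Rightarrow> 'p oper) \<Rightarrow> bool"
  where "star_product X C \<longleftrightarrow>
    C 0 = mu0 X \<and> (\<forall>r\<ge>1. C r \<in> polydiff_ops X 2) \<and>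
    (let star = formal_product C; A = formal_functions X; one = const_fun X 1 in
      (\<forall>F\<in>A. \<forall>G\<in>A. star F G \<in> A) \<and>
      (\<forall>F\<in>A. \<forall>F'\<in>A. \<forall>G\<in>A. \<forall>a::complex fps.
         star (F + F') G = star F G + star F' G \<and> star (scal a F) G = scal a (star F G) \<and>
         star G (F + F') = star G F + star G F' \<and> star G (scal a F) = scal a (star G F)) \<and>
      (\<forall>F\<in>A. \<forall>G\<in>A. \<forall>K\<in>A. star (star F G) K = star F (star G K)) \<and>
      (\<forall>F\<in>A. star F one = F \<and> star one F = F))"


section \<open>Lie algebroids and the dual bundle\<close>

text \<open>The fibres of a vector bundle are subspaces \<open>fibre x\<close> of a common real vector space, on which no
  topology is assumed (e.g. the algebraic direct sum of all fibres). The smooth structure is given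
  by local frames \<open>(U, e)\<close> with \<open>e 0 x, \<dots>, e (rank - 1) x\<close> a basis of \<open>fibre x\<close> for \<open>x \<in> U\<close>.\<close>

record ('m, 'v) vbundle =
  base :: "'m mfd"
  rank :: nat
  fibre :: "'m \<Rightarrow> 'v set"
  frames :: "('m set \<times> (nat \<Rightarrow> 'm \<Rightarrow> 'v)) set"

definition frame_coord ::
  "('m, 'v::real_vector, 'z) vbundle_scheme \<Rightarrow> (nat \<Rightarrow> 'm \<Rightarrow> 'v) \<Rightarrow> nat \<Rightarrow> 'm \<Rightarrow> 'v \<Rightarrow> real"
  where "frame_coord A e i x v = representation ((\<lambda>j. e j x) ` {..<rank A}) v (e i x)"

definition vector_bundle :: "('m, 'v::real_vector, 'z) vbundle_scheme \<Rightarrow> bool"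
  where "vector_bundle A \<longleftrightarrow>
    smooth_manifold (base A) \<and>
    (\<Union>(U, e)\<in>frames A. U) = pts (base A) \<and>
    (\<forall>(U, e)\<in>frames A. openin (mfd_topology (base A)) U \<and>
       (\<forall>x\<in>U. inj_on (\<lambda>j. e j x) {..<rank A} \<and>
               independent ((\<lambda>j. e j x) ` {..<rank A}) \<and>
               span ((\<lambda>j. e j x) ` {..<rank A}) = fibre A x)) \<and>
    (\<forall>(U, e)\<in>frames A. \<forall>(V, b)\<in>frames A. \<forall>i<rank A. \<forall>j<rank A.
       smooth_on (base A) (U \<inter> V) (\<lambda>x. frame_coord A e i x (b j x)))"

definition sections :: "('m, 'v::real_vector, 'z) vbundle_scheme \<Rightarrow> ('m \<Rightarrow> 'v) set"
  where "sections A = {s.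
    (\<forall>x\<in>pts (base A). s x \<in> fibre A x) \<and> (\<forall>x. x \<notin> pts (base A) \<longrightarrow> s x = 0) \<and>
    (\<forall>(U, e)\<in>frames A. \<forall>i<rank A. smooth_on (base A) U (\<lambda>x. frame_coord A e i x (s x)))}"

text \<open>The anchor maps \<open>v \<in> A\<^sub>x\<close> to a tangent vector at \<open>x\<close>, i.e. to a derivation at \<open>x\<close> of the real
  smooth functions.\<close>

record ('m, 'v) algebroid = "('m, 'v) vbundle" +
  anchor :: "'m \<Rightarrow> 'v \<Rightarrow> ('m \<Rightarrow> real) \<Rightarrow> real"
  lbracket :: "('m \<Rightarrow> 'v) \<Rightarrow> ('m \<Rightarrow> 'v) \<Rightarrow> ('m \<Rightarrow> 'v)"

definition tangent_vectors :: "'m mfd \<Rightarrow> 'm \<Rightarrow> (('m \<Rightarrow> real) \<Rightarrow> real) set"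
  where "tangent_vectors M x = {v. \<forall>f\<in>Cinf M. \<forall>g\<in>Cinf M. \<forall>c.
    v (f + g) = v f + v g \<and> v (scal c f) = c * v f \<and> v (f * g) = f x * v g + g x * v f}"

definition anchor_act ::
  "('m, 'v::real_vector, 'z) algebroid_scheme \<Rightarrow> ('m \<Rightarrow> 'v) \<Rightarrow> ('m \<Rightarrow> real) \<Rightarrow> 'm \<Rightarrow> real"
  where "anchor_act A s f = (\<lambda>x. if x \<in> pts (base A) then anchor A x (s x) f else 0)"

definition lie_algebroid :: "('m, 'v::real_vector, 'z) algebroid_scheme \<Rightarrow> bool"
  where "lie_algebroid A \<longleftrightarrow>
    vector_bundle A \<and>
    (\<forall>x\<in>pts (base A). \<forall>v\<in>fibre A x. anchor A x v \<in> tangent_vectors (base A) x \<and>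
       (\<forall>w\<in>fibre A x. \<forall>a b. \<forall>f\<in>Cinf (base A).
          anchor A x (a *\<^sub>R v + b *\<^sub>R w) f = a * anchor A x v f + b * anchor A x w f)) \<and>
    (\<forall>s\<in>sections A. \<forall>f\<in>Cinf (base A). anchor_act A s f \<in> Cinf (base A)) \<and>
    (\<forall>s\<in>sections A. \<forall>t\<in>sections A. lbracket A s t \<in> sections A \<and>
       lbracket A s t = - lbracket A t s \<and>
       (\<forall>u\<in>sections A. lbracket A s (t + u) = lbracket A s t + lbracket A s u \<and>
          lbracket A s (lbracket A t u) + lbracket A t (lbracket A u s)
            + lbracket A u (lbracket A s t) = 0) \<and>
       (\<forall>c::real. lbracket A s (\<lambda>x. c *\<^sub>R t x) = (\<lambda>x. c *\<^sub>R lbracket A s t x)) \<and>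
       (\<forall>f\<in>Cinf (base A). lbracket A s (\<lambda>x. f x *\<^sub>R t x) =
          (\<lambda>x. f x *\<^sub>R lbracket A s t x + anchor_act A s f x *\<^sub>R t x)))"

definition anchor_act_complex ::
  "('m, 'v::real_vector, 'z) algebroid_scheme \<Rightarrow> ('m \<Rightarrow> 'v) \<Rightarrow> ('m \<Rightarrow> complex) \<Rightarrow> 'm \<Rightarrow> complex"
  where "anchor_act_complex A s f =
    (\<lambda>x. Complex (anchor_act A s (\<lambda>y. Re (f y)) x) (anchor_act A s (\<lambda>y. Im (f y)) x))"

subsection \<open>Forms and the Lie algebroid differential\<close>

text \<open>Sections of \<open>\<Lambda>\<^sup>k A\<^sup>*\<close> with complex coefficients are smooth families of alternating real-multilinear
  maps \<open>A\<^sub>x \<times> \<dots> \<times> A\<^sub>x \<rightarrow> \<complex>\<close>; the values of \<open>\<alpha> x\<close> off the fibre are irrelevant. A product of one-forms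
  is the determinant, \<open>(\<alpha> \<and> \<beta>) (v, w) = \<alpha> v \<beta> w - \<alpha> w \<beta> v\<close>.\<close>

definition forms :: "('m, 'v::real_vector, 'z) vbundle_scheme \<Rightarrow> nat \<Rightarrow> ('m \<Rightarrow> 'v list \<Rightarrow> complex) set"
  where "forms A k = {\<alpha>.
    (\<forall>x\<in>pts (base A). \<forall>vs. length vs = k \<and> set vs \<subseteq> fibre A x \<longrightarrow>
       (\<forall>j<k. \<forall>v\<in>fibre A x. \<forall>w\<in>fibre A x. \<forall>a b.
          \<alpha> x (vs[j := a *\<^sub>R v + b *\<^sub>R w]) = a *\<^sub>R \<alpha> x (vs[j := v]) + b *\<^sub>R \<alpha> x (vs[j := w])) \<and>
       (\<forall>i<k. \<forall>j<k. i \<noteq> j \<and> vs ! i = vs ! j \<longrightarrow> \<alpha> x vs = 0)) \<and>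
    (\<forall>(U, e)\<in>frames A. \<forall>is. length is = k \<and> set is \<subseteq> {..<rank A} \<longrightarrow>
       smooth_on (base A) U (\<lambda>x. \<alpha> x (map (\<lambda>i. e i x) is)))}"

definition form_eval ::
  "('m, 'v::real_vector, 'z) vbundle_scheme \<Rightarrow> ('m \<Rightarrow> 'v list \<Rightarrow> complex) \<Rightarrow> ('m \<Rightarrow> 'v) list \<Rightarrow> 'm \<Rightarrow> complex"
  where "form_eval A \<alpha> ss = (\<lambda>x. if x \<in> pts (base A) then \<alpha> x (map (\<lambda>s. s x) ss) else 0)"

definition omit :: "nat \<Rightarrow> 'a list \<Rightarrow> 'a list"
  where "omit i xs = take i xs @ drop (Suc i) xs"

text \<open>The indices run from \<open>0\<close> here, which turns the sign \<open>(-1)\<^sup>i\<^sup>+\<^sup>1\<close> of the first sum into \<open>(-1)\<^sup>i\<close>.\<close>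

definition lie_diff ::
  "('m, 'v::real_vector, 'z) algebroid_scheme \<Rightarrow> ('m \<Rightarrow> 'v list \<Rightarrow> complex) \<Rightarrow> ('m \<Rightarrow> 'v) list \<Rightarrow> 'm \<Rightarrow> complex"
  where "lie_diff A \<alpha> ss =
    (\<Sum>i<length ss. scal ((-1) ^ i) (anchor_act_complex A (ss ! i) (form_eval A \<alpha> (omit i ss)))) +
    (\<Sum>j<length ss. \<Sum>i<j. scal ((-1) ^ (i + j))
       (form_eval A \<alpha> (lbracket A (ss ! i) (ss ! j) # omit i (omit j ss))))"

definition lie_closed ::
  "('m, 'v::real_vector, 'z) algebroid_scheme \<Rightarrow> nat \<Rightarrow> ('m \<Rightarrow> 'v list \<Rightarrow> complex) \<Rightarrow> bool"
  where "lie_closed A k \<alpha> \<longleftrightarrow>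
    (\<forall>ss. length ss = k + 1 \<and> set ss \<subseteq> sections A \<longrightarrow> lie_diff A \<alpha> ss = 0)"

subsection \<open>The total space of the dual bundle\<close>

text \<open>A point of \<open>A\<^sup>*\<close> over \<open>x\<close> is a pair \<open>(x, \<xi>)\<close> with \<open>\<xi>\<close> linear on \<open>A\<^sub>x\<close>, extended by \<open>0\<close> off \<open>A\<^sub>x\<close>. Charts
  combine a chart of the base with the components of \<open>\<xi>\<close> in a local frame.\<close>

definition dual_fibre :: "('m, 'v::real_vector, 'z) vbundle_scheme \<Rightarrow> 'm \<Rightarrow> ('v \<Rightarrow> real) set"
  where "dual_fibre A x = {\<xi>.
    (\<forall>v\<in>fibre A x. \<forall>w\<in>fibre A x. \<forall>a b. \<xi> (a *\<^sub>R v + b *\<^sub>R w) = a * \<xi> v + b * \<xi> w) \<and>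
    (\<forall>v. v \<notin> fibre A x \<longrightarrow> \<xi> v = 0)}"

definition dual_points :: "('m, 'v::real_vector, 'z) vbundle_scheme \<Rightarrow> ('m \<times> ('v \<Rightarrow> real)) set"
  where "dual_points A = Sigma (pts (base A)) (dual_fibre A)"

definition dual_chart ::
  "('m, 'v::real_vector, 'z) vbundle_scheme \<Rightarrow> ('m \<Rightarrow> nat \<Rightarrow> real) \<Rightarrow> (nat \<Rightarrow> 'm \<Rightarrow> 'v)
     \<Rightarrow> 'm \<times> ('v \<Rightarrow> real) \<Rightarrow> nat \<Rightarrow> real"
  where "dual_chart A \<phi> e = (\<lambda>(x, \<xi>) i.
    if i < mdim (base A) then \<phi> x i
    else if i < mdim (base A) + rank A then \<xi> (e (i - mdim (base A)) x)
    else 0)"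

definition dual :: "('m, 'v::real_vector, 'z) vbundle_scheme \<Rightarrow> ('m \<times> ('v \<Rightarrow> real)) mfd"
  where "dual A = \<lparr>
    pts = dual_points A,
    mdim = mdim (base A) + rank A,
    atlas = {({p \<in> dual_points A. fst p \<in> U \<inter> W}, dual_chart A \<phi> e) | U \<phi> W e.
               (U, \<phi>) \<in> atlas (base A) \<and> (W, e) \<in> frames A}\<rparr>"

definition pullback ::
  "('m, 'v::real_vector, 'z) vbundle_scheme \<Rightarrow> ('m \<Rightarrow> complex) \<Rightarrow> 'm \<times> ('v \<Rightarrow> real) \<Rightarrow> complex"
  where "pullback A f = (\<lambda>p. if p \<in> dual_points A then f (fst p) else 0)"

definition fibre_linear ::
  "('m, 'v::real_vector, 'z) vbundle_scheme \<Rightarrow> ('m \<Rightarrow> 'v) \<Rightarrow> 'm \<times> ('v \<Rightarrow> real) \<Rightarrow> complex"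
  where "fibre_linear A s = (\<lambda>p. if p \<in> dual_points A then of_real (snd p (s (fst p))) else 0)"

definition KKS_bracket ::
  "('m, 'v::real_vector, 'z) algebroid_scheme \<Rightarrow> ('m \<times> ('v \<Rightarrow> real)) oper \<Rightarrow> bool"
  where "KKS_bracket A P \<longleftrightarrow>
    poisson_structure (dual A) P \<and>
    (\<forall>f\<in>Cinf (base A). \<forall>g\<in>Cinf (base A). P [pullback A f, pullback A g] = 0) \<and>
    (\<forall>s\<in>sections A. \<forall>t\<in>sections A.
       P [fibre_linear A s, fibre_linear A t] = - fibre_linear A (lbracket A s t)) \<and>
    (\<forall>f\<in>Cinf (base A). \<forall>s\<in>sections A.
       P [pullback A f, fibre_linear A s] = pullback A (anchor_act_complex A s f))"

subsection \<open>Vertical lifts\<close>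

definition vert_lift ::
  "('m, 'v::real_vector, 'z) vbundle_scheme \<Rightarrow> ('m \<Rightarrow> 'v \<Rightarrow> real)
     \<Rightarrow> ('m \<times> ('v \<Rightarrow> real) \<Rightarrow> complex) \<Rightarrow> 'm \<times> ('v \<Rightarrow> real) \<Rightarrow> complex"
  where "vert_lift A \<alpha> f = (\<lambda>(x, \<xi>). if (x, \<xi>) \<in> dual_points A
    then vector_derivative (\<lambda>t. f (x, \<lambda>v. \<xi> v + t * \<alpha> x v)) (at 0) else 0)"

text \<open>Let \<open>b\<^sub>1, \<dots>, b\<^sub>n\<close> be a basis of \<open>A\<^sub>x\<close> with dual basis \<open>b\<^sup>1, \<dots>, b\<^sup>n\<close>. Then
  \<open>B\<^sub>x = 1/k! \<Sum> B\<^sub>x (b\<^sub>i\<^sub>1, \<dots>, b\<^sub>i\<^sub>k) b\<^sup>i\<^sup>1 \<and> \<dots> \<and> b\<^sup>i\<^sup>k\<close>, the sum being over all \<open>k\<close>-tuples of indices. Linear and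
  multiplicative extension of the vertical lift replaces each \<open>b\<^sup>i\<close> by the corresponding vertical
  derivative; since \<open>B\<close> is alternating, each of the \<open>k!\<close> terms of the determinant contributes the
  same, which leaves the sum below. It does not depend on the basis.\<close>

definition fibre_basis :: "('m, 'v::real_vector, 'z) vbundle_scheme \<Rightarrow> 'm \<Rightarrow> 'v set"
  where "fibre_basis A x = (SOME b. independent b \<and> span b = fibre A x)"

definition multi_vert_lift ::
  "('m, 'v::real_vector, 'z) vbundle_scheme \<Rightarrow> nat \<Rightarrow> ('m \<Rightarrow> 'v list \<Rightarrow> complex)
     \<Rightarrow> ('m \<times> ('v \<Rightarrow> real)) oper"
  where "multi_vert_lift A k B = (\<lambda>fs. if fs \<in> args (dual A) k
    then (\<lambda>p. if p \<in> dual_points A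
      then \<Sum>bs | length bs = k \<and> set bs \<subseteq> fibre_basis A (fst p).
        B (fst p) bs *
          (\<Prod>i<k. vert_lift A (\<lambda>x v. representation (fibre_basis A x) v (bs ! i)) (fs ! i) p)
      else 0)
    else 0)"

subsection \<open>The Euler vector field and homogeneity\<close>

definition euler ::
  "('m, 'v::real_vector, 'z) vbundle_scheme
     \<Rightarrow> ('m \<times> ('v \<Rightarrow> real) \<Rightarrow> 'b::real_normed_vector) \<Rightarrow> 'm \<times> ('v \<Rightarrow> real) \<Rightarrow> 'b"
  where "euler A f = (if f \<in> Cinf (dual A)
    then (\<lambda>(x, \<xi>). if (x, \<xi>) \<in> dual_points A
      then vector_derivative (\<lambda>t. f (x, \<lambda>v. exp t * \<xi> v)) (at 0) else 0)
    else (\<lambda>p. 0))"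

definition lie_euler_op ::
  "('m, 'v::real_vector, 'z) vbundle_scheme \<Rightarrow> ('m \<times> ('v \<Rightarrow> real)) oper"
  where "lie_euler_op A = (\<lambda>fs. if fs \<in> args (dual A) 1 then euler A (fs ! 0) else 0)"

definition homogeneous_op ::
  "('m, 'v::real_vector, 'z) vbundle_scheme \<Rightarrow> int \<Rightarrow> int \<Rightarrow> ('m \<times> ('v \<Rightarrow> real)) oper \<Rightarrow> bool"
  \<comment> \<open>\<open>d\<close> is the Hochschild degree of \<open>D\<close>, \<open>j\<close> its degree of homogeneity\<close>
  where "homogeneous_op A d j D \<longleftrightarrow> gbracket 0 d (lie_euler_op A) D = scale_op (of_int j) D"

definition lie_euler_multivector ::
  "('m, 'v::real_vector, 'z) vbundle_scheme
     \<Rightarrow> ('m \<times> ('v \<Rightarrow> real)) oper \<Rightarrow> ('m \<times> ('v \<Rightarrow> real)) oper"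
  where "lie_euler_multivector A P =
    (\<lambda>fs. euler A (P fs) - (\<Sum>i<length fs. P (fs[i := euler A (fs ! i)])))"

definition homogeneous_multivector ::
  "('m, 'v::real_vector, 'z) vbundle_scheme \<Rightarrow> int \<Rightarrow> ('m \<times> ('v \<Rightarrow> real)) oper \<Rightarrow> bool"
  where "homogeneous_multivector A j P \<longleftrightarrow> lie_euler_multivector A P = scale_op (of_int j) P"

definition homogeneous_connection ::
  "('m, 'v::real_vector, 'z) vbundle_scheme \<Rightarrow> ('m \<times> ('v \<Rightarrow> real)) connection \<Rightarrow> bool"
  where "homogeneous_connection A nabla \<longleftrightarrow>
    (\<forall>V\<in>vector_fields (dual A). \<forall>W\<in>vector_fields (dual A).
       vf_bracket (euler A) (nabla V W) =
         nabla (vf_bracket (euler A) V) W + nabla V (vf_bracket (euler A) W))"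

definition homogeneous_star_product ::
  "('m, 'v::real_vector, 'z) vbundle_scheme \<Rightarrow> (nat \<Rightarrow> ('m \<times> ('v \<Rightarrow> real)) oper) \<Rightarrow> bool"
  where "homogeneous_star_product A C \<longleftrightarrow>
    star_product (dual A) C \<and> (\<forall>r\<ge>1. homogeneous_op A 1 (- int r) (C r))"

subsection \<open>The maps of the Hochschild-Kostant-Rosenberg theorem\<close>

definition linear_on_ops :: "'p oper set \<Rightarrow> ('p oper \<Rightarrow> 'p oper) \<Rightarrow> bool"
  where "linear_on_ops S T \<longleftrightarrow>
    (\<forall>D\<in>S. \<forall>E\<in>S. \<forall>c. T (D + E) = T D + T E \<and> T (scale_op c D) = scale_op c (T D))"

definition HKR_maps ::
  "('m, 'v::real_vector, 'z) vbundle_scheme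
     \<Rightarrow> (('m \<times> ('v \<Rightarrow> real)) oper \<Rightarrow> ('m \<times> ('v \<Rightarrow> real)) oper)
     \<Rightarrow> (('m \<times> ('v \<Rightarrow> real)) oper \<Rightarrow> ('m \<times> ('v \<Rightarrow> real)) oper) \<Rightarrow> bool"
  where "HKR_maps A hkr_inv H \<longleftrightarrow> (\<forall>k\<ge>-1.
    linear_on_ops (HC (dual A) k) hkr_inv \<and> linear_on_ops (HC (dual A) k) H \<and>
    (\<forall>P\<in>multivector_fields (dual A) (k + 1). hkr_inv (hkr P) = P) \<and>
    (\<forall>D\<in>HC (dual A) k.
       hkr_inv D \<in> multivector_fields (dual A) (k + 1) \<and> H D \<in> HC (dual A) (k - 1) \<and>
       hochschild_diff (dual A) (k - 1) (H D) + H (hochschild_diff (dual A) k D) = D - hkr (hkr_inv D) \<and>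
       (\<forall>j. homogeneous_op A k j D \<longrightarrow>
          homogeneous_multivector A j (hkr_inv D) \<and> homogeneous_op A (k - 1) j (H D))))"

subsection \<open>The recursively defined cochains\<close>

fun star_coeff ::
  "('m, 'v::real_vector, 'z) vbundle_scheme
     \<Rightarrow> (('m \<times> ('v \<Rightarrow> real)) oper \<Rightarrow> ('m \<times> ('v \<Rightarrow> real)) oper)
     \<Rightarrow> ('m \<times> ('v \<Rightarrow> real)) oper \<Rightarrow> ('m \<Rightarrow> 'v list \<Rightarrow> complex)
     \<Rightarrow> nat \<Rightarrow> ('m \<times> ('v \<Rightarrow> real)) oper"
where
  "star_coeff A H P B r =
    (if r = 0 then mu0 (dual A)
     else if r = 1 then scale_op (\<i> / 2) P
     else if r = 2 then
       scale_op (- 1 / 4) (sym_plus (H (gbracket 1 1 (star_coeff A H P B 1) (star_coeff A H P B 1))))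
       + hkr (multi_vert_lift A 2 B)
     else scale_op (- 1 / 2)
       (H (\<Sum>l = 1..r - 1. gbracket 1 1 (star_coeff A H P B l) (star_coeff A H P B (r - l)))))"

declare star_coeff.simps [simp del]

end

theory Submission
  imports Defs
begin

text \<open>If the product is associative below order \<open>r\<close>, the Gerstenhaber brackets of the lower
  cochains sum up to a cocycle \<open>R\<^sub>r\<close> (this is the pentagon identity of the associator), so that the
  homotopy gives \<open>R\<^sub>r = \<partial> H R\<^sub>r + hkr T\<^sub>r\<close> with a trivector field \<open>T\<^sub>r\<close>, homogeneous of degree \<open>-r\<close>.
  Everything hinges on \<open>T\<^sub>r = 0\<close>. For \<open>r \<ge> 4\<close> this holds by homogeneity: on functions that are constant or
  linear along the fibres, \<open>T\<^sub>r\<close> takes values of negative degree, which would blow up at the zero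
  section, and multiderivations are determined by these functions. For \<open>r = 2, 3\<close> the field \<open>T\<^sub>r\<close> is the
  total antisymmetrization of \<open>R\<^sub>r\<close>, which kills coboundaries: for \<open>r = 2\<close> it is a multiple of the
  Jacobiator of the Poisson bracket; for \<open>r = 3\<close> the symmetric part of \<open>C\<^sub>2\<close> drops out and what remains is
  a multiple of the Schouten bracket of the Poisson tensor with the vertical lift of \<open>B\<close>, which
  vanishes because \<open>B\<close> is closed.\<close>

text \<open>\<open>C 2\<close> is symmetrized so that its antisymmetric part is precisely
  \<open>hkr\<close> of the lift of B; otherwise the antisymmetrized obstruction at order 3 would
  also contain an uncontrolled bivector produced by H. At order 2 symmetrizing is harmless:
  \<open>C 1\<close> is antisymmetric, hence the order-2 terms change sign when f, g, h are
  reversed, and reversing the arguments of a cochain reverses and negates its coboundary. The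
  cochain and its reversal thus contribute equally, which explains -1/4 in place of -1/2. Adding a
  bivector field changes no coboundary. Three fibrewise linear functions have total degree 3, which
  places the threshold for the homogeneity argument at r = 4. That multiderivations are determined
  by pullbacks and fibrewise linear functions is the analytic part: Hadamard's lemma in a chart,
  made global by a cutoff. A chart of \<open>dual A\<close> contains whole fibres, so it suffices to
  cut off along the base; global sections arise from local frames in the same way.\<close>

abbreviation E_carrier :: "nat \<Rightarrow> (nat \<Rightarrow> real) set"
  where "E_carrier n \<equiv> {y. \<forall>i\<ge>n. y i = 0}"

lemma Euclidean_space_eq: "Euclidean_space n = top_of_set (E_carrier n)"
  by (simp add: Euclidean_space_def euclidean_product_topology)

lemma openin_Euclidean_space_iff:
  "openin (Euclidean_space n) V \<longleftrightarrow> (\<exists>T. open T \<and> V = E_carrier n \<inter> T)"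
  by (auto simp: Euclidean_space_eq openin_open)

lemma openin_Euclidean_space_subset: "openin (Euclidean_space n) V \<Longrightarrow> V \<subseteq> E_carrier n"
  by (auto simp: openin_Euclidean_space_iff)

lemma continuous_map_Euclidean_iff:
  assumes "V \<subseteq> E_carrier n"
  shows "continuous_map (subtopology (Euclidean_space n) V) euclidean f \<longleftrightarrow> continuous_on V f"
proof -
  have "E_carrier n \<inter> V = V" using assms by blast
  then show ?thesis
    by (simp add: Euclidean_space_eq subtopology_subtopology)
qed

lemma continuous_on_coord: "continuous_on S (\<lambda>y::nat \<Rightarrow> real. y i)"
  by (rule continuous_on_subset[OF continuous_on_product_coordinates]) simp

lemma continuous_on_update:
  assumes "continuous_on S f" "continuous_on S g"
  shows "continuous_on S (\<lambda>x. (f x :: nat \<Rightarrow> real)(i := g x))"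
proof (rule continuous_on_coordinatewise_then_product)
  fix j
  have "continuous_on S (\<lambda>x. f x j)"
    by (rule continuous_on_product_then_coordinatewise[OF assms(1)])
  then show "continuous_on S (\<lambda>x. ((f x)(i := g x)) j)"
    using assms(2) by (cases "j = i") auto
qed

text \<open>Changing a coordinate below n keeps a point inside \<open>E_carrier n\<close>, so
  relative openness suffices. Thanks to this, the two-sided derivatives in \<open>Ck_on\<close>
  depend only on the values of a function in V.\<close>

lemma eventually_update_in_open:
  assumes V: "openin (Euclidean_space n) V" and "y \<in> V" "i < n"
  shows "\<forall>\<^sub>F t in nhds (y i). y(i := t) \<in> V"
proof -
  obtain T where T: "open T" "V = E_carrier n \<inter> T" using V by (auto simp: openin_Euclidean_space_iff)
  have c: "continuous_on UNIV (\<lambda>t. y(i := t))"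
    by (intro continuous_on_update continuous_intros)
  have "open ((\<lambda>t. y(i := t)) -` T)" using c T(1) by (simp add: continuous_on_open_vimage)
  moreover have "y i \<in> (\<lambda>t. y(i := t)) -` T" using assms(2) T by auto
  ultimately have "\<forall>\<^sub>F t in nhds (y i). y(i := t) \<in> T"
    using eventually_nhds by blast
  then show ?thesis
    by eventually_elim (use assms T in auto)
qed

lemma has_vector_derivative_cong_nhds:
  assumes "\<forall>\<^sub>F t in nhds x. f t = g t"
  shows "(f has_vector_derivative d) (at x) \<longleftrightarrow> (g has_vector_derivative d) (at x)"
  using has_vector_derivative_cong_ev[of UNIV f g x d] assms eventually_nhds_x_imp_x[OF assms] by simp

section \<open>Partial derivatives and functions of class C^k\<close>

definition partial :: "nat \<Rightarrow> ((nat \<Rightarrow> real) \<Rightarrow> 'b::real_normed_vector) \<Rightarrow> (nat \<Rightarrow> real) \<Rightarrow> 'b"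
  where "partial i f y = vector_derivative (\<lambda>t. f (y(i := t))) (at (y i))"

lemma partial_eqI:
  "((\<lambda>t. f (y(i := t))) has_vector_derivative d) (at (y i)) \<Longrightarrow> partial i f y = d"
  unfolding partial_def by (rule vector_derivative_at)

lemma Ck_on_cong:
  assumes V: "openin (Euclidean_space n) V" and eq: "\<And>y. y \<in> V \<Longrightarrow> f y = g y" and "Ck_on n k V f"
  shows "Ck_on n k V g"
proof -
  note sub = openin_Euclidean_space_subset[OF V]
  have c: "continuous_on V g" if "continuous_on V f"
    using that eq by (metis continuous_on_cong)
  show ?thesis
  proof (cases k)
    case 0
    then show ?thesis using assms(3) c by (simp add: continuous_map_Euclidean_iff[OF sub])
  next
    case (Suc m)
    have "\<exists>d. Ck_on n m V d \<and> (\<forall>y\<in>V. ((\<lambda>t. g (y(i := t))) has_vector_derivative d y) (at (y i)))"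
      if "i < n" for i
    proof -
      obtain d where d: "Ck_on n m V d"
        "\<And>y. y \<in> V \<Longrightarrow> ((\<lambda>t. f (y(i := t))) has_vector_derivative d y) (at (y i))"
        using assms(3) Suc \<open>i < n\<close> by auto
      have "((\<lambda>t. g (y(i := t))) has_vector_derivative d y) (at (y i))" if "y \<in> V" for y
        using d(2)[OF that] eventually_update_in_open[OF V that \<open>i < n\<close>]
        by (subst has_vector_derivative_cong_nhds[where g = "\<lambda>t. f (y(i := t))"])
           (auto elim!: eventually_mono simp: eq)
      then show ?thesis using d(1) by blast
    qed
    then show ?thesis using assms(3) c Suc by (simp add: continuous_map_Euclidean_iff[OF sub])
  qed
qed

text \<open>Vector derivatives are unique, so the existentially quantified derivative in
  \<open>Ck_on\<close> can only be \<open>partial i f\<close> on V. This fixed witness is what later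
  inductions work with.\<close>

lemma Ck_on_Suc_iff:
  assumes V: "openin (Euclidean_space n) V"
  shows "Ck_on n (Suc k) V f \<longleftrightarrow> continuous_on V f \<and>
    (\<forall>i<n. Ck_on n k V (partial i f) \<and>
       (\<forall>y\<in>V. ((\<lambda>t. f (y(i := t))) has_vector_derivative partial i f y) (at (y i))))"
proof -
  note sub = openin_Euclidean_space_subset[OF V]
  have "(\<exists>g. Ck_on n k V g \<and> (\<forall>y\<in>V. ((\<lambda>t. f (y(i := t))) has_vector_derivative g y) (at (y i)))) \<longleftrightarrow>
      Ck_on n k V (partial i f) \<and>
       (\<forall>y\<in>V. ((\<lambda>t. f (y(i := t))) has_vector_derivative partial i f y) (at (y i)))" if "i < n" for i
  proof safe
    fix g assume g: "Ck_on n k V g" and d: "\<forall>y\<in>V. ((\<lambda>t. f (y(i := t))) has_vector_derivative g y) (at (y i))"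
    have e: "g y = partial i f y" if "y \<in> V" for y using d that partial_eqI by metis
    show "Ck_on n k V (partial i f)" by (rule Ck_on_cong[OF V e g])
    fix y assume "y \<in> V"
    then show "((\<lambda>t. f (y(i := t))) has_vector_derivative partial i f y) (at (y i))" using d e by metis
  qed blast
  then show ?thesis by (auto simp: continuous_map_Euclidean_iff[OF sub])
qed

lemma Ck_on_0_iff:
  assumes "openin (Euclidean_space n) V"
  shows "Ck_on n 0 V f \<longleftrightarrow> continuous_on V f"
  using continuous_map_Euclidean_iff[OF openin_Euclidean_space_subset[OF assms]] by simp

lemma C_infinity_on_iff:
  assumes V: "openin (Euclidean_space n) V"
  shows "C_infinity_on n V f \<longleftrightarrow> continuous_on V f \<and>
    (\<forall>i<n. C_infinity_on n V (partial i f) \<and>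
       (\<forall>y\<in>V. ((\<lambda>t. f (y(i := t))) has_vector_derivative partial i f y) (at (y i))))"
  (is "?L \<longleftrightarrow> ?R")
proof
  assume ?L
  then have "Ck_on n (Suc k) V f" for k by (simp only: C_infinity_on_def)
  then show ?R by (auto simp: Ck_on_Suc_iff[OF V] C_infinity_on_def simp del: Ck_on.simps)
next
  assume ?R
  then have "Ck_on n k V f" for k
    by (cases k) (simp_all add: Ck_on_Suc_iff[OF V] Ck_on_0_iff[OF V] C_infinity_on_def del: Ck_on.simps)
  then show ?L by (simp add: C_infinity_on_def)
qed

lemma C_infinity_on_continuous:
  "openin (Euclidean_space n) V \<Longrightarrow> C_infinity_on n V f \<Longrightarrow> continuous_on V f"
  using C_infinity_on_iff by blast

lemma C_infinity_on_partial:
  "openin (Euclidean_space n) V \<Longrightarrow> C_infinity_on n V f \<Longrightarrow> i < n \<Longrightarrow> C_infinity_on n V (partial i f)"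
  using C_infinity_on_iff by blast

lemma C_infinity_on_has_partial:
  "openin (Euclidean_space n) V \<Longrightarrow> C_infinity_on n V f \<Longrightarrow> i < n \<Longrightarrow> y \<in> V \<Longrightarrow>
    ((\<lambda>t. f (y(i := t))) has_vector_derivative partial i f y) (at (y i))"
  using C_infinity_on_iff by blast

lemma C_infinity_on_cong:
  assumes "openin (Euclidean_space n) V" "\<And>y. y \<in> V \<Longrightarrow> f y = g y" "C_infinity_on n V f"
  shows "C_infinity_on n V g"
  using Ck_on_cong[OF assms(1,2)] assms(3) by (auto simp: C_infinity_on_def)

lemma Ck_on_subset:
  assumes "V' \<subseteq> V" "Ck_on n k V f"
  shows "Ck_on n k V' f"
  using assms(2)
proof (induction k arbitrary: f)
  case 0
  then show ?case
    using assms(1) by (auto intro: continuous_map_from_subtopology_mono)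
next
  case (Suc k)
  have "continuous_map (subtopology (Euclidean_space n) V') euclidean f"
    using Suc.prems assms(1) by (auto intro: continuous_map_from_subtopology_mono)
  moreover have "\<exists>g. Ck_on n k V' g \<and> (\<forall>y\<in>V'. ((\<lambda>t. f (y(i := t))) has_vector_derivative g y) (at (y i)))"
    if "i < n" for i
    using Suc.prems Suc.IH that assms(1) by (force simp: subset_iff)
  ultimately show ?case by simp
qed

lemma C_infinity_on_subset: "V' \<subseteq> V \<Longrightarrow> C_infinity_on n V f \<Longrightarrow> C_infinity_on n V' f"
  by (auto simp: C_infinity_on_def intro: Ck_on_subset)

text \<open>Induction on the order with f generalized: the local hypothesis speaks of all orders,
  hence passes unchanged to the partial derivatives. Only continuity needs an argument with
  neighbourhoods.\<close>

lemma C_infinity_on_locally: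
  assumes V: "openin (Euclidean_space n) V"
    and loc: "\<And>y. y \<in> V \<Longrightarrow> \<exists>W. openin (Euclidean_space n) W \<and> y \<in> W \<and> C_infinity_on n W f"
  shows "C_infinity_on n V f"
proof -
  have "Ck_on n k V f"
    if "\<And>y. y \<in> V \<Longrightarrow> \<exists>W. openin (Euclidean_space n) W \<and> y \<in> W \<and> C_infinity_on n W f" for k and f :: "(nat \<Rightarrow> real) \<Rightarrow> 'a"
    using that
  proof (induction k arbitrary: f)
    have "continuous_on V f"
      if loc: "\<And>y. y \<in> V \<Longrightarrow> \<exists>W. openin (Euclidean_space n) W \<and> y \<in> W \<and> C_infinity_on n W f"
      for f :: "(nat \<Rightarrow> real) \<Rightarrow> 'a"
    proof (rule continuous_on_eq_continuous_within[THEN iffD2], rule ballI)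
      fix y assume "y \<in> V"
      then obtain W where W: "openin (Euclidean_space n) W" "y \<in> W" "C_infinity_on n W f"
        using loc by blast
      obtain T where T: "open T" "W = E_carrier n \<inter> T"
        using W(1) by (auto simp: openin_Euclidean_space_iff)
      have "continuous (at y within W) f"
        using C_infinity_on_continuous[OF W(1,3)] W(2) by (simp add: continuous_on_eq_continuous_within)
      moreover have "V \<inter> T \<subseteq> W" using T openin_Euclidean_space_subset[OF V] by blast
      ultimately have "continuous (at y within V \<inter> T) f" by (rule continuous_within_subset)
      moreover have "at y within V \<inter> T = at y within V"
        using T W(2) by (intro at_within_nhd[of y T]) auto
      ultimately show "continuous (at y within V) f" by (simp add: continuous_within)
    qed
    note cont = this
    {
      case 0
      show ?case using cont[OF 0] by (simp add: Ck_on_0_iff[OF V] del: Ck_on.simps)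
    next
      case (Suc k)
      have "Ck_on n k V (partial i f)" if "i < n" for i
      proof (rule Suc.IH)
        fix y assume "y \<in> V"
        then obtain W where W: "openin (Euclidean_space n) W" "y \<in> W" "C_infinity_on n W f"
          using Suc.prems by blast
        show "\<exists>W. openin (Euclidean_space n) W \<and> y \<in> W \<and> C_infinity_on n W (partial i f)"
          using W(1,2) C_infinity_on_partial[OF W(1,3) \<open>i < n\<close>] by blast
      qed
      moreover have "((\<lambda>t. f (y(i := t))) has_vector_derivative partial i f y) (at (y i))"
        if "i < n" "y \<in> V" for i y
      proof -
        obtain W where W: "openin (Euclidean_space n) W" "y \<in> W" "C_infinity_on n W f"
          using Suc.prems \<open>y \<in> V\<close> by blast
        show ?thesis by (rule C_infinity_on_has_partial[OF W(1,3) \<open>i < n\<close> W(2)])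
      qed
      ultimately show ?case using cont[OF Suc.prems] by (simp add: Ck_on_Suc_iff[OF V] del: Ck_on.simps)
    }
  qed
  then show ?thesis using loc by (auto simp: C_infinity_on_def)
qed

section \<open>Algebra of smooth functions\<close>

lemma Ck_on_SucI:
  assumes "openin (Euclidean_space n) V" "continuous_on V f"
    and "\<And>i. i < n \<Longrightarrow> Ck_on n k V (g i)"
    and "\<And>i y. i < n \<Longrightarrow> y \<in> V \<Longrightarrow> ((\<lambda>t. f (y(i := t))) has_vector_derivative g i y) (at (y i))"
  shows "Ck_on n (Suc k) V f"
  using assms(3,4) assms(2)[folded continuous_map_Euclidean_iff[OF openin_Euclidean_space_subset[OF assms(1)]]]
  unfolding Ck_on.simps by blast

text \<open>Smoothness is the largest property of continuous functions that is stable under partial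
  derivatives. The rule serves for families given by a formula whose derivatives stay in the family,
  which avoids an induction on the order each time.\<close>

lemma C_infinity_on_coinduct:
  assumes V: "openin (Euclidean_space n) V" and "\<Phi> f"
    and cont: "\<And>f. \<Phi> f \<Longrightarrow> continuous_on V f"
    and deriv: "\<And>f i. \<Phi> f \<Longrightarrow> i < n \<Longrightarrow>
      \<exists>g. \<Phi> g \<and> (\<forall>y\<in>V. ((\<lambda>t. f (y(i := t))) has_vector_derivative g y) (at (y i)))"
  shows "C_infinity_on n V f"
proof -
  have "Ck_on n k V f" if "\<Phi> f" for k f
    using that
  proof (induction k arbitrary: f)
    case 0
    then show ?case using cont by (simp add: Ck_on_0_iff[OF V] del: Ck_on.simps)
  next
    case (Suc k)
    obtain g where g: "\<And>i. i < n \<Longrightarrow> \<Phi> (g i) \<and>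
        (\<forall>y\<in>V. ((\<lambda>t. f (y(i := t))) has_vector_derivative g i y) (at (y i)))"
      using deriv[OF Suc.prems] by metis
    then show ?case using Suc cont by (intro Ck_on_SucI[OF V, of f k g]) auto
  qed
  then show ?thesis using \<open>\<Phi> f\<close> by (simp add: C_infinity_on_def)
qed

lemma Ck_on_mono:
  assumes V: "openin (Euclidean_space n) V"
  shows "Ck_on n (Suc k) V f \<Longrightarrow> Ck_on n k V f"
proof (induction k arbitrary: f)
  case 0
  then show ?case by (simp add: Ck_on_Suc_iff[OF V] Ck_on_0_iff[OF V] del: Ck_on.simps)
next
  case (Suc k)
  then show ?case using Ck_on_Suc_iff[OF V] by blast
qed

lemma Ck_on_add:
  assumes V: "openin (Euclidean_space n) V"
  shows "Ck_on n k V f \<Longrightarrow> Ck_on n k V g \<Longrightarrow> Ck_on n k V (\<lambda>y. f y + g y)"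
proof (induction k arbitrary: f g)
  case 0
  then show ?case by (simp add: Ck_on_0_iff[OF V] continuous_on_add del: Ck_on.simps)
next
  case (Suc k)
  note f = Suc.prems(1)[unfolded Ck_on_Suc_iff[OF V]] and g = Suc.prems(2)[unfolded Ck_on_Suc_iff[OF V]]
  show ?case
  proof (rule Ck_on_SucI[OF V, where g = "\<lambda>i y. partial i f y + partial i g y"])
    fix i y assume "i < n" "y \<in> V"
    then show "((\<lambda>t. f (y(i := t)) + g (y(i := t))) has_vector_derivative
        partial i f y + partial i g y) (at (y i))"
      using f g by (intro has_vector_derivative_add) blast+
  qed (use f g Suc.IH in \<open>auto intro: continuous_on_add\<close>)
qed

text \<open>Leibniz' rule leads from products to sums of products, so products alone form no class
  for the coinduction rule; hence an induction on the order together with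
  \<open>Ck_on_add\<close>.\<close>

lemma Ck_on_bilinear:
  assumes V: "openin (Euclidean_space n) V" and "bounded_bilinear mul"
  shows "Ck_on n k V f \<Longrightarrow> Ck_on n k V g \<Longrightarrow> Ck_on n k V (\<lambda>y. mul (f y) (g y))"
proof (induction k arbitrary: f g)
  case 0
  then show ?case
    by (simp add: Ck_on_0_iff[OF V] bounded_bilinear.continuous_on[OF assms(2)] del: Ck_on.simps)
next
  case (Suc k)
  note f = Suc.prems(1)[unfolded Ck_on_Suc_iff[OF V]] and g = Suc.prems(2)[unfolded Ck_on_Suc_iff[OF V]]
  show ?case
  proof (rule Ck_on_SucI[OF V, where g = "\<lambda>i y. mul (f y) (partial i g y) + mul (partial i f y) (g y)"])
    show "continuous_on V (\<lambda>y. mul (f y) (g y))"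
      using f g by (simp add: bounded_bilinear.continuous_on[OF assms(2)])
    fix i assume i: "i < n"
    show "Ck_on n k V (\<lambda>y. mul (f y) (partial i g y) + mul (partial i f y) (g y))"
      using f g i Ck_on_mono[OF V Suc.prems(1)] Ck_on_mono[OF V Suc.prems(2)]
      by (intro Ck_on_add[OF V] Suc.IH) blast+
    fix y assume y: "y \<in> V"
    show "((\<lambda>t. mul (f (y(i := t))) (g (y(i := t)))) has_vector_derivative
        mul (f y) (partial i g y) + mul (partial i f y) (g y)) (at (y i))"
    proof -
      have F: "((\<lambda>t. f (y(i := t))) has_vector_derivative partial i f y) (at (y i))"
        and G: "((\<lambda>t. g (y(i := t))) has_vector_derivative partial i g y) (at (y i))"
        using f g i y by blast+
      from bounded_bilinear.has_vector_derivative[OF assms(2) F G] show ?thesis by simp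
    qed
  qed
qed

lemma C_infinity_on_bilinear:
  "openin (Euclidean_space n) V \<Longrightarrow> bounded_bilinear mul \<Longrightarrow>
    C_infinity_on n V f \<Longrightarrow> C_infinity_on n V g \<Longrightarrow> C_infinity_on n V (\<lambda>y. mul (f y) (g y))"
  by (simp add: C_infinity_on_def Ck_on_bilinear)

lemma C_infinity_on_add:
  "openin (Euclidean_space n) V \<Longrightarrow> C_infinity_on n V f \<Longrightarrow> C_infinity_on n V g \<Longrightarrow>
    C_infinity_on n V (\<lambda>y. f y + g y)"
  by (simp add: C_infinity_on_def Ck_on_add)

lemma C_infinity_on_linear:
  assumes V: "openin (Euclidean_space n) V" and T: "bounded_linear T" and "C_infinity_on n V f"
  shows "C_infinity_on n V (\<lambda>y. T (f y))"
proof (rule C_infinity_on_coinduct[OF V, where \<Phi> = "\<lambda>h. \<exists>f. C_infinity_on n V f \<and> h = (\<lambda>y. T (f y))"])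
  show "\<exists>g. (\<exists>f. C_infinity_on n V f \<and> g = (\<lambda>y. T (f y))) \<and>
      (\<forall>y\<in>V. ((\<lambda>t. h (y(i := t))) has_vector_derivative g y) (at (y i)))"
    if h: "\<exists>f. C_infinity_on n V f \<and> h = (\<lambda>y. T (f y))" and "i < n" for h i
  proof -
    obtain f where f: "C_infinity_on n V f" "h = (\<lambda>y. T (f y))" using h by blast
    have "\<forall>y\<in>V. ((\<lambda>t. h (y(i := t))) has_vector_derivative T (partial i f y)) (at (y i))"
      unfolding f(2)
      using bounded_linear.has_vector_derivative[OF T C_infinity_on_has_partial[OF V f(1) \<open>i < n\<close>]] by blast
    then show ?thesis
      using C_infinity_on_partial[OF V f(1) \<open>i < n\<close>] by blast
  qed
next
  show "continuous_on V h" if "\<exists>f. C_infinity_on n V f \<and> h = (\<lambda>y. T (f y))" for h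
    using that C_infinity_on_continuous[OF V] bounded_linear.continuous_on[OF T] by blast
qed (use assms(3) in blast)

lemma C_infinity_on_const:
  assumes V: "openin (Euclidean_space n) V"
  shows "C_infinity_on n V (\<lambda>y. c)"
  by (rule C_infinity_on_coinduct[OF V, where \<Phi> = "\<lambda>f. \<exists>c. f = (\<lambda>y. c)"])
    (blast, clarsimp, use has_vector_derivative_const in \<open>fastforce intro: exI[of _ "\<lambda>y. 0"]\<close>)

lemma C_infinity_on_sum:
  assumes V: "openin (Euclidean_space n) V"
  shows "(\<And>i. i \<in> I \<Longrightarrow> C_infinity_on n V (f i)) \<Longrightarrow> C_infinity_on n V (\<lambda>y. \<Sum>i\<in>I. f i y)"
  by (induction I rule: infinite_finite_induct)
     (simp_all add: C_infinity_on_const[OF V] C_infinity_on_add[OF V])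

lemma C_infinity_on_mult:
  fixes f g :: "_ \<Rightarrow> 'b::real_normed_algebra"
  shows "openin (Euclidean_space n) V \<Longrightarrow> C_infinity_on n V f \<Longrightarrow> C_infinity_on n V g \<Longrightarrow>
    C_infinity_on n V (\<lambda>y. f y * g y)"
  by (rule C_infinity_on_bilinear[OF _ bounded_bilinear_mult])

lemma C_infinity_on_prod:
  fixes f :: "'i \<Rightarrow> _ \<Rightarrow> 'b::{real_normed_algebra_1,comm_ring_1}"
  assumes V: "openin (Euclidean_space n) V"
  shows "(\<And>i. i \<in> I \<Longrightarrow> C_infinity_on n V (f i)) \<Longrightarrow> C_infinity_on n V (\<lambda>y. \<Prod>i\<in>I. f i y)"
  by (induction I rule: infinite_finite_induct)
     (simp_all add: C_infinity_on_const[OF V] C_infinity_on_mult[OF V])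

text \<open>S is a class of functions of one real variable stable under differentiation. Each
  derivative of the composite with an affine function of one coordinate gives a factor s, or 0 for
  the other coordinates; the scalar b in the coinduction class absorbs these factors.\<close>

lemma C_infinity_on_coordinate_family:
  fixes S :: "(real \<Rightarrow> real) \<Rightarrow> bool"
  assumes V: "openin (Euclidean_space n) V" and "S \<theta>"
    and deriv: "\<And>\<theta>. S \<theta> \<Longrightarrow> \<exists>\<theta>'. S \<theta>' \<and> (\<forall>x. (\<theta> has_real_derivative \<theta>' x) (at x))"
  shows "C_infinity_on n V (\<lambda>y. \<theta> (s * y i + a))"
proof (rule C_infinity_on_coinduct[OF V, where
    \<Phi> = "\<lambda>f. \<exists>\<theta> b. S \<theta> \<and> f = (\<lambda>y. b * \<theta> (s * y i + a))"])
  show "\<exists>\<theta>' b. S \<theta>' \<and> (\<lambda>y. \<theta> (s * y i + a)) = (\<lambda>y. b * \<theta>' (s * y i + a))"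
    using assms(2) by (intro exI[of _ \<theta>] exI[of _ 1]) simp
next
  fix f assume "\<exists>\<theta> b. S \<theta> \<and> f = (\<lambda>y::nat \<Rightarrow> real. b * \<theta> (s * y i + a))"
  then obtain \<theta> b where \<theta>: "S \<theta>" "f = (\<lambda>y. b * \<theta> (s * y i + a))" by blast
  have "isCont \<theta> x" for x using deriv[OF \<theta>(1)] DERIV_isCont by blast
  then have c: "continuous_on UNIV \<theta>" by (simp add: continuous_on_eq_continuous_at)
  have "continuous_on V (\<lambda>y. s * y i + a)"
    by (intro continuous_on_add continuous_on_mult_left continuous_on_const continuous_on_coord)
  then have "continuous_on V (\<lambda>y. \<theta> (s * y i + a))"
    by (rule continuous_on_compose2[OF c]) simp
  then show "continuous_on V f" unfolding \<theta>(2) by (rule continuous_on_mult_left)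
next
  fix f j assume "\<exists>\<theta> b. S \<theta> \<and> f = (\<lambda>y::nat \<Rightarrow> real. b * \<theta> (s * y i + a))"
  then obtain \<theta> b where \<theta>: "S \<theta>" "f = (\<lambda>y. b * \<theta> (s * y i + a))" by blast
  obtain \<theta>' where \<theta>': "S \<theta>'" "\<And>x. (\<theta> has_real_derivative \<theta>' x) (at x)" using deriv[OF \<theta>(1)] by blast
  show "\<exists>g. (\<exists>\<theta> b. S \<theta> \<and> g = (\<lambda>y. b * \<theta> (s * y i + a))) \<and>
      (\<forall>y\<in>V. ((\<lambda>t. f (y(j := t))) has_vector_derivative g y) (at (y j)))"
  proof (cases "j = i")
    case True
    have "((\<lambda>t. f (y(j := t))) has_real_derivative b * (\<theta>' (s * y i + a) * s)) (at (y j))" for y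
    proof -
      have "((\<lambda>t. s * t + a) has_real_derivative s) (at (y i))" by (auto intro!: derivative_eq_intros)
      from DERIV_cmult[OF DERIV_chain2[OF \<theta>'(2) this]] show ?thesis unfolding \<theta>(2) True by simp
    qed
    then have "\<forall>y\<in>V. ((\<lambda>t. f (y(j := t))) has_vector_derivative (b * s) * \<theta>' (s * y i + a)) (at (y j))"
      by (simp add: has_real_derivative_iff_has_vector_derivative mult_ac)
    then show ?thesis using \<theta>'(1) by blast
  next
    case False
    then have "\<forall>y\<in>V. ((\<lambda>t. f (y(j := t))) has_vector_derivative 0 * \<theta> (s * y i + a)) (at (y j))"
      by (simp add: \<theta>(2))
    then show ?thesis using \<theta>(1) by blast
  qed
qed

lemma C_infinity_on_coordinate:
  assumes V: "openin (Euclidean_space n) V"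
  shows "C_infinity_on n V (\<lambda>y. y i)"
proof -
  \<comment> \<open>Affine functions are stable under differentiation; the constant derivative c is
    written 0 * x + c to be recognized as affine.\<close>
  have "\<exists>\<theta>'. (\<exists>c d. \<theta>' = (\<lambda>x. c * x + d)) \<and> (\<forall>x. (\<theta> has_real_derivative \<theta>' x) (at x))"
    if "\<exists>c d. \<theta> = (\<lambda>x::real. c * x + d)" for \<theta>
  proof -
    obtain c d where "\<theta> = (\<lambda>x. c * x + d)" using \<open>\<exists>c d. \<theta> = (\<lambda>x. c * x + d)\<close> by blast
    moreover have "((\<lambda>x. c * x + d) has_real_derivative 0 * x + c) (at x)" for x
      by (auto intro!: derivative_eq_intros)
    ultimately show ?thesis by blast
  qed
  moreover have "\<exists>c d. (\<lambda>x::real. x) = (\<lambda>x. c * x + d)"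
    by (rule exI[of _ 1], rule exI[of _ 0]) simp
  ultimately have "C_infinity_on n V (\<lambda>y. (\<lambda>x. x) (1 * y i + 0))"
    by (intro C_infinity_on_coordinate_family[OF V, where S = "\<lambda>\<theta>. \<exists>c d. \<theta> = (\<lambda>x. c * x + d)"])
  then show ?thesis by simp
qed

section \<open>The chain rule\<close>

lemma tendsto_funI:
  fixes f :: "'a \<Rightarrow> nat \<Rightarrow> real"
  assumes "\<And>i. ((\<lambda>x. f x i) \<longlongrightarrow> l i) F"
  shows "(f \<longlongrightarrow> l) F"
proof -
  have "limitin (powertop_real UNIV) f l F"
    using assms by (simp add: limitin_componentwise)
  then show ?thesis by (simp add: euclidean_product_topology)
qed

text \<open>The curve need only be differentiable at the single time t0. Its coordinates are
  released one at a time, and each release is a chain rule for a function of two variables: one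
  derivative is known at the point by induction, the other exists nearby and is continuous, which
  together give total differentiability.\<close>

lemma chain_rule_curve:
  fixes f :: "(nat \<Rightarrow> real) \<Rightarrow> 'b::real_normed_vector"
  assumes V: "openin (Euclidean_space n) V" and f: "C_infinity_on n V f"
    and c0: "c t0 \<in> V" and cV: "\<forall>\<^sub>F t in nhds t0. c t \<in> V"
    and c': "\<And>i. i < n \<Longrightarrow> ((\<lambda>t. c t i) has_vector_derivative c' i) (at t0)"
  shows "((\<lambda>t. f (c t)) has_vector_derivative (\<Sum>i<n. c' i *\<^sub>R partial i f (c t0))) (at t0)"
proof -
  obtain T where T: "open T" "V = E_carrier n \<inter> T"
    using V by (auto simp: openin_Euclidean_space_iff)
  \<comment> \<open>\<open>cm m\<close> follows the curve in the first m coordinates and is frozen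
    at time t0 in the others.\<close>
  define cm where "cm m t i = (if i < m then c t i else c t0 i)" for m t i
  have cm0: "cm m t0 = c t0" for m by (auto simp: cm_def)
  have main: "((\<lambda>t. f (cm m t)) has_vector_derivative (\<Sum>i<m. c' i *\<^sub>R partial i f (c t0))) (at t0)"
    if "m \<le> n" for m
    using that
  proof (induction m)
    case 0
    then show ?case by (simp add: cm_def)
  next
    case (Suc m)
    then have m: "m < n" and IH: "((\<lambda>t. f (cm m t)) has_vector_derivative (\<Sum>i<m. c' i *\<^sub>R partial i f (c t0))) (at t0)"
      by auto
    \<comment> \<open>Decouples the coordinate to be released: the first m coordinates at time s,
      coordinate m equal to a free parameter u. Inserting u = c s m recovers
      \<open>cm (Suc m)\<close>.\<close>
    define w where "w p = (cm m (fst p))(m := snd p)" for p :: "real \<times> real"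
    let ?p = "(t0, c t0 m)"
    have wp: "w ?p = c t0" by (auto simp: w_def cm0)
    have cont_w: "isCont w ?p"
      unfolding isCont_def
    proof (rule tendsto_funI)
      fix i
      have "isCont (\<lambda>p. w p i) ?p"
      proof (cases "i < m")
        case True
        have "isCont (\<lambda>t. c t i) (fst ?p)"
          using has_vector_derivative_continuous[OF c'[of i]] True m by simp
        then have "isCont (\<lambda>p. c (fst p) i) ?p"
          by (intro isCont_o2[where f = fst and g = "\<lambda>t. c t i"]) auto
        then show ?thesis using True by (simp add: w_def cm_def)
      qed (cases "i = m"; simp add: w_def cm_def)
      then show "((\<lambda>p. w p i) \<longlongrightarrow> w ?p i) (at ?p)" by (simp add: isCont_def)
    qed
    then have "(w \<longlongrightarrow> w ?p) (nhds ?p)" by (simp only: isCont_def tendsto_at_iff_tendsto_nhds)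
    moreover have "w ?p \<in> T" using c0 T(2) wp by simp
    ultimately have "\<forall>\<^sub>F p in nhds ?p. w p \<in> T" using T(1) topological_tendstoD by blast
    then obtain Pf Pg where P: "\<forall>\<^sub>F s in nhds t0. Pf s" "\<forall>\<^sub>F u in nhds (c t0 m). Pg u"
      "\<And>s u. Pf s \<Longrightarrow> Pg u \<Longrightarrow> w (s, u) \<in> T"
      by (auto simp: nhds_prod eventually_prod_filter)
    have "\<forall>\<^sub>F s in nhds t0. Pf s \<and> c s \<in> V" using P(1) cV by eventually_elim auto
    then obtain d where d: "d > 0" "\<And>s. dist s t0 < d \<Longrightarrow> Pf s \<and> c s \<in> V"
      by (auto simp: eventually_nhds_metric)
    obtain e where e: "e > 0" "\<And>u. dist u (c t0 m) < e \<Longrightarrow> Pg u"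
      using P(2) by (auto simp: eventually_nhds_metric)
    let ?X = "ball t0 d" and ?Y = "ball (c t0 m) e"
    have wV: "w (s, u) \<in> V" if "s \<in> ?X" "u \<in> ?Y" for s u
    proof -
      have "w (s, u) \<in> T" using that d(2) e(2) P(3) by (simp add: dist_commute)
      moreover have "c s \<in> V" "c t0 \<in> V" using that d(2) c0 by (auto simp: dist_commute)
      then have "w (s, u) \<in> E_carrier n"
        using T m by (auto simp: w_def cm_def)
      ultimately show ?thesis using T by blast
    qed
    have "((\<lambda>(s, u). f (w (s, u))) has_derivative
        (\<lambda>(ts, tu). ts *\<^sub>R (\<Sum>i<m. c' i *\<^sub>R partial i f (c t0)) +
           blinfun_apply (blinfun_scaleR_left (partial m f (w (t0, c t0 m)))) tu)) (at ?p within ?X \<times> ?Y)"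
    proof (rule has_derivative_partialsI[where f = "\<lambda>s u. f (w (s, u))" and
        fx = "\<lambda>ts. ts *\<^sub>R (\<Sum>i<m. c' i *\<^sub>R partial i f (c t0))" and fy = "\<lambda>s u. blinfun_scaleR_left (partial m f (w (s, u)))"])
      have "w (s, c t0 m) = cm m s" for s by (rule ext) (simp add: w_def cm_def)
      then have eq: "(\<lambda>s. f (w (s, c t0 m))) = (\<lambda>s. f (cm m s))" by simp
      show "((\<lambda>s. f (w (s, c t0 m))) has_derivative
          (\<lambda>ts. ts *\<^sub>R (\<Sum>i<m. c' i *\<^sub>R partial i f (c t0)))) (at t0 within ?X)"
        unfolding eq by (rule has_derivative_at_withinI[OF IH[unfolded has_vector_derivative_def]])
    next
      fix s u assume su: "s \<in> ?X" "u \<in> ?Y"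
      have "((\<lambda>u'. f ((w (s, u))(m := u'))) has_vector_derivative partial m f (w (s, u))) (at (w (s, u) m))"
        by (rule C_infinity_on_has_partial[OF V f m wV[OF su]])
      then have "((\<lambda>u. f (w (s, u))) has_derivative (\<lambda>h. h *\<^sub>R partial m f (w (s, u)))) (at u)"
        by (simp add: w_def has_vector_derivative_def)
      then show "((\<lambda>u. f (w (s, u))) has_derivative
          blinfun_apply (blinfun_scaleR_left (partial m f (w (s, u))))) (at u within ?Y)"
        by (simp add: has_derivative_at_withinI)
    next
      have "((\<lambda>p. partial m f (w p)) \<longlongrightarrow> partial m f (c t0)) (at ?p within ?X \<times> ?Y)"
      proof (rule continuous_on_tendsto_compose[where f = "partial m f" and s = V and g = w])
        show "continuous_on V (partial m f)"
          by (rule C_infinity_on_continuous[OF V C_infinity_on_partial[OF V f m]])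
        show "(w \<longlongrightarrow> c t0) (at ?p within ?X \<times> ?Y)"
          using cont_w unfolding isCont_def wp by (rule tendsto_within_subset) simp
        show "\<forall>\<^sub>F p in at ?p within ?X \<times> ?Y. w p \<in> V"
          unfolding eventually_at_filter by (rule always_eventually) (use wV in auto)
      qed (rule c0)
      then show "continuous (at ?p within ?X \<times> ?Y) (\<lambda>(s, u). blinfun_scaleR_left (partial m f (w (s, u))))"
        unfolding continuous_within case_prod_beta' prod.collapse wp
        by (intro bounded_linear.tendsto[OF bounded_linear_blinfun_scaleR_left])
    qed (use e in auto)
    moreover have "at ?p within ?X \<times> ?Y = at ?p"
      using d e by (intro at_within_open open_Times) auto
    ultimately have D: "((\<lambda>p. f (w p)) has_derivative
        (\<lambda>(ts, tu). ts *\<^sub>R (\<Sum>i<m. c' i *\<^sub>R partial i f (c t0)) + tu *\<^sub>R partial m f (c t0))) (at (t0, c t0 m))"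
      by (simp add: wp case_prod_beta')
    have "((\<lambda>t. (t, c t m)) has_derivative (\<lambda>h. (h, h *\<^sub>R c' m))) (at t0)"
      using c'[OF m] unfolding has_vector_derivative_def
      by (intro has_derivative_Pair has_derivative_ident)
    from has_derivative_compose[OF this D]
    have "((\<lambda>t. f (w (t, c t m))) has_derivative (\<lambda>h. h *\<^sub>R (\<Sum>i<Suc m. c' i *\<^sub>R partial i f (c t0)))) (at t0)"
      by (simp add: scaleR_add_right)
    moreover have "w (t, c t m) = cm (Suc m) t" for t
      by (rule ext) (simp add: w_def cm_def less_Suc_eq)
    ultimately show ?case by (simp add: has_vector_derivative_def)
  qed
  have "\<forall>\<^sub>F t in nhds t0. f (c t) = f (cm n t)"
    using cV
  proof eventually_elim
    case (elim t)
    \<comment> \<open>Points of V have no coordinates from n on, so releasing n coordinates releases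
      the whole curve.\<close>
    then have "c t x = 0 \<and> c t0 x = 0" if "n \<le> x" for x
      using that c0 openin_Euclidean_space_subset[OF V] by blast
    then have "cm n t = c t" by (auto simp: cm_def fun_eq_iff not_less)
    then show ?case by simp
  qed
  then show ?thesis using main[OF order_refl] by (simp add: has_vector_derivative_cong_nhds)
qed

text \<open>Induction on the order for all smooth f at once: the chain rule writes a derivative of
  the composite through derivatives of \<tau> and composites of \<tau> with partial derivatives of
  f, to which the induction hypothesis applies. Coordinates of \<tau> from m on are 0 because its
  values lie in V.\<close>

lemma C_infinity_on_compose:
  fixes f :: "(nat \<Rightarrow> real) \<Rightarrow> 'b::real_normed_vector"
  assumes V: "openin (Euclidean_space m) V" and W: "openin (Euclidean_space n) W"
    and \<tau>: "\<And>i. i < m \<Longrightarrow> C_infinity_on n W (\<lambda>y. \<tau> y i)" and \<tau>V: "\<And>y. y \<in> W \<Longrightarrow> \<tau> y \<in> V"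
    and f: "C_infinity_on m V f"
  shows "C_infinity_on n W (\<lambda>y. f (\<tau> y))"
proof -
  have \<tau>_cont: "continuous_on W \<tau>"
  proof (rule continuous_on_coordinatewise_then_product)
    fix i
    show "continuous_on W (\<lambda>y. \<tau> y i)"
    proof (cases "i < m")
      case True
      then show ?thesis using C_infinity_on_continuous[OF W \<tau>] by blast
    next
      case False
      then have "\<tau> y i = 0" if "y \<in> W" for y
        using \<tau>V[OF that] openin_Euclidean_space_subset[OF V] by auto
      then show ?thesis using continuous_on_cong[of W W "\<lambda>y. \<tau> y i" "\<lambda>y. 0"] by simp
    qed
  qed
  have "Ck_on n k W (\<lambda>y. f (\<tau> y))" if "C_infinity_on m V f" for k and f :: "(nat \<Rightarrow> real) \<Rightarrow> 'b"
    using that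
  proof (induction k arbitrary: f)
    have cont: "continuous_on W (\<lambda>y. f (\<tau> y))" if "C_infinity_on m V f" for f :: "(nat \<Rightarrow> real) \<Rightarrow> 'b"
      by (rule continuous_on_compose2[OF C_infinity_on_continuous[OF V that] \<tau>_cont]) (use \<tau>V in blast)
    {
      case 0
      show ?case using cont[OF 0] by (simp only: Ck_on_0_iff[OF W])
    next
      case (Suc k)
      show ?case
      proof (rule Ck_on_SucI[OF W cont[OF Suc.prems], where
          g = "\<lambda>j y. \<Sum>i<m. partial j (\<lambda>y. \<tau> y i) y *\<^sub>R partial i f (\<tau> y)"])
        fix j assume j: "j < n"
        have sum: "Ck_on n k W (\<lambda>y. \<Sum>i\<in>I. h i y)" if "finite I" "\<And>i. i \<in> I \<Longrightarrow> Ck_on n k W (h i)"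
          for I :: "nat set" and h :: "nat \<Rightarrow> _ \<Rightarrow> 'b"
          using that C_infinity_on_const[OF W, of "0::'b"]
          by (induction I rule: finite_induct) (simp_all add: C_infinity_on_def Ck_on_add[OF W])
        show "Ck_on n k W (\<lambda>y. \<Sum>i<m. partial j (\<lambda>y. \<tau> y i) y *\<^sub>R partial i f (\<tau> y))"
        proof (rule sum)
          fix i assume "i \<in> {..<m}"
          then have i: "i < m" by simp
          have "Ck_on n k W (partial j (\<lambda>y. \<tau> y i))"
            using C_infinity_on_partial[OF W \<tau>[OF i] j] by (simp add: C_infinity_on_def)
          moreover have "Ck_on n k W (\<lambda>y. partial i f (\<tau> y))"
            by (rule Suc.IH[OF C_infinity_on_partial[OF V Suc.prems i]])
          ultimately show "Ck_on n k W (\<lambda>y. partial j (\<lambda>y. \<tau> y i) y *\<^sub>R partial i f (\<tau> y))"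
            by (rule Ck_on_bilinear[OF W bounded_bilinear_scaleR])
        qed simp
        fix y assume y: "y \<in> W"
        have ev: "\<forall>\<^sub>F t in nhds (y j). \<tau> (y(j := t)) \<in> V"
          using eventually_update_in_open[OF W y j] by eventually_elim (rule \<tau>V)
        have "((\<lambda>t. f (\<tau> (y(j := t)))) has_vector_derivative
            (\<Sum>i<m. partial j (\<lambda>y. \<tau> y i) y *\<^sub>R partial i f (\<tau> (y(j := y j))))) (at (y j))"
          by (rule chain_rule_curve[OF V Suc.prems _ ev])
             (use \<tau>V[OF y] C_infinity_on_has_partial[OF W \<tau> j y] in simp_all)
        then show "((\<lambda>t. f (\<tau> (y(j := t)))) has_vector_derivative
            (\<Sum>i<m. partial j (\<lambda>y. \<tau> y i) y *\<^sub>R partial i f (\<tau> y))) (at (y j))"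
          by simp
      qed
    }
  qed
  then show ?thesis using f by (simp add: C_infinity_on_def)
qed

section \<open>Hadamard's lemma\<close>

definition segment_point :: "(nat \<Rightarrow> real) \<Rightarrow> (nat \<Rightarrow> real) \<Rightarrow> real \<Rightarrow> nat \<Rightarrow> real"
  where "segment_point p y t = (\<lambda>i. p i + t * (y i - p i))"

text \<open>The coefficients of Hadamard's lemma are the case k = 0. The weight t^k makes the family
  stable under differentiation below the integral sign, where every derivative yields a factor
  t.\<close>

definition segment_integral ::
  "(nat \<Rightarrow> real) \<Rightarrow> nat \<Rightarrow> ((nat \<Rightarrow> real) \<Rightarrow> 'b::banach) \<Rightarrow> (nat \<Rightarrow> real) \<Rightarrow> 'b"
  where "segment_integral p k f y = integral {0..1} (\<lambda>t. t ^ k *\<^sub>R f (segment_point p y t))"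

lemma continuous_on_segment_point:
  assumes "continuous_on S y" "continuous_on S t"
  shows "continuous_on S (\<lambda>x. segment_point p (y x) (t x))"
  unfolding segment_point_def
  by (intro continuous_on_coordinatewise_then_product continuous_on_add continuous_on_mult continuous_on_diff
        continuous_on_const assms(2) continuous_on_product_then_coordinatewise[OF assms(1)])

lemma continuous_on_segment_integrand:
  fixes f :: "(nat \<Rightarrow> real) \<Rightarrow> 'b::banach"
  assumes f: "continuous_on V f" and seg: "\<And>x. x \<in> S \<Longrightarrow> segment_point p (y x) (t x) \<in> V"
    and y: "continuous_on S y" and t: "continuous_on S t"
  shows "continuous_on S (\<lambda>x. t x ^ k *\<^sub>R f (segment_point p (y x) (t x)))"
proof -
  have "continuous_on S (\<lambda>x. f (segment_point p (y x) (t x)))"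
    by (rule continuous_on_compose2[OF f continuous_on_segment_point[OF y t]]) (use seg in blast)
  then show ?thesis using t by (intro continuous_on_scaleR continuous_on_power)
qed

locale star_domain =
  fixes n :: nat and V :: "(nat \<Rightarrow> real) set" and p :: "nat \<Rightarrow> real"
  assumes V: "openin (Euclidean_space n) V" and p: "p \<in> V"
    and star: "\<And>y t. y \<in> V \<Longrightarrow> 0 \<le> t \<Longrightarrow> t \<le> 1 \<Longrightarrow> segment_point p y t \<in> V"
begin

lemma continuous_on_segment_integral:
  fixes f :: "(nat \<Rightarrow> real) \<Rightarrow> 'b::banach"
  assumes f: "continuous_on V f"
  shows "continuous_on V (segment_integral p k f)"
proof -
  have "continuous_on (V \<times> cbox 0 (1::real)) (\<lambda>x. snd x ^ k *\<^sub>R f (segment_point p (fst x) (snd x)))"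
    by (rule continuous_on_segment_integrand[OF f]) (auto intro: star continuous_intros)
  then have "continuous_on V (\<lambda>y. integral (cbox 0 1) (\<lambda>t. t ^ k *\<^sub>R f (segment_point p y t)))"
    by (intro integral_continuous_on_param) (simp add: case_prod_beta')
  then show ?thesis by (simp add: segment_integral_def[abs_def])
qed

lemma segment_integrable:
  fixes f :: "(nat \<Rightarrow> real) \<Rightarrow> 'b::banach"
  assumes f: "continuous_on V f" and y: "y \<in> V"
  shows "(\<lambda>t. t ^ k *\<^sub>R f (segment_point p y t)) integrable_on {0..1}"
proof -
  have "continuous_on {0..1} (\<lambda>t. t ^ k *\<^sub>R f (segment_point p y t))"
    by (rule continuous_on_segment_integrand[OF f]) (use y in \<open>auto intro: star continuous_intros\<close>)
  then show ?thesis by (rule integrable_continuous_interval)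
qed

lemma segment_integral_has_partial:
  fixes f :: "(nat \<Rightarrow> real) \<Rightarrow> 'b::banach"
  assumes f: "C_infinity_on n V f" and i: "i < n" and y: "y \<in> V"
  shows "((\<lambda>s. segment_integral p k f (y(i := s))) has_vector_derivative
    segment_integral p (Suc k) (partial i f) y) (at (y i))"
proof -
  obtain e where e: "e > 0" "\<And>s. dist s (y i) < e \<Longrightarrow> y(i := s) \<in> V"
    using eventually_update_in_open[OF V y i] by (auto simp: eventually_nhds_metric)
  let ?U = "ball (y i) e"
  have yV: "y(i := s) \<in> V" if "s \<in> ?U" for s using e(2) that by (simp add: dist_commute)
  have f_cont: "continuous_on V f" by (rule C_infinity_on_continuous[OF V f])
  have pf_cont: "continuous_on V (partial i f)"
    by (rule C_infinity_on_continuous[OF V C_infinity_on_partial[OF V f i]])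
  have "((\<lambda>s. integral (cbox 0 1) (\<lambda>t. t ^ k *\<^sub>R f (segment_point p (y(i := s)) t))) has_vector_derivative
      integral (cbox 0 1) (\<lambda>t. t ^ Suc k *\<^sub>R partial i f (segment_point p (y(i := y i)) t))) (at (y i) within ?U)"
  proof (rule leibniz_rule_vector_derivative)
    fix s t :: real assume s: "s \<in> ?U" and t: "t \<in> cbox 0 1"
    define z where "z = segment_point p (y(i := s)) t"
    have z: "z \<in> V" unfolding z_def using star[OF yV[OF s]] t by simp
    \<comment> \<open>Only coordinate i of the segment point depends on the varied coordinate,
      affinely with slope t. This slope raises the weight from t^k to t^(k + 1).\<close>
    have eq: "segment_point p (y(i := s')) t = z(i := p i + t * (s' - p i))" for s'
      by (auto simp: z_def segment_point_def fun_eq_iff)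
    have "z i = p i + t * (s - p i)" by (simp add: z_def segment_point_def)
    then have D: "((\<lambda>u. f (z(i := u))) has_vector_derivative partial i f z) (at (p i + t * (s - p i)))"
      using C_infinity_on_has_partial[OF V f i z] by simp
    have "((\<lambda>s'. p i + t * (s' - p i)) has_real_derivative t) (at s)"
      by (auto intro!: derivative_eq_intros)
    then have "((\<lambda>s'. p i + t * (s' - p i)) has_vector_derivative t) (at s)"
      by (simp add: has_real_derivative_iff_has_vector_derivative)
    from bounded_linear.has_vector_derivative[OF bounded_linear_scaleR_right vector_diff_chain_at[OF this D], of "t ^ k"]
    have "((\<lambda>s'. t ^ k *\<^sub>R f (z(i := p i + t * (s' - p i)))) has_vector_derivative
        t ^ k *\<^sub>R t *\<^sub>R partial i f z) (at s)"
      by (simp only: o_def)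
    then have "((\<lambda>s'. t ^ k *\<^sub>R f (segment_point p (y(i := s')) t)) has_vector_derivative
        t ^ Suc k *\<^sub>R partial i f z) (at s)"
      unfolding eq by (simp add: mult.commute)
    then show "((\<lambda>s'. t ^ k *\<^sub>R f (segment_point p (y(i := s')) t)) has_vector_derivative
        t ^ Suc k *\<^sub>R partial i f (segment_point p (y(i := s)) t)) (at s within ?U)"
      unfolding z_def by (rule has_vector_derivative_at_within)
  next
    fix s assume "s \<in> ?U"
    from segment_integrable[OF f_cont yV[OF this]]
    show "(\<lambda>t. t ^ k *\<^sub>R f (segment_point p (y(i := s)) t)) integrable_on cbox 0 1" by simp
  next
    have "continuous_on (?U \<times> cbox 0 (1::real))
        (\<lambda>x. snd x ^ Suc k *\<^sub>R partial i f (segment_point p (y(i := fst x)) (snd x)))"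
    proof (rule continuous_on_segment_integrand[OF pf_cont])
      show "continuous_on (?U \<times> cbox 0 (1::real)) (\<lambda>x. y(i := fst x))"
        by (intro continuous_on_update continuous_intros)
      fix x assume "x \<in> ?U \<times> cbox 0 (1::real)"
      then have "fst x \<in> ?U" "0 \<le> snd x" "snd x \<le> 1" by auto
      then show "segment_point p (y(i := fst x)) (snd x) \<in> V" using star yV by blast
    qed (intro continuous_intros)
    then show "continuous_on (?U \<times> cbox 0 1)
        (\<lambda>(s, t). t ^ Suc k *\<^sub>R partial i f (segment_point p (y(i := s)) t))"
      by (simp add: case_prod_beta')
  qed (use e in auto)
  moreover have "at (y i) within ?U = at (y i)" using e by (intro at_within_open) auto
  ultimately show ?thesis by (simp add: segment_integral_def)
qed

lemma C_infinity_on_segment_integral: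
  fixes f :: "(nat \<Rightarrow> real) \<Rightarrow> 'b::banach"
  assumes f: "C_infinity_on n V f"
  shows "C_infinity_on n V (segment_integral p k f)"
proof (rule C_infinity_on_coinduct[OF V, where
    \<Phi> = "\<lambda>h. \<exists>k f. C_infinity_on n V f \<and> h = segment_integral p k f"])
  fix h i assume "\<exists>k f. C_infinity_on n V f \<and> h = segment_integral p k (f :: _ \<Rightarrow> 'b)" and i: "i < n"
  then obtain k and f :: "_ \<Rightarrow> 'b" where f: "C_infinity_on n V f" and h: "h = segment_integral p k f" by blast
  show "\<exists>g. (\<exists>k f. C_infinity_on n V f \<and> g = segment_integral p k f) \<and>
      (\<forall>y\<in>V. ((\<lambda>t. h (y(i := t))) has_vector_derivative g y) (at (y i)))"
    unfolding h using C_infinity_on_partial[OF V f i] segment_integral_has_partial[OF f i] by blast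
next
  fix h assume "\<exists>k f. C_infinity_on n V f \<and> h = segment_integral p k (f :: _ \<Rightarrow> 'b)"
  then show "continuous_on V h"
    using continuous_on_segment_integral C_infinity_on_continuous[OF V] by blast
qed (use f in blast)

lemma Hadamard:
  fixes f :: "(nat \<Rightarrow> real) \<Rightarrow> 'b::banach"
  assumes f: "C_infinity_on n V f" and y: "y \<in> V"
  shows "f y - f p = (\<Sum>i<n. (y i - p i) *\<^sub>R segment_integral p 0 (partial i f) y)"
proof -
  obtain T where T: "open T" "V = E_carrier n \<inter> T" using V by (auto simp: openin_Euclidean_space_iff)
  \<comment> \<open>The chain rule needs a two-sided neighbourhood of times also at t = 0 and t = 1,
    where star-shapedness says nothing beyond the segment; openness of V does.\<close>
  have ev: "\<forall>\<^sub>F t in nhds t0. segment_point p y t \<in> V" if "t0 \<in> {0..1}" for t0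
  proof -
    have "segment_point p y t0 \<in> T" using star[OF y] that T(2) by auto
    moreover have "continuous_on UNIV (segment_point p y)"
      using continuous_on_segment_point[of UNIV "\<lambda>_. y" "\<lambda>t. t" p] by simp
    ultimately have "\<forall>\<^sub>F t in nhds t0. t \<in> segment_point p y -` T"
      using T(1) by (intro eventually_nhds_in_open open_vimage) auto
    then show ?thesis
      by eventually_elim (use y p T(2) in \<open>auto simp: segment_point_def\<close>)
  qed
  have "((\<lambda>t. f (segment_point p y t)) has_vector_derivative
      (\<Sum>i<n. (y i - p i) *\<^sub>R partial i f (segment_point p y t))) (at t within {0..1})" if t: "t \<in> {0..1}" for t
  proof (rule has_vector_derivative_at_within, rule chain_rule_curve[OF V f _ ev[OF t]])
    show "segment_point p y t \<in> V" using star[OF y] t by auto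
    show "((\<lambda>t. segment_point p y t i) has_vector_derivative y i - p i) (at t)" for i
      unfolding segment_point_def has_real_derivative_iff_has_vector_derivative[symmetric]
      by (auto intro!: derivative_eq_intros)
  qed
  then have "((\<lambda>t. \<Sum>i<n. (y i - p i) *\<^sub>R partial i f (segment_point p y t)) has_integral
      f (segment_point p y 1) - f (segment_point p y 0)) {0..1}"
    by (intro fundamental_theorem_of_calculus) auto
  then have "f (segment_point p y 1) - f (segment_point p y 0) =
      integral {0..1} (\<lambda>t. \<Sum>i<n. (y i - p i) *\<^sub>R partial i f (segment_point p y t))"
    by (simp add: integral_unique)
  also have "\<dots> = (\<Sum>i<n. integral {0..1} (\<lambda>t. (y i - p i) *\<^sub>R partial i f (segment_point p y t)))"
  proof (rule integral_sum)
    fix i assume "i \<in> {..<n}"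
    then have "continuous_on V (partial i f)"
      using C_infinity_on_continuous[OF V C_infinity_on_partial[OF V f]] by simp
    from segment_integrable[OF this y, of 0]
    show "(\<lambda>t. (y i - p i) *\<^sub>R partial i f (segment_point p y t)) integrable_on {0..1}"
      by (simp add: integrable_cmul)
  qed simp
  also have "\<dots> = (\<Sum>i<n. (y i - p i) *\<^sub>R segment_integral p 0 (partial i f) y)"
    by (simp add: segment_integral_def)
  finally show ?thesis by (simp add: segment_point_def)
qed

end

section \<open>Bump functions\<close>

text \<open>For q = 1 this is the standard flat function exp(-1/x). The polynomial in 1/x is carried
  along because the derivatives have this shape.\<close>

definition flat_fun :: "real poly \<Rightarrow> real \<Rightarrow> real"
  where "flat_fun q x = (if x > 0 then poly q (inverse x) * exp (- inverse x) else 0)"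

lemma poly_over_exp_tendsto_0: "((\<lambda>u::real. poly q u * exp (- u)) \<longlongrightarrow> 0) at_top"
proof -
  have "((\<lambda>u. \<Sum>i\<le>degree q. coeff q i * (u ^ i / exp u)) \<longlongrightarrow> (\<Sum>i\<le>degree q. coeff q i * 0)) at_top"
    by (intro tendsto_sum tendsto_mult tendsto_const tendsto_power_div_exp_0)
  then show ?thesis
    by (simp add: poly_altdef sum_distrib_right exp_minus divide_inverse mult.assoc)
qed

lemma flat_fun_right_limit: "(flat_fun q \<longlongrightarrow> 0) (at_right 0)"
proof -
  have "((\<lambda>x. poly q (inverse x) * exp (- inverse x)) \<longlongrightarrow> 0) (at_right 0)"
    by (rule filterlim_compose[OF poly_over_exp_tendsto_0 filterlim_inverse_at_top_right])
  moreover have "\<forall>\<^sub>F x in at_right 0. poly q (inverse x) * exp (- inverse x) = flat_fun q x"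
    unfolding eventually_at_filter by (simp add: flat_fun_def)
  ultimately show ?thesis by (rule Lim_transform_eventually)
qed

text \<open>With u = 1/x one has du/dx = -u^2, so q(u) exp(-u) has the derivative u^2 (q(u) - q'(u))
  exp(-u). At 0 the right difference quotient is again a flat function, with u q(u) in place of
  q(u), and tends to 0.\<close>

lemma flat_fun_has_derivative:
  "(flat_fun q has_real_derivative flat_fun ([:0, 0, 1:] * (q - pderiv q)) x) (at x)"
proof (cases x "0::real" rule: linorder_cases)
  case less
  have "((\<lambda>x. 0) has_real_derivative 0) (at x)" by simp
  then have "(flat_fun q has_real_derivative 0) (at x)"
    by (rule has_field_derivative_transform_within_open[of _ _ _ "{..<0}"]) (use less in \<open>auto simp: flat_fun_def\<close>)
  then show ?thesis using less by (simp add: flat_fun_def)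
next
  case equal
  have "((\<lambda>h. (flat_fun q (0 + h) - flat_fun q 0) / h) \<longlongrightarrow> 0) (at 0)"
  proof (rule filterlim_split_at)
    have "\<forall>\<^sub>F h in at_left (0::real). (flat_fun q (0 + h) - flat_fun q 0) / h = 0"
      unfolding eventually_at_filter by (simp add: flat_fun_def)
    then show "((\<lambda>h. (flat_fun q (0 + h) - flat_fun q 0) / h) \<longlongrightarrow> 0) (at_left 0)"
      by (simp add: tendsto_eventually)
    have "\<forall>\<^sub>F h in at_right (0::real). flat_fun ([:0, 1:] * q) h = (flat_fun q (0 + h) - flat_fun q 0) / h"
      unfolding eventually_at_filter by (simp add: flat_fun_def divide_inverse)
    with flat_fun_right_limit show "((\<lambda>h. (flat_fun q (0 + h) - flat_fun q 0) / h) \<longlongrightarrow> 0) (at_right 0)"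
      by (rule Lim_transform_eventually)
  qed
  then show ?thesis by (simp add: equal DERIV_def flat_fun_def)
next
  case greater
  have "((\<lambda>x. poly q (inverse x) * exp (- inverse x)) has_real_derivative
      flat_fun ([:0, 0, 1:] * (q - pderiv q)) x) (at x)"
    using greater
    by (auto intro!: derivative_eq_intros DERIV_chain2[OF poly_DERIV]
        simp: flat_fun_def field_simps power2_eq_square)
  then show ?thesis
    by (rule has_field_derivative_transform_within_open[of _ _ _ "{0<..}"])
       (use greater in \<open>auto simp: flat_fun_def\<close>)
qed

text \<open>Nonzero exactly where the first n coordinates lie in the open box of radius r around p.
  For n = 0 it is the constant 1.\<close>

definition box_bump :: "nat \<Rightarrow> (nat \<Rightarrow> real) \<Rightarrow> real \<Rightarrow> (nat \<Rightarrow> real) \<Rightarrow> real"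
  where "box_bump n p r y = (\<Prod>i<n. flat_fun 1 (y i - p i + r) * flat_fun 1 (p i - y i + r))"

lemma C_infinity_on_box_bump:
  assumes V: "openin (Euclidean_space n) V"
  shows "C_infinity_on n V (box_bump m p r)"
proof -
  have "C_infinity_on n V (\<lambda>y. flat_fun 1 (s * y i + a))" for i s a
    by (rule C_infinity_on_coordinate_family[OF V, where S = "\<lambda>\<theta>. \<exists>q. \<theta> = flat_fun q"])
       (use flat_fun_has_derivative in metis)+
  from this[of 1] this[of "- 1"]
  have "C_infinity_on n V (\<lambda>y. flat_fun 1 (1 * y i + (r - p i)))"
    "C_infinity_on n V (\<lambda>y. flat_fun 1 (- 1 * y i + (p i + r)))" for i by blast+
  then have "C_infinity_on n V (\<lambda>y. flat_fun 1 (y i - p i + r))"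
    "C_infinity_on n V (\<lambda>y. flat_fun 1 (p i - y i + r))" for i
    by (simp_all add: algebra_simps)
  then show ?thesis unfolding box_bump_def by (intro C_infinity_on_prod[OF V] C_infinity_on_mult[OF V])
qed

lemma box_bump_eq_0: "i < n \<Longrightarrow> r \<le> \<bar>y i - p i\<bar> \<Longrightarrow> box_bump n p r y = 0"
  unfolding box_bump_def
  by (rule prod_zero) (auto intro!: bexI[of _ i] simp: flat_fun_def)

lemma box_bump_self: "r > 0 \<Longrightarrow> box_bump n p r p \<noteq> 0"
  by (simp add: box_bump_def flat_fun_def)

section \<open>Functions on smooth atlases\<close>

text \<open>The conditions of \<open>smooth_manifold\<close> on charts. They are what is verified
  for \<open>dual A\<close>; the compactness argument behind bump functions takes place on the base,
  and its results are pulled back.\<close>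

definition smooth_atlas :: "'p mfd \<Rightarrow> bool"
  where "smooth_atlas X \<longleftrightarrow>
    (\<Union>(U, \<phi>)\<in>atlas X. U) = pts X \<and>
    (\<forall>(U, \<phi>)\<in>atlas X. inj_on \<phi> U \<and> openin (Euclidean_space (mdim X)) (\<phi> ` U)) \<and>
    (\<forall>(U, \<phi>)\<in>atlas X. \<forall>(V, \<psi>)\<in>atlas X.
       openin (Euclidean_space (mdim X)) (\<phi> ` (U \<inter> V)) \<and>
       (\<forall>i<mdim X. C_infinity_on (mdim X) (\<phi> ` (U \<inter> V)) (\<lambda>y. \<psi> (inv_into U \<phi> y) i)))"

lemma smooth_manifold_imp_atlas: "smooth_manifold X \<Longrightarrow> smooth_atlas X"
  by (simp add: smooth_manifold_def smooth_atlas_def)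

locale atlas_mfd =
  fixes X :: "'p mfd"
  assumes smooth_atlas: "smooth_atlas X"
begin

abbreviation E_topology where "E_topology \<equiv> Euclidean_space (mdim X)"
abbreviation X_open where "X_open \<equiv> openin (mfd_topology X)"

lemma chart_inj_open:
  assumes "(U, \<phi>) \<in> atlas X"
  shows "inj_on \<phi> U \<and> openin E_topology (\<phi> ` U)"
proof -
  have "\<forall>(U, \<phi>)\<in>atlas X. inj_on \<phi> U \<and> openin E_topology (\<phi> ` U)"
    using smooth_atlas unfolding smooth_atlas_def by (elim conjE)
  from bspec[OF this assms] show ?thesis by simp
qed

lemmas chart_inj = chart_inj_open[THEN conjunct1]
  and chart_open = chart_inj_open[THEN conjunct2]

lemma atlas_Union: "(\<Union>(U, \<phi>)\<in>atlas X. U) = pts X"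
  using smooth_atlas unfolding smooth_atlas_def by (elim conjE)

lemma chart_subset: "(U, \<phi>) \<in> atlas X \<Longrightarrow> U \<subseteq> pts X"
  unfolding atlas_Union[symmetric] by auto

lemma chart_cover: "x \<in> pts X \<Longrightarrow> \<exists>U \<phi>. (U, \<phi>) \<in> atlas X \<and> x \<in> U"
  unfolding atlas_Union[symmetric] by auto

lemma transition:
  assumes "(U, \<phi>) \<in> atlas X" "(V, \<psi>) \<in> atlas X"
  shows "openin E_topology (\<phi> ` (U \<inter> V)) \<and>
       (\<forall>i<mdim X. C_infinity_on (mdim X) (\<phi> ` (U \<inter> V)) (\<lambda>y. \<psi> (inv_into U \<phi> y) i))"
proof -
  have "\<forall>(U, \<phi>)\<in>atlas X. \<forall>(V, \<psi>)\<in>atlas X. openin E_topology (\<phi> ` (U \<inter> V)) \<and>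
       (\<forall>i<mdim X. C_infinity_on (mdim X) (\<phi> ` (U \<inter> V)) (\<lambda>y. \<psi> (inv_into U \<phi> y) i))"
    using smooth_atlas unfolding smooth_atlas_def by (elim conjE)
  from bspec[OF bspec[OF this assms(1), unfolded prod.case] assms(2), unfolded prod.case] show ?thesis .
qed

lemmas transition_open = transition[THEN conjunct1]
  and transition_smooth = transition[THEN conjunct2, rule_format]

lemma chart_inv [simp]: "(U, \<phi>) \<in> atlas X \<Longrightarrow> x \<in> U \<Longrightarrow> inv_into U \<phi> (\<phi> x) = x"
  by (rule inv_into_f_f[OF chart_inj])

lemma chart_range: "(U, \<phi>) \<in> atlas X \<Longrightarrow> x \<in> U \<Longrightarrow> \<phi> x \<in> E_carrier (mdim X)"
  using openin_Euclidean_space_subset[OF chart_open] by blast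

lemma transition_preimage:
  assumes "(U, \<phi>) \<in> atlas X" "(V, \<psi>) \<in> atlas X" and G: "openin E_topology G" 
  shows "openin E_topology {y \<in> \<phi> ` (U \<inter> V). \<psi> (inv_into U \<phi> y) \<in> G}"
proof -
  let ?D = "\<phi> ` (U \<inter> V)" and ?\<tau> = "\<lambda>y. \<psi> (inv_into U \<phi> y)"
  obtain T where T: "open T" "G = E_carrier (mdim X) \<inter> T" using G by (auto simp: openin_Euclidean_space_iff)
  obtain S where S: "open S" "?D = E_carrier (mdim X) \<inter> S"
    using transition_open[OF assms(1,2)] by (auto simp: openin_Euclidean_space_iff)
  have range: "?\<tau> y \<in> E_carrier (mdim X)" if "y \<in> ?D" for y
    using that chart_range[OF assms(2)] assms(1) by auto
  have "continuous_on ?D ?\<tau>"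
  proof (rule continuous_on_coordinatewise_then_product)
    fix i
    show "continuous_on ?D (\<lambda>y. ?\<tau> y i)"
    proof (cases "i < mdim X")
      case True
      then show ?thesis
        using C_infinity_on_continuous[OF transition_open[OF assms(1,2)] transition_smooth[OF assms(1,2)]] by simp
    next
      case False
      then have "?\<tau> y i = 0" if "y \<in> ?D" for y using range[OF that] by simp
      then show ?thesis using continuous_on_cong[of ?D ?D "\<lambda>y. ?\<tau> y i" "\<lambda>y. 0"] by simp
    qed
  qed
  then obtain R where R: "open R" "R \<inter> ?D = ?\<tau> -` T \<inter> ?D"
    using T(1) by (auto simp: continuous_on_open_invariant)
  have "{y \<in> ?D. ?\<tau> y \<in> G} = ?\<tau> -` T \<inter> ?D" using range T(2) by auto
  also have "\<dots> = R \<inter> ?D" by (rule R(2)[symmetric])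
  also have "\<dots> = R \<inter> (E_carrier (mdim X) \<inter> S)" by (simp only: S(2))
  also have "\<dots> = E_carrier (mdim X) \<inter> (R \<inter> S)" by (rule Int_left_commute)
  finally have "{y \<in> ?D. ?\<tau> y \<in> G} = E_carrier (mdim X) \<inter> (R \<inter> S)" .
  moreover have "open (R \<inter> S)" using R(1) S(1) by (rule open_Int)
  ultimately show ?thesis unfolding openin_Euclidean_space_iff by (intro exI conjI)
qed

text \<open>A generating set is known to be open in one chart only; that every other chart sees it
  as open is continuity of the transition maps (\<open>transition_preimage\<close>). Finite
  intersections are preserved because charts are injective.\<close>

lemma X_open_chart_images:
  assumes "X_open N"
  shows "N \<subseteq> pts X \<and> (\<forall>U \<phi>. (U, \<phi>) \<in> atlas X \<longrightarrow> openin E_topology (\<phi> ` (U \<inter> N)))"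
proof -
  have "generate_topology_on {W. \<exists>(U, \<phi>)\<in>atlas X. W \<subseteq> U \<and> openin E_topology (\<phi> ` W)} N"
    using assms by (simp add: mfd_topology_def openin_topology_generated_by_iff)
  then show ?thesis
  proof (induction rule: generate_topology_on.induct)
    case (Int a b)
    have "openin E_topology (\<phi> ` (U \<inter> (a \<inter> b)))" if "(U, \<phi>) \<in> atlas X" for U \<phi>
    proof -
      have "\<phi> ` (U \<inter> (a \<inter> b)) = \<phi> ` (U \<inter> a) \<inter> \<phi> ` (U \<inter> b)"
        using chart_inj[OF that] by (auto simp: inj_on_def)
      moreover have "openin E_topology (\<phi> ` (U \<inter> a))" "openin E_topology (\<phi> ` (U \<inter> b))"
        using Int that by simp_all
      ultimately show ?thesis by (simp add: openin_Int)
    qed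
    then show ?case using Int by auto
  next
    case (UN K)
    have "openin E_topology (\<phi> ` (U \<inter> \<Union>K))" if "(U, \<phi>) \<in> atlas X" for U \<phi>
    proof -
      have "openin E_topology (\<phi> ` (U \<inter> k))" if "k \<in> K" for k
        using UN[OF that] \<open>(U, \<phi>) \<in> atlas X\<close> by simp
      then have "openin E_topology (\<Union>k\<in>K. \<phi> ` (U \<inter> k))" by (intro openin_Union) auto
      moreover have "\<phi> ` (U \<inter> \<Union>K) = (\<Union>k\<in>K. \<phi> ` (U \<inter> k))" by blast
      ultimately show ?thesis by simp
    qed
    moreover have "\<Union>K \<subseteq> pts X" using UN by (simp add: Union_least)
    ultimately show ?case by simp
  next
    case (Basis W)
    then obtain V \<psi> where V: "(V, \<psi>) \<in> atlas X" "W \<subseteq> V" "openin E_topology (\<psi> ` W)" by auto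
    have "openin E_topology (\<phi> ` (U \<inter> W))" if U: "(U, \<phi>) \<in> atlas X" for U \<phi>
    proof -
      have "\<phi> ` (U \<inter> W) = {y \<in> \<phi> ` (U \<inter> V). \<psi> (inv_into U \<phi> y) \<in> \<psi> ` W}"
      proof (intro set_eqI iffI)
        fix y assume "y \<in> {y \<in> \<phi> ` (U \<inter> V). \<psi> (inv_into U \<phi> y) \<in> \<psi> ` W}"
        then obtain x w where x: "x \<in> U" "x \<in> V" "y = \<phi> x" and w: "w \<in> W" "\<psi> x = \<psi> w" using U by auto
        then have "x = w" using inj_onD[OF chart_inj[OF V(1)]] V(2) by blast
        then show "y \<in> \<phi> ` (U \<inter> W)" using x w by blast
      qed (use V(2) U in auto)
      then show ?thesis using transition_preimage[OF U V(1,3)] by simp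
    qed
    then show ?case using V(2) chart_subset[OF V(1)] by simp
  qed auto
qed

lemma openin_mfd_iff:
  "X_open N \<longleftrightarrow> N \<subseteq> pts X \<and> (\<forall>U \<phi>. (U, \<phi>) \<in> atlas X \<longrightarrow> openin E_topology (\<phi> ` (U \<inter> N)))"
proof
  assume R: "N \<subseteq> pts X \<and> (\<forall>U \<phi>. (U, \<phi>) \<in> atlas X \<longrightarrow> openin E_topology (\<phi> ` (U \<inter> N)))"
  show "X_open N"
  proof (subst openin_subopen, rule ballI)
    fix x assume "x \<in> N"
    then obtain U \<phi> where U: "(U, \<phi>) \<in> atlas X" "x \<in> U" using R chart_cover[of x] by auto
    have "X_open (U \<inter> N)"
      unfolding mfd_topology_def
      by (rule topology_generated_by_Basis) (use U R in auto)
    then show "\<exists>T. X_open T \<and> x \<in> T \<and> T \<subseteq> N" using U(2) \<open>x \<in> N\<close> by (intro exI[of _ "U \<inter> N"]) simp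
  qed
qed (rule X_open_chart_images)

lemma topspace_mfd [simp]: "topspace (mfd_topology X) = pts X"
proof
  show "topspace (mfd_topology X) \<subseteq> pts X" using X_open_chart_images[OF openin_topspace] by simp
  have "openin E_topology (\<phi> ` (U \<inter> pts X))" if "(U, \<phi>) \<in> atlas X" for U \<phi>
    using chart_open[OF that] chart_subset[OF that] by (simp add: Int_absorb2)
  then have "X_open (pts X)" unfolding openin_mfd_iff by simp
  then show "pts X \<subseteq> topspace (mfd_topology X)" by (rule openin_subset)
qed

lemma X_open_pts [simp]: "X_open (pts X)" using openin_topspace[of "mfd_topology X"] by simp

lemma X_open_subset: "X_open N \<Longrightarrow> N \<subseteq> pts X" using openin_subset by fastforce

lemma chart_image_open: "(U, \<phi>) \<in> atlas X \<Longrightarrow> X_open N \<Longrightarrow> openin E_topology (\<phi> ` (U \<inter> N))"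
  using X_open_chart_images by simp

lemma X_open_chart: "(U, \<phi>) \<in> atlas X \<Longrightarrow> X_open U"
  unfolding openin_mfd_iff using transition_open chart_subset by auto

lemma smooth_onD:
  "smooth_on X W f \<Longrightarrow> (U, \<phi>) \<in> atlas X \<Longrightarrow>
    C_infinity_on (mdim X) (\<phi> ` (U \<inter> W)) (\<lambda>y. f (inv_into U \<phi> y))"
  unfolding smooth_on_def by auto

lemma smooth_onI:
  "(\<And>U \<phi>. (U, \<phi>) \<in> atlas X \<Longrightarrow> C_infinity_on (mdim X) (\<phi> ` (U \<inter> W)) (\<lambda>y. f (inv_into U \<phi> y))) \<Longrightarrow>
    smooth_on X W f"
  unfolding smooth_on_def by auto

lemma smooth_on_subset: "smooth_on X W f \<Longrightarrow> W' \<subseteq> W \<Longrightarrow> smooth_on X W' f"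
proof (rule smooth_onI)
  fix U \<phi> assume "smooth_on X W f" "W' \<subseteq> W" and U: "(U, \<phi>) \<in> atlas X"
  then have "\<phi> ` (U \<inter> W') \<subseteq> \<phi> ` (U \<inter> W)" by blast
  from C_infinity_on_subset[OF this smooth_onD[OF \<open>smooth_on X W f\<close> U]]
  show "C_infinity_on (mdim X) (\<phi> ` (U \<inter> W')) (\<lambda>y. f (inv_into U \<phi> y))" .
qed

lemma smooth_on_cong:
  assumes "X_open W" "\<And>x. x \<in> W \<Longrightarrow> f x = g x" "smooth_on X W f"
  shows "smooth_on X W g"
proof (rule smooth_onI)
  fix U \<phi> assume U: "(U, \<phi>) \<in> atlas X"
  show "C_infinity_on (mdim X) (\<phi> ` (U \<inter> W)) (\<lambda>y. g (inv_into U \<phi> y))"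
    by (rule C_infinity_on_cong[OF chart_image_open[OF U assms(1)] _ smooth_onD[OF assms(3) U]])
       (use U assms(2) in auto)
qed

lemma smooth_on_add: "X_open W \<Longrightarrow> smooth_on X W f \<Longrightarrow> smooth_on X W g \<Longrightarrow> smooth_on X W (\<lambda>x. f x + g x)"
  by (rule smooth_onI, rule C_infinity_on_add, rule chart_image_open, assumption+)
     (rule smooth_onD, assumption+)+

lemma smooth_on_bilinear:
  "X_open W \<Longrightarrow> bounded_bilinear mul \<Longrightarrow> smooth_on X W f \<Longrightarrow> smooth_on X W g \<Longrightarrow>
    smooth_on X W (\<lambda>x. mul (f x) (g x))"
  by (rule smooth_onI, rule C_infinity_on_bilinear, rule chart_image_open, assumption+)
     (rule smooth_onD, assumption+)+

lemmas smooth_on_mult = smooth_on_bilinear[OF _ bounded_bilinear_mult]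
lemmas smooth_on_scaleR = smooth_on_bilinear[OF _ bounded_bilinear_scaleR]

lemma smooth_on_linear:
  "X_open W \<Longrightarrow> bounded_linear T \<Longrightarrow> smooth_on X W f \<Longrightarrow> smooth_on X W (\<lambda>x. T (f x))"
  by (rule smooth_onI, rule C_infinity_on_linear, rule chart_image_open, assumption+)
     (rule smooth_onD, assumption+)

lemma smooth_on_const: "X_open W \<Longrightarrow> smooth_on X W (\<lambda>x. c)"
  by (rule smooth_onI, rule C_infinity_on_const, rule chart_image_open)

lemma smooth_on_sum:
  "X_open W \<Longrightarrow> (\<And>i. i \<in> I \<Longrightarrow> smooth_on X W (f i)) \<Longrightarrow> smooth_on X W (\<lambda>x. \<Sum>i\<in>I. f i x)"
  by (induction I rule: infinite_finite_induct) (simp_all add: smooth_on_const smooth_on_add)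

lemma smooth_on_locally:
  assumes "\<And>x. x \<in> W \<Longrightarrow> \<exists>N. X_open N \<and> x \<in> N \<and> N \<subseteq> W \<and> smooth_on X N f"
  shows "smooth_on X W f"
proof (rule smooth_onI)
  fix U \<phi> assume U: "(U, \<phi>) \<in> atlas X"
  have "X_open W" by (subst openin_subopen) (use assms in blast)
  show "C_infinity_on (mdim X) (\<phi> ` (U \<inter> W)) (\<lambda>y. f (inv_into U \<phi> y))"
  proof (rule C_infinity_on_locally[OF chart_image_open[OF U \<open>X_open W\<close>]])
    fix y assume "y \<in> \<phi> ` (U \<inter> W)"
    then obtain x where x: "x \<in> U" "x \<in> W" "y = \<phi> x" by blast
    then obtain N where N: "X_open N" "x \<in> N" "smooth_on X N f" using assms by blast
    show "\<exists>G. openin E_topology G \<and> y \<in> G \<and> C_infinity_on (mdim X) G (\<lambda>y. f (inv_into U \<phi> y))"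
      using chart_image_open[OF U N(1)] smooth_onD[OF N(3) U] x N(2) by blast
  qed
qed

text \<open>In any other chart the function is the given representative composed with a transition
  map.\<close>

lemma smooth_on_chartI:
  assumes U: "(U, \<phi>) \<in> atlas X" and N: "X_open N" "N \<subseteq> U"
    and f: "C_infinity_on (mdim X) (\<phi> ` N) (\<lambda>y. f (inv_into U \<phi> y))"
  shows "smooth_on X N f"
proof (rule smooth_onI)
  fix V \<psi> assume V: "(V, \<psi>) \<in> atlas X"
  let ?D = "\<psi> ` (V \<inter> N)"
  note D = chart_image_open[OF V N(1)]
  have oN: "openin E_topology (\<phi> ` N)" using chart_image_open[OF U N(1)] N(2) by (simp add: Int_absorb1)
  have "C_infinity_on (mdim X) ?D (\<lambda>z. f (inv_into U \<phi> (\<phi> (inv_into V \<psi> z))))"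
  proof (rule C_infinity_on_compose[OF oN D _ _ f])
    show "C_infinity_on (mdim X) ?D (\<lambda>z. \<phi> (inv_into V \<psi> z) i)" if "i < mdim X" for i
      by (rule C_infinity_on_subset[OF _ transition_smooth[OF V U that]]) (use N(2) in blast)
    show "\<phi> (inv_into V \<psi> z) \<in> \<phi> ` N" if "z \<in> ?D" for z using that V by auto
  qed
  then show "C_infinity_on (mdim X) ?D (\<lambda>z. f (inv_into V \<psi> z))"
    by (rule C_infinity_on_cong[OF D, rotated]) (use U V N(2) in \<open>auto simp: subset_iff\<close>)
qed

lemma smooth_on_chart_coordinate:
  assumes U: "(U, \<phi>) \<in> atlas X" and N: "X_open N" "N \<subseteq> U"
  shows "smooth_on X N (\<lambda>x. \<phi> x i)"
proof (rule smooth_on_chartI[OF U N])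
  have oN: "openin E_topology (\<phi> ` N)" using chart_image_open[OF U N(1)] N(2) by (simp add: Int_absorb1)
  show "C_infinity_on (mdim X) (\<phi> ` N) (\<lambda>y. \<phi> (inv_into U \<phi> y) i)"
    by (rule C_infinity_on_cong[OF oN _ C_infinity_on_coordinate[OF oN, of i]])
       (use U N(2) in \<open>auto simp: subset_iff\<close>)
qed

text \<open>N and the complement of K are open and cover the manifold; on the second the function is
  0. Closedness of K is therefore the point to establish in every application.\<close>

lemma smooth_on_extend_zero:
  assumes N: "X_open N" and K: "closedin (mfd_topology X) K" and "K \<subseteq> N" and W: "X_open W"
    and f: "smooth_on X (N \<inter> W) f" and zero: "\<And>x. x \<in> pts X \<Longrightarrow> x \<notin> K \<Longrightarrow> f x = 0"
  shows "smooth_on X W f"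
proof (rule smooth_on_locally)
  fix x assume x: "x \<in> W"
  show "\<exists>N. X_open N \<and> x \<in> N \<and> N \<subseteq> W \<and> smooth_on X N f"
  proof (cases "x \<in> N")
    case True
    then show ?thesis using N W f x by (intro exI[of _ "N \<inter> W"]) auto
  next
    case False
    let ?N = "(pts X - K) \<inter> W"
    have "X_open (pts X - K)" using K by (metis openin_diff X_open_pts)
    then have o: "X_open ?N" using W by blast
    have "smooth_on X ?N f"
      by (rule smooth_on_cong[OF o _ smooth_on_const[OF o, of 0]]) (use zero in auto)
    then show ?thesis using o x False \<open>K \<subseteq> N\<close> X_open_subset[OF W] by blast
  qed
qed

lemma CinfI: "smooth_on X (pts X) f \<Longrightarrow> (\<And>x. x \<notin> pts X \<Longrightarrow> f x = 0) \<Longrightarrow> f \<in> Cinf X"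
  by (simp add: Cinf_def)

lemma Cinf_smooth_on: "f \<in> Cinf X \<Longrightarrow> W \<subseteq> pts X \<Longrightarrow> smooth_on X W f"
  using smooth_on_subset by (auto simp: Cinf_def)

lemma Cinf_outside: "f \<in> Cinf X \<Longrightarrow> x \<notin> pts X \<Longrightarrow> f x = 0"
  by (simp add: Cinf_def)

lemma Cinf_add [intro]: "f \<in> Cinf X \<Longrightarrow> g \<in> Cinf X \<Longrightarrow> f + g \<in> Cinf X"
  by (rule CinfI) (simp_all add: plus_fun_def smooth_on_add Cinf_smooth_on Cinf_outside)

lemma Cinf_mult [intro]:
  fixes f g :: "'p \<Rightarrow> 'b::real_normed_algebra"
  shows "f \<in> Cinf X \<Longrightarrow> g \<in> Cinf X \<Longrightarrow> f * g \<in> Cinf X"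
  by (rule CinfI) (simp_all add: times_fun_def smooth_on_mult Cinf_smooth_on Cinf_outside)

lemma Cinf_linear:
  "bounded_linear T \<Longrightarrow> f \<in> Cinf X \<Longrightarrow> (\<lambda>x. T (f x)) \<in> Cinf X"
  by (rule CinfI) (simp_all add: smooth_on_linear Cinf_smooth_on Cinf_outside linear_simps)

lemma Cinf_scal [intro]:
  fixes f :: "'p \<Rightarrow> 'b::real_normed_algebra"
  shows "f \<in> Cinf X \<Longrightarrow> scal c f \<in> Cinf X"
  unfolding scal_def by (rule Cinf_linear[OF bounded_linear_mult_right])

lemma Cinf_uminus [intro]: "f \<in> Cinf X \<Longrightarrow> - f \<in> Cinf X"
  unfolding fun_Compl_def by (rule Cinf_linear[OF bounded_linear_minus[OF bounded_linear_ident]])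

lemma Cinf_diff [intro]: "f \<in> Cinf X \<Longrightarrow> g \<in> Cinf X \<Longrightarrow> f - g \<in> Cinf X"
  using Cinf_add[OF _ Cinf_uminus, of f g] by simp

lemma Cinf_zero [simp, intro]: "0 \<in> Cinf X"
  by (rule CinfI) (simp_all add: zero_fun_def smooth_on_const)

lemma Cinf_const [intro]: "const_fun X c \<in> Cinf X"
proof (rule CinfI)
  show "smooth_on X (pts X) (const_fun X c)"
    by (rule smooth_on_cong[OF _ _ smooth_on_const[of _ c]]) (auto simp: const_fun_def)
qed (simp add: const_fun_def)

end

section \<open>Bump functions on manifolds\<close>

lemma compact_box: "compact {y::nat \<Rightarrow> real. \<forall>i. y i \<in> {a i..b i}}"
proof -
  have "compactin (powertop_real UNIV) (PiE UNIV (\<lambda>i. {a i..b i}))"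
    by (subst compactin_PiE) auto
  moreover have "PiE UNIV (\<lambda>i. {a i..b i}) = {y. \<forall>i. y i \<in> {a i..b i}}" by auto
  ultimately show ?thesis by (simp add: euclidean_product_topology)
qed

lemma closed_box_in_open:
  assumes V: "openin (Euclidean_space n) V" and p: "p \<in> V"
  shows "\<exists>r>0. \<forall>y\<in>E_carrier n. (\<forall>i<n. \<bar>y i - p i\<bar> \<le> r) \<longrightarrow> y \<in> V"
proof -
  obtain T where T: "open T" "V = E_carrier n \<inter> T" using V by (auto simp: openin_Euclidean_space_iff)
  have "openin (powertop_real UNIV) T" using T(1) by (simp add: euclidean_product_topology)
  moreover have "p \<in> T" using p T(2) by blast
  ultimately obtain S where S: "finite {i. S i \<noteq> UNIV}" "\<And>i. open (S i)" "p \<in> PiE UNIV S" "PiE UNIV S \<subseteq> T"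
    by (auto simp: openin_product_topology_alt)
  have "\<exists>e>0. \<forall>u. \<bar>u - p i\<bar> \<le> e \<longrightarrow> u \<in> S i" for i
  proof -
    have "p i \<in> S i" using S(3) by auto
    then obtain e where "e > 0" "cball (p i) e \<subseteq> S i" using S(2) open_contains_cball by blast
    then show ?thesis by (intro exI[of _ e]) (auto simp: dist_real_def abs_minus_commute subset_iff)
  qed
  then obtain e where e: "\<And>i. e i > 0" "\<And>i u. \<bar>u - p i\<bar> \<le> e i \<Longrightarrow> u \<in> S i" by metis
  \<comment> \<open>The 1 keeps the minimum meaningful for n = 0. Beyond n both points have
    coordinate 0, so that the remaining factors S i impose nothing.\<close>
  define r where "r = Min (insert 1 (e ` {..<n}))"
  show ?thesis
  proof (intro exI conjI ballI impI)
    show "r > 0" using e(1) by (simp add: r_def)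
    fix y assume y: "y \<in> E_carrier n" and b: "\<forall>i<n. \<bar>y i - p i\<bar> \<le> r"
    have "y i \<in> S i" for i
    proof (rule e(2))
      have "r \<le> e i" if "i < n" using that by (simp add: r_def)
      moreover have "y i - p i = 0" if "\<not> i < n" using that y p T(2) by simp
      ultimately show "\<bar>y i - p i\<bar> \<le> e i" using b e(1)[of i] by (cases "i < n") auto
    qed
    then show "y \<in> V" using S(4) y T(2) by (auto simp: PiE_UNIV_domain subset_iff)
  qed
qed

text \<open>K is the preimage of the closed box of radius r/2 and carries the bump function: it is
  compact, hence closed since the manifold is Hausdorff, so extension by zero is smooth. Q is mapped
  onto a full open box, which will supply the star-shaped domain for Hadamard's lemma.\<close>

lemma smooth_manifold_bump:
  assumes M: "smooth_manifold M" and U: "(U, \<phi>) \<in> atlas M"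
    and N: "openin (mfd_topology M) N" and x: "x \<in> U \<inter> N"
  obtains r Q K and \<beta> :: "'p \<Rightarrow> real" where "r > 0" "openin (mfd_topology M) Q" "closedin (mfd_topology M) K"
    "x \<in> K" "K \<subseteq> Q" "Q \<subseteq> U \<inter> N"
    "\<phi> ` Q = {y \<in> E_carrier (mdim M). \<forall>i<mdim M. \<bar>y i - \<phi> x i\<bar> < r}"
    "\<beta> \<in> Cinf M" "\<beta> x \<noteq> 0" "\<And>z. z \<notin> K \<Longrightarrow> \<beta> z = 0"
proof -
  interpret atlas_mfd M using M by unfold_locales (rule smooth_manifold_imp_atlas)
  let ?n = "mdim M"
  have x': "x \<in> U" "x \<in> N" using x by auto
  obtain r where r: "r > 0" "\<forall>y\<in>E_carrier ?n. (\<forall>i<?n. \<bar>y i - \<phi> x i\<bar> \<le> r) \<longrightarrow> y \<in> \<phi> ` (U \<inter> N)"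
    using closed_box_in_open[OF chart_image_open[OF U N] imageI[OF x, of \<phi>]] by auto
  let ?B = "{y \<in> E_carrier ?n. \<forall>i<?n. \<bar>y i - \<phi> x i\<bar> < r}"
  let ?C = "{y \<in> E_carrier ?n. \<forall>i<?n. \<bar>y i - \<phi> x i\<bar> \<le> r / 2}"
  have B_sub: "?B \<subseteq> \<phi> ` (U \<inter> N)" using r(2) by (auto simp: less_imp_le)
  have C_sub: "?C \<subseteq> ?B"
  proof
    fix y assume y: "y \<in> ?C"
    have "\<bar>y i - \<phi> x i\<bar> < r" if "i < ?n" for i
    proof -
      have "\<bar>y i - \<phi> x i\<bar> \<le> r / 2" using y that by blast
      then show ?thesis using r(1) by linarith
    qed
    then show "y \<in> ?B" using y by blast
  qed
  define Q where "Q = {z \<in> U \<inter> N. \<phi> z \<in> ?B}"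
  define K where "K = inv_into U \<phi> ` ?C"
  have Q_eq: "\<phi> ` Q = ?B"
  proof
    show "?B \<subseteq> \<phi> ` Q"
    proof
      fix y assume y: "y \<in> ?B"
      then have "y \<in> \<phi> ` (U \<inter> N)" using B_sub by blast
      then show "y \<in> \<phi> ` Q" using y unfolding Q_def by blast
    qed
  qed (auto simp: Q_def)
  have B_open: "openin E_topology ?B"
  proof -
    have "open {y::nat \<Rightarrow> real. \<forall>i\<in>{..<?n}. \<bar>y i - \<phi> x i\<bar> < r}"
    proof -
      have "open {y::nat \<Rightarrow> real. \<bar>y i - \<phi> x i\<bar> < r}" for i
        by (intro open_Collect_less continuous_on_rabs continuous_on_diff continuous_on_coord continuous_on_const)
      then have "open (\<Inter>i\<in>{..<?n}. {y::nat \<Rightarrow> real. \<bar>y i - \<phi> x i\<bar> < r})" by (intro open_INT) auto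
      moreover have "(\<Inter>i\<in>{..<?n}. {y::nat \<Rightarrow> real. \<bar>y i - \<phi> x i\<bar> < r}) = {y. \<forall>i\<in>{..<?n}. \<bar>y i - \<phi> x i\<bar> < r}"
        by auto
      ultimately show ?thesis by simp
    qed
    then show ?thesis unfolding openin_Euclidean_space_iff
      by (intro exI[of _ "{y. \<forall>i\<in>{..<?n}. \<bar>y i - \<phi> x i\<bar> < r}"]) auto
  qed
  have Q_open: "X_open Q"
    unfolding mfd_topology_def
  proof (rule topology_generated_by_Basis, clarify, rule bexI[OF _ U], simp, intro conjI)
    show "Q \<subseteq> U" by (auto simp: Q_def)
    show "openin E_topology (\<phi> ` Q)" unfolding Q_eq by (rule B_open)
  qed
  have C_compact: "compact ?C"
  proof -
    \<comment> \<open>From n on the intervals degenerate to {0..0}; this makes the box in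
      \<open>E_carrier n\<close> a product of compact intervals, to which Tychonoff's theorem
      applies.\<close>
    have eq: "?C = {y. \<forall>i. y i \<in> {(if i < ?n then \<phi> x i - r / 2 else 0)..(if i < ?n then \<phi> x i + r / 2 else 0)}}"
      (is "_ = ?C'")
    proof (intro set_eqI iffI)
      fix y assume "y \<in> ?C"
      then have *: "\<bar>y i - \<phi> x i\<bar> \<le> r / 2" if "i < ?n" for i using that by blast
      have "y i \<in> {(if i < ?n then \<phi> x i - r / 2 else 0)..(if i < ?n then \<phi> x i + r / 2 else 0)}" for i
      proof (cases "i < ?n")
        case True
        then show ?thesis using *[OF True] unfolding abs_le_iff by simp
      qed (use \<open>y \<in> ?C\<close> in auto)
      then show "y \<in> ?C'" by blast
    next
      fix y assume "y \<in> ?C'"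
      then have *: "y i \<in> {(if i < ?n then \<phi> x i - r / 2 else 0)..(if i < ?n then \<phi> x i + r / 2 else 0)}" for i by blast
      show "y \<in> ?C"
      proof (safe)
        fix i assume "i \<ge> ?n" then show "y i = 0" using *[of i] by simp
      next
        fix i assume "i < ?n"
        then have "\<phi> x i - r / 2 \<le> y i" "y i \<le> \<phi> x i + r / 2" using *[of i] by simp_all
        then show "\<bar>y i - \<phi> x i\<bar> \<le> r / 2" by linarith
      qed
    qed
    show ?thesis unfolding eq by (rule compact_box)
  qed
  have "continuous_map (subtopology E_topology (\<phi> ` U)) (mfd_topology M) (inv_into U \<phi>)"
    unfolding continuous_map_def
  proof (intro conjI allI impI)
    show "inv_into U \<phi> \<in> topspace (subtopology E_topology (\<phi> ` U)) \<rightarrow> topspace (mfd_topology M)"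
      using U chart_subset[OF U] by (auto simp: subset_iff)
    fix G assume G: "X_open G"
    have "{y \<in> topspace (subtopology E_topology (\<phi> ` U)). inv_into U \<phi> y \<in> G} = \<phi> ` (U \<inter> G)"
      using U chart_range[OF U] by (auto simp: topspace_Euclidean_space)
    then show "openin (subtopology E_topology (\<phi> ` U)) {y \<in> topspace (subtopology E_topology (\<phi> ` U)). inv_into U \<phi> y \<in> G}"
      using chart_image_open[OF U G] by (auto simp: openin_subtopology intro!: exI[of _ "\<phi> ` (U \<inter> G)"])
  qed
  moreover have "compactin (subtopology E_topology (\<phi> ` U)) ?C"
  proof -
    have "?C \<subseteq> \<phi> ` U" using subset_trans[OF C_sub B_sub] by (rule subset_trans) (rule image_mono, simp)
    moreover have "?C \<subseteq> E_carrier ?n" by (rule Collect_mono) simp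
    ultimately show ?thesis using C_compact
      by (simp only: compactin_subtopology Euclidean_space_eq compactin_euclidean_iff)
  qed
  ultimately have "compactin (mfd_topology M) K"
    unfolding K_def by (rule image_compactin[rotated])
  then have K_closed: "closedin (mfd_topology M) K"
    using M by (intro compactin_imp_closedin) (auto simp: smooth_manifold_def)
  have KQ: "K \<subseteq> Q"
  proof
    fix z assume "z \<in> K"
    then obtain y where y: "y \<in> ?C" "z = inv_into U \<phi> y" by (auto simp: K_def)
    then have "y \<in> \<phi> ` Q" unfolding Q_eq using C_sub by (elim subsetD)
    then obtain w where "w \<in> Q" "y = \<phi> w" by (elim imageE)
    then show "z \<in> Q" using y(2) U by (simp add: Q_def)
  qed
  have KI: "z \<in> K" if "z \<in> U" "\<phi> z \<in> ?C" for z
    unfolding K_def using U that by (intro image_eqI[of _ _ "\<phi> z"]) auto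
  have Q_sub: "Q \<subseteq> U \<inter> N" by (auto simp: Q_def)
  define \<beta> where "\<beta> z = (if z \<in> Q then box_bump ?n (\<phi> x) (r / 2) (\<phi> z) else 0)" for z
  have zero: "\<beta> z = 0" if "z \<notin> K" for z
  proof (cases "z \<in> Q")
    case True
    then have "z \<in> U" by (simp add: Q_def)
    moreover have "\<phi> z \<in> E_carrier ?n" by (rule chart_range[OF U \<open>z \<in> U\<close>])
    ultimately have "\<not> (\<forall>i<?n. \<bar>\<phi> z i - \<phi> x i\<bar> \<le> r / 2)"
      using KI[of z] \<open>z \<notin> K\<close> unfolding mem_Collect_eq by argo
    then obtain i where i: "i < ?n" "\<not> \<bar>\<phi> z i - \<phi> x i\<bar> \<le> r / 2" by auto
    then have "r / 2 \<le> \<bar>\<phi> z i - \<phi> x i\<bar>" by linarith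
    then have "box_bump ?n (\<phi> x) (r / 2) (\<phi> z) = 0" by (rule box_bump_eq_0[OF i(1)])
    then show ?thesis by (simp add: \<beta>_def)
  qed (simp add: \<beta>_def)
  have "smooth_on M Q (\<lambda>z. box_bump ?n (\<phi> x) (r / 2) (\<phi> z))"
  proof (rule smooth_on_chartI[OF U Q_open])
    have o: "openin E_topology (\<phi> ` Q)" unfolding Q_eq by (rule B_open)
    show "C_infinity_on ?n (\<phi> ` Q) (\<lambda>y. box_bump ?n (\<phi> x) (r / 2) (\<phi> (inv_into U \<phi> y)))"
      by (rule C_infinity_on_cong[OF o _ C_infinity_on_box_bump[OF o]]) (use U in \<open>auto simp: Q_def\<close>)
  qed (auto simp: Q_def)
  then have sm: "smooth_on M Q \<beta>"
    by (rule smooth_on_cong[OF Q_open, rotated]) (simp add: \<beta>_def)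
  have "\<beta> \<in> Cinf M"
  proof (rule CinfI)
    show "smooth_on M (pts M) \<beta>"
    proof (rule smooth_on_extend_zero[OF Q_open K_closed KQ X_open_pts])
      show "smooth_on M (Q \<inter> pts M) \<beta>" by (rule smooth_on_subset[OF sm]) simp
    qed (rule zero)
    show "\<beta> z = 0" if "z \<notin> pts M" for z using that X_open_subset[OF Q_open] by (auto simp: \<beta>_def)
  qed
  moreover have xK: "x \<in> K" using r(1) chart_range[OF U x'(1)] by (intro KI[OF x'(1)]) simp
  moreover have "\<beta> x \<noteq> 0" using xK KQ box_bump_self[of "r / 2"] r(1) by (auto simp: \<beta>_def)
  ultimately show ?thesis by (intro that[OF r(1) Q_open K_closed xK KQ Q_sub Q_eq _ _ zero])
qed

section \<open>The manifold structure of the dual bundle\<close>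

text \<open>In the charts of the dual bundle this is the bundle projection: the covector components
  from index n on are dropped.\<close>

definition trunc :: "nat \<Rightarrow> (nat \<Rightarrow> real) \<Rightarrow> nat \<Rightarrow> real"
  where "trunc n y = (\<lambda>i. if i < n then y i else 0)"

lemma trunc_carrier [simp]: "trunc n y \<in> E_carrier n"
  by (simp add: trunc_def)

lemma openin_cylinder:
  assumes "openin (Euclidean_space n) G"
  shows "openin (Euclidean_space (n + k)) {y \<in> E_carrier (n + k). trunc n y \<in> G}"
proof -
  obtain T where T: "open T" "G = E_carrier n \<inter> T" using assms by (auto simp: openin_Euclidean_space_iff)
  have "continuous_on UNIV (trunc n)"
  proof (rule continuous_on_coordinatewise_then_product)
    show "continuous_on UNIV (\<lambda>y. trunc n y i)" for i
      by (cases "i < n") (simp_all add: trunc_def continuous_on_coord)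
  qed
  then have "open (trunc n -` T)" using T(1) by (simp add: open_vimage)
  moreover have "{y \<in> E_carrier (n + k). trunc n y \<in> G} = E_carrier (n + k) \<inter> trunc n -` T"
    using trunc_carrier[of n] unfolding T(2) by auto
  ultimately show ?thesis unfolding openin_Euclidean_space_iff by (intro exI conjI)
qed

lemma C_infinity_on_cylinder:
  assumes G: "openin (Euclidean_space n) G" and f: "C_infinity_on n G f"
  shows "C_infinity_on (n + k) {y \<in> E_carrier (n + k). trunc n y \<in> G} (\<lambda>y. f (trunc n y))"
proof (rule C_infinity_on_compose[OF G openin_cylinder[OF G] _ _ f])
  fix i assume "i < n"
  then show "C_infinity_on (n + k) {y \<in> E_carrier (n + k). trunc n y \<in> G} (\<lambda>y. trunc n y i)"
    using C_infinity_on_coordinate[OF openin_cylinder[OF G]] by (simp add: trunc_def)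
qed simp

lemma sum_lessThan_split: "(\<Sum>i<n + k. g i) = (\<Sum>i<n. g i) + (\<Sum>j<k. g (n + j))"
  for g :: "nat \<Rightarrow> 'a::comm_monoid_add"
  by (induction k) (simp_all add: add.assoc)

locale smooth_bundle =
  fixes A :: "('m, 'v::real_vector, 'z) vbundle_scheme"
  assumes vector_bundle: "vector_bundle A"
begin

abbreviation "M \<equiv> base A"
abbreviation "n \<equiv> mdim (base A)"
abbreviation "k \<equiv> rank A"
abbreviation "coord e i x v \<equiv> frame_coord A e i x v"

lemma base_manifold: "smooth_manifold M"
  using vector_bundle unfolding vector_bundle_def by (elim conjE)

sublocale b: atlas_mfd M
  by unfold_locales (rule smooth_manifold_imp_atlas[OF base_manifold])

lemma frames_Union: "(\<Union>(U, e)\<in>frames A. U) = pts M"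
  using vector_bundle unfolding vector_bundle_def by (elim conjE)

lemma frame_cover: "x \<in> pts M \<Longrightarrow> \<exists>W e. (W, e) \<in> frames A \<and> x \<in> W"
  unfolding frames_Union[symmetric] by auto

lemma frame:
  assumes "(W, e) \<in> frames A"
  shows "b.X_open W \<and> (\<forall>x\<in>W. inj_on (\<lambda>j. e j x) {..<k} \<and>
    independent ((\<lambda>j. e j x) ` {..<k}) \<and> span ((\<lambda>j. e j x) ` {..<k}) = fibre A x)"
proof -
  have "\<forall>(U, e)\<in>frames A. b.X_open U \<and> (\<forall>x\<in>U. inj_on (\<lambda>j. e j x) {..<k} \<and>
    independent ((\<lambda>j. e j x) ` {..<k}) \<and> span ((\<lambda>j. e j x) ` {..<k}) = fibre A x)"
    using vector_bundle unfolding vector_bundle_def by (elim conjE)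
  from bspec[OF this assms, unfolded prod.case] show ?thesis .
qed

lemma frame_open: "(W, e) \<in> frames A \<Longrightarrow> b.X_open W"
  using frame by simp

lemma frame_subset: "(W, e) \<in> frames A \<Longrightarrow> W \<subseteq> pts M"
  using b.X_open_subset[OF frame_open] .

lemma frame_transition:
  assumes "(U, e) \<in> frames A" "(V, b) \<in> frames A" "i < k" "j < k"
  shows "smooth_on M (U \<inter> V) (\<lambda>x. coord e i x (b j x))"
proof -
  have "\<forall>(U, e)\<in>frames A. \<forall>(V, b)\<in>frames A. \<forall>i<k. \<forall>j<k.
       smooth_on M (U \<inter> V) (\<lambda>x. coord e i x (b j x))"
    using vector_bundle unfolding vector_bundle_def by (elim conjE)
  from bspec[OF bspec[OF this assms(1), unfolded prod.case] assms(2), unfolded prod.case]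
  show ?thesis using assms(3,4) by simp
qed

context
  fixes W e x
  assumes W: "(W, e) \<in> frames A" and x: "x \<in> W"
begin

lemma frame_inj: "inj_on (\<lambda>j. e j x) {..<k}"
  and frame_independent: "independent ((\<lambda>j. e j x) ` {..<k})"
  and frame_span: "span ((\<lambda>j. e j x) ` {..<k}) = fibre A x"
  using frame[OF W] x by simp_all

lemma frame_in_fibre: "j < k \<Longrightarrow> e j x \<in> fibre A x"
  unfolding frame_span[symmetric] by (rule span_base) simp

lemma frame_expand: "v \<in> fibre A x \<Longrightarrow> v = (\<Sum>i<k. coord e i x v *\<^sub>R e i x)"
  unfolding frame_coord_def
  using sum_representation_eq[OF frame_independent, of v "(\<lambda>j. e j x) ` {..<k}"] frame_span
  by (simp add: sum.reindex[OF frame_inj])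

lemma coord_add: "v \<in> fibre A x \<Longrightarrow> w \<in> fibre A x \<Longrightarrow> coord e i x (v + w) = coord e i x v + coord e i x w"
  unfolding frame_coord_def using representation_add[OF frame_independent] frame_span by simp

lemma coord_scale: "v \<in> fibre A x \<Longrightarrow> coord e i x (c *\<^sub>R v) = c * coord e i x v"
  unfolding frame_coord_def using representation_scale[OF frame_independent] frame_span by simp

lemma coord_frame: "i < k \<Longrightarrow> j < k \<Longrightarrow> coord e i x (e j x) = (if i = j then 1 else 0)"
  unfolding frame_coord_def
  using representation_basis[OF frame_independent, of "e j x"] inj_onD[OF frame_inj, of i j] by auto

end

lemma coord_0 [simp]: "coord e i x 0 = 0"
  by (simp add: frame_coord_def representation_zero)

lemma subspace_fibre: "x \<in> pts M \<Longrightarrow> subspace (fibre A x)"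
  using frame_cover frame_span subspace_span by metis

text \<open>Covectors and forms are linear on a fibre only, with value 0 or an arbitrary value off
  it; hence linearity relative to a subspace.\<close>

lemma fibre_linear_sum:
  fixes F :: "'v \<Rightarrow> 'b::real_vector"
  assumes sub: "subspace S"
    and lin: "\<And>v w a b. v \<in> S \<Longrightarrow> w \<in> S \<Longrightarrow> F (a *\<^sub>R v + b *\<^sub>R w) = a *\<^sub>R F v + b *\<^sub>R F w"
    and fin: "finite I" and S: "\<And>i. i \<in> I \<Longrightarrow> f i \<in> S"
  shows "F (\<Sum>i\<in>I. c i *\<^sub>R f i) = (\<Sum>i\<in>I. c i *\<^sub>R F (f i))"
  using fin S
proof (induction I rule: finite_induct)
  case empty
  show ?case using lin[of 0 0 0 0] subspace_0[OF sub] by simp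
next
  case (insert i I)
  have "(\<Sum>i\<in>I. c i *\<^sub>R f i) \<in> S" using insert by (intro subspace_sum[OF sub] subspace_mul[OF sub]) auto
  then have "F (c i *\<^sub>R f i + 1 *\<^sub>R (\<Sum>i\<in>I. c i *\<^sub>R f i)) = c i *\<^sub>R F (f i) + 1 *\<^sub>R F (\<Sum>i\<in>I. c i *\<^sub>R f i)"
    using insert by (intro lin) auto
  then show ?case using insert by simp
qed

lemma frame_linear:
  fixes F :: "'v \<Rightarrow> 'b::real_vector"
  assumes W: "(W, e) \<in> frames A" "x \<in> W"
    and lin: "\<And>v w a b. v \<in> fibre A x \<Longrightarrow> w \<in> fibre A x \<Longrightarrow> F (a *\<^sub>R v + b *\<^sub>R w) = a *\<^sub>R F v + b *\<^sub>R F w"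
    and v: "v \<in> fibre A x"
  shows "F v = (\<Sum>i<k. coord e i x v *\<^sub>R F (e i x))"
proof -
  have "F v = F (\<Sum>i<k. coord e i x v *\<^sub>R e i x)" using frame_expand[OF W v] by simp
  also have "\<dots> = (\<Sum>i<k. coord e i x v *\<^sub>R F (e i x))"
    by (rule fibre_linear_sum[OF subspace_fibre lin])
       (use W frame_subset frame_in_fibre[OF W] in auto)
  finally show ?thesis .
qed

lemma dual_fibre_linear:
  "\<xi> \<in> dual_fibre A x \<Longrightarrow> v \<in> fibre A x \<Longrightarrow> w \<in> fibre A x \<Longrightarrow> \<xi> (a *\<^sub>R v + b *\<^sub>R w) = a * \<xi> v + b * \<xi> w"
  by (simp add: dual_fibre_def)

lemma dual_fibre_expand:
  assumes "(W, e) \<in> frames A" "x \<in> W" "\<xi> \<in> dual_fibre A x" "v \<in> fibre A x"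
  shows "\<xi> v = (\<Sum>i<k. coord e i x v * \<xi> (e i x))"
  using frame_linear[OF assms(1,2), of \<xi> v] dual_fibre_linear[OF assms(3)] assms(4) by simp

definition over :: "'m set \<Rightarrow> ('m \<times> ('v \<Rightarrow> real)) set"
  where "over S = {p \<in> dual_points A. fst p \<in> S}"

lemma dual_simps [simp]: "pts (dual A) = dual_points A" "mdim (dual A) = n + k"
  by (simp_all add: dual_def)

lemma dual_points_iff: "(x, \<xi>) \<in> dual_points A \<longleftrightarrow> x \<in> pts M \<and> \<xi> \<in> dual_fibre A x"
  by (simp add: dual_points_def)

lemma dual_atlasI: "(U, \<phi>) \<in> atlas M \<Longrightarrow> (W, e) \<in> frames A \<Longrightarrow> (over (U \<inter> W), dual_chart A \<phi> e) \<in> atlas (dual A)"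
  by (auto simp: dual_def over_def)

lemma dual_atlasE:
  assumes "(D, \<psi>) \<in> atlas (dual A)"
  obtains U \<phi> W e where "(U, \<phi>) \<in> atlas M" "(W, e) \<in> frames A" "D = over (U \<inter> W)" "\<psi> = dual_chart A \<phi> e"
  using assms by (auto simp: dual_def over_def)

context
  fixes U \<phi> W e
  assumes U: "(U, \<phi>) \<in> atlas M" and W: "(W, e) \<in> frames A"
begin

abbreviation "\<psi> \<equiv> dual_chart A \<phi> e"

lemma dual_chart_trunc: "fst p \<in> U \<Longrightarrow> trunc n (\<psi> p) = \<phi> (fst p)"
  using b.chart_range[OF U, of "fst p"]
  by (auto simp: trunc_def dual_chart_def fun_eq_iff split: prod.split)

lemma dual_chart_fibre: "j < k \<Longrightarrow> \<psi> p (n + j) = snd p (e j (fst p))"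
  by (simp add: dual_chart_def split: prod.split)

lemma dual_chart_carrier: "\<psi> p \<in> E_carrier (n + k)"
  by (simp add: dual_chart_def split: prod.split)

lemma dual_chart_inj: "inj_on \<psi> (over (U \<inter> W))"
proof (rule inj_onI)
  fix p q assume p: "p \<in> over (U \<inter> W)" and q: "q \<in> over (U \<inter> W)" and eq: "\<psi> p = \<psi> q"
  have "\<phi> (fst p) = \<phi> (fst q)" using dual_chart_trunc[of p] dual_chart_trunc[of q] p q eq by (simp add: over_def)
  then have x: "fst p = fst q" using inj_onD[OF b.chart_inj[OF U]] p q by (auto simp: over_def)
  have mem: "snd p \<in> dual_fibre A (fst p)" "snd q \<in> dual_fibre A (fst p)" "fst p \<in> W"
    using p q x by (auto simp: over_def dual_points_def)
  have "snd p v = snd q v" for v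
  proof (cases "v \<in> fibre A (fst p)")
    case True
    have "snd p (e j (fst p)) = snd q (e j (fst p))" if "j < k" for j
      using dual_chart_fibre[OF that, of p] dual_chart_fibre[OF that, of q] eq x by simp
    then show ?thesis
      using dual_fibre_expand[OF W mem(3,1) True] dual_fibre_expand[OF W mem(3,2) True] by simp
  next
    case False
    then show ?thesis using mem(1,2) by (simp add: dual_fibre_def)
  qed
  then show "p = q" using x by (simp add: prod_eq_iff fun_eq_iff)
qed

text \<open>The fibre components of a covector are unrestricted, so the image is a full cylinder
  over the chart image of S. Openness of charts and smoothness of functions pulled back from the
  base both reduce to cylinders.\<close>

lemma dual_chart_image:
  assumes "S \<subseteq> U \<inter> W"
  shows "\<psi> ` over S = {y \<in> E_carrier (n + k). trunc n y \<in> \<phi> ` S}"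
proof (intro set_eqI iffI)
  fix y assume "y \<in> \<psi> ` over S"
  then obtain p where p: "p \<in> over S" "y = \<psi> p" by blast
  then have "trunc n y = \<phi> (fst p)" using assms dual_chart_trunc[of p] by (auto simp: over_def)
  then show "y \<in> {y \<in> E_carrier (n + k). trunc n y \<in> \<phi> ` S}"
    using p dual_chart_carrier[of p] by (auto simp: over_def)
next
  fix y assume y: "y \<in> {y \<in> E_carrier (n + k). trunc n y \<in> \<phi> ` S}"
  then obtain x where x: "x \<in> S" "trunc n y = \<phi> x" by blast
  then have xUW: "x \<in> U" "x \<in> W" using assms by auto
  \<comment> \<open>The covector with the prescribed components in the frame, extended by 0 off the
    fibre as \<open>dual_fibre\<close> demands.\<close>
  define \<xi> where "\<xi> v = (if v \<in> fibre A x then \<Sum>j<k. coord e j x v * y (n + j) else 0)" for v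
  have sub: "subspace (fibre A x)" using subspace_fibre frame_subset[OF W] xUW(2) by blast
  have "\<xi> \<in> dual_fibre A x"
    unfolding dual_fibre_def
  proof (intro CollectI conjI ballI allI impI)
    fix v w a b assume vw: "v \<in> fibre A x" "w \<in> fibre A x"
    then have "a *\<^sub>R v \<in> fibre A x" "b *\<^sub>R w \<in> fibre A x" "a *\<^sub>R v + b *\<^sub>R w \<in> fibre A x"
      using sub by (auto intro: subspace_add subspace_mul)
    then show "\<xi> (a *\<^sub>R v + b *\<^sub>R w) = a * \<xi> v + b * \<xi> w"
      using vw coord_add[OF W xUW(2)] coord_scale[OF W xUW(2)]
      by (simp add: \<xi>_def sum_distrib_left sum.distrib[symmetric] algebra_simps)
  qed (simp add: \<xi>_def)
  then have p: "(x, \<xi>) \<in> over S"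
    using x xUW frame_subset[OF W] by (auto simp: over_def dual_points_iff)
  have "\<psi> (x, \<xi>) i = y i" for i
  proof -
    consider "i < n" | "n \<le> i" "i < n + k" | "n + k \<le> i" by linarith
    then show ?thesis
    proof cases
      case 1
      then have "y i = trunc n y i" by (simp add: trunc_def)
      also have "\<dots> = \<phi> x i" using x(2) by (rule fun_cong)
      finally show ?thesis using 1 by (simp add: dual_chart_def)
    next
      case 2
      define j where "j = i - n"
      have j: "i = n + j" "j < k" using 2 by (auto simp: j_def)
      have "\<xi> (e j x) = (\<Sum>l<k. coord e l x (e j x) * y (n + l))"
        using frame_in_fibre[OF W xUW(2) j(2)] by (simp add: \<xi>_def)
      also have "\<dots> = (\<Sum>l<k. (if l = j then y (n + l) else 0))"
        by (rule sum.cong) (simp_all add: coord_frame[OF W xUW(2) _ j(2)])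
      also have "\<dots> = y i" using j by simp
      finally show ?thesis using j dual_chart_fibre[OF j(2), of "(x, \<xi>)"] by simp
    next
      case 3
      then show ?thesis using y dual_chart_carrier[of "(x, \<xi>)"] by simp
    qed
  qed
  then show "y \<in> \<psi> ` over S" using p by (intro image_eqI[of _ _ "(x, \<xi>)"]) (auto simp: fun_eq_iff)
qed

lemma UW_open: "b.X_open (U \<inter> W)"
  using b.X_open_chart[OF U] frame_open[OF W] by (rule openin_Int)

lemma base_image_open: "S \<subseteq> U \<Longrightarrow> b.X_open S \<Longrightarrow> openin (Euclidean_space n) (\<phi> ` S)"
  using b.chart_image_open[OF U, of S] by (simp add: Int_absorb1)

lemma dual_chart_image_open: "S \<subseteq> U \<inter> W \<Longrightarrow> b.X_open S \<Longrightarrow> openin (Euclidean_space (n + k)) (\<psi> ` over S)"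
  by (subst dual_chart_image, assumption, rule openin_cylinder, rule base_image_open) auto

lemma dual_chart_inv: "p \<in> over (U \<inter> W) \<Longrightarrow> inv_into (over (U \<inter> W)) \<psi> (\<psi> p) = p"
  by (rule inv_into_f_f[OF dual_chart_inj])

lemma C_infinity_on_dual_chart_base:
  assumes S: "S \<subseteq> U \<inter> W" "b.X_open S" and f: "smooth_on M S f"
  shows "C_infinity_on (n + k) (\<psi> ` over S) (\<lambda>y. f (fst (inv_into (over (U \<inter> W)) \<psi> y)))"
proof -
  have SU: "S \<subseteq> U" using S(1) by blast
  have o: "openin (Euclidean_space n) (\<phi> ` S)" by (rule base_image_open[OF SU S(2)])
  have "C_infinity_on n (\<phi> ` S) (\<lambda>y. f (inv_into U \<phi> y))"
    using b.smooth_onD[OF f U] SU by (simp add: Int_absorb1)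
  from C_infinity_on_cylinder[OF o this, of k]
  have "C_infinity_on (n + k) (\<psi> ` over S) (\<lambda>y. f (inv_into U \<phi> (trunc n y)))"
    unfolding dual_chart_image[OF S(1)] .
  then show ?thesis
  proof (rule C_infinity_on_cong[OF dual_chart_image_open[OF S], rotated])
    fix y assume "y \<in> \<psi> ` over S"
    then obtain p where p: "p \<in> over S" "y = \<psi> p" by blast
    then have "p \<in> over (U \<inter> W)" "fst p \<in> U" using S(1) by (auto simp: over_def)
    then show "f (inv_into U \<phi> (trunc n y)) = f (fst (inv_into (over (U \<inter> W)) \<psi> y))"
      using p(2) dual_chart_inv dual_chart_trunc U by simp
  qed
qed

end

text \<open>Base coordinates change as on M. Fibre coordinates change linearly, \<xi>(e'_j) being
  the sum of the products of the l-th component of e'_j with \<xi>(e_l), and these components are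
  smooth by the compatibility of frames.\<close>

lemma dual_transition:
  assumes U: "(U, \<phi>) \<in> atlas M" and W: "(W, e) \<in> frames A"
    and U': "(U', \<phi>') \<in> atlas M" and W': "(W', e') \<in> frames A" and i: "i < n + k"
  shows "C_infinity_on (n + k) (dual_chart A \<phi> e ` over (U \<inter> W \<inter> (U' \<inter> W')))
    (\<lambda>y. dual_chart A \<phi>' e' (inv_into (over (U \<inter> W)) (dual_chart A \<phi> e) y) i)"
proof -
  let ?S = "U \<inter> W \<inter> (U' \<inter> W')" and ?\<psi> = "dual_chart A \<phi> e"
  let ?inv = "inv_into (over (U \<inter> W)) ?\<psi>"
  have S: "?S \<subseteq> U \<inter> W" "b.X_open ?S"
    using UW_open[OF U W] UW_open[OF U' W'] by (auto intro: openin_Int)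
  note o = dual_chart_image_open[OF U W S]
  have inv: "?inv (?\<psi> p) = p" if "p \<in> over ?S" for p
    using dual_chart_inv[OF U W] that by (auto simp: over_def)
  show ?thesis
  proof (cases "i < n")
    case True
    have "smooth_on M ?S (\<lambda>x. \<phi>' x i)" by (rule b.smooth_on_chart_coordinate[OF U' S(2)]) blast
    from C_infinity_on_dual_chart_base[OF U W S this] show ?thesis
      by (rule C_infinity_on_cong[OF o, rotated]) (use True in \<open>simp add: dual_chart_def split: prod.split\<close>)
  next
    case False
    define j where "j = i - n"
    have j: "i = n + j" "j < k" using i False by (auto simp: j_def)
    have "C_infinity_on (n + k) (?\<psi> ` over ?S) (\<lambda>y. coord e l (fst (?inv y)) (e' j (fst (?inv y))) * y (n + l))"
      if "l < k" for l
    proof (rule C_infinity_on_mult[OF o _ C_infinity_on_coordinate[OF o]])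
      have "smooth_on M ?S (\<lambda>x. coord e l x (e' j x))"
        by (rule b.smooth_on_subset[OF frame_transition[OF W W' that j(2)]]) blast
      from C_infinity_on_dual_chart_base[OF U W S this]
      show "C_infinity_on (n + k) (?\<psi> ` over ?S) (\<lambda>y. coord e l (fst (?inv y)) (e' j (fst (?inv y))))" .
    qed
    then have "C_infinity_on (n + k) (?\<psi> ` over ?S)
        (\<lambda>y. \<Sum>l<k. coord e l (fst (?inv y)) (e' j (fst (?inv y))) * y (n + l))"
      by (intro C_infinity_on_sum[OF o]) simp
    then show ?thesis
    proof (rule C_infinity_on_cong[OF o, rotated])
      fix y assume "y \<in> ?\<psi> ` over ?S"
      then obtain p where p: "p \<in> over ?S" "y = ?\<psi> p" by blast
      then have x: "fst p \<in> W" "fst p \<in> W'" "snd p \<in> dual_fibre A (fst p)" by (auto simp: over_def dual_points_def)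
      have "snd p (e' j (fst p)) = (\<Sum>l<k. coord e l (fst p) (e' j (fst p)) * snd p (e l (fst p)))"
        by (rule dual_fibre_expand[OF W x(1,3) frame_in_fibre[OF W' x(2) j(2)]])
      then show "(\<Sum>l<k. coord e l (fst (?inv y)) (e' j (fst (?inv y))) * y (n + l)) = dual_chart A \<phi>' e' (?inv y) i"
        using p inv dual_chart_fibre[OF U W, of _ p] dual_chart_fibre[OF U' W' j(2), of p] j(1) by simp
    qed
  qed
qed

lemma over_Int: "over S \<inter> over T = over (S \<inter> T)"
  by (auto simp: over_def)

lemma dual_smooth_atlas: "smooth_atlas (dual A)"
  unfolding smooth_atlas_def dual_simps
proof (intro conjI)
  show "(\<Union>(D, \<psi>)\<in>atlas (dual A). D) = dual_points A"
  proof
    show "(\<Union>(D, \<psi>)\<in>atlas (dual A). D) \<subseteq> dual_points A"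
      by (auto elim!: dual_atlasE simp: over_def)
    show "dual_points A \<subseteq> (\<Union>(D, \<psi>)\<in>atlas (dual A). D)"
    proof
      fix p assume p: "p \<in> dual_points A"
      then have x: "fst p \<in> pts M" by (auto simp: dual_points_def)
      obtain U \<phi> where U: "(U, \<phi>) \<in> atlas M" "fst p \<in> U" using b.chart_cover[OF x] by blast
      obtain W e where W: "(W, e) \<in> frames A" "fst p \<in> W" using frame_cover[OF x] by blast
      have "p \<in> over (U \<inter> W)" using p U W by (simp add: over_def)
      then show "p \<in> (\<Union>(D, \<psi>)\<in>atlas (dual A). D)" using dual_atlasI[OF U(1) W(1)] by auto
    qed
  qed
next
  show "\<forall>(D, \<psi>)\<in>atlas (dual A). inj_on \<psi> D \<and> openin (Euclidean_space (n + k)) (\<psi> ` D)"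
  proof (intro ballI, clarify, rule conjI)
    fix D \<psi> assume "(D, \<psi>) \<in> atlas (dual A)"
    then obtain U \<phi> W e where c: "(U, \<phi>) \<in> atlas M" "(W, e) \<in> frames A" "D = over (U \<inter> W)" "\<psi> = dual_chart A \<phi> e"
      by (rule dual_atlasE)
    show "inj_on \<psi> D" unfolding c(3,4) by (rule dual_chart_inj[OF c(1,2)])
    show "openin (Euclidean_space (n + k)) (\<psi> ` D)"
      unfolding c(3,4) by (rule dual_chart_image_open[OF c(1,2) _ UW_open[OF c(1,2)]]) simp
  qed
next
  show "\<forall>(D, \<psi>)\<in>atlas (dual A). \<forall>(D', \<psi>')\<in>atlas (dual A).
      openin (Euclidean_space (n + k)) (\<psi> ` (D \<inter> D')) \<and>
      (\<forall>i<n + k. C_infinity_on (n + k) (\<psi> ` (D \<inter> D')) (\<lambda>y. \<psi>' (inv_into D \<psi> y) i))"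
  proof (intro ballI, clarify, intro conjI allI impI)
    fix D \<psi> D' \<psi>' assume "(D, \<psi>) \<in> atlas (dual A)" "(D', \<psi>') \<in> atlas (dual A)"
    then obtain U \<phi> W e U' \<phi>' W' e' where
      c: "(U, \<phi>) \<in> atlas M" "(W, e) \<in> frames A" "D = over (U \<inter> W)" "\<psi> = dual_chart A \<phi> e" and
      c': "(U', \<phi>') \<in> atlas M" "(W', e') \<in> frames A" "D' = over (U' \<inter> W')" "\<psi>' = dual_chart A \<phi>' e'"
      by (elim dual_atlasE)
    show "openin (Euclidean_space (n + k)) (\<psi> ` (D \<inter> D'))"
      unfolding c(3,4) c'(3) over_Int
      by (rule dual_chart_image_open[OF c(1,2)])
         (use UW_open[OF c(1,2)] UW_open[OF c'(1,2)] in \<open>auto intro: openin_Int\<close>)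
    show "C_infinity_on (n + k) (\<psi> ` (D \<inter> D')) (\<lambda>y. \<psi>' (inv_into D \<psi> y) i)" if "i < n + k" for i
      unfolding c(3,4) c'(3,4) over_Int by (rule dual_transition[OF c(1,2) c'(1,2) that])
  qed
qed

sublocale d: atlas_mfd "dual A"
  by unfold_locales (rule dual_smooth_atlas)

end

lemma sum_lists_length_2:
  assumes "finite S"
  shows "(\<Sum>bs | length bs = 2 \<and> set bs \<subseteq> S. h bs) = (\<Sum>b\<in>S. \<Sum>c\<in>S. h [b, c])"
proof -
  have "{bs. length bs = 2 \<and> set bs \<subseteq> S} = (\<lambda>(b, c). [b, c]) ` (S \<times> S)"
    by (auto simp: numeral_2_eq_2 length_Suc_conv image_iff)
  moreover have "inj_on (\<lambda>(b, c). [b, c]) (S \<times> S)" by (auto simp: inj_on_def)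
  ultimately show ?thesis by (simp add: sum.reindex sum.cartesian_product case_prod_beta')
qed

context smooth_bundle
begin

section \<open>Pullbacks and fibrewise linear functions\<close>

lemma over_open:
  assumes S: "b.X_open S"
  shows "d.X_open (over S)"
  unfolding d.openin_mfd_iff
proof (intro conjI allI impI)
  show "over S \<subseteq> pts (dual A)" by (auto simp: over_def)
  fix D \<psi> assume "(D, \<psi>) \<in> atlas (dual A)"
  then obtain U \<phi> W e where c: "(U, \<phi>) \<in> atlas M" "(W, e) \<in> frames A" "D = over (U \<inter> W)" "\<psi> = dual_chart A \<phi> e"
    by (rule dual_atlasE)
  have "b.X_open (U \<inter> W \<inter> S)" using UW_open[OF c(1,2)] S by (rule openin_Int)
  from dual_chart_image_open[OF c(1,2) Int_lower1 this]
  show "openin (Euclidean_space (mdim (dual A))) (\<psi> ` (D \<inter> over S))"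
    unfolding c(3,4) over_Int dual_simps .
qed

lemma over_subset: "over S \<subseteq> dual_points A"
  by (auto simp: over_def)

lemma over_pts: "over (pts M) = dual_points A"
  by (auto simp: over_def dual_points_def)

lemma smooth_on_over:
  assumes S: "b.X_open S" and f: "smooth_on M S f"
  shows "smooth_on (dual A) (over S) (\<lambda>p. f (fst p))"
proof (rule d.smooth_onI)
  fix D \<psi> assume "(D, \<psi>) \<in> atlas (dual A)"
  then obtain U \<phi> W e where c: "(U, \<phi>) \<in> atlas M" "(W, e) \<in> frames A" "D = over (U \<inter> W)" "\<psi> = dual_chart A \<phi> e"
    by (rule dual_atlasE)
  have "b.X_open (U \<inter> W \<inter> S)" using UW_open[OF c(1,2)] S by (rule openin_Int)
  from C_infinity_on_dual_chart_base[OF c(1,2) Int_lower1 this b.smooth_on_subset[OF f Int_lower2]]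
  show "C_infinity_on (mdim (dual A)) (\<psi> ` (D \<inter> over S)) (\<lambda>y. f (fst (inv_into D \<psi> y)))"
    unfolding c(3,4) over_Int dual_simps .
qed

lemma dual_chart_at:
  assumes "p \<in> dual_points A"
  shows "\<exists>U \<phi> W e. (U, \<phi>) \<in> atlas M \<and> (W, e) \<in> frames A \<and> fst p \<in> U \<and> fst p \<in> W"
proof -
  have x: "fst p \<in> pts M" using assms by (auto simp: dual_points_def)
  show ?thesis using b.chart_cover[OF x] frame_cover[OF x] by auto
qed

lemma smooth_on_fibre_coordinate:
  assumes W: "(W, e) \<in> frames A" and j: "j < k"
  shows "smooth_on (dual A) (over W) (\<lambda>p. snd p (e j (fst p)))"
proof (rule d.smooth_on_locally)
  fix p assume p: "p \<in> over W"
  then obtain U \<phi> where U: "(U, \<phi>) \<in> atlas M" "fst p \<in> U"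
    using b.chart_cover[of "fst p"] frame_subset[OF W] by (auto simp: over_def)
  have o: "d.X_open (over (U \<inter> W))" by (rule over_open[OF UW_open[OF U(1) W]])
  have "smooth_on (dual A) (over (U \<inter> W)) (\<lambda>p. dual_chart A \<phi> e p (n + j))"
    by (rule d.smooth_on_chart_coordinate[OF dual_atlasI[OF U(1) W] o]) simp
  then have "smooth_on (dual A) (over (U \<inter> W)) (\<lambda>p. snd p (e j (fst p)))"
    by (rule d.smooth_on_cong[OF o, rotated]) (rule dual_chart_fibre[OF U(1) W j])
  then show "\<exists>N. d.X_open N \<and> p \<in> N \<and> N \<subseteq> over W \<and> smooth_on (dual A) N (\<lambda>p. snd p (e j (fst p)))"
    using o p U(2) by (intro exI[of _ "over (U \<inter> W)"]) (auto simp: over_def)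
qed

lemma pullback_Cinf:
  assumes f: "f \<in> Cinf M"
  shows "pullback A f \<in> Cinf (dual A)"
proof (rule d.CinfI)
  have "smooth_on (dual A) (over (pts M)) (\<lambda>p. f (fst p))"
    by (rule smooth_on_over[OF b.X_open_pts b.Cinf_smooth_on[OF f order_refl]])
  then have "smooth_on (dual A) (pts (dual A)) (\<lambda>p. f (fst p))" by (simp add: over_pts)
  then show "smooth_on (dual A) (pts (dual A)) (pullback A f)"
    by (rule d.smooth_on_cong[OF d.X_open_pts, rotated]) (simp add: pullback_def)
qed (simp add: pullback_def)

lemma section_in_fibre: "s \<in> sections A \<Longrightarrow> x \<in> pts M \<Longrightarrow> s x \<in> fibre A x"
  by (simp add: sections_def)

lemma section_smooth:
  assumes "s \<in> sections A" "(W, e) \<in> frames A" "i < k"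
  shows "smooth_on M W (\<lambda>x. coord e i x (s x))"
proof -
  have "\<forall>(U, e)\<in>frames A. \<forall>i<k. smooth_on M U (\<lambda>x. coord e i x (s x))"
    using assms(1) unfolding sections_def by simp
  from bspec[OF this assms(2), unfolded prod.case] show ?thesis using assms(3) by simp
qed

lemma fibre_linear_Cinf:
  assumes s: "s \<in> sections A"
  shows "fibre_linear A s \<in> Cinf (dual A)"
proof (rule d.CinfI)
  show "smooth_on (dual A) (pts (dual A)) (fibre_linear A s)"
  proof (rule d.smooth_on_locally)
    fix p assume p: "p \<in> pts (dual A)"
    then obtain U \<phi> W e where W: "(W, e) \<in> frames A" "fst p \<in> W" using dual_chart_at[of p] by auto
    have o: "d.X_open (over W)" by (rule over_open[OF frame_open[OF W(1)]])
    have "smooth_on (dual A) (over W) (\<lambda>p. coord e j (fst p) (s (fst p)) * snd p (e j (fst p)))" if "j < k" for j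
      by (rule d.smooth_on_mult[OF o smooth_on_over[OF frame_open[OF W(1)] section_smooth[OF s W(1) that]]
            smooth_on_fibre_coordinate[OF W(1) that]])
    then have "smooth_on (dual A) (over W) (\<lambda>p. \<Sum>j<k. coord e j (fst p) (s (fst p)) * snd p (e j (fst p)))"
      by (intro d.smooth_on_sum[OF o]) simp
    from d.smooth_on_linear[OF o bounded_linear_of_real this]
    have "smooth_on (dual A) (over W) (fibre_linear A s)"
    proof (rule d.smooth_on_cong[OF o, rotated])
      fix q assume "q \<in> over W"
      then have q: "q \<in> dual_points A" "fst q \<in> W" "snd q \<in> dual_fibre A (fst q)" "fst q \<in> pts M"
        by (auto simp: over_def dual_points_def)
      have "snd q (s (fst q)) = (\<Sum>j<k. coord e j (fst q) (s (fst q)) * snd q (e j (fst q)))"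
        by (rule dual_fibre_expand[OF W(1) q(2,3) section_in_fibre[OF s q(4)]])
      then show "complex_of_real (\<Sum>j<k. coord e j (fst q) (s (fst q)) * snd q (e j (fst q))) = fibre_linear A s q"
        using q(1) by (simp add: fibre_linear_def)
    qed
    then show "\<exists>N. d.X_open N \<and> p \<in> N \<and> N \<subseteq> pts (dual A) \<and> smooth_on (dual A) N (fibre_linear A s)"
      using o p W(2) over_subset[of W] by (intro exI[of _ "over W"]) (auto simp: over_def)
  qed
qed (simp add: fibre_linear_def)

section \<open>Derivatives along the fibres\<close>

text \<open>The fibre coordinates of the chart follow the n base coordinates, whence the index n +
  j.\<close>

definition fibre_partial ::
  "'m set \<Rightarrow> ('m \<Rightarrow> nat \<Rightarrow> real) \<Rightarrow> 'm set \<Rightarrow> (nat \<Rightarrow> 'm \<Rightarrow> 'v) \<Rightarrow> nat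
     \<Rightarrow> ('m \<times> ('v \<Rightarrow> real) \<Rightarrow> 'b::real_normed_vector) \<Rightarrow> 'm \<times> ('v \<Rightarrow> real) \<Rightarrow> 'b"
  where "fibre_partial U \<phi> W e j f p =
    partial (n + j) (\<lambda>y. f (inv_into (over (U \<inter> W)) (dual_chart A \<phi> e) y)) (dual_chart A \<phi> e p)"

lemma Cinf_dual_chart:
  assumes "(U, \<phi>) \<in> atlas M" "(W, e) \<in> frames A" "f \<in> Cinf (dual A)"
  shows "C_infinity_on (n + k) (dual_chart A \<phi> e ` over (U \<inter> W))
    (\<lambda>y. f (inv_into (over (U \<inter> W)) (dual_chart A \<phi> e) y))"
  using d.smooth_onD[OF d.Cinf_smooth_on[OF assms(3)] dual_atlasI[OF assms(1,2)], of "over (U \<inter> W)"]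
    over_subset by simp

lemma smooth_on_fibre_partial:
  assumes U: "(U, \<phi>) \<in> atlas M" and W: "(W, e) \<in> frames A" and f: "f \<in> Cinf (dual A)" and j: "j < k"
  shows "smooth_on (dual A) (over (U \<inter> W)) (fibre_partial U \<phi> W e j f)"
proof (rule d.smooth_on_chartI[OF dual_atlasI[OF U W] over_open[OF UW_open[OF U W]] order_refl])
  have o: "openin (Euclidean_space (n + k)) (dual_chart A \<phi> e ` over (U \<inter> W))"
    by (rule dual_chart_image_open[OF U W order_refl UW_open[OF U W]])
  have "n + j < n + k" using j by simp
  from C_infinity_on_partial[OF o Cinf_dual_chart[OF U W f] this]
  show "C_infinity_on (mdim (dual A)) (dual_chart A \<phi> e ` over (U \<inter> W))
      (\<lambda>y. fibre_partial U \<phi> W e j f (inv_into (over (U \<inter> W)) (dual_chart A \<phi> e) y))"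
    unfolding dual_simps
    by (rule C_infinity_on_cong[OF o, rotated]) (auto simp: fibre_partial_def dual_chart_inv[OF U W])
qed

text \<open>The base coordinates are constant along the curve, so only the k fibre terms of the
  chain rule survive.\<close>

lemma fibre_curve_has_derivative:
  assumes U: "(U, \<phi>) \<in> atlas M" and W: "(W, e) \<in> frames A" and x: "x \<in> U" "x \<in> W"
    and f: "f \<in> Cinf (dual A)" and \<eta>: "\<And>t. \<eta> t \<in> dual_fibre A x"
    and \<eta>': "\<And>j. j < k \<Longrightarrow> ((\<lambda>t. \<eta> t (e j x)) has_real_derivative c j) (at t0)"
  shows "((\<lambda>t. f (x, \<eta> t)) has_vector_derivative
    (\<Sum>j<k. c j *\<^sub>R fibre_partial U \<phi> W e j f (x, \<eta> t0))) (at t0)"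
proof -
  let ?\<psi> = "dual_chart A \<phi> e" and ?D = "over (U \<inter> W)"
  have o: "openin (Euclidean_space (n + k)) (?\<psi> ` ?D)"
    by (rule dual_chart_image_open[OF U W order_refl UW_open[OF U W]])
  have mem: "(x, \<eta> t) \<in> ?D" for t using x \<eta> frame_subset[OF W] by (auto simp: over_def dual_points_iff)
  have "((\<lambda>t. f (inv_into ?D ?\<psi> (?\<psi> (x, \<eta> t)))) has_vector_derivative
      (\<Sum>i<n + k. (if i < n then 0 else c (i - n)) *\<^sub>R
        partial i (\<lambda>y. f (inv_into ?D ?\<psi> y)) (?\<psi> (x, \<eta> t0)))) (at t0)"
  proof (rule chain_rule_curve[OF o Cinf_dual_chart[OF U W f]])
    show "?\<psi> (x, \<eta> t0) \<in> ?\<psi> ` ?D" using mem by blast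
    show "\<forall>\<^sub>F t in nhds t0. ?\<psi> (x, \<eta> t) \<in> ?\<psi> ` ?D" using mem by simp
    fix i assume i: "i < n + k"
    show "((\<lambda>t. ?\<psi> (x, \<eta> t) i) has_vector_derivative (if i < n then 0 else c (i - n))) (at t0)"
    proof (cases "i < n")
      case False
      then have "((\<lambda>t. \<eta> t (e (i - n) x)) has_real_derivative c (i - n)) (at t0)" using i by (intro \<eta>') simp
      then show ?thesis
        using False i by (simp add: dual_chart_def has_real_derivative_iff_has_vector_derivative)
    qed (simp add: dual_chart_def)
  qed
  then show ?thesis
    by (simp add: dual_chart_inv[OF U W mem] sum_lessThan_split fibre_partial_def)
qed

text \<open>Covers the Euler flow exp(t) \<xi> and the vertical translations \<xi> + t \<alpha> at
  once; linearity, Leibniz' rule and the values on generators are proved once for both.\<close>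

definition fibre_curve :: "'m \<Rightarrow> (real \<Rightarrow> 'v \<Rightarrow> real) \<Rightarrow> bool"
  where "fibre_curve x \<eta> \<longleftrightarrow> x \<in> pts M \<and> (\<forall>t. \<eta> t \<in> dual_fibre A x) \<and>
    (\<forall>v. \<exists>c. ((\<lambda>t. \<eta> t v) has_real_derivative c) (at 0))"

definition fibre_deriv :: "(real \<Rightarrow> 'v \<Rightarrow> real) \<Rightarrow> 'm \<Rightarrow> ('m \<times> ('v \<Rightarrow> real) \<Rightarrow> 'b::real_normed_vector) \<Rightarrow> 'b"
  where "fibre_deriv \<eta> x f = vector_derivative (\<lambda>t. f (x, \<eta> t)) (at 0)"

lemma fibre_deriv_has:
  assumes \<eta>: "fibre_curve x \<eta>" and f: "f \<in> Cinf (dual A)"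
  shows "((\<lambda>t. f (x, \<eta> t)) has_vector_derivative fibre_deriv \<eta> x f) (at 0)"
proof -
  have \<eta>0: "x \<in> pts M" "\<And>t. \<eta> t \<in> dual_fibre A x" using \<eta> by (auto simp: fibre_curve_def)
  then have "(x, \<eta> 0) \<in> dual_points A" by (simp add: dual_points_iff)
  from dual_chart_at[OF this] obtain U \<phi> W e where
    c: "(U, \<phi>) \<in> atlas M" "(W, e) \<in> frames A" "x \<in> U" "x \<in> W" by auto
  obtain c' where "\<And>v. ((\<lambda>t. \<eta> t v) has_real_derivative c' v) (at 0)"
    using \<eta> unfolding fibre_curve_def by metis
  from fibre_curve_has_derivative[OF c f \<eta>0(2) this]
  show ?thesis unfolding fibre_deriv_def by (simp add: vector_derivative_at)
qed

lemma fibre_deriv_eqI: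
  "((\<lambda>t. f (x, \<eta> t)) has_vector_derivative c) (at 0) \<Longrightarrow> fibre_deriv \<eta> x f = c"
  unfolding fibre_deriv_def by (rule vector_derivative_at)

lemma fibre_deriv_chart:
  assumes "(U, \<phi>) \<in> atlas M" "(W, e) \<in> frames A" "x \<in> U" "x \<in> W" "f \<in> Cinf (dual A)"
    and "fibre_curve x \<eta>" and "\<And>j. j < k \<Longrightarrow> ((\<lambda>t. \<eta> t (e j x)) has_real_derivative c j) (at 0)"
  shows "fibre_deriv \<eta> x f = (\<Sum>j<k. c j *\<^sub>R fibre_partial U \<phi> W e j f (x, \<eta> 0))"
proof (rule fibre_deriv_eqI)
  have \<eta>: "\<And>t. \<eta> t \<in> dual_fibre A x" using assms(6) by (simp add: fibre_curve_def)
  show "((\<lambda>t. f (x, \<eta> t)) has_vector_derivative (\<Sum>j<k. c j *\<^sub>R fibre_partial U \<phi> W e j f (x, \<eta> 0))) (at 0)"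
    by (rule fibre_curve_has_derivative[where c = c and \<eta> = \<eta>, OF assms(1-5) \<eta>]) (rule assms(7))
qed

context
  fixes x \<eta>
  assumes \<eta>: "fibre_curve x \<eta>"
begin

lemma fibre_deriv_add:
  "f \<in> Cinf (dual A) \<Longrightarrow> g \<in> Cinf (dual A) \<Longrightarrow> fibre_deriv \<eta> x (f + g) = fibre_deriv \<eta> x f + fibre_deriv \<eta> x g"
  using has_vector_derivative_add[OF fibre_deriv_has[OF \<eta>] fibre_deriv_has[OF \<eta>]]
  by (intro fibre_deriv_eqI) simp

lemma fibre_deriv_mult:
  fixes f g :: "_ \<Rightarrow> complex"
  shows "f \<in> Cinf (dual A) \<Longrightarrow> g \<in> Cinf (dual A) \<Longrightarrow>
    fibre_deriv \<eta> x (f * g) = f (x, \<eta> 0) * fibre_deriv \<eta> x g + g (x, \<eta> 0) * fibre_deriv \<eta> x f"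
  using has_vector_derivative_mult[OF fibre_deriv_has[OF \<eta>] fibre_deriv_has[OF \<eta>], of f g]
  by (intro fibre_deriv_eqI) (simp add: mult.commute)

lemma fibre_deriv_scal:
  fixes f :: "_ \<Rightarrow> complex"
  shows "f \<in> Cinf (dual A) \<Longrightarrow> fibre_deriv \<eta> x (scal c f) = c * fibre_deriv \<eta> x f"
  using bounded_linear.has_vector_derivative[OF bounded_linear_mult_right fibre_deriv_has[OF \<eta>]]
  by (intro fibre_deriv_eqI) (simp add: scal_def)

lemma fibre_deriv_pullback: "fibre_deriv \<eta> x (pullback A f) = 0"
proof (rule fibre_deriv_eqI)
  have "pullback A f (x, \<eta> t) = f x" for t
    using \<eta> by (simp add: pullback_def fibre_curve_def dual_points_iff)
  then show "((\<lambda>t. pullback A f (x, \<eta> t)) has_vector_derivative 0) (at 0)" by simp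
qed

lemma fibre_deriv_fibre_linear:
  assumes "((\<lambda>t. \<eta> t (s x)) has_real_derivative c) (at 0)"
  shows "fibre_deriv \<eta> x (fibre_linear A s) = of_real c"
proof (rule fibre_deriv_eqI)
  have "fibre_linear A s (x, \<eta> t) = of_real (\<eta> t (s x))" for t
    using \<eta> by (simp add: fibre_linear_def fibre_curve_def dual_points_iff)
  then show "((\<lambda>t. fibre_linear A s (x, \<eta> t)) has_vector_derivative of_real c) (at 0)"
    using assms by (simp add: bounded_linear.has_vector_derivative[OF bounded_linear_of_real]
        has_real_derivative_iff_has_vector_derivative)
qed

end

lemma dual_fibre_combine:
  assumes "\<xi> \<in> dual_fibre A x" "\<alpha> \<in> dual_fibre A x"
  shows "(\<lambda>v. a * \<xi> v + c * \<alpha> v) \<in> dual_fibre A x"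
  using assms unfolding dual_fibre_def by (auto simp: algebra_simps)

lemma euler_curve:
  assumes "(x, \<xi>) \<in> dual_points A"
  shows "fibre_curve x (\<lambda>t v. exp t * \<xi> v)"
proof -
  have \<xi>: "x \<in> pts M" "\<xi> \<in> dual_fibre A x" using assms by (simp_all add: dual_points_iff)
  have "((\<lambda>t. exp t * \<xi> v) has_real_derivative \<xi> v) (at 0)" for v by (auto intro!: derivative_eq_intros)
  moreover have "(\<lambda>v. exp t * \<xi> v) \<in> dual_fibre A x" for t
    using dual_fibre_combine[OF \<xi>(2,2), of "exp t" 0] by simp
  ultimately show ?thesis using \<xi>(1) by (auto simp: fibre_curve_def)
qed

lemma vertical_curve:
  assumes "(x, \<xi>) \<in> dual_points A" "\<alpha> \<in> dual_fibre A x"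
  shows "fibre_curve x (\<lambda>t v. \<xi> v + t * \<alpha> v)"
proof -
  have \<xi>: "x \<in> pts M" "\<xi> \<in> dual_fibre A x" using assms by (simp_all add: dual_points_iff)
  have "((\<lambda>t. \<xi> v + t * \<alpha> v) has_real_derivative \<alpha> v) (at 0)" for v by (auto intro!: derivative_eq_intros)
  moreover have "(\<lambda>v. \<xi> v + t * \<alpha> v) \<in> dual_fibre A x" for t
    using dual_fibre_combine[OF \<xi>(2) assms(2), of 1 t] by simp
  ultimately show ?thesis using \<xi>(1) by (auto simp: fibre_curve_def)
qed

section \<open>The Euler vector field\<close>

lemma euler_eq:
  assumes "f \<in> Cinf (dual A)" "(x, \<xi>) \<in> dual_points A"
  shows "euler A f (x, \<xi>) = fibre_deriv (\<lambda>t v. exp t * \<xi> v) x f"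
  using assms by (simp add: euler_def fibre_deriv_def)

lemma euler_outside: "p \<notin> dual_points A \<Longrightarrow> euler A f p = 0"
  by (cases p) (simp add: euler_def)

text \<open>In a chart the Euler field is the sum of the fibre coordinates times the fibre
  derivatives, a formula in which every ingredient is smooth.\<close>

lemma euler_Cinf [intro]:
  fixes f :: "_ \<Rightarrow> complex"
  assumes f: "f \<in> Cinf (dual A)"
  shows "euler A f \<in> Cinf (dual A)"
proof (rule d.CinfI)
  show "smooth_on (dual A) (pts (dual A)) (euler A f)"
  proof (rule d.smooth_on_locally)
    fix p assume p: "p \<in> pts (dual A)"
    then obtain U \<phi> W e where c: "(U, \<phi>) \<in> atlas M" "(W, e) \<in> frames A" and x: "fst p \<in> U" "fst p \<in> W"
      using dual_chart_at[of p] by auto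
    have o: "d.X_open (over (U \<inter> W))" by (rule over_open[OF UW_open[OF c]])
    have "smooth_on (dual A) (over (U \<inter> W)) (\<lambda>p. snd p (e j (fst p)) *\<^sub>R fibre_partial U \<phi> W e j f p)"
      if "j < k" for j
    proof (rule d.smooth_on_scaleR[OF o _ smooth_on_fibre_partial[OF c f that]])
      show "smooth_on (dual A) (over (U \<inter> W)) (\<lambda>p. snd p (e j (fst p)))"
        by (rule d.smooth_on_subset[OF smooth_on_fibre_coordinate[OF c(2) that]]) (auto simp: over_def)
    qed
    then have "smooth_on (dual A) (over (U \<inter> W)) (\<lambda>p. \<Sum>j<k. snd p (e j (fst p)) *\<^sub>R fibre_partial U \<phi> W e j f p)"
      by (intro d.smooth_on_sum[OF o]) simp
    then have "smooth_on (dual A) (over (U \<inter> W)) (euler A f)"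
    proof (rule d.smooth_on_cong[OF o, rotated])
      fix q assume "q \<in> over (U \<inter> W)"
      then have q: "(fst q, snd q) \<in> dual_points A" "fst q \<in> U" "fst q \<in> W" by (auto simp: over_def)
      have "euler A f (fst q, snd q) = (\<Sum>j<k. snd q (e j (fst q)) *\<^sub>R
          fibre_partial U \<phi> W e j f (fst q, \<lambda>v. exp 0 * snd q v))"
        unfolding euler_eq[OF f q(1)]
        by (rule fibre_deriv_chart[OF c q(2,3) f euler_curve[OF q(1)]]) (auto intro!: derivative_eq_intros)
      then show "(\<Sum>j<k. snd q (e j (fst q)) *\<^sub>R fibre_partial U \<phi> W e j f q) = euler A f q" by simp
    qed
    then show "\<exists>N. d.X_open N \<and> p \<in> N \<and> N \<subseteq> pts (dual A) \<and> smooth_on (dual A) N (euler A f)"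
      using o p x by (intro exI[of _ "over (U \<inter> W)"]) (auto simp: over_def)
  qed
qed (simp add: euler_outside)

context
  fixes f g :: "'m \<times> ('v \<Rightarrow> real) \<Rightarrow> complex"
  assumes f: "f \<in> Cinf (dual A)" and g: "g \<in> Cinf (dual A)"
begin

lemma euler_add: "euler A (f + g) = euler A f + euler A g"
proof
  fix p show "euler A (f + g) p = (euler A f + euler A g) p"
    using fibre_deriv_add[OF euler_curve f g] euler_eq[OF f] euler_eq[OF g] euler_eq[OF d.Cinf_add[OF f g]]
    by (cases p; cases "p \<in> dual_points A") (simp_all add: euler_outside)
qed

lemma euler_mult: "euler A (f * g) = f * euler A g + g * euler A f"
proof
  fix p show "euler A (f * g) p = (f * euler A g + g * euler A f) p"
    using fibre_deriv_mult[OF euler_curve f g] euler_eq[OF f] euler_eq[OF g] euler_eq[OF d.Cinf_mult[OF f g]]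
    by (cases p; cases "p \<in> dual_points A") (simp_all add: euler_outside)
qed

lemma euler_scal: "euler A (scal c f) = scal c (euler A f)"
proof
  fix p show "euler A (scal c f) p = scal c (euler A f) p"
    using fibre_deriv_scal[OF euler_curve f] euler_eq[OF f] euler_eq[OF d.Cinf_scal[OF f]]
    by (cases p; cases "p \<in> dual_points A") (simp_all add: euler_outside scal_def)
qed

end

lemma euler_fibre_linear:
  assumes s: "s \<in> sections A"
  shows "euler A (fibre_linear A s) = fibre_linear A s"
proof
  fix p
  show "euler A (fibre_linear A s) p = fibre_linear A s p"
  proof (cases "p \<in> dual_points A")
    case True
    then obtain x \<xi> where p: "p = (x, \<xi>)" "(x, \<xi>) \<in> dual_points A" by (cases p) auto
    have "fibre_deriv (\<lambda>t v. exp t * \<xi> v) x (fibre_linear A s) = of_real (\<xi> (s x))"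
      by (rule fibre_deriv_fibre_linear[OF euler_curve[OF p(2)]]) (auto intro!: derivative_eq_intros)
    then show ?thesis using p euler_eq[OF fibre_linear_Cinf[OF s] p(2)] by (simp add: fibre_linear_def)
  qed (simp add: euler_outside fibre_linear_def)
qed

text \<open>A smooth function of negative homogeneity would blow up at the zero section.\<close>

lemma negative_homogeneous_eq_0:
  fixes f :: "_ \<Rightarrow> complex"
  assumes f: "f \<in> Cinf (dual A)" and hom: "euler A f = scal (- of_nat (Suc m)) f"
  shows "f = 0"
proof
  fix p
  show "f p = 0 p"
  proof (cases "p \<in> dual_points A")
    case True
    then obtain x \<xi> where p: "p = (x, \<xi>)" "x \<in> pts M" "\<xi> \<in> dual_fibre A x" by (cases p) (auto simp: dual_points_iff)
    have fib: "(\<lambda>v. s * \<xi> v) \<in> dual_fibre A x" for s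
      using dual_fibre_combine[OF p(3,3), of s 0] by simp
    then have pt: "(x, \<lambda>v. s * \<xi> v) \<in> dual_points A" for s using p(2) by (simp add: dual_points_iff)
    obtain U \<phi> W e where c: "(U, \<phi>) \<in> atlas M" "(W, e) \<in> frames A" "x \<in> U" "x \<in> W"
      using dual_chart_at[OF pt[of 1]] by auto
    define h where "h s = f (x, \<lambda>v. s * \<xi> v)" for s
    have h': "\<exists>d. (h has_vector_derivative d) (at s)" for s
    proof -
      have "((\<lambda>t. t * \<xi> (e j x)) has_real_derivative \<xi> (e j x)) (at s)" for j
        by (auto intro!: derivative_eq_intros)
      from fibre_curve_has_derivative[where \<eta> = "\<lambda>t v. t * \<xi> v" and c = "\<lambda>j. \<xi> (e j x)" and ?t0.0 = s, OF c f fib this]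
      show ?thesis unfolding h_def by (rule exI)
    qed
    \<comment> \<open>Homogeneity at the point s\<xi>: the Euler flow there is h(exp(t) s), whose
      derivative at t = 0 is s h'(s).\<close>
    have sh: "s *\<^sub>R d = - of_nat (Suc m) * h s" if d: "(h has_vector_derivative d) (at s)" for s d
    proof -
      have "((\<lambda>t. exp t * s) has_vector_derivative s) (at 0)"
        unfolding has_real_derivative_iff_has_vector_derivative[symmetric] by (auto intro!: derivative_eq_intros)
      from vector_diff_chain_at[OF this, of h d] d
      have "((\<lambda>t. h (exp t * s)) has_vector_derivative s *\<^sub>R d) (at 0)" by (simp add: o_def)
      then have "fibre_deriv (\<lambda>t v. exp t * (s * \<xi> v)) x f = s *\<^sub>R d"
        by (intro fibre_deriv_eqI) (simp add: h_def mult.assoc)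
      then show ?thesis
        using euler_eq[OF f pt[of s]] fun_cong[OF hom, of "(x, \<lambda>v. s * \<xi> v)"] by (simp add: scal_def h_def)
    qed
    \<comment> \<open>By the preceding equation s^(m+1) h(s) is constant on the whole line. At s = 0
      it is 0 because h is finite there, hence h(1) = 0.\<close>
    have "((\<lambda>s. s ^ Suc m *\<^sub>R h s) has_vector_derivative 0) (at s within UNIV)" for s
    proof -
      obtain d where d: "(h has_vector_derivative d) (at s)" using h' by blast
      have "((\<lambda>s. s ^ Suc m) has_real_derivative real (Suc m) * s ^ m) (at s)"
        using DERIV_pow[of "Suc m" s] by simp
      from has_vector_derivative_scaleR[OF this d]
      have "((\<lambda>s. s ^ Suc m *\<^sub>R h s) has_vector_derivative
          s ^ Suc m *\<^sub>R d + (real (Suc m) * s ^ m) *\<^sub>R h s) (at s)" .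
      moreover have "s ^ Suc m *\<^sub>R d = s ^ m *\<^sub>R (s *\<^sub>R d)" by (simp add: mult.commute)
      then have "s ^ Suc m *\<^sub>R d + (real (Suc m) * s ^ m) *\<^sub>R h s = 0"
        unfolding sh[OF d] by (simp add: scaleR_conv_of_real algebra_simps)
      ultimately show ?thesis by simp
    qed
    then obtain c where "\<And>s. s \<in> UNIV \<Longrightarrow> s ^ Suc m *\<^sub>R h s = c"
      using has_vector_derivative_zero_constant[of UNIV "\<lambda>s. s ^ Suc m *\<^sub>R h s"] by auto
    from this[of 0] this[of 1] have "h 1 = 0" by simp
    then show ?thesis using p(1) by (simp add: h_def)
  qed (use d.Cinf_outside[OF f] in simp)
qed

end

lemma sum_fun_apply: "(\<Sum>i\<in>I. u i) x = (\<Sum>i\<in>I. u i x)"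
  by (induction I rule: infinite_finite_induct) simp_all

section \<open>Derivations and bivector fields\<close>

lemma scal_simps:
  fixes f g :: "'p \<Rightarrow> complex"
  shows "scal c (f + g) = scal c f + scal c g" "scal c (f - g) = scal c f - scal c g"
    "scal c (- f) = - scal c f" "scal c (f * g) = f * scal c g" "scal c f * g = f * scal c g"
    "scal c (scal a f) = scal (c * a) f" "scal 1 f = f" "scal 0 f = 0" "scal c 0 = 0"
  by (auto simp: scal_def fun_eq_iff algebra_simps)

text \<open>Complex-valued and silent about arguments that are not smooth, so that an operator with
  all but one argument fixed qualifies directly.\<close>

definition derivation :: "'p mfd \<Rightarrow> (('p \<Rightarrow> complex) \<Rightarrow> 'p \<Rightarrow> complex) \<Rightarrow> bool"
  where "derivation X D \<longleftrightarrow> (\<forall>f\<in>Cinf X. D f \<in> Cinf X \<and> (\<forall>c. D (scal c f) = scal c (D f)) \<and>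
    (\<forall>g\<in>Cinf X. D (f + g) = D f + D g \<and> D (f * g) = f * D g + g * D f))"

lemma derivationI:
  assumes "\<And>f. f \<in> Cinf X \<Longrightarrow> D f \<in> Cinf X" "\<And>f c. f \<in> Cinf X \<Longrightarrow> D (scal c f) = scal c (D f)"
    "\<And>f g. f \<in> Cinf X \<Longrightarrow> g \<in> Cinf X \<Longrightarrow> D (f + g) = D f + D g"
    "\<And>f g. f \<in> Cinf X \<Longrightarrow> g \<in> Cinf X \<Longrightarrow> D (f * g) = f * D g + g * D f"
  shows "derivation X D"
  using assms by (simp add: derivation_def)

lemma derivationD:
  assumes "derivation X D" "f \<in> Cinf X"
  shows "D f \<in> Cinf X" "D (scal c f) = scal c (D f)"
    "g \<in> Cinf X \<Longrightarrow> D (f + g) = D f + D g" "g \<in> Cinf X \<Longrightarrow> D (f * g) = f * D g + g * D f"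
  using assms by (simp_all add: derivation_def)

definition bivector :: "'p mfd \<Rightarrow> (('p \<Rightarrow> complex) \<Rightarrow> ('p \<Rightarrow> complex) \<Rightarrow> 'p \<Rightarrow> complex) \<Rightarrow> bool"
  where "bivector X P \<longleftrightarrow> (\<forall>g\<in>Cinf X. derivation X (\<lambda>f. P f g)) \<and>
    (\<forall>f\<in>Cinf X. \<forall>g\<in>Cinf X. P g f = - P f g)"

text \<open>The Jacobiator P(P(f,g),h) + cyclic, polarized: up to normalization the Schouten bracket
  of the two bivector fields.\<close>

definition schouten ::
  "(('p \<Rightarrow> complex) \<Rightarrow> ('p \<Rightarrow> complex) \<Rightarrow> 'p \<Rightarrow> complex) \<Rightarrow>
   (('p \<Rightarrow> complex) \<Rightarrow> ('p \<Rightarrow> complex) \<Rightarrow> 'p \<Rightarrow> complex) \<Rightarrow>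
   ('p \<Rightarrow> complex) \<Rightarrow> ('p \<Rightarrow> complex) \<Rightarrow> ('p \<Rightarrow> complex) \<Rightarrow> 'p \<Rightarrow> complex"
  where "schouten P B f g h =
    P (B f g) h + P (B g h) f + P (B h f) g + (B (P f g) h + B (P g h) f + B (P h f) g)"

context atlas_mfd
begin

lemma derivation_minus: "derivation X D \<Longrightarrow> f \<in> Cinf X \<Longrightarrow> D (- f) = - D f"
proof -
  assume D: "derivation X D" and f: "f \<in> Cinf X"
  have "- f = scal (- 1) f" and "- D f = scal (- 1) (D f)" by (simp_all add: scal_def fun_eq_iff)
  then show ?thesis using derivationD(2)[OF D f] by simp
qed

lemma derivation_zero: "derivation X D \<Longrightarrow> D 0 = 0"
  using derivationD(2)[of X D 0 0] by (simp add: scal_simps)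

lemma derivation_diff:
  assumes D: "derivation X D" and E: "derivation X E"
  shows "derivation X (\<lambda>f. D f - E f)"
  by (rule derivationI)
     (simp_all add: derivationD[OF D] derivationD[OF E] scal_simps algebra_simps Cinf_diff)

lemma derivation_scal:
  assumes D: "derivation X D"
  shows "derivation X (\<lambda>f. scal c (D f))"
  by (rule derivationI)
     (simp_all add: derivationD[OF D] scal_simps Cinf_scal mult.commute)

lemma derivation_commutator:
  assumes D: "derivation X D" and E: "derivation X E"
  shows "derivation X (\<lambda>f. D (E f) - E (D f))"
proof (rule derivationI)
  fix f g :: "'p \<Rightarrow> complex" assume f: "f \<in> Cinf X" and g: "g \<in> Cinf X"
  note fg = f g derivationD(1)[OF D f] derivationD(1)[OF D g] derivationD(1)[OF E f] derivationD(1)[OF E g]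
  show "D (E (f + g)) - E (D (f + g)) = D (E f) - E (D f) + (D (E g) - E (D g))"
    by (simp add: derivationD(3)[OF D] derivationD(3)[OF E] fg)
  show "D (E (f * g)) - E (D (f * g)) = f * (D (E g) - E (D g)) + g * (D (E f) - E (D f))"
    by (simp add: derivationD(3,4)[OF D] derivationD(3,4)[OF E] fg Cinf_mult algebra_simps)
qed (simp_all add: derivationD(1,2)[OF D] derivationD(1,2)[OF E] Cinf_diff scal_simps)

lemma bivectorD:
  assumes P: "bivector X P" and g: "g \<in> Cinf X"
  shows "derivation X (\<lambda>f. P f g)" "derivation X (\<lambda>f. P g f)" "f \<in> Cinf X \<Longrightarrow> P g f = - P f g"
proof -
  show D: "derivation X (\<lambda>f. P f g)"
    using bspec[OF conjunct1[OF P[unfolded bivector_def]] g] .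
  have *: "P g f = - P f g" if "f \<in> Cinf X" for f
    using bspec[OF bspec[OF conjunct2[OF P[unfolded bivector_def]] that] g] .
  then show "f \<in> Cinf X \<Longrightarrow> P g f = - P f g" .
  show "derivation X (\<lambda>f. P g f)"
  proof (rule derivationI)
    fix f h :: "'p \<Rightarrow> complex" and c assume f: "f \<in> Cinf X" and h: "h \<in> Cinf X"
    show "P g f \<in> Cinf X" unfolding *[OF f] by (rule Cinf_uminus[OF derivationD(1)[OF D f]])
    show "P g (scal c f) = scal c (P g f)"
      unfolding *[OF f] *[OF Cinf_scal[OF f]] derivationD(2)[OF D f] by (simp add: scal_simps)
    show "P g (f + h) = P g f + P g h"
      unfolding *[OF f] *[OF h] *[OF Cinf_add[OF f h]] derivationD(3)[OF D f h] by simp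
    show "P g (f * h) = f * P g h + h * P g f"
      unfolding *[OF f] *[OF h] *[OF Cinf_mult[OF f h]] derivationD(4)[OF D f h] by simp
  qed
qed

lemma bivector_Cinf: "bivector X P \<Longrightarrow> f \<in> Cinf X \<Longrightarrow> g \<in> Cinf X \<Longrightarrow> P f g \<in> Cinf X"
  by (rule derivationD(1)[OF bivectorD(1)])

lemma bivector_rules:
  assumes P: "bivector X P" and "f \<in> Cinf X" "g \<in> Cinf X" "h \<in> Cinf X"
  shows "P (f + g) h = P f h + P g h" "P h (f + g) = P h f + P h g"
    "P (f * g) h = f * P g h + g * P f h" "P h (f * g) = f * P h g + g * P h f"
    "P (scal c f) h = scal c (P f h)" "P h (scal c f) = scal c (P h f)"
  using derivationD[OF bivectorD(1)[OF P assms(4)] assms(2)] derivationD[OF bivectorD(2)[OF P assms(4)] assms(2)]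
    assms(3) by simp_all

text \<open>Expanding a product in the first slot leaves cross terms such as B(f2,g) P(f1,h). By
  antisymmetry they cancel between the cyclic sum with P outside and the one with B outside.\<close>

lemma schouten_derivation:
  assumes P: "bivector X P" and B: "bivector X B" and g: "g \<in> Cinf X" and h: "h \<in> Cinf X"
  shows "derivation X (\<lambda>f. schouten P B f g h)"
proof (rule derivationI)
  note C = bivector_Cinf[OF P] bivector_Cinf[OF B] Cinf_add Cinf_mult Cinf_scal g h
  note R = bivector_rules[OF P] bivector_rules[OF B]
  fix f1 f2 :: "'p \<Rightarrow> complex" assume f: "f1 \<in> Cinf X" "f2 \<in> Cinf X"
  show "schouten P B (f1 + f2) g h = schouten P B f1 g h + schouten P B f2 g h"
    using f by (simp add: schouten_def R C)
  have anti: "P h f1 = - P f1 h" "P h f2 = - P f2 h" "B h f1 = - B f1 h" "B h f2 = - B f2 h"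
    using f h by (simp_all add: bivectorD(3)[OF P h] bivectorD(3)[OF B h])
  have e1: "P (B (f1 * f2) g) h = f1 * P (B f2 g) h + B f2 g * P f1 h + (f2 * P (B f1 g) h + B f1 g * P f2 h)"
    and e2: "P (B g h) (f1 * f2) = f1 * P (B g h) f2 + f2 * P (B g h) f1"
    and e3: "P (B h (f1 * f2)) g = f1 * P (B h f2) g + B h f2 * P f1 g + (f2 * P (B h f1) g + B h f1 * P f2 g)"
    and e4: "B (P (f1 * f2) g) h = f1 * B (P f2 g) h + P f2 g * B f1 h + (f2 * B (P f1 g) h + P f1 g * B f2 h)"
    and e5: "B (P g h) (f1 * f2) = f1 * B (P g h) f2 + f2 * B (P g h) f1"
    and e6: "B (P h (f1 * f2)) g = f1 * B (P h f2) g + P h f2 * B f1 g + (f2 * B (P h f1) g + P h f1 * B f2 g)"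
    using f by (simp_all add: R C)
  show "schouten P B (f1 * f2) g h = f1 * schouten P B f2 g h + f2 * schouten P B f1 g h"
    unfolding schouten_def e1 e2 e3 e4 e5 e6 anti by (simp add: algebra_simps)
next
  note C = bivector_Cinf[OF P] bivector_Cinf[OF B] Cinf_add Cinf_mult Cinf_scal g h
  note R = bivector_rules[OF P] bivector_rules[OF B]
  fix f :: "'p \<Rightarrow> complex" and c assume f: "f \<in> Cinf X"
  show "schouten P B f g h \<in> Cinf X" unfolding schouten_def using f by (intro Cinf_add C)
  show "schouten P B (scal c f) g h = scal c (schouten P B f g h)"
    unfolding schouten_def using f by (simp add: R(5,6,11,12) C scal_simps(1))
qed

lemma schouten_cyclic: "schouten P B f g h = schouten P B g h f"
  by (simp add: schouten_def algebra_simps)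

end

context smooth_bundle
begin

section \<open>Derivations are determined by their values on generators\<close>

lemma over_closed:
  assumes "closedin (mfd_topology M) K"
  shows "closedin (mfd_topology (dual A)) (over K)"
proof -
  have "b.X_open (pts M - K)" using assms by (metis openin_diff b.X_open_pts)
  from over_open[OF this] have "d.X_open (over (pts M - K))" .
  moreover have "over (pts M - K) = pts (dual A) - over K" by (auto simp: over_def dual_points_def)
  ultimately show ?thesis using over_subset[of K] by (simp add: closedin_def)
qed

text \<open>Frames are only local, whereas the defining properties of the Poisson bracket and of
  closedness concern global sections. The cutoff lives on the closed set K inside the domain of the
  frame, so extension by 0 remains smooth in every other frame.\<close>

lemma cutoff_frame_section:
  assumes W: "(W, e) \<in> frames A" and Q: "b.X_open Q" and K: "closedin (mfd_topology M) K" "K \<subseteq> Q" "Q \<subseteq> W"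
    and \<beta>: "\<beta> \<in> Cinf M" "\<And>z. z \<notin> K \<Longrightarrow> \<beta> z = 0" and j: "j < k"
  shows "(\<lambda>z. \<beta> z *\<^sub>R e j z) \<in> sections A"
proof -
  have "\<beta> z *\<^sub>R e j z \<in> fibre A z" if z: "z \<in> pts M" for z
  proof (cases "z \<in> W")
    case True
    then show ?thesis using frame_in_fibre[OF W True j] subspace_fibre[OF z] by (simp add: subspace_mul)
  next
    case False
    then have "\<beta> z = 0" using K \<beta>(2) by blast
    then show ?thesis using subspace_fibre[OF z] by (simp add: subspace_0)
  qed
  moreover have "\<beta> z *\<^sub>R e j z = 0" if "z \<notin> pts M" for z using b.Cinf_outside[OF \<beta>(1) that] by simp
  moreover have "smooth_on M V (\<lambda>z. coord b i z (\<beta> z *\<^sub>R e j z))" if V: "(V, b) \<in> frames A" and i: "i < k" for V b i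
  proof (rule b.smooth_on_extend_zero[OF Q K(1,2) frame_open[OF V]])
    have o: "b.X_open (Q \<inter> V)" using Q frame_open[OF V] by (rule openin_Int)
    have "smooth_on M (Q \<inter> V) (\<lambda>z. \<beta> z * coord b i z (e j z))"
    proof (rule b.smooth_on_mult[OF o])
      show "smooth_on M (Q \<inter> V) \<beta>" by (rule b.Cinf_smooth_on[OF \<beta>(1) b.X_open_subset[OF o]])
      show "smooth_on M (Q \<inter> V) (\<lambda>z. coord b i z (e j z))"
        by (rule b.smooth_on_subset[OF frame_transition[OF V W i j]]) (use K(3) in auto)
    qed
    then show "smooth_on M (Q \<inter> V) (\<lambda>z. coord b i z (\<beta> z *\<^sub>R e j z))"
    proof (rule b.smooth_on_cong[OF o, rotated])
      fix z assume "z \<in> Q \<inter> V"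
      then have z: "z \<in> V" "z \<in> W" using K(3) by auto
      have "e j z \<in> fibre A z" by (rule frame_in_fibre[OF W z(2) j])
      from coord_scale[OF V z(1) this, of i "\<beta> z"]
      show "\<beta> z * coord b i z (e j z) = coord b i z (\<beta> z *\<^sub>R e j z)" by simp
    qed
    show "coord b i z (\<beta> z *\<^sub>R e j z) = 0" if "z \<notin> K" for z using \<beta>(2)[OF that] by simp
  qed
  ultimately show ?thesis unfolding sections_def by auto
qed

text \<open>Near p, Hadamard's lemma gives f = f(p) + sum of (y_i - y_i(p)) g_i. After
  multiplication by the square of a cutoff b, each summand is a product of a global function that
  vanishes at p and is killed by v with another global function, so Leibniz' rule annihilates
  it.\<close>

theorem point_derivation_eq_0:
  fixes v :: "('m \<times> ('v \<Rightarrow> real) \<Rightarrow> complex) \<Rightarrow> complex"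
  assumes p: "p \<in> dual_points A"
    and add: "\<And>f g. f \<in> Cinf (dual A) \<Longrightarrow> g \<in> Cinf (dual A) \<Longrightarrow> v (f + g) = v f + v g"
    and scal: "\<And>f c. f \<in> Cinf (dual A) \<Longrightarrow> v (scal c f) = c * v f"
    and leibniz: "\<And>f g. f \<in> Cinf (dual A) \<Longrightarrow> g \<in> Cinf (dual A) \<Longrightarrow> v (f * g) = f p * v g + g p * v f"
    and pb: "\<And>f. f \<in> Cinf M \<Longrightarrow> v (pullback A f) = 0"
    and fl: "\<And>s. s \<in> sections A \<Longrightarrow> v (fibre_linear A s) = 0"
    and f: "f \<in> Cinf (dual A)"
  shows "v f = 0"
proof -
  define x where "x = fst p"
  obtain U \<phi> W e where U: "(U, \<phi>) \<in> atlas M" and W: "(W, e) \<in> frames A" and x: "x \<in> U" "x \<in> W"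
    using dual_chart_at[OF p] unfolding x_def by auto
  have xUW: "x \<in> U \<inter> W" using x by simp
  obtain r Q K and \<beta> :: "'m \<Rightarrow> real" where r: "r > 0" and Q: "b.X_open Q"
    and K: "closedin (mfd_topology M) K" "x \<in> K" "K \<subseteq> Q" and QUW: "Q \<subseteq> U \<inter> W"
    and Q_eq: "\<phi> ` Q = {y \<in> E_carrier n. \<forall>i<n. \<bar>y i - \<phi> x i\<bar> < r}"
    and \<beta>: "\<beta> \<in> Cinf M" "\<beta> x \<noteq> 0" "\<And>z. z \<notin> K \<Longrightarrow> \<beta> z = 0"
  proof (rule smooth_manifold_bump[OF base_manifold U frame_open[OF W] xUW])
    fix r Q K and \<beta> :: "'m \<Rightarrow> real"
    assume "r > 0" "b.X_open Q" "closedin (mfd_topology M) K" "x \<in> K" "K \<subseteq> Q" "Q \<subseteq> U \<inter> W"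
      "\<phi> ` Q = {y \<in> E_carrier n. \<forall>i<n. \<bar>y i - \<phi> x i\<bar> < r}"
      "\<beta> \<in> Cinf M" "\<beta> x \<noteq> 0" "\<And>z. z \<notin> K \<Longrightarrow> \<beta> z = 0"
    then show thesis by (rule that)
  qed
  let ?\<psi> = "dual_chart A \<phi> e"
  let ?inv = "inv_into (over (U \<inter> W)) ?\<psi>"
  have xQ: "x \<in> Q" using K by blast
  have QU: "Q \<subseteq> U" and QW: "Q \<subseteq> W" using QUW by auto
  have \<psi>_base: "?\<psi> q i = \<phi> (fst q) i" if "i < n" for q i using that by (simp add: dual_chart_def split: prod.split)
  have \<psi>_fib: "?\<psi> q (n + j) = snd q (e j (fst q))" if "j < k" for q j by (rule dual_chart_fibre[OF U W that])
  have over_sub: "over Q \<subseteq> over (U \<inter> W)" using QUW by (auto simp: over_def)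
  have pQ: "p \<in> over Q" using p xQ by (simp add: over_def x_def)
  have V_eq: "?\<psi> ` over Q = {y \<in> E_carrier (n + k). \<forall>i<n. \<bar>y i - \<phi> x i\<bar> < r}"
    unfolding dual_chart_image[OF U W QUW] Q_eq by (auto simp: trunc_def)
  have oV: "openin (Euclidean_space (n + k)) (?\<psi> ` over Q)" by (rule dual_chart_image_open[OF U W QUW Q])
  \<comment> \<open>In the chart the domain is a box in the base directions times all of R^k, and p
    lies over the centre of the box; moving towards p shrinks the base offset by the factor
    t.\<close>
  interpret star_domain "n + k" "?\<psi> ` over Q" "?\<psi> p"
  proof
    show "openin (Euclidean_space (n + k)) (?\<psi> ` over Q)" by (rule oV)
    show "?\<psi> p \<in> ?\<psi> ` over Q" using pQ by (rule imageI)
    fix y t assume y: "y \<in> ?\<psi> ` over Q" and t: "0 \<le> t" "t \<le> (1::real)"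
    have y': "y \<in> E_carrier (n + k)" "\<And>i. i < n \<Longrightarrow> \<bar>y i - \<phi> x i\<bar> < r" using y unfolding V_eq by auto
    show "segment_point (?\<psi> p) y t \<in> ?\<psi> ` over Q"
      unfolding V_eq
    proof (intro CollectI conjI allI impI)
      show "segment_point (?\<psi> p) y t i = 0" if "n + k \<le> i" for i
        using that y'(1) dual_chart_carrier[OF U W, of p] by (simp add: segment_point_def)
      fix i assume i: "i < n"
      have "\<bar>segment_point (?\<psi> p) y t i - \<phi> x i\<bar> = t * \<bar>y i - \<phi> x i\<bar>"
        using \<psi>_base[OF i, of p] t(1) by (simp add: segment_point_def x_def abs_mult)
      also have "\<dots> \<le> 1 * \<bar>y i - \<phi> x i\<bar>" using t(2) by (intro mult_right_mono) auto
      finally show "\<bar>segment_point (?\<psi> p) y t i - \<phi> x i\<bar> < r" using y'(2)[OF i] by simp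
    qed
  qed
  define h where "h y = f (?inv y)" for y
  have h: "C_infinity_on (n + k) (?\<psi> ` over Q) h"
    unfolding h_def by (rule C_infinity_on_subset[OF image_mono[OF over_sub] Cinf_dual_chart[OF U W f]])
  have inv: "?inv (?\<psi> q) = q" if "q \<in> over Q" for q using dual_chart_inv[OF U W] over_sub that by blast
  define g where "g i = segment_integral (?\<psi> p) 0 (partial i h)" for i
  have g: "C_infinity_on (n + k) (?\<psi> ` over Q) (g i)" if "i < n + k" for i
    unfolding g_def by (rule C_infinity_on_segment_integral[OF C_infinity_on_partial[OF oV h that]])
  have hadamard: "f q = f p + (\<Sum>i<n + k. of_real (?\<psi> q i - ?\<psi> p i) * g i (?\<psi> q))" if "q \<in> over Q" for q
    using Hadamard[OF h imageI[OF that]] inv[OF that] inv[OF pQ]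
    by (simp add: h_def g_def scaleR_conv_of_real diff_eq_eq)
  define \<gamma> where "\<gamma> z = complex_of_real (\<beta> z)" for z
  have \<gamma>: "\<gamma> \<in> Cinf M"
    unfolding \<gamma>_def by (rule b.Cinf_linear[OF bounded_linear_of_real \<beta>(1)])
  define b where "b = pullback A \<gamma>"
  have b: "b \<in> Cinf (dual A)" unfolding b_def by (rule pullback_Cinf[OF \<gamma>])
  have b_val: "b q = of_real (\<beta> (fst q))" if "q \<in> over Q" for q
    using that by (simp add: b_def pullback_def \<gamma>_def over_def)
  have b_out: "b q = 0" if "q \<notin> over Q" for q
    using that K(3) \<beta>(3)[of "fst q"] by (auto simp: b_def pullback_def \<gamma>_def over_def)
  \<comment> \<open>The first factor b: it turns the Hadamard coefficients into global smooth
    functions supported over K.\<close>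
  define G where "G i q = (if q \<in> over Q then of_real (\<beta> (fst q)) * g i (?\<psi> q) else 0)" for i q
  have G: "G i \<in> Cinf (dual A)" if i: "i < n + k" for i
  proof (rule d.CinfI)
    have oQ: "d.X_open (over Q)" by (rule over_open[OF Q])
    have "smooth_on (dual A) (over Q) (\<lambda>q. g i (?\<psi> q))"
    proof (rule d.smooth_on_chartI[OF dual_atlasI[OF U W] oQ over_sub])
      show "C_infinity_on (mdim (dual A)) (?\<psi> ` over Q) (\<lambda>y. g i (?\<psi> (?inv y)))"
        unfolding dual_simps by (rule C_infinity_on_cong[OF oV _ g[OF i]]) (auto simp: inv)
    qed
    moreover have "smooth_on (dual A) (over Q) (\<lambda>q. \<gamma> (fst q))"
      by (rule smooth_on_over[OF Q b.Cinf_smooth_on[OF \<gamma> b.X_open_subset[OF Q]]])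
    ultimately have "smooth_on (dual A) (over Q) (\<lambda>q. \<gamma> (fst q) * g i (?\<psi> q))"
      by (intro d.smooth_on_mult[OF oQ])
    then have sm: "smooth_on (dual A) (over Q) (G i)"
      by (rule d.smooth_on_cong[OF oQ, rotated]) (simp add: G_def \<gamma>_def)
    show "smooth_on (dual A) (pts (dual A)) (G i)"
    proof (rule d.smooth_on_extend_zero[OF oQ over_closed[OF K(1)] _ d.X_open_pts])
      show "over K \<subseteq> over Q" using K(3) by (auto simp: over_def)
      show "smooth_on (dual A) (over Q \<inter> pts (dual A)) (G i)" by (rule d.smooth_on_subset[OF sm]) simp
      show "G i q = 0" if "q \<in> pts (dual A)" "q \<notin> over K" for q
        using that \<beta>(3)[of "fst q"] by (auto simp: G_def over_def)
    qed
  qed (auto simp: G_def over_def)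
  \<comment> \<open>The second factor b: a cut-off base coordinate, normalized to vanish at p. It is
    a pullback, hence killed by v.\<close>
  define F where "F i = pullback A (\<lambda>z. complex_of_real (\<beta> z * (\<phi> z i - \<phi> x i)))" for i
  have F_base: "(\<lambda>z. complex_of_real (\<beta> z * (\<phi> z i - \<phi> x i))) \<in> Cinf M" for i
  proof (rule b.Cinf_linear[OF bounded_linear_of_real], rule b.CinfI)
    have "smooth_on M Q (\<lambda>z. \<beta> z * (\<phi> z i + - \<phi> x i))"
      by (intro b.smooth_on_mult[OF Q] b.smooth_on_add[OF Q] b.smooth_on_const[OF Q]
          b.Cinf_smooth_on[OF \<beta>(1) b.X_open_subset[OF Q]] b.smooth_on_chart_coordinate[OF U Q QU])
    then have sm: "smooth_on M Q (\<lambda>z. \<beta> z * (\<phi> z i - \<phi> x i))" by simp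
    show "smooth_on M (pts M) (\<lambda>z. \<beta> z * (\<phi> z i - \<phi> x i))"
    proof (rule b.smooth_on_extend_zero[OF Q K(1,3) b.X_open_pts])
      show "smooth_on M (Q \<inter> pts M) (\<lambda>z. \<beta> z * (\<phi> z i - \<phi> x i))" by (rule b.smooth_on_subset[OF sm]) simp
    qed (simp add: \<beta>(3))
  qed (simp add: b.Cinf_outside[OF \<beta>(1)])
  have F: "F i \<in> Cinf (dual A)" "v (F i) = 0" for i
    unfolding F_def using pullback_Cinf[OF F_base] pb[OF F_base] by auto
  define s where "s j z = \<beta> z *\<^sub>R e j z" for j z
  have s: "s j \<in> sections A" if "j < k" for j
    unfolding s_def using cutoff_frame_section[OF W Q K(1,3) QW \<beta>(1,3) that] .
  \<comment> \<open>The corresponding cut-off fibre coordinate. It comes from the global section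
    \<open>s j\<close>; subtracting a constant multiple of b makes it vanish at p, and b itself is a
    pullback.\<close>
  define F' where "F' j = fibre_linear A (s j) + scal (- of_real (snd p (e j x))) b" for j
  have F': "F' j \<in> Cinf (dual A)" "v (F' j) = 0" if "j < k" for j
  proof -
    note sj = fibre_linear_Cinf[OF s[OF that]]
    show "F' j \<in> Cinf (dual A)" unfolding F'_def by (intro d.Cinf_add d.Cinf_scal sj b)
    have "v (scal (- of_real (snd p (e j x))) b) = 0" unfolding scal[OF b] using pb[OF \<gamma>] by (simp add: b_def)
    then show "v (F' j) = 0"
      unfolding F'_def add[OF sj d.Cinf_scal[OF b]] by (simp add: fl[OF s[OF that]])
  qed
  have F_val: "F i q = of_real (\<beta> (fst q) * (?\<psi> q i - ?\<psi> p i))" if "q \<in> over Q" "i < n" for q i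
    using that \<psi>_base by (simp add: F_def pullback_def over_def x_def)
  have F'_val: "F' j q = of_real (\<beta> (fst q) * (?\<psi> q (n + j) - ?\<psi> p (n + j)))" if q: "q \<in> over Q" and j: "j < k" for q j
  proof -
    have q': "q \<in> dual_points A" "fst q \<in> W" "snd q \<in> dual_fibre A (fst q)"
      using q QW by (auto simp: over_def dual_points_def)
    have "e j (fst q) \<in> fibre A (fst q)" by (rule frame_in_fibre[OF W q'(2) j])
    from dual_fibre_linear[OF q'(3) this this, of "\<beta> (fst q)" 0]
    have "snd q (s j (fst q)) = \<beta> (fst q) * snd q (e j (fst q))" by (simp add: s_def)
    then show ?thesis using q'(1) b_val[OF q] \<psi>_fib[OF j]
      by (simp add: F'_def fibre_linear_def scal_def x_def algebra_simps)
  qed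
  have v0: "v 0 = 0" using scal[OF d.Cinf_zero, of 0] by (simp add: scal_simps)
  have C_sum: "(\<Sum>i\<in>I. u i) \<in> Cinf (dual A) \<and> v (\<Sum>i\<in>I. u i) = (\<Sum>i\<in>I. v (u i))"
    if "finite I" "\<And>i. i \<in> I \<Longrightarrow> u i \<in> Cinf (dual A)" for I :: "nat set" and u
    using that by (induction I rule: finite_induct) (auto simp: v0 add)
  \<comment> \<open>Over Q this is b^2 times Hadamard's formula, with one factor b given to the
    coordinates and the other to the coefficients; off \<open>over Q\<close> both sides are
    0.\<close>
  have "b * b * f = scal (f p) (b * b) + ((\<Sum>i<n. F i * G i) + (\<Sum>j<k. F' j * G (n + j)))"
  proof
    fix q
    show "(b * b * f) q = (scal (f p) (b * b) + ((\<Sum>i<n. F i * G i) + (\<Sum>j<k. F' j * G (n + j)))) q"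
    proof (cases "q \<in> over Q")
      case True
      have "(\<Sum>i<n. F i * G i) q + (\<Sum>j<k. F' j * G (n + j)) q =
          (\<Sum>i<n + k. b q * b q * (of_real (?\<psi> q i - ?\<psi> p i) * g i (?\<psi> q)))"
        unfolding sum_lessThan_split sum_fun_apply
        by (intro arg_cong2[where f = "(+)"] sum.cong refl)
           (simp_all add: F_val[OF True] F'_val[OF True] G_def True b_val[OF True])
      also have "\<dots> = b q * b q * (f q - f p)"
        using hadamard[OF True] by (simp add: sum_distrib_left[symmetric])
      finally show ?thesis by (simp add: scal_def algebra_simps)
    next
      case False
      then show ?thesis using b_out by (simp add: scal_def sum_fun_apply G_def)
    qed
  qed
  then have "v (b * b * f) = v (scal (f p) (b * b) + ((\<Sum>i<n. F i * G i) + (\<Sum>j<k. F' j * G (n + j))))"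
    by (rule arg_cong)
  also have "\<dots> = f p * v (b * b)"
  proof -
    have bb: "b * b \<in> Cinf (dual A)" using b by (intro d.Cinf_mult)
    have Fp: "F i p = 0" if "i < n" for i using F_val[OF pQ that] by simp
    have F'p: "F' j p = 0" if "j < k" for j using F'_val[OF pQ that] by simp
    have 1: "(\<Sum>i<n. F i * G i) \<in> Cinf (dual A)" "v (\<Sum>i<n. F i * G i) = 0"
      using C_sum[of "{..<n}" "\<lambda>i. F i * G i"] by (auto simp: F G leibniz Fp d.Cinf_mult)
    have 2: "(\<Sum>j<k. F' j * G (n + j)) \<in> Cinf (dual A)" "v (\<Sum>j<k. F' j * G (n + j)) = 0"
      using C_sum[of "{..<k}" "\<lambda>j. F' j * G (n + j)"] by (auto simp: F' G leibniz F'p d.Cinf_mult)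
    show ?thesis
      using 1 2 bb by (simp add: add scal d.Cinf_add d.Cinf_scal)
  qed
  \<comment> \<open>Leibniz' rule for v(b^2 f) also produces f(p) v(b^2), which matches the
    right-hand side and leaves b(p)^2 v(f) = 0.\<close>
  finally have "(b * b) p * v f = 0"
    using leibniz[OF d.Cinf_mult[OF b b] f] by simp
  moreover have "(b * b) p \<noteq> 0" using b_val[OF pQ] \<beta>(2) by (simp add: x_def)
  ultimately show ?thesis by simp
qed

text \<open>Real sections suffice although functions are complex: derivations are complex
  linear.\<close>

definition generators :: "('m \<times> ('v \<Rightarrow> real) \<Rightarrow> complex) set"
  where "generators = pullback A ` Cinf M \<union> fibre_linear A ` sections A"

lemma generators_Cinf: "g \<in> generators \<Longrightarrow> g \<in> Cinf (dual A)"
  using pullback_Cinf fibre_linear_Cinf by (auto simp: generators_def)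

theorem derivation_eq_0:
  assumes D: "derivation (dual A) D" and 0: "\<And>g. g \<in> generators \<Longrightarrow> D g = 0" and f: "f \<in> Cinf (dual A)"
  shows "D f = 0"
proof
  fix p
  show "D f p = 0 p"
  proof (cases "p \<in> dual_points A")
    case True
    have "(\<lambda>f. D f p) f = 0"
    proof (rule point_derivation_eq_0[OF True _ _ _ _ _ f])
      show "D (pullback A h) p = 0" if "h \<in> Cinf M" for h using 0[of "pullback A h"] that by (simp add: generators_def)
      show "D (fibre_linear A s) p = 0" if "s \<in> sections A" for s
        using 0[of "fibre_linear A s"] that by (simp add: generators_def)
      fix f g :: "_ \<Rightarrow> complex" and c assume f: "f \<in> Cinf (dual A)" and g: "g \<in> Cinf (dual A)"
      show "D (f + g) p = D f p + D g p" unfolding derivationD(3)[OF D f g] by simp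
      show "D (scal c f) p = c * D f p" unfolding derivationD(2)[OF D f] by (simp add: scal_def)
      show "D (f * g) p = f p * D g p + g p * D f p" unfolding derivationD(4)[OF D f g] by simp
    qed
    then show ?thesis by simp
  next
    case False
    then show ?thesis using d.Cinf_outside[OF derivationD(1)[OF D f]] by simp
  qed
qed

lemma biderivation_eq_0:
  assumes "\<And>g. g \<in> Cinf (dual A) \<Longrightarrow> derivation (dual A) (\<lambda>f. T f g)"
    and "\<And>f. f \<in> Cinf (dual A) \<Longrightarrow> derivation (dual A) (\<lambda>g. T f g)"
    and 0: "\<And>f g. f \<in> generators \<Longrightarrow> g \<in> generators \<Longrightarrow> T f g = 0"
    and f: "f \<in> Cinf (dual A)" and g: "g \<in> Cinf (dual A)"
  shows "T f g = 0"
  by (rule derivation_eq_0[OF assms(1)[OF g] _ f], rule derivation_eq_0[OF assms(2) _ g])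
     (use 0 generators_Cinf in auto)

lemma triderivation_eq_0:
  assumes "\<And>g h. g \<in> Cinf (dual A) \<Longrightarrow> h \<in> Cinf (dual A) \<Longrightarrow> derivation (dual A) (\<lambda>f. T f g h)"
    and "\<And>f h. f \<in> Cinf (dual A) \<Longrightarrow> h \<in> Cinf (dual A) \<Longrightarrow> derivation (dual A) (\<lambda>g. T f g h)"
    and "\<And>f g. f \<in> Cinf (dual A) \<Longrightarrow> g \<in> Cinf (dual A) \<Longrightarrow> derivation (dual A) (\<lambda>h. T f g h)"
    and 0: "\<And>f g h. f \<in> generators \<Longrightarrow> g \<in> generators \<Longrightarrow> h \<in> generators \<Longrightarrow> T f g h = 0"
    and f: "f \<in> Cinf (dual A)" and g: "g \<in> Cinf (dual A)" and h: "h \<in> Cinf (dual A)"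
  shows "T f g h = 0"
  by (rule derivation_eq_0[OF assms(1)[OF g h] _ f], rule biderivation_eq_0[OF assms(2,3) _ g h])
     (use 0 generators_Cinf in auto)

end

context smooth_bundle
begin

section \<open>Vertical lifts of two-forms\<close>

abbreviation "rho x b v \<equiv> representation (fibre_basis A x) v b"

lemma fibre_basis:
  assumes x: "x \<in> pts M"
  shows "independent (fibre_basis A x)" "span (fibre_basis A x) = fibre A x" "finite (fibre_basis A x)"
proof -
  obtain W e where W: "(W, e) \<in> frames A" "x \<in> W" using frame_cover[OF x] by blast
  have "\<exists>b. independent b \<and> span b = fibre A x"
    using frame_independent[OF W] frame_span[OF W] by blast
  then have "independent (fibre_basis A x) \<and> span (fibre_basis A x) = fibre A x"
    unfolding fibre_basis_def by (rule someI_ex)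
  then show 1: "independent (fibre_basis A x)" and 2: "span (fibre_basis A x) = fibre A x" by simp_all
  have "fibre_basis A x \<subseteq> span ((\<lambda>j. e j x) ` {..<k})"
    unfolding frame_span[OF W] 2[symmetric] by (rule span_superset)
  from independent_span_bound[OF _ 1 this] show "finite (fibre_basis A x)" by simp
qed

lemma basis_in_fibre: "x \<in> pts M \<Longrightarrow> b \<in> fibre_basis A x \<Longrightarrow> b \<in> fibre A x"
  using span_base fibre_basis(2) by metis

lemma rho_dual_fibre:
  assumes x: "x \<in> pts M"
  shows "rho x b \<in> dual_fibre A x"
  unfolding dual_fibre_def
proof (intro CollectI conjI ballI allI impI)
  fix v w a c assume vw: "v \<in> fibre A x" "w \<in> fibre A x"
  then have "a *\<^sub>R v \<in> span (fibre_basis A x)" "c *\<^sub>R w \<in> span (fibre_basis A x)"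
    "v \<in> span (fibre_basis A x)" "w \<in> span (fibre_basis A x)"
    using fibre_basis(2)[OF x] by (auto intro: span_scale)
  then show "rho x b (a *\<^sub>R v + c *\<^sub>R w) = a * rho x b v + c * rho x b w"
    using fibre_basis(1)[OF x] by (simp add: representation_add representation_scale)
next
  fix v assume "v \<notin> fibre A x"
  then show "rho x b v = 0" using fibre_basis(2)[OF x] by (simp add: representation_def)
qed

lemma rho_expand: "x \<in> pts M \<Longrightarrow> v \<in> fibre A x \<Longrightarrow> v = (\<Sum>b\<in>fibre_basis A x. rho x b v *\<^sub>R b)"
  using sum_representation_eq[of "fibre_basis A x" v "fibre_basis A x"] fibre_basis by simp

context
  fixes B :: "'m \<Rightarrow> 'v list \<Rightarrow> complex"
  assumes B: "B \<in> forms A 2"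
begin

lemma form2_slot:
  assumes "x \<in> pts M" "length vs = 2" "set vs \<subseteq> fibre A x" "j < 2" "v \<in> fibre A x" "w \<in> fibre A x"
  shows "B x (vs[j := a *\<^sub>R v + c *\<^sub>R w]) = a *\<^sub>R B x (vs[j := v]) + c *\<^sub>R B x (vs[j := w])"
  using B assms unfolding forms_def by blast

lemma form2_left:
  assumes "x \<in> pts M" "v \<in> fibre A x" "w \<in> fibre A x" "u \<in> fibre A x"
  shows "B x [a *\<^sub>R v + c *\<^sub>R w, u] = a *\<^sub>R B x [v, u] + c *\<^sub>R B x [w, u]"
  using form2_slot[of x "[u, u]" 0 v w a c] assms by simp

lemma form2_right:
  assumes "x \<in> pts M" "v \<in> fibre A x" "w \<in> fibre A x" "u \<in> fibre A x"
  shows "B x [u, a *\<^sub>R v + c *\<^sub>R w] = a *\<^sub>R B x [u, v] + c *\<^sub>R B x [u, w]"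
  using form2_slot[of x "[u, u]" 1 v w a c] assms by simp

lemma form2_self:
  assumes "x \<in> pts M" "v \<in> fibre A x"
  shows "B x [v, v] = 0"
proof -
  have "\<forall>x\<in>pts M. \<forall>vs. length vs = 2 \<and> set vs \<subseteq> fibre A x \<longrightarrow>
       (\<forall>i<2. \<forall>j<2. i \<noteq> j \<and> vs ! i = vs ! j \<longrightarrow> B x vs = 0)"
    using B unfolding forms_def by blast
  then have "\<forall>i<2. \<forall>j<2. i \<noteq> j \<and> [v, v] ! i = [v, v] ! j \<longrightarrow> B x [v, v] = 0"
    using assms by (auto dest!: bspec[OF _ assms(1)] spec[of _ "[v, v]"])
  from this[rule_format, of 0 1] show ?thesis by simp
qed

lemma form2_swap:
  assumes x: "x \<in> pts M" and v: "v \<in> fibre A x" and w: "w \<in> fibre A x"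
  shows "B x [w, v] = - B x [v, w]"
proof -
  have vw: "1 *\<^sub>R v + 1 *\<^sub>R w \<in> fibre A x"
    using subspace_fibre[OF x] v w by (simp add: subspace_add)
  have "B x [1 *\<^sub>R v + 1 *\<^sub>R w, 1 *\<^sub>R v + 1 *\<^sub>R w] = 0" by (rule form2_self[OF x vw])
  then have "B x [v, w] + B x [w, v] = 0"
    unfolding form2_left[OF x v w vw] form2_right[OF x v w v] form2_right[OF x v w w]
    by (simp add: form2_self[OF x v] form2_self[OF x w])
  then show ?thesis by (simp add: add_eq_0_iff2 add.commute)
qed

lemma form2_smooth:
  assumes "(W, e) \<in> frames A" "i < k" "j < k"
  shows "smooth_on M W (\<lambda>x. B x [e i x, e j x])"
proof -
  have "\<forall>(U, e)\<in>frames A. \<forall>is. length is = 2 \<and> set is \<subseteq> {..<k} \<longrightarrow>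
       smooth_on M U (\<lambda>x. B x (map (\<lambda>i. e i x) is))"
    using B unfolding forms_def by blast
  from bspec[OF this assms(1), unfolded prod.case, rule_format, of "[i, j]"] show ?thesis
    using assms(2,3) by simp
qed

lemma form2_basis:
  assumes x: "x \<in> pts M" and u: "u \<in> fibre A x" and w: "w \<in> fibre A x"
  shows "B x [u, w] = (\<Sum>b\<in>fibre_basis A x. \<Sum>c\<in>fibre_basis A x. of_real (rho x b u * rho x c w) * B x [b, c])"
proof -
  let ?S = "fibre_basis A x"
  have "B x [u, w] = B x [\<Sum>b\<in>?S. rho x b u *\<^sub>R b, w]" using rho_expand[OF x u] by simp
  also have "\<dots> = (\<Sum>b\<in>?S. rho x b u *\<^sub>R B x [b, w])"
    by (rule fibre_linear_sum[where F = "\<lambda>u. B x [u, w]", OF subspace_fibre[OF x] form2_left[OF x _ _ w] fibre_basis(3)[OF x] basis_in_fibre[OF x]])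
  also have "\<dots> = (\<Sum>b\<in>?S. rho x b u *\<^sub>R (\<Sum>c\<in>?S. rho x c w *\<^sub>R B x [b, c]))"
  proof (rule sum.cong[OF refl])
    fix b assume "b \<in> ?S"
    then have b: "b \<in> fibre A x" by (rule basis_in_fibre[OF x])
    have "B x [b, w] = B x [b, \<Sum>c\<in>?S. rho x c w *\<^sub>R c]" using rho_expand[OF x w] by simp
    also have "\<dots> = (\<Sum>c\<in>?S. rho x c w *\<^sub>R B x [b, c])"
      by (rule fibre_linear_sum[where F = "\<lambda>u. B x [b, u]", OF subspace_fibre[OF x] form2_right[OF x _ _ b] fibre_basis(3)[OF x] basis_in_fibre[OF x]])
    finally show "rho x b u *\<^sub>R B x [b, w] = rho x b u *\<^sub>R (\<Sum>c\<in>?S. rho x c w *\<^sub>R B x [b, c])" by simp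
  qed
  finally show ?thesis by (simp add: scaleR_conv_of_real sum_distrib_left mult.assoc)
qed

lemma form2_frame:
  assumes W: "(W, e) \<in> frames A" "x \<in> W" and u: "u \<in> fibre A x" and w: "w \<in> fibre A x"
  shows "B x [u, w] = (\<Sum>i<k. \<Sum>j<k. of_real (coord e i x u * coord e j x w) * B x [e i x, e j x])"
proof -
  have x: "x \<in> pts M" using W frame_subset by blast
  have "B x [u, w] = (\<Sum>i<k. coord e i x u *\<^sub>R B x [e i x, w])"
    by (rule frame_linear[where F = "\<lambda>u. B x [u, w]", OF W form2_left[OF x _ _ w] u])
  also have "\<dots> = (\<Sum>i<k. coord e i x u *\<^sub>R (\<Sum>j<k. coord e j x w *\<^sub>R B x [e i x, e j x]))"
  proof (rule sum.cong[OF refl])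
    fix i assume "i \<in> {..<k}"
    then have i: "e i x \<in> fibre A x" using frame_in_fibre[OF W] by simp
    have "B x [e i x, w] = (\<Sum>j<k. coord e j x w *\<^sub>R B x [e i x, e j x])"
      by (rule frame_linear[where F = "\<lambda>u. B x [e i x, u]", OF W form2_right[OF x _ _ i] w])
    then show "coord e i x u *\<^sub>R B x [e i x, w] = coord e i x u *\<^sub>R (\<Sum>j<k. coord e j x w *\<^sub>R B x [e i x, e j x])" by simp
  qed
  finally show ?thesis by (simp add: scaleR_conv_of_real sum_distrib_left mult.assoc)
qed

lemma form_eval_Cinf:
  assumes s: "s \<in> sections A" and t: "t \<in> sections A"
  shows "form_eval A B [s, t] \<in> Cinf M"
proof (rule b.CinfI)
  show "smooth_on M (pts M) (form_eval A B [s, t])"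
  proof (rule b.smooth_on_locally)
    fix x assume x: "x \<in> pts M"
    obtain W e where W: "(W, e) \<in> frames A" "x \<in> W" using frame_cover[OF x] by blast
    have o: "b.X_open W" by (rule frame_open[OF W(1)])
    have "smooth_on M W (\<lambda>x. of_real (coord e i x (s x) * coord e j x (t x)) * B x [e i x, e j x])"
      if "i < k" "j < k" for i j
      by (rule b.smooth_on_mult[OF o b.smooth_on_linear[OF o bounded_linear_of_real
            b.smooth_on_mult[OF o section_smooth[OF s W(1) that(1)] section_smooth[OF t W(1) that(2)]]]
            form2_smooth[OF W(1) that]])
    then have "smooth_on M W (\<lambda>x. \<Sum>i<k. \<Sum>j<k. of_real (coord e i x (s x) * coord e j x (t x)) * B x [e i x, e j x])"
      by (intro b.smooth_on_sum[OF o]) simp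
    then have "smooth_on M W (form_eval A B [s, t])"
    proof (rule b.smooth_on_cong[OF o, rotated])
      fix z assume z: "z \<in> W"
      then have zM: "z \<in> pts M" using frame_subset[OF W(1)] by blast
      show "(\<Sum>i<k. \<Sum>j<k. of_real (coord e i z (s z) * coord e j z (t z)) * B z [e i z, e j z]) = form_eval A B [s, t] z"
        using form2_frame[OF W(1) z section_in_fibre[OF s zM] section_in_fibre[OF t zM]] zM
        by (simp add: form_eval_def)
    qed
    then show "\<exists>N. b.X_open N \<and> x \<in> N \<and> N \<subseteq> pts M \<and> smooth_on M N (form_eval A B [s, t])"
      using o W(2) frame_subset[OF W(1)] by blast
  qed
qed (simp add: form_eval_def)

definition vert2 where "vert2 f g = multi_vert_lift A 2 B [f, g]"

definition vert_deriv where "vert_deriv b f x \<xi> = fibre_deriv (\<lambda>t v. \<xi> v + t * rho x b v) x f"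

lemma vert2_eq:
  fixes f g :: "_ \<Rightarrow> complex"
  assumes f: "f \<in> Cinf (dual A)" and g: "g \<in> Cinf (dual A)" and p: "(x, \<xi>) \<in> dual_points A"
  shows "vert2 f g (x, \<xi>) = (\<Sum>b\<in>fibre_basis A x. \<Sum>c\<in>fibre_basis A x.
    B x [b, c] * (vert_deriv b f x \<xi> * vert_deriv c g x \<xi>))"
proof -
  have x: "x \<in> pts M" using p by (simp add: dual_points_iff)
  have "[f, g] \<in> args (dual A) 2" using f g by (simp add: args_def)
  then have "vert2 f g (x, \<xi>) = (\<Sum>bs | length bs = 2 \<and> set bs \<subseteq> fibre_basis A x. B x bs *
      (\<Prod>i<2. vert_lift A (\<lambda>x v. representation (fibre_basis A x) v (bs ! i)) ([f, g] ! i) (x, \<xi>)))"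
    using p by (simp add: vert2_def multi_vert_lift_def)
  also have "\<dots> = (\<Sum>b\<in>fibre_basis A x. \<Sum>c\<in>fibre_basis A x. B x [b, c] *
      (\<Prod>i<2. vert_lift A (\<lambda>x v. representation (fibre_basis A x) v ([b, c] ! i)) ([f, g] ! i) (x, \<xi>)))"
    by (rule sum_lists_length_2[OF fibre_basis(3)[OF x]])
  finally show ?thesis
    using p by (simp add: numeral_2_eq_2 vert_lift_def vert_deriv_def fibre_deriv_def)
qed

lemma vert2_outside: "f \<in> Cinf (dual A) \<Longrightarrow> g \<in> Cinf (dual A) \<Longrightarrow> p \<notin> dual_points A \<Longrightarrow> vert2 f g p = 0"
  by (simp add: vert2_def multi_vert_lift_def)

lemma vert_curve: "(x, \<xi>) \<in> dual_points A \<Longrightarrow> fibre_curve x (\<lambda>t v. \<xi> v + t * rho x b v)"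
  by (rule vertical_curve) (simp_all add: rho_dual_fibre dual_points_iff)

lemma vert_deriv_chart:
  assumes c: "(U, \<phi>) \<in> atlas M" "(W, e) \<in> frames A" "x \<in> U" "x \<in> W"
    and f: "f \<in> Cinf (dual A)" and p: "(x, \<xi>) \<in> dual_points A"
  shows "vert_deriv b f x \<xi> = (\<Sum>j<k. rho x b (e j x) *\<^sub>R fibre_partial U \<phi> W e j f (x, \<xi>))"
proof -
  have "((\<lambda>t. \<xi> (e j x) + t * rho x b (e j x)) has_real_derivative rho x b (e j x)) (at 0)" for j
    by (auto intro!: derivative_eq_intros)
  from fibre_deriv_chart[where c = "\<lambda>j. rho x b (e j x)", OF c f vert_curve[OF p] this]
  show ?thesis by (simp add: vert_deriv_def)
qed

lemma sum_swap4:
  "(\<Sum>b\<in>S. \<Sum>c\<in>S. \<Sum>i\<in>I. \<Sum>j\<in>I. F b c i j) = (\<Sum>i\<in>I. \<Sum>j\<in>I. \<Sum>b\<in>S. \<Sum>c\<in>S. F b c i j)"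
  for F :: "_ \<Rightarrow> _ \<Rightarrow> _ \<Rightarrow> _ \<Rightarrow> complex"
proof -
  have "(\<Sum>b\<in>S. \<Sum>c\<in>S. \<Sum>i\<in>I. \<Sum>j\<in>I. F b c i j) = (\<Sum>b\<in>S. \<Sum>i\<in>I. \<Sum>c\<in>S. \<Sum>j\<in>I. F b c i j)"
    by (intro sum.cong refl) (rule sum.swap)
  also have "\<dots> = (\<Sum>i\<in>I. \<Sum>b\<in>S. \<Sum>c\<in>S. \<Sum>j\<in>I. F b c i j)" by (rule sum.swap)
  also have "\<dots> = (\<Sum>i\<in>I. \<Sum>b\<in>S. \<Sum>j\<in>I. \<Sum>c\<in>S. F b c i j)"
    by (intro sum.cong refl) (rule sum.swap)
  also have "\<dots> = (\<Sum>i\<in>I. \<Sum>j\<in>I. \<Sum>b\<in>S. \<Sum>c\<in>S. F b c i j)"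
    by (intro sum.cong refl) (rule sum.swap)
  finally show ?thesis .
qed

text \<open>\<open>fibre_basis\<close> is chosen pointwise and need not depend smoothly on x. Both
  fibre derivatives are expanded in a smooth local frame, and the sums over the chosen basis then
  recombine into components of B in that frame, from which smoothness can be read off.\<close>

lemma vert2_chart:
  assumes c: "(U, \<phi>) \<in> atlas M" "(W, e) \<in> frames A" "x \<in> U" "x \<in> W"
    and f: "f \<in> Cinf (dual A)" and g: "g \<in> Cinf (dual A)" and p: "(x, \<xi>) \<in> dual_points A"
  shows "vert2 f g (x, \<xi>) = (\<Sum>i<k. \<Sum>j<k. B x [e i x, e j x] *
    (fibre_partial U \<phi> W e i f (x, \<xi>) * fibre_partial U \<phi> W e j g (x, \<xi>)))"
proof -
  let ?S = "fibre_basis A x" and ?f = "\<lambda>i. fibre_partial U \<phi> W e i f (x, \<xi>)"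
    and ?g = "\<lambda>i. fibre_partial U \<phi> W e i g (x, \<xi>)"
  have x: "x \<in> pts M" using p by (simp add: dual_points_iff)
  have "vert2 f g (x, \<xi>) = (\<Sum>b\<in>?S. \<Sum>c\<in>?S. \<Sum>i<k. \<Sum>j<k.
      of_real (rho x b (e i x) * rho x c (e j x)) * B x [b, c] * (?f i * ?g j))"
    unfolding vert2_eq[OF f g p] vert_deriv_chart[OF c f p] vert_deriv_chart[OF c g p] sum_product
    unfolding sum_distrib_left
    by (simp add: scaleR_conv_of_real mult_ac)
  also have "\<dots> = (\<Sum>i<k. \<Sum>j<k. (\<Sum>b\<in>?S. \<Sum>c\<in>?S.
      of_real (rho x b (e i x) * rho x c (e j x)) * B x [b, c]) * (?f i * ?g j))"
    unfolding sum_distrib_right by (rule sum_swap4)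
  also have "\<dots> = (\<Sum>i<k. \<Sum>j<k. B x [e i x, e j x] * (?f i * ?g j))"
  proof (intro sum.cong refl)
    fix i j assume "i \<in> {..<k}" "j \<in> {..<k}"
    then have "e i x \<in> fibre A x" "e j x \<in> fibre A x" using frame_in_fibre[OF c(2,4)] by simp_all
    from form2_basis[OF x this]
    show "(\<Sum>b\<in>?S. \<Sum>c\<in>?S. of_real (rho x b (e i x) * rho x c (e j x)) * B x [b, c]) * (?f i * ?g j) =
        B x [e i x, e j x] * (?f i * ?g j)" by (rule arg_cong[OF sym])
  qed
  finally show ?thesis .
qed

lemma vert2_Cinf:
  assumes f: "f \<in> Cinf (dual A)" and g: "g \<in> Cinf (dual A)"
  shows "vert2 f g \<in> Cinf (dual A)"
proof (rule d.CinfI)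
  show "smooth_on (dual A) (pts (dual A)) (vert2 f g)"
  proof (rule d.smooth_on_locally)
    fix p assume p: "p \<in> pts (dual A)"
    then obtain U \<phi> W e where c: "(U, \<phi>) \<in> atlas M" "(W, e) \<in> frames A" and x: "fst p \<in> U" "fst p \<in> W"
      using dual_chart_at[of p] by auto
    have o: "d.X_open (over (U \<inter> W))" by (rule over_open[OF UW_open[OF c]])
    have "smooth_on (dual A) (over (U \<inter> W)) (\<lambda>p. B (fst p) [e i (fst p), e j (fst p)] *
        (fibre_partial U \<phi> W e i f p * fibre_partial U \<phi> W e j g p))" if "i < k" "j < k" for i j
    proof (rule d.smooth_on_mult[OF o _ d.smooth_on_mult[OF o smooth_on_fibre_partial[OF c f that(1)]
          smooth_on_fibre_partial[OF c g that(2)]]])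
      have "smooth_on M (U \<inter> W) (\<lambda>x. B x [e i x, e j x])"
        by (rule b.smooth_on_subset[OF form2_smooth[OF c(2) that]]) simp
      from smooth_on_over[OF UW_open[OF c] this]
      show "smooth_on (dual A) (over (U \<inter> W)) (\<lambda>p. B (fst p) [e i (fst p), e j (fst p)])" .
    qed
    then have "smooth_on (dual A) (over (U \<inter> W)) (\<lambda>p. \<Sum>i<k. \<Sum>j<k. B (fst p) [e i (fst p), e j (fst p)] *
        (fibre_partial U \<phi> W e i f p * fibre_partial U \<phi> W e j g p))"
      by (intro d.smooth_on_sum[OF o]) simp
    then have "smooth_on (dual A) (over (U \<inter> W)) (vert2 f g)"
    proof (rule d.smooth_on_cong[OF o, rotated])
      fix q assume "q \<in> over (U \<inter> W)"
      then have q: "fst q \<in> U" "fst q \<in> W" "(fst q, snd q) \<in> dual_points A" by (auto simp: over_def)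
      from vert2_chart[OF c q(1,2) f g q(3)]
      show "(\<Sum>i<k. \<Sum>j<k. B (fst q) [e i (fst q), e j (fst q)] *
        (fibre_partial U \<phi> W e i f q * fibre_partial U \<phi> W e j g q)) = vert2 f g q" by simp
    qed
    then show "\<exists>N. d.X_open N \<and> p \<in> N \<and> N \<subseteq> pts (dual A) \<and> smooth_on (dual A) N (vert2 f g)"
      using o p x by (intro exI[of _ "over (U \<inter> W)"]) (auto simp: over_def)
  qed
qed (simp add: vert2_outside[OF f g])

lemma vert2_bivector: "bivector (dual A) vert2"
  unfolding bivector_def
proof (intro conjI ballI)
  fix g :: "_ \<Rightarrow> complex" assume g: "g \<in> Cinf (dual A)"
  show "derivation (dual A) (\<lambda>f. vert2 f g)"
  proof (rule derivationI)
    fix f h :: "_ \<Rightarrow> complex" and c assume f: "f \<in> Cinf (dual A)" and h: "h \<in> Cinf (dual A)"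
    show "vert2 f g \<in> Cinf (dual A)" by (rule vert2_Cinf[OF f g])
    show "vert2 (scal c f) g = scal c (vert2 f g)"
    proof
      fix p show "vert2 (scal c f) g p = scal c (vert2 f g) p"
      proof (cases "p \<in> dual_points A")
        case True
        then obtain x \<xi> where p: "p = (x, \<xi>)" "(x, \<xi>) \<in> dual_points A" by (cases p) auto
        show ?thesis
          unfolding p(1) scal_def[of c "vert2 f g"] vert2_eq[OF f g p(2)] vert2_eq[OF d.Cinf_scal[OF f] g p(2)]
          by (simp add: vert_deriv_def fibre_deriv_scal[OF vert_curve[OF p(2)] f] sum_distrib_left mult_ac)
      qed (use vert2_outside[OF f g] vert2_outside[OF d.Cinf_scal[OF f] g] in \<open>simp add: scal_def\<close>)
    qed
    show "vert2 (f + h) g = vert2 f g + vert2 h g"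
    proof
      fix p show "vert2 (f + h) g p = (vert2 f g + vert2 h g) p"
      proof (cases "p \<in> dual_points A")
        case True
        then obtain x \<xi> where p: "p = (x, \<xi>)" "(x, \<xi>) \<in> dual_points A" by (cases p) auto
        show ?thesis
          by (simp add: p(1) vert2_eq[OF f g p(2)] vert2_eq[OF h g p(2)] vert2_eq[OF d.Cinf_add[OF f h] g p(2)]
              vert_deriv_def fibre_deriv_add[OF vert_curve[OF p(2)] f h] sum.distrib[symmetric] algebra_simps)
      qed (use vert2_outside[OF f g] vert2_outside[OF h g] vert2_outside[OF d.Cinf_add[OF f h] g] in simp)
    qed
    show "vert2 (f * h) g = f * vert2 h g + h * vert2 f g"
    proof
      fix p show "vert2 (f * h) g p = (f * vert2 h g + h * vert2 f g) p"
      proof (cases "p \<in> dual_points A")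
        case True
        then obtain x \<xi> where p: "p = (x, \<xi>)" "(x, \<xi>) \<in> dual_points A" by (cases p) auto
        show ?thesis
          by (simp add: p(1) vert2_eq[OF f g p(2)] vert2_eq[OF h g p(2)] vert2_eq[OF d.Cinf_mult[OF f h] g p(2)]
              vert_deriv_def fibre_deriv_mult[OF vert_curve[OF p(2)] f h] sum_distrib_left
              sum.distrib[symmetric] algebra_simps)
      qed (use vert2_outside[OF f g] vert2_outside[OF h g] vert2_outside[OF d.Cinf_mult[OF f h] g] in simp)
    qed
  qed
next
  fix f g :: "_ \<Rightarrow> complex" assume f: "f \<in> Cinf (dual A)" and g: "g \<in> Cinf (dual A)"
  show "vert2 g f = - vert2 f g"
  proof
    fix p show "vert2 g f p = (- vert2 f g) p"
    proof (cases "p \<in> dual_points A")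
      case True
      then obtain x \<xi> where p: "p = (x, \<xi>)" "(x, \<xi>) \<in> dual_points A" by (cases p) auto
      have x: "x \<in> pts M" using p(2) by (simp add: dual_points_iff)
      have "vert2 g f (x, \<xi>) = (\<Sum>c\<in>fibre_basis A x. \<Sum>b\<in>fibre_basis A x.
          B x [b, c] * (vert_deriv b g x \<xi> * vert_deriv c f x \<xi>))"
        unfolding vert2_eq[OF g f p(2)] by (rule sum.swap)
      also have "\<dots> = (\<Sum>c\<in>fibre_basis A x. \<Sum>b\<in>fibre_basis A x.
          - (B x [c, b] * (vert_deriv c f x \<xi> * vert_deriv b g x \<xi>)))"
      proof (intro sum.cong refl)
        fix c b assume "c \<in> fibre_basis A x" "b \<in> fibre_basis A x"
        then have "B x [b, c] = - B x [c, b]" by (intro form2_swap[OF x] basis_in_fibre[OF x])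
        then show "B x [b, c] * (vert_deriv b g x \<xi> * vert_deriv c f x \<xi>) =
            - (B x [c, b] * (vert_deriv c f x \<xi> * vert_deriv b g x \<xi>))"
          by (simp only: mult_minus_left mult.commute)
      qed
      finally show ?thesis unfolding p(1) fun_Compl_def vert2_eq[OF f g p(2)] by (simp add: sum_negf)
    qed (use vert2_outside[OF f g] vert2_outside[OF g f] in simp)
  qed
qed

text \<open>Pullbacks are constant along the vertical curves. The functions may be arbitrary: a list
  containing a function that is not smooth is no argument list, and the lift is 0 there by
  definition.\<close>

lemma vert2_pullback:
  fixes g :: "_ \<Rightarrow> complex"
  shows "vert2 (pullback A f) g = 0" "vert2 g (pullback A f) = 0"
proof -
  have "vert2 (pullback A f) g p = 0 \<and> vert2 g (pullback A f) p = 0" for p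
  proof (cases "pullback A f \<in> Cinf (dual A) \<and> g \<in> Cinf (dual A)")
    case True
    then have C: "pullback A f \<in> Cinf (dual A)" "g \<in> Cinf (dual A)" by simp_all
    show ?thesis
    proof (cases "p \<in> dual_points A")
      case True
      then obtain x \<xi> where p: "p = (x, \<xi>)" "(x, \<xi>) \<in> dual_points A" by (cases p) auto
      have "vert_deriv b (pullback A f) x \<xi> = 0" for b
        unfolding vert_deriv_def by (rule fibre_deriv_pullback[OF vert_curve[OF p(2)]])
      then show ?thesis unfolding p(1) vert2_eq[OF C p(2)] vert2_eq[OF C(2,1) p(2)] by simp
    qed (use vert2_outside[OF C] vert2_outside[OF C(2,1)] in simp)
  next
    case False
    then show ?thesis by (auto simp: vert2_def multi_vert_lift_def args_def)
  qed
  then show "vert2 (pullback A f) g = 0" "vert2 g (pullback A f) = 0" by (simp_all add: fun_eq_iff)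
qed

text \<open>The vertical derivative of a fibrewise linear function is constant along the fibre,
  namely a component of the section. This is where the lift turns back into B, so that closedness
  can enter.\<close>

lemma vert2_fibre_linear:
  assumes s: "s \<in> sections A" and t: "t \<in> sections A"
  shows "vert2 (fibre_linear A s) (fibre_linear A t) = pullback A (form_eval A B [s, t])"
proof
  note C = fibre_linear_Cinf[OF s] fibre_linear_Cinf[OF t]
  fix p show "vert2 (fibre_linear A s) (fibre_linear A t) p = pullback A (form_eval A B [s, t]) p"
  proof (cases "p \<in> dual_points A")
    case True
    then obtain x \<xi> where p: "p = (x, \<xi>)" "(x, \<xi>) \<in> dual_points A" by (cases p) auto
    have x: "x \<in> pts M" using p(2) by (simp add: dual_points_iff)
    have "vert_deriv b (fibre_linear A u) x \<xi> = of_real (rho x b (u x))" for b u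
      unfolding vert_deriv_def
      by (rule fibre_deriv_fibre_linear[OF vert_curve[OF p(2)]]) (auto intro!: derivative_eq_intros)
    then have "vert2 (fibre_linear A s) (fibre_linear A t) (x, \<xi>) = B x [s x, t x]"
      unfolding vert2_eq[OF C p(2)] form2_basis[OF x section_in_fibre[OF s x] section_in_fibre[OF t x]]
      by (simp add: mult_ac)
    then show ?thesis using p x by (simp add: pullback_def form_eval_def)
  qed (use vert2_outside[OF C] in \<open>simp add: pullback_def\<close>)
qed

end

end

section \<open>Bivector and trivector fields, slot by slot\<close>

lemma args_2_iff: "fs \<in> args X 2 \<longleftrightarrow> (\<exists>f\<in>Cinf X. \<exists>g\<in>Cinf X. fs = [f, g])"
  by (auto simp: args_def numeral_2_eq_2 length_Suc_conv)

lemma args_3_iff: "fs \<in> args X 3 \<longleftrightarrow> (\<exists>f\<in>Cinf X. \<exists>g\<in>Cinf X. \<exists>h\<in>Cinf X. fs = [f, g, h])"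
  by (auto simp: args_def numeral_3_eq_3 length_Suc_conv)

lemma multilinear_opsD:
  assumes "D \<in> multilinear_ops X a"
  shows "fs \<in> args X a \<Longrightarrow> D fs \<in> Cinf X" "fs \<notin> args X a \<Longrightarrow> D fs = 0"
    "fs \<in> args X a \<Longrightarrow> j < a \<Longrightarrow> f \<in> Cinf X \<Longrightarrow> g \<in> Cinf X \<Longrightarrow> D (fs[j := f + g]) = D (fs[j := f]) + D (fs[j := g])"
    "fs \<in> args X a \<Longrightarrow> j < a \<Longrightarrow> f \<in> Cinf X \<Longrightarrow> D (fs[j := scal c f]) = scal c (D (fs[j := f]))"
  using assms unfolding multilinear_ops_def by auto

lemma multivector_fieldsD:
  assumes "P \<in> multivector_fields X (int a)"
  shows "P \<in> multilinear_ops X a"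
    "fs \<in> args X a \<Longrightarrow> j < a \<Longrightarrow> f \<in> Cinf X \<Longrightarrow> g \<in> Cinf X \<Longrightarrow>
      P (fs[j := f * g]) = f * P (fs[j := g]) + g * P (fs[j := f])"
    "fs \<in> args X a \<Longrightarrow> i < a \<Longrightarrow> j < a \<Longrightarrow> i \<noteq> j \<Longrightarrow> fs ! i = fs ! j \<Longrightarrow> P fs = 0"
  using assms unfolding multivector_fields_def by auto

lemma scal_minus_1: "scal (- 1) f = - f" for f :: "'p \<Rightarrow> complex"
  by (simp add: scal_def fun_eq_iff)

context atlas_mfd
begin

lemma multivector_slot_derivation:
  assumes P: "P \<in> multivector_fields X (int a)" and fs: "fs \<in> args X a" and j: "j < a"
  shows "derivation X (\<lambda>f. P (fs[j := f]))"
proof (rule derivationI)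
  note M = multivector_fieldsD(1)[OF P]
  fix f g :: "'p \<Rightarrow> complex" and c assume f: "f \<in> Cinf X" and g: "g \<in> Cinf X"
  have "fs[j := f] \<in> args X a" using fs f set_update_subset_insert[of fs j f] by (auto simp: args_def)
  then show "P (fs[j := f]) \<in> Cinf X" by (rule multilinear_opsD(1)[OF M])
  show "P (fs[j := scal c f]) = scal c (P (fs[j := f]))" by (rule multilinear_opsD(4)[OF M fs j f])
  show "P (fs[j := f + g]) = P (fs[j := f]) + P (fs[j := g])" by (rule multilinear_opsD(3)[OF M fs j f g])
  show "P (fs[j := f * g]) = f * P (fs[j := g]) + g * P (fs[j := f])" by (rule multivector_fieldsD(2)[OF P fs j f g])
qed

text \<open>Polarization: P(f + g, f + g) = 0 expands to P(f,g) + P(g,f) = 0.\<close>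

lemma alternating_imp_antisymmetric:
  assumes D1: "\<And>g. g \<in> Cinf X \<Longrightarrow> derivation X (\<lambda>f. P f g)" and D2: "\<And>f. f \<in> Cinf X \<Longrightarrow> derivation X (P f)"
    and alt: "\<And>f. f \<in> Cinf X \<Longrightarrow> P f f = 0" and f: "f \<in> Cinf X" and g: "g \<in> Cinf X"
  shows "P g f = - P f g"
proof -
  have "P (f + g) (f + g) = P f (f + g) + P g (f + g)"
    by (rule derivationD(3)[OF D1[OF Cinf_add[OF f g]] f g])
  also have "\<dots> = (P f f + P f g) + (P g f + P g g)"
    unfolding derivationD(3)[OF D2[OF f] f g] derivationD(3)[OF D2[OF g] f g] by (rule refl)
  finally have "P f g + P g f = 0"
    unfolding alt[OF f] alt[OF g] alt[OF Cinf_add[OF f g]] by simp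
  then show ?thesis by (simp add: add_eq_0_iff)
qed

lemma multivector2_bivector:
  assumes P: "P \<in> multivector_fields X 2"
  shows "bivector X (\<lambda>f g. P [f, g])"
proof -
  have P': "P \<in> multivector_fields X (int 2)" using P by simp
  have d1: "derivation X (\<lambda>f. P [f, g])" if "g \<in> Cinf X" for g
    using multivector_slot_derivation[OF P', of "[g, g]" 0] that by (simp add: args_def)
  have d2: "derivation X (\<lambda>g. P [f, g])" if "f \<in> Cinf X" for f
    using multivector_slot_derivation[OF P', of "[f, f]" 1] that by (simp add: args_def)
  have "P [g, f] = - P [f, g]" if "f \<in> Cinf X" "g \<in> Cinf X" for f g
  proof (rule alternating_imp_antisymmetric[where P = "\<lambda>f g. P [f, g]", OF d1 d2 _ that])
    show "P [h, h] = 0" if "h \<in> Cinf X" for h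
      using multivector_fieldsD(3)[OF P', of "[h, h]" 0 1] that by (simp add: args_def)
  qed
  then show ?thesis using d1 by (simp only: bivector_def) blast
qed

text \<open>The two adjacent transpositions given here generate all permutations of the
  arguments.\<close>

lemma multivector3:
  assumes T: "T \<in> multivector_fields X 3" and g: "g \<in> Cinf X" and h: "h \<in> Cinf X"
  shows "derivation X (\<lambda>f. T [f, g, h])" "derivation X (\<lambda>f. T [g, f, h])" "derivation X (\<lambda>f. T [g, h, f])"
    "f \<in> Cinf X \<Longrightarrow> T [g, f, h] = - T [f, g, h]" "f \<in> Cinf X \<Longrightarrow> T [f, h, g] = - T [f, g, h]"
proof -
  have T': "T \<in> multivector_fields X (int 3)" using T by simp
  have d: "derivation X (\<lambda>f. T [f, g, h])" "derivation X (\<lambda>f. T [g, f, h])" "derivation X (\<lambda>f. T [g, h, f])"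
    if "g \<in> Cinf X" "h \<in> Cinf X" for g h
    using multivector_slot_derivation[OF T', of "[g, g, h]" 0] multivector_slot_derivation[OF T', of "[g, g, h]" 1]
      multivector_slot_derivation[OF T', of "[g, h, h]" 2] that
    by (simp_all add: args_def numeral_2_eq_2)
  show "derivation X (\<lambda>f. T [f, g, h])" "derivation X (\<lambda>f. T [g, f, h])" "derivation X (\<lambda>f. T [g, h, f])"
    by (rule d[OF g h])+
  show "T [g, f, h] = - T [f, g, h]" if f: "f \<in> Cinf X"
  proof (rule alternating_imp_antisymmetric[where P = "\<lambda>f g. T [f, g, h]", OF d(1)[OF _ h] d(2)[OF _ h] _ f g])
    show "T [u, u, h] = 0" if "u \<in> Cinf X" for u
      using multivector_fieldsD(3)[OF T', of "[u, u, h]" 0 1] that h by (simp add: args_def)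
  qed
  show "T [f, h, g] = - T [f, g, h]" if f: "f \<in> Cinf X"
  proof (rule alternating_imp_antisymmetric[where P = "\<lambda>g h. T [f, g, h]", OF d(2)[OF f] d(3)[OF f] _ g h])
    show "T [f, u, u] = 0" if "u \<in> Cinf X" for u
      using multivector_fieldsD(3)[OF T', of "[f, u, u]" 1 2] that f by (simp add: args_def)
  qed
qed

end

context smooth_bundle
begin

section \<open>Homogeneity of multivector fields\<close>

lemma euler_derivation: "derivation (dual A) (euler A)"
  by (rule derivationI) (simp_all add: euler_Cinf euler_scal euler_add euler_mult)

lemma euler_pullback: "euler A (pullback A f) = 0" for f :: "'m \<Rightarrow> complex"
proof (cases "pullback A f \<in> Cinf (dual A)")
  case True
  show ?thesis
  proof
    fix p
    from euler_eq[OF True] fibre_deriv_pullback[OF euler_curve]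
    show "euler A (pullback A f) p = 0 p"
      by (cases p; cases "p \<in> dual_points A") (simp_all add: euler_outside)
  qed
qed (simp add: euler_def zero_fun_def)

lemma generators_cases:
  assumes "g \<in> generators"
  obtains (pullback) f where "f \<in> Cinf M" "g = pullback A f" | (linear) s where "s \<in> sections A" "g = fibre_linear A s"
  using assms by (auto simp: generators_def)

lemma euler_generator:
  assumes "g \<in> generators"
  obtains a :: nat where "a \<le> 1" "euler A g = scal (of_nat a) g"
  using assms
proof (cases rule: generators_cases)
  case (pullback f)
  then show ?thesis using that[of 0] euler_pullback by (simp add: scal_simps)
next
  case (linear s)
  then show ?thesis using that[of 1] euler_fibre_linear by (simp add: scal_simps)
qed

text \<open>In each slot the homogeneity defect is built from a commutator with the Euler field,
  hence a derivation. So it is determined by generators, where all degrees are 0 or 1.\<close>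

lemma homogeneous_bivector:
  assumes P: "bivector (dual A) P"
    and gen: "\<And>f g. f \<in> generators \<Longrightarrow> g \<in> generators \<Longrightarrow>
      euler A (P f g) - P (euler A f) g - P f (euler A g) = scal c (P f g)"
    and f: "f \<in> Cinf (dual A)" and g: "g \<in> Cinf (dual A)"
  shows "euler A (P f g) - P (euler A f) g - P f (euler A g) = scal c (P f g)"
proof -
  note E = euler_derivation
  let ?Q = "\<lambda>f g. euler A (P f g) - P (euler A f) g - P f (euler A g) - scal c (P f g)"
  have "?Q f g = 0"
  proof (rule biderivation_eq_0[of ?Q, OF _ _ _ f g])
    fix g :: "_ \<Rightarrow> complex" assume g: "g \<in> Cinf (dual A)"
    show "derivation (dual A) (\<lambda>f. ?Q f g)"
      by (intro d.derivation_diff d.derivation_scal d.derivation_commutator[OF E] d.bivectorD(1)[OF P] g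
          derivationD(1)[OF E])
    \<comment> \<open>Reordering the subtracted terms exhibits the commutator with the Euler field
      in the second slot.\<close>
    have eq: "(\<lambda>f. ?Q g f) = (\<lambda>f. euler A (P g f) - P g (euler A f) - P (euler A g) f - scal c (P g f))"
      by (simp add: algebra_simps)
    show "derivation (dual A) (\<lambda>f. ?Q g f)"
      unfolding eq by (intro d.derivation_diff d.derivation_scal d.derivation_commutator[OF E] d.bivectorD(2)[OF P] g
          derivationD(1)[OF E])
  qed (simp add: gen)
  then show ?thesis by simp
qed

lemma negative_trivector_eq_0:
  assumes T: "T \<in> multivector_fields (dual A) 3" and r: "r \<ge> 4"
    and hom: "\<And>f g h. f \<in> Cinf (dual A) \<Longrightarrow> g \<in> Cinf (dual A) \<Longrightarrow> h \<in> Cinf (dual A) \<Longrightarrow>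
      euler A (T [f, g, h]) - T [euler A f, g, h] - T [f, euler A g, h] - T [f, g, euler A h] =
      scal (- of_nat r) (T [f, g, h])"
    and f: "f \<in> Cinf (dual A)" and g: "g \<in> Cinf (dual A)" and h: "h \<in> Cinf (dual A)"
  shows "T [f, g, h] = 0"
proof (rule triderivation_eq_0[of "\<lambda>f g h. T [f, g, h]", OF _ _ _ _ f g h])
  fix f g h assume gen: "f \<in> generators" "g \<in> generators" "h \<in> generators"
  note C = gen[THEN generators_Cinf]
  obtain a b c :: nat where a: "a \<le> 1" "euler A f = scal (of_nat a) f" and b: "b \<le> 1" "euler A g = scal (of_nat b) g"
    and c: "c \<le> 1" "euler A h = scal (of_nat c) h"
    using gen by (auto elim!: euler_generator)
  have TC: "T [f, g, h] \<in> Cinf (dual A)" using derivationD(1)[OF d.multivector3(1)[OF T C(2,3)] C(1)] .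
  have "euler A (T [f, g, h]) = scal (- of_nat r) (T [f, g, h]) + scal (of_nat a) (T [f, g, h]) +
      scal (of_nat b) (T [f, g, h]) + scal (of_nat c) (T [f, g, h])"
    using hom[OF C] derivationD(2)[OF d.multivector3(1)[OF T C(2,3)] C(1)]
      derivationD(2)[OF d.multivector3(2)[OF T C(1,3)] C(2)]
      derivationD(2)[OF d.multivector3(3)[OF T C(1,2)] C(3)]
    unfolding a(2) b(2) c(2) by (simp add: algebra_simps)
  \<comment> \<open>Since a + b + c \<le> 3 < r, the truncated subtraction is exact and the degree a
    + b + c - r is at most -1; it is brought into the form - Suc m.\<close>
  also have "\<dots> = scal (- of_nat (Suc (r - a - b - c - 1))) (T [f, g, h])"
    using r a(1) b(1) c(1) by (auto simp: scal_def fun_eq_iff algebra_simps of_nat_diff)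
  finally show "T [f, g, h] = 0" by (rule negative_homogeneous_eq_0[OF TC])
qed (rule d.multivector3[OF T]; assumption)+

text \<open>Only two fibrewise linear arguments matter: each has degree 1, while the value is a
  pullback and has degree 0.\<close>

lemma vert2_homogeneous:
  assumes B: "B \<in> forms A 2" and f: "f \<in> Cinf (dual A)" and g: "g \<in> Cinf (dual A)"
  shows "euler A (vert2 B f g) - vert2 B (euler A f) g - vert2 B f (euler A g) = scal (- 2) (vert2 B f g)"
proof (rule homogeneous_bivector[OF vert2_bivector[OF B] _ f g])
  note biv = vert2_bivector[OF B]
  have z: "vert2 B 0 u = 0" "vert2 B u 0 = 0" if "u \<in> Cinf (dual A)" for u
    using d.derivation_zero[OF d.bivectorD(1)[OF biv that]] d.derivation_zero[OF d.bivectorD(2)[OF biv that]] by auto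
  fix f g assume f: "f \<in> generators" and g: "g \<in> generators"
  note C = generators_Cinf[OF f] generators_Cinf[OF g]
  have E0: "euler A (0 :: _ \<Rightarrow> complex) = 0" by (rule d.derivation_zero[OF euler_derivation])
  from f show "euler A (vert2 B f g) - vert2 B (euler A f) g - vert2 B f (euler A g) = scal (- 2) (vert2 B f g)"
  proof (cases rule: generators_cases)
    case (pullback u)
    then show ?thesis using z[OF C(2)] by (simp add: vert2_pullback[OF B] euler_pullback E0 scal_simps)
  next
    case s: (linear s)
    from g show ?thesis
    proof (cases rule: generators_cases)
      case (pullback u)
      then show ?thesis using z[OF C(1)] by (simp add: vert2_pullback[OF B] euler_pullback E0 scal_simps)
    next
      case t: (linear t)
      show ?thesis
        unfolding s(2) t(2) euler_fibre_linear[OF s(1)] euler_fibre_linear[OF t(1)]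
          vert2_fibre_linear[OF B s(1) t(1)] euler_pullback
        by (simp add: scal_def fun_eq_iff)
    qed
  qed
qed

end

section \<open>The linear Poisson bracket and its Schouten bracket with the lift of B\<close>

locale lie_algebroid_KKS =
  fixes A :: "('m, 'v::real_vector, 'z) algebroid_scheme" and P :: "('m \<times> ('v \<Rightarrow> real)) oper"
  assumes lie_algebroid: "lie_algebroid A" and KKS: "KKS_bracket A P"
begin

sublocale smooth_bundle A
  by unfold_locales (use lie_algebroid in \<open>simp add: lie_algebroid_def\<close>)

lemma KKS_multivector: "P \<in> multivector_fields (dual A) 2"
  and KKS_jacobi: "f \<in> Cinf (dual A) \<Longrightarrow> g \<in> Cinf (dual A) \<Longrightarrow> h \<in> Cinf (dual A) \<Longrightarrow>
    P [f, P [g, h]] + P [g, P [h, f]] + P [h, P [f, g]] = 0"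
  using KKS by (simp_all add: KKS_bracket_def poisson_structure_def)

lemma KKS_pullback: "f \<in> Cinf M \<Longrightarrow> g \<in> Cinf M \<Longrightarrow> P [pullback A f, pullback A g] = 0"
  and KKS_linear: "s \<in> sections A \<Longrightarrow> t \<in> sections A \<Longrightarrow>
       P [fibre_linear A s, fibre_linear A t] = - fibre_linear A (lbracket A s t)"
  and KKS_mixed: "f \<in> Cinf M \<Longrightarrow> s \<in> sections A \<Longrightarrow>
       P [pullback A f, fibre_linear A s] = pullback A (anchor_act_complex A s f)"
  using KKS by (simp_all add: KKS_bracket_def)

lemma lbracket_section: "s \<in> sections A \<Longrightarrow> t \<in> sections A \<Longrightarrow> lbracket A s t \<in> sections A"
  using lie_algebroid unfolding lie_algebroid_def by blast

definition "Pb f g = P [f, g]"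

lemma Pb_bivector: "bivector (dual A) Pb"
  unfolding Pb_def[abs_def] by (rule d.multivector2_bivector[OF KKS_multivector])

lemma Pb_zero: "u \<in> Cinf (dual A) \<Longrightarrow> Pb 0 u = 0" "u \<in> Cinf (dual A) \<Longrightarrow> Pb u 0 = 0"
  using d.derivation_zero[OF d.bivectorD(1)[OF Pb_bivector]] d.derivation_zero[OF d.bivectorD(2)[OF Pb_bivector]]
  by auto

lemma Pb_swap: "f \<in> Cinf (dual A) \<Longrightarrow> g \<in> Cinf (dual A) \<Longrightarrow> Pb g f = - Pb f g"
  using d.bivectorD(3)[OF Pb_bivector] .

text \<open>A check on generators: two linear functions give a linear one, a linear function and a
  pullback give a pullback, two pullbacks give 0. Each time the degree drops by one.\<close>

lemma Pb_homogeneous: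
  assumes f: "f \<in> Cinf (dual A)" and g: "g \<in> Cinf (dual A)"
  shows "euler A (Pb f g) - Pb (euler A f) g - Pb f (euler A g) = scal (- 1) (Pb f g)"
proof (rule homogeneous_bivector[OF Pb_bivector _ f g])
  note E = euler_derivation
  have E0: "euler A (0 :: _ \<Rightarrow> complex) = 0" by (rule d.derivation_zero[OF euler_derivation])
  have mixed: "euler A (Pb (pullback A u) (fibre_linear A s)) = 0" if "u \<in> Cinf M" "s \<in> sections A" for u s
    unfolding Pb_def KKS_mixed[OF that] by (rule euler_pullback)
  fix f g assume f: "f \<in> generators" and g: "g \<in> generators"
  note C = generators_Cinf[OF f] generators_Cinf[OF g]
  from f show "euler A (Pb f g) - Pb (euler A f) g - Pb f (euler A g) = scal (- 1) (Pb f g)"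
  proof (cases rule: generators_cases)
    case u: (pullback u)
    from g show ?thesis
    proof (cases rule: generators_cases)
      case v: (pullback v)
      have "Pb f g = 0" unfolding Pb_def u(2) v(2) by (rule KKS_pullback[OF u(1) v(1)])
      then show ?thesis using Pb_zero C by (simp add: u(2) v(2) euler_pullback E0 scal_simps)
    next
      case s: (linear s)
      show ?thesis
        using mixed[OF u(1) s(1)] Pb_zero(1)[OF C(2)] euler_fibre_linear[OF s(1)]
        by (simp add: u(2) s(2) euler_pullback scal_minus_1)
    qed
  next
    case s: (linear s)
    from g show ?thesis
    proof (cases rule: generators_cases)
      case u: (pullback u)
      have "Pb f g = - Pb g f" by (rule Pb_swap[OF C(2,1)])
      then have "euler A (Pb f g) = 0"
        using mixed[OF u(1) s(1)] d.derivation_minus[OF E d.bivector_Cinf[OF Pb_bivector C(2,1)]] by (simp add: u(2) s(2))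
      then show ?thesis
        using Pb_zero(2)[OF C(1)] euler_fibre_linear[OF s(1)]
        by (simp add: u(2) s(2) euler_pullback scal_minus_1)
    next
      case t: (linear t)
      have br: "lbracket A s t \<in> sections A" by (rule lbracket_section[OF s(1) t(1)])
      have "Pb f g = - fibre_linear A (lbracket A s t)" unfolding Pb_def s(2) t(2) by (rule KKS_linear[OF s(1) t(1)])
      moreover have "euler A (- fibre_linear A (lbracket A s t)) = - fibre_linear A (lbracket A s t)"
        using d.derivation_minus[OF E fibre_linear_Cinf[OF br]] euler_fibre_linear[OF br] by simp
      ultimately show ?thesis
        by (simp add: s(2) t(2) euler_fibre_linear[OF s(1)] euler_fibre_linear[OF t(1)] scal_minus_1)
    qed
  qed
qed

lemma lie_diff_3:
  "lie_diff A B [s, t, u] =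
    anchor_act_complex A s (form_eval A B [t, u]) - anchor_act_complex A t (form_eval A B [s, u]) +
    anchor_act_complex A u (form_eval A B [s, t]) - form_eval A B [lbracket A s t, u] +
    form_eval A B [lbracket A s u, t] - form_eval A B [lbracket A t u, s]"
  by (simp add: lie_diff_def omit_def numeral_3_eq_3 lessThan_Suc scal_def fun_eq_iff)

text \<open>On three fibrewise linear functions the expression is the pullback of d_A B evaluated on
  the sections; with a pullback among the arguments every single term vanishes.\<close>

theorem schouten_KKS_vert2:
  assumes B: "B \<in> forms A 2" and closed: "lie_closed A 2 B"
    and f: "f \<in> Cinf (dual A)" and g: "g \<in> Cinf (dual A)" and h: "h \<in> Cinf (dual A)"
  shows "schouten Pb (vert2 B) f g h = 0"
proof (rule triderivation_eq_0[of "schouten Pb (vert2 B)", OF _ _ _ _ f g h])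
  note biv = vert2_bivector[OF B]
  have Bz: "vert2 B 0 u = 0" "vert2 B u 0 = 0" if "u \<in> Cinf (dual A)" for u
    using d.derivation_zero[OF d.bivectorD(1)[OF biv that]] d.derivation_zero[OF d.bivectorD(2)[OF biv that]] by auto
  note S1 = d.schouten_derivation[OF Pb_bivector biv]
  show "derivation (dual A) (\<lambda>f. schouten Pb (vert2 B) f g h)" if "g \<in> Cinf (dual A)" "h \<in> Cinf (dual A)" for g h
    by (rule S1[OF that])
  show "derivation (dual A) (\<lambda>g. schouten Pb (vert2 B) f g h)" if "f \<in> Cinf (dual A)" "h \<in> Cinf (dual A)" for f h
    unfolding d.schouten_cyclic[of Pb "vert2 B" f] by (rule S1[OF that(2,1)])
  show "derivation (dual A) (\<lambda>h. schouten Pb (vert2 B) f g h)" if "f \<in> Cinf (dual A)" "g \<in> Cinf (dual A)" for f g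
    unfolding d.schouten_cyclic[of Pb "vert2 B" _ f g, symmetric] by (rule S1[OF that])
  have Pb_pb: "\<exists>v. Pb (pullback A u) g = pullback A v" if u: "u \<in> Cinf M" and g: "g \<in> generators" for u g
    using g
  proof (cases rule: generators_cases)
    case (pullback v)
    have "pullback A (\<lambda>_. 0) = 0" by (simp add: pullback_def fun_eq_iff)
    then show ?thesis using KKS_pullback[OF u pullback(1)] pullback(2) by (metis Pb_def)
  next
    case (linear s)
    then show ?thesis using KKS_mixed[OF u] by (auto simp: Pb_def)
  qed
  \<comment> \<open>P of a pullback and a generator is again a pullback, which the lift of B
    annihilates; the lift of B on generators gives pullbacks, which Poisson commute. Cyclic symmetry
    later moves the pullback into the first slot.\<close>
  have pb: "schouten Pb (vert2 B) (pullback A u) g h = 0"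
    if u: "u \<in> Cinf M" and g: "g \<in> generators" and h: "h \<in> generators" for u g h
  proof -
    note C = generators_Cinf[OF g] generators_Cinf[OF h] pullback_Cinf[OF u]
    have 1: "vert2 B (Pb (pullback A u) g) h = 0"
      using Pb_pb[OF u g] vert2_pullback(1)[OF B] by auto
    have "Pb h (pullback A u) = - Pb (pullback A u) h" by (rule Pb_swap[OF C(3,2)])
    moreover obtain v where v: "Pb (pullback A u) h = pullback A v" using Pb_pb[OF u h] by blast
    moreover have "pullback A v \<in> Cinf (dual A)" unfolding v[symmetric] by (rule d.bivector_Cinf[OF Pb_bivector C(3,2)])
    ultimately have 2: "vert2 B (Pb h (pullback A u)) g = 0"
      using d.derivation_minus[OF d.bivectorD(1)[OF biv C(1)]] vert2_pullback(1)[OF B] by simp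
    have 3: "Pb (vert2 B g h) (pullback A u) = 0"
      using g
    proof (cases rule: generators_cases)
      case (pullback v)
      then show ?thesis using vert2_pullback(1)[OF B] Pb_zero(1)[OF C(3)] by simp
    next
      case s: (linear s)
      from h show ?thesis
      proof (cases rule: generators_cases)
        case (pullback v)
        then show ?thesis using vert2_pullback(2)[OF B] Pb_zero(1)[OF C(3)] by simp
      next
        case t: (linear t)
        show ?thesis
          unfolding s(2) t(2) vert2_fibre_linear[OF B s(1) t(1)] Pb_def
          by (rule KKS_pullback[OF form_eval_Cinf[OF B s(1) t(1)] u])
      qed
    qed
    show ?thesis
      by (simp add: schouten_def 1 2 3 vert2_pullback[OF B] Pb_zero C)
  qed
  fix f g h assume gen: "f \<in> generators" "g \<in> generators" "h \<in> generators"
  show "schouten Pb (vert2 B) f g h = 0"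
    using gen(1)
  proof (cases rule: generators_cases)
    case (pullback u)
    then show ?thesis using pb gen by simp
  next
    case s: (linear s)
    from gen(2) show ?thesis
    proof (cases rule: generators_cases)
      case (pullback u)
      then show ?thesis using pb gen d.schouten_cyclic[of Pb "vert2 B" f g h] by simp
    next
      case t: (linear t)
      from gen(3) show ?thesis
      proof (cases rule: generators_cases)
        case (pullback u)
        then show ?thesis using pb gen d.schouten_cyclic[of Pb "vert2 B" h f g] by simp
      next
        case u: (linear u)
        note C = fibre_linear_Cinf[OF s(1)] fibre_linear_Cinf[OF t(1)] fibre_linear_Cinf[OF u(1)]
        have PB: "Pb (vert2 B (fibre_linear A a) (fibre_linear A b)) (fibre_linear A c) =
            pullback A (anchor_act_complex A c (form_eval A B [a, b]))"
          if "a \<in> sections A" "b \<in> sections A" "c \<in> sections A" for a b c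
          unfolding vert2_fibre_linear[OF B that(1,2)] Pb_def
          by (rule KKS_mixed[OF form_eval_Cinf[OF B that(1,2)] that(3)])
        have BP: "vert2 B (Pb (fibre_linear A a) (fibre_linear A b)) (fibre_linear A c) =
            - pullback A (form_eval A B [lbracket A a b, c])"
          if "a \<in> sections A" "b \<in> sections A" "c \<in> sections A" for a b c
        proof -
          have "lbracket A a b \<in> sections A" by (rule lbracket_section[OF that(1,2)])
          then show ?thesis
            unfolding Pb_def KKS_linear[OF that(1,2)]
            using d.derivation_minus[OF d.bivectorD(1)[OF biv fibre_linear_Cinf[OF that(3)]] fibre_linear_Cinf]
              vert2_fibre_linear[OF B _ that(3)] by simp
        qed
        \<comment> \<open>The cyclic sum contains the pair (u, s), whereas d_A uses the increasing
          order (s, u); the swap produces the minus sign of the middle terms of d_A.\<close>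
        have swapB: "Pb (vert2 B h f) g = - Pb (vert2 B f h) g"
          unfolding d.bivectorD(3)[OF biv generators_Cinf[OF gen(3)] generators_Cinf[OF gen(1)]]
          by (rule d.derivation_minus[OF d.bivectorD(1)[OF Pb_bivector] d.bivector_Cinf[OF biv]])
             (use gen generators_Cinf in auto)
        have swapP: "vert2 B (Pb h f) g = - vert2 B (Pb f h) g"
          unfolding d.bivectorD(3)[OF Pb_bivector generators_Cinf[OF gen(3)] generators_Cinf[OF gen(1)]]
          by (rule d.derivation_minus[OF d.bivectorD(1)[OF biv] d.bivector_Cinf[OF Pb_bivector]])
             (use gen generators_Cinf in auto)
        have "schouten Pb (vert2 B) f g h = pullback A (lie_diff A B [s, t, u])"
          unfolding schouten_def swapB swapP
          unfolding s(2) t(2) u(2) PB[OF s(1) t(1) u(1)] PB[OF t(1) u(1) s(1)] PB[OF s(1) u(1) t(1)]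
            BP[OF s(1) t(1) u(1)] BP[OF t(1) u(1) s(1)] BP[OF s(1) u(1) t(1)] lie_diff_3
          by (simp add: pullback_def fun_eq_iff)
        moreover have "lie_diff A B [s, t, u] = 0" using closed s(1) t(1) u(1) by (simp add: lie_closed_def)
        ultimately show ?thesis by (simp add: pullback_def fun_eq_iff)
      qed
    qed
  qed
qed

end

section \<open>Hochschild cochains of low degree\<close>

lemmas pointwise = plus_fun_apply zero_fun_apply times_fun_apply minus_apply uminus_apply

text \<open>As rewrite rules these would turn a sum \<open>f + g\<close> of functions into an abstraction, to which no
  linearity rule applies.\<close>

declare pointwise [simp del]

definition linear_op :: "'p mfd \<Rightarrow> (('p \<Rightarrow> complex) \<Rightarrow> 'p \<Rightarrow> complex) \<Rightarrow> bool"
  where "linear_op X L \<longleftrightarrow> (\<forall>f\<in>Cinf X. L f \<in> Cinf X \<and> (\<forall>c. L (scal c f) = scal c (L f)) \<and>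
    (\<forall>g\<in>Cinf X. L (f + g) = L f + L g))"

lemma linear_opI:
  assumes "\<And>f. f \<in> Cinf X \<Longrightarrow> L f \<in> Cinf X" "\<And>f c. f \<in> Cinf X \<Longrightarrow> L (scal c f) = scal c (L f)"
    "\<And>f g. f \<in> Cinf X \<Longrightarrow> g \<in> Cinf X \<Longrightarrow> L (f + g) = L f + L g"
  shows "linear_op X L"
  using assms by (simp add: linear_op_def)

lemma linear_opD:
  assumes "linear_op X L" "f \<in> Cinf X"
  shows "L f \<in> Cinf X" "L (scal c f) = scal c (L f)" "g \<in> Cinf X \<Longrightarrow> L (f + g) = L f + L g"
  using assms by (simp_all add: linear_op_def)

lemma derivation_linear_op: "derivation X D \<Longrightarrow> linear_op X D"
  by (rule linear_opI) (simp_all add: derivationD)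

definition mult_comm :: "('p \<Rightarrow> complex) \<Rightarrow> (('p \<Rightarrow> complex) \<Rightarrow> 'p \<Rightarrow> complex) \<Rightarrow> ('p \<Rightarrow> complex) \<Rightarrow> 'p \<Rightarrow> complex"
  where "mult_comm g L = (\<lambda>f. g * L f - L (g * f))"

text \<open>\<open>dorder X n L\<close> says that \<open>L\<close> is a differential operator of order less than \<open>n\<close>.\<close>

primrec dorder :: "'p mfd \<Rightarrow> nat \<Rightarrow> (('p \<Rightarrow> complex) \<Rightarrow> 'p \<Rightarrow> complex) \<Rightarrow> bool" where
  "dorder X 0 L \<longleftrightarrow> (\<forall>f\<in>Cinf X. L f = 0)"
| "dorder X (Suc n) L \<longleftrightarrow> (\<forall>g\<in>Cinf X. dorder X n (mult_comm g L))"

text \<open>In \<open>foldr\<close> the last list element acts innermost, and the recursion of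
  \<open>dorder\<close> peels off just this commutator first. Hence argument lists are decomposed at
  their end.\<close>

lemma dorder_iff_foldr:
  "dorder X n L \<longleftrightarrow> (\<forall>gs\<in>args X n. \<forall>f\<in>Cinf X. foldr mult_comm gs L f = 0)"
proof (induction n arbitrary: L)
  case 0
  have "args X 0 = {[]}" by (auto simp: args_def)
  then show ?case by simp
next
  case (Suc n)
  have "args X (Suc n) = (\<lambda>(gs, g). gs @ [g]) ` (args X n \<times> Cinf X)"
  proof (intro set_eqI iffI)
    fix hs assume hs: "hs \<in> args X (Suc n)"
    then have "hs \<noteq> []" by (auto simp: args_def)
    then have "hs = butlast hs @ [last hs]" "last hs \<in> set hs" by simp_all
    moreover have "set (butlast hs) \<subseteq> set hs" by (auto dest: in_set_butlastD)
    ultimately show "hs \<in> (\<lambda>(gs, g). gs @ [g]) ` (args X n \<times> Cinf X)"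
      using hs by (intro image_eqI[of _ _ "(butlast hs, last hs)"]) (auto simp: args_def)
  qed (auto simp: args_def)
  then show ?case by (auto simp: Suc.IH)
qed

lemma foldr_mult_commutator:
  assumes "j < length fs"
  shows "foldr (mult_commutator j) gs D (fs[j := f]) = foldr mult_comm gs (\<lambda>f. D (fs[j := f])) f"
  by (induction gs arbitrary: f) (simp_all add: assms mult_commutator_def mult_comm_def)

text \<open>A commutator in slot j leaves the other arguments alone, so the condition concerns the
  operators of one argument obtained by freezing the rest.\<close>

lemma polydiff_slot_iff:
  assumes j: "j < a"
  shows "(\<forall>gs\<in>args X m. \<forall>fs\<in>args X a. foldr (mult_commutator j) gs D fs = 0) \<longleftrightarrow>
    (\<forall>fs\<in>args X a. dorder X m (\<lambda>f. D (fs[j := f])))"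
proof -
  have *: "fs[j := f] \<in> args X a" if "fs \<in> args X a" "f \<in> Cinf X" for fs f
    using that set_update_subset_insert[of fs j f] by (auto simp: args_def)
  have "foldr (mult_commutator j) gs D fs = foldr mult_comm gs (\<lambda>f. D (fs[j := f])) (fs ! j)"
    if "fs \<in> args X a" for fs gs
    using foldr_mult_commutator[of j fs gs D "fs ! j"] that j by (simp add: args_def)
  moreover have "foldr mult_comm gs (\<lambda>f. D (fs[j := f])) f = foldr (mult_commutator j) gs D (fs[j := f])"
    if "fs \<in> args X a" for fs gs f
    using foldr_mult_commutator[of j fs gs D f] that j by (simp add: args_def)
  moreover have "fs ! j \<in> Cinf X" if "fs \<in> args X a" for fs using that j by (auto simp: args_def)
  ultimately show ?thesis unfolding dorder_iff_foldr using * by metis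
qed

context atlas_mfd
begin

lemma dorder_cong: "(\<And>f. f \<in> Cinf X \<Longrightarrow> L f = L' f) \<Longrightarrow> dorder X n L \<Longrightarrow> dorder X n L'"
proof (induction n arbitrary: L L')
  case (Suc n)
  have "dorder X n (mult_comm g L')" if g: "g \<in> Cinf X" for g
  proof (rule Suc.IH)
    show "dorder X n (mult_comm g L)" using Suc.prems(2) g by simp
    show "mult_comm g L f = mult_comm g L' f" if "f \<in> Cinf X" for f
      using Suc.prems(1)[OF that] Suc.prems(1)[OF Cinf_mult[OF g that]] by (simp add: mult_comm_def)
  qed
  then show ?case by simp
qed simp

lemma dorder_add: "dorder X n L \<Longrightarrow> dorder X n L' \<Longrightarrow> dorder X n (\<lambda>f. L f + L' f)"
proof (induction n arbitrary: L L')
  case (Suc n)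
  have "mult_comm g (\<lambda>f. L f + L' f) = (\<lambda>f. mult_comm g L f + mult_comm g L' f)" for g
    by (simp add: mult_comm_def fun_eq_iff pointwise algebra_simps)
  then show ?case using Suc by simp
qed simp

lemma dorder_scal: "dorder X n L \<Longrightarrow> dorder X n (\<lambda>f. scal c (L f))"
proof (induction n arbitrary: L)
  case (Suc n)
  have "mult_comm g (\<lambda>f. scal c (L f)) = (\<lambda>f. scal c (mult_comm g L f))" for g
    by (simp add: mult_comm_def fun_eq_iff pointwise scal_def algebra_simps)
  then show ?case using Suc by simp
qed (simp add: scal_simps)

lemma dorder_Suc: "dorder X n L \<Longrightarrow> dorder X (Suc n) L"
proof (induction n arbitrary: L)
  case 0
  then show ?case by (simp add: mult_comm_def Cinf_mult)
next
  case (Suc n)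
  have "dorder X (Suc n) (mult_comm g L)" if "g \<in> Cinf X" for g
    using Suc.prems that by (intro Suc.IH) simp
  then show ?case by simp
qed

lemma dorder_mono: "n \<le> m \<Longrightarrow> dorder X n L \<Longrightarrow> dorder X m L"
  by (induction m rule: dec_induct) (use dorder_Suc in auto)

lemma linear_op_zero: "linear_op X L \<Longrightarrow> L 0 = 0"
  using linear_opD(2)[of X L 0 0] by (simp add: scal_simps)

lemma linear_op_uminus: "linear_op X L \<Longrightarrow> f \<in> Cinf X \<Longrightarrow> L (- f) = - L f"
  using linear_opD(2)[of X L f "- 1"] by (simp add: scal_minus_1)

lemma linear_op_diff: "linear_op X L \<Longrightarrow> f \<in> Cinf X \<Longrightarrow> g \<in> Cinf X \<Longrightarrow> L (f - g) = L f - L g"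
  using linear_opD(3)[of X L f "- g"] linear_op_uminus[of L g] by (simp add: Cinf_uminus)

lemma Cinf_sum: "(\<And>i. i \<in> I \<Longrightarrow> u i \<in> Cinf X) \<Longrightarrow> (\<Sum>i\<in>I. u i) \<in> Cinf X"
  by (induction I rule: infinite_finite_induct) (simp_all add: Cinf_add)

lemma linear_op_sum:
  "linear_op X L \<Longrightarrow> (\<And>i. i \<in> I \<Longrightarrow> u i \<in> Cinf X) \<Longrightarrow> L (\<Sum>i\<in>I. u i) = (\<Sum>i\<in>I. L (u i))"
  by (induction I rule: infinite_finite_induct) (simp_all add: linear_op_zero linear_opD(3) Cinf_sum)

lemma linear_op_mult_comm:
  assumes L: "linear_op X L" and g: "g \<in> Cinf X"
  shows "linear_op X (mult_comm g L)"
proof (rule linear_opI)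
  fix f h :: "'p \<Rightarrow> complex" and c assume f: "f \<in> Cinf X" and h: "h \<in> Cinf X"
  have gf: "g * f \<in> Cinf X" and gh: "g * h \<in> Cinf X" using f g h by (simp_all add: Cinf_mult)
  show "mult_comm g L f \<in> Cinf X"
    unfolding mult_comm_def by (intro Cinf_diff Cinf_mult g linear_opD(1)[OF L] f gf)
  have eq: "g * scal c f = scal c (g * f)" by (simp only: scal_simps)
  show "mult_comm g L (scal c f) = scal c (mult_comm g L f)"
    unfolding mult_comm_def eq linear_opD(2)[OF L f] linear_opD(2)[OF L gf] scal_simps(2)
    by (simp only: scal_simps(4)[of c g "L f"])
  show "mult_comm g L (f + h) = mult_comm g L f + mult_comm g L h"
    unfolding mult_comm_def distrib_left linear_opD(3)[OF L f h] linear_opD(3)[OF L gf gh] by simp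
qed

lemma linear_op_compose: "linear_op X L \<Longrightarrow> linear_op X L' \<Longrightarrow> linear_op X (\<lambda>f. L (L' f))"
  by (rule linear_opI) (simp_all add: linear_opD)

text \<open>Taking the commutator with a multiplication is a derivation for composition, [g, L L'] =
  [g, L] L' + L [g, L']; each summand lowers one of the two orders. Hence a double
  induction.\<close>

lemma dorder_compose:
  assumes "linear_op X L" "linear_op X L'" "dorder X n L" "dorder X m L'"
  shows "dorder X (n + m) (\<lambda>f. L (L' f))"
  using assms
proof (induction n arbitrary: L L' m)
  case 0
  then have "dorder X 0 (\<lambda>f. L (L' f))" by (simp add: linear_opD(1))
  then show ?case by (rule dorder_mono[rotated]) simp
next
  case (Suc n)
  note outer = Suc.IH
  from Suc.prems show ?case
  proof (induction m arbitrary: L')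
    case 0
    then have "dorder X 0 (\<lambda>f. L (L' f))" by (simp add: linear_op_zero)
    then show ?case by (rule dorder_mono[rotated]) simp
  next
    case (Suc m)
    have "dorder X (Suc n + m) (mult_comm g (\<lambda>f. L (L' f)))" if g: "g \<in> Cinf X" for g
    proof (rule dorder_cong)
      have "dorder X (n + Suc m) (\<lambda>f. mult_comm g L (L' f))"
        by (rule outer) (use Suc.prems g linear_op_mult_comm in auto)
      moreover have "dorder X (Suc n + m) (\<lambda>f. L (mult_comm g L' f))"
        by (rule Suc.IH) (use Suc.prems g linear_op_mult_comm in auto)
      ultimately show "dorder X (Suc n + m) (\<lambda>f. mult_comm g L (L' f) + L (mult_comm g L' f))"
        by (intro dorder_add) simp_all
      fix f :: "'p \<Rightarrow> complex" assume f: "f \<in> Cinf X"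
      have "L' f \<in> Cinf X" "L' (g * f) \<in> Cinf X"
        using linear_opD(1)[OF Suc.prems(2)] f g by (simp_all add: Cinf_mult)
      then have "L (g * L' f - L' (g * f)) = L (g * L' f) - L (L' (g * f))"
        using linear_op_diff[OF Suc.prems(1)] g by (simp add: Cinf_mult)
      then show "mult_comm g L (L' f) + L (mult_comm g L' f) = mult_comm g (\<lambda>f. L (L' f)) f"
        by (simp add: mult_comm_def)
    qed
    then show ?case by simp
  qed
qed

text \<open>The commutator is g D f - D(g f) = - f D g, a multiplication operator, and these commute
  with each other.\<close>

lemma dorder_derivation: "derivation X D \<Longrightarrow> dorder X 2 D"
  unfolding numeral_2_eq_2 dorder.simps
  by (auto simp: mult_comm_def derivationD Cinf_mult algebra_simps)

text \<open>The function u, 1 on the manifold and 0 outside, is idempotent and a unit for smooth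
  functions, so Leibniz' rule gives D u = 2 D u.\<close>

lemma derivation_const:
  assumes D: "derivation X D"
  shows "D (const_fun X c) = 0"
proof -
  define u where "u = const_fun X (1::complex)"
  have 1: "u \<in> Cinf X" "u * u = u"
    unfolding u_def by (rule Cinf_const) (simp add: const_fun_def fun_eq_iff pointwise)
  have "u * D u = D u"
    using Cinf_outside[OF derivationD(1)[OF D 1(1)]] by (auto simp: u_def const_fun_def fun_eq_iff pointwise)
  then have "D u = D u + D u" using derivationD(4)[OF D 1(1,1)] 1(2) by simp
  then have "D u = 0" by simp
  moreover have "const_fun X c = scal c u" by (auto simp: u_def const_fun_def scal_def fun_eq_iff pointwise)
  ultimately show ?thesis using derivationD(2)[OF D 1(1)] by (simp add: scal_simps)
qed

text \<open>\<open>HC X 1\<close> in a form without list updates (see \<open>HC1_iff\<close>), which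
  treats each slot as a linear operator of one argument; compositions of cochains are then handled
  by lemmas about such operators.\<close>

definition cochain1 :: "'p oper \<Rightarrow> bool"
  where "cochain1 D \<longleftrightarrow> (\<forall>fs. fs \<notin> args X 2 \<longrightarrow> D fs = 0) \<and>
    (\<forall>h\<in>Cinf X. linear_op X (\<lambda>f. D [f, h]) \<and> linear_op X (\<lambda>f. D [h, f]) \<and>
      (\<forall>c. D [const_fun X c, h] = 0 \<and> D [h, const_fun X c] = 0)) \<and>
    (\<exists>N. \<forall>h\<in>Cinf X. dorder X N (\<lambda>f. D [f, h]) \<and> dorder X N (\<lambda>f. D [h, f]))"

definition cochain2 :: "'p oper \<Rightarrow> bool"
  where "cochain2 R \<longleftrightarrow> (\<forall>fs. fs \<notin> args X 3 \<longrightarrow> R fs = 0) \<and>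
    (\<forall>h\<in>Cinf X. \<forall>k\<in>Cinf X.
      linear_op X (\<lambda>f. R [f, h, k]) \<and> linear_op X (\<lambda>f. R [h, f, k]) \<and> linear_op X (\<lambda>f. R [h, k, f]) \<and>
      (\<forall>c. R [const_fun X c, h, k] = 0 \<and> R [h, const_fun X c, k] = 0 \<and> R [h, k, const_fun X c] = 0)) \<and>
    (\<exists>N. \<forall>h\<in>Cinf X. \<forall>k\<in>Cinf X.
      dorder X N (\<lambda>f. R [f, h, k]) \<and> dorder X N (\<lambda>f. R [h, f, k]) \<and> dorder X N (\<lambda>f. R [h, k, f]))"

lemma all_less_2: "(\<forall>j<2. Q j) \<longleftrightarrow> Q 0 \<and> Q (1::nat)"
  by (auto simp: numeral_2_eq_2 less_Suc_eq)

lemma all_less_3: "(\<forall>j<3. Q j) \<longleftrightarrow> Q 0 \<and> Q 1 \<and> Q (2::nat)"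
  by (auto simp: numeral_3_eq_3 numeral_2_eq_2 less_Suc_eq)

lemma ball_args_2: "(\<forall>fs\<in>args X 2. Q fs) \<longleftrightarrow> (\<forall>f\<in>Cinf X. \<forall>g\<in>Cinf X. Q [f, g])"
  by (auto simp: args_2_iff)

lemma ball_args_3: "(\<forall>fs\<in>args X 3. Q fs) \<longleftrightarrow> (\<forall>f\<in>Cinf X. \<forall>g\<in>Cinf X. \<forall>h\<in>Cinf X. Q [f, g, h])"
  by (auto simp: args_3_iff)

lemma multilinear_ops_iff:
  "D \<in> multilinear_ops X a \<longleftrightarrow> (\<forall>fs\<in>args X a. D fs \<in> Cinf X) \<and> (\<forall>fs. fs \<notin> args X a \<longrightarrow> D fs = 0) \<and>
    (\<forall>j<a. \<forall>fs\<in>args X a. \<forall>f\<in>Cinf X. \<forall>g\<in>Cinf X. \<forall>c.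
       D (fs[j := f + g]) = D (fs[j := f]) + D (fs[j := g]) \<and>
       D (fs[j := scal c f]) = scal c (D (fs[j := f])))"
  unfolding multilinear_ops_def by blast

lemma polydiff_ops_iff:
  "D \<in> polydiff_ops X a \<longleftrightarrow> D \<in> multilinear_ops X a \<and>
    (\<exists>N. \<forall>j<a. \<forall>fs\<in>args X a. dorder X (Suc N) (\<lambda>f. D (fs[j := f])))"
proof -
  have "(\<forall>j<a. \<forall>gs\<in>args X (N + 1). \<forall>fs\<in>args X a. foldr (mult_commutator j) gs D fs = 0) \<longleftrightarrow>
      (\<forall>j<a. \<forall>fs\<in>args X a. dorder X (Suc N) (\<lambda>f. D (fs[j := f])))" for N
    using polydiff_slot_iff[of _ a X "Suc N" D] by simp
  then show ?thesis unfolding polydiff_ops_def by simp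
qed

text \<open>In fs[j := f] the old entry at j is irrelevant but still quantified over; nonemptiness
  removes this quantifier.\<close>

lemma Cinf_nonempty: "\<exists>f :: 'p \<Rightarrow> complex. f \<in> Cinf X"
  by (rule exI[of _ 0]) (rule Cinf_zero)

lemma multilinear2_iff:
  "D \<in> multilinear_ops X 2 \<longleftrightarrow> (\<forall>fs. fs \<notin> args X 2 \<longrightarrow> D fs = 0) \<and>
    (\<forall>h\<in>Cinf X. linear_op X (\<lambda>f. D [f, h]) \<and> linear_op X (\<lambda>f. D [h, f]))"
  (is "?L \<longleftrightarrow> ?R")
proof
  assume ?L
  then show ?R unfolding multilinear_ops_iff all_less_2 ball_args_2 linear_op_def by (simp add: Cinf_nonempty)
next
  assume ?R
  then show ?L unfolding multilinear_ops_iff all_less_2 ball_args_2 linear_op_def by (simp add: Cinf_nonempty)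
qed

lemma multilinear3_iff:
  "R \<in> multilinear_ops X 3 \<longleftrightarrow> (\<forall>fs. fs \<notin> args X 3 \<longrightarrow> R fs = 0) \<and>
    (\<forall>h\<in>Cinf X. \<forall>k\<in>Cinf X.
      linear_op X (\<lambda>f. R [f, h, k]) \<and> linear_op X (\<lambda>f. R [h, f, k]) \<and> linear_op X (\<lambda>f. R [h, k, f]))"
  (is "?L \<longleftrightarrow> ?R")
proof
  assume ?L
  then show ?R unfolding multilinear_ops_iff all_less_3 ball_args_3 linear_op_def by (simp add: numeral_2_eq_2 Cinf_nonempty)
next
  assume ?R
  then show ?L unfolding multilinear_ops_iff all_less_3 ball_args_3 linear_op_def by (simp add: numeral_2_eq_2 Cinf_nonempty)
qed

text \<open>\<open>polydiff_ops\<close> asks for the vanishing of N + 1 commutators, the cochain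
  predicates for that of N. As the bound is monotone, the shift does not matter once N is
  existentially quantified.\<close>

lemma ex_dorder_Suc:
  assumes "\<And>n m. n \<le> m \<Longrightarrow> Q n \<Longrightarrow> Q m"
  shows "(\<exists>N. Q (Suc N)) \<longleftrightarrow> (\<exists>N. Q N)"
  using assms[of _ "Suc _"] by (metis le_SucI order_refl)

lemma polydiff2_iff:
  "D \<in> polydiff_ops X 2 \<longleftrightarrow> D \<in> multilinear_ops X 2 \<and>
    (\<exists>N. \<forall>h\<in>Cinf X. dorder X N (\<lambda>f. D [f, h]) \<and> dorder X N (\<lambda>f. D [h, f]))"
proof -
  have "(\<forall>j<2. \<forall>fs\<in>args X 2. dorder X (Suc N) (\<lambda>f. D (fs[j := f]))) \<longleftrightarrow>
      (\<forall>h\<in>Cinf X. dorder X (Suc N) (\<lambda>f. D [f, h]) \<and> dorder X (Suc N) (\<lambda>f. D [h, f]))" for N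
    unfolding all_less_2 ball_args_2 by (simp del: dorder.simps add: Cinf_nonempty) blast
  then show ?thesis
    unfolding polydiff_ops_iff
    using ex_dorder_Suc[of "\<lambda>N. \<forall>h\<in>Cinf X. dorder X N (\<lambda>f. D [f, h]) \<and> dorder X N (\<lambda>f. D [h, f])"] dorder_mono
    by (simp del: dorder.simps)
qed

lemma polydiff3_iff:
  "R \<in> polydiff_ops X 3 \<longleftrightarrow> R \<in> multilinear_ops X 3 \<and>
    (\<exists>N. \<forall>h\<in>Cinf X. \<forall>k\<in>Cinf X.
      dorder X N (\<lambda>f. R [f, h, k]) \<and> dorder X N (\<lambda>f. R [h, f, k]) \<and> dorder X N (\<lambda>f. R [h, k, f]))"
proof -
  have "(\<forall>j<3. \<forall>fs\<in>args X 3. dorder X (Suc N) (\<lambda>f. R (fs[j := f]))) \<longleftrightarrow>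
      (\<forall>h\<in>Cinf X. \<forall>k\<in>Cinf X. dorder X (Suc N) (\<lambda>f. R [f, h, k]) \<and> dorder X (Suc N) (\<lambda>f. R [h, f, k]) \<and>
        dorder X (Suc N) (\<lambda>f. R [h, k, f]))" for N
    unfolding all_less_3 ball_args_3 by (simp del: dorder.simps add: numeral_2_eq_2 Cinf_nonempty) blast
  then show ?thesis
    unfolding polydiff_ops_iff
    using ex_dorder_Suc[of "\<lambda>N. \<forall>h\<in>Cinf X. \<forall>k\<in>Cinf X.
      dorder X N (\<lambda>f. R [f, h, k]) \<and> dorder X N (\<lambda>f. R [h, f, k]) \<and> dorder X N (\<lambda>f. R [h, k, f])"] dorder_mono
    by (simp del: dorder.simps)
qed

lemma const_arg_imp_zero:
  "\<forall>fs. (\<exists>f\<in>set fs. \<exists>c. f = const_fun X c) \<longrightarrow> D fs = 0 \<Longrightarrow> const_fun X c \<in> set fs \<Longrightarrow> D fs = 0"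
  by blast

lemma HC1_iff: "D \<in> HC X 1 \<longleftrightarrow> cochain1 D"
proof -
  have "(\<forall>fs. (\<exists>f\<in>set fs. \<exists>c. f = const_fun X c) \<longrightarrow> D fs = 0) \<longleftrightarrow>
      (\<forall>h\<in>Cinf X. \<forall>c. D [const_fun X c, h] = 0 \<and> D [h, const_fun X c] = 0)"
    if out: "\<forall>fs. fs \<notin> args X 2 \<longrightarrow> D fs = 0"
  proof (intro iffI ballI allI impI conjI)
    fix fs :: "('p \<Rightarrow> complex) list" assume R: "\<forall>h\<in>Cinf X. \<forall>c. D [const_fun X c, h] = 0 \<and> D [h, const_fun X c] = 0"
      and c: "\<exists>f\<in>set fs. \<exists>c. f = const_fun X c"
    show "D fs = 0"
    proof (cases "fs \<in> args X 2")
      case True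
      then obtain f g where "f \<in> Cinf X" "g \<in> Cinf X" "fs = [f, g]" unfolding args_2_iff by blast
      then show ?thesis using R c by auto
    qed (use out in simp)
  next
    fix h :: "'p \<Rightarrow> complex" and c
    assume A: "\<forall>fs. (\<exists>f\<in>set fs. \<exists>c. f = const_fun X c) \<longrightarrow> D fs = 0"
    show "D [const_fun X c, h] = 0" "D [h, const_fun X c] = 0"
      by (rule const_arg_imp_zero[OF A, of c], simp)+
  qed
  moreover have "nat (1 + 1) = 2" by simp
  ultimately show ?thesis
    unfolding HC_def cochain1_def by (auto simp: polydiff2_iff multilinear2_iff)
qed

lemma HC2_iff: "R \<in> HC X 2 \<longleftrightarrow> cochain2 R"
proof -
  have "(\<forall>fs. (\<exists>f\<in>set fs. \<exists>c. f = const_fun X c) \<longrightarrow> R fs = 0) \<longleftrightarrow>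
      (\<forall>h\<in>Cinf X. \<forall>k\<in>Cinf X. \<forall>c. R [const_fun X c, h, k] = 0 \<and> R [h, const_fun X c, k] = 0 \<and> R [h, k, const_fun X c] = 0)"
    if out: "\<forall>fs. fs \<notin> args X 3 \<longrightarrow> R fs = 0"
  proof (intro iffI ballI allI impI conjI)
    fix fs :: "('p \<Rightarrow> complex) list" assume A: "\<forall>h\<in>Cinf X. \<forall>k\<in>Cinf X. \<forall>c. R [const_fun X c, h, k] = 0 \<and> R [h, const_fun X c, k] = 0 \<and> R [h, k, const_fun X c] = 0"
      and c: "\<exists>f\<in>set fs. \<exists>c. f = const_fun X c"
    show "R fs = 0"
    proof (cases "fs \<in> args X 3")
      case True
      then obtain f g h where "f \<in> Cinf X" "g \<in> Cinf X" "h \<in> Cinf X" "fs = [f, g, h]" unfolding args_3_iff by blast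
      then show ?thesis using A c by auto
    qed (use out in simp)
  next
    fix h k :: "'p \<Rightarrow> complex" and c
    assume A: "\<forall>fs. (\<exists>f\<in>set fs. \<exists>c. f = const_fun X c) \<longrightarrow> R fs = 0"
    show "R [const_fun X c, h, k] = 0" "R [h, const_fun X c, k] = 0" "R [h, k, const_fun X c] = 0"
      by (rule const_arg_imp_zero[OF A, of c], simp)+
  qed
  moreover have "nat (2 + 1) = 3" by simp
  ultimately have "R \<in> HC X 2 \<longleftrightarrow> (\<forall>fs. fs \<notin> args X 3 \<longrightarrow> R fs = 0) \<and>
      (\<forall>h\<in>Cinf X. \<forall>k\<in>Cinf X.
        linear_op X (\<lambda>f. R [f, h, k]) \<and> linear_op X (\<lambda>f. R [h, f, k]) \<and> linear_op X (\<lambda>f. R [h, k, f])) \<and>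
      (\<exists>N. \<forall>h\<in>Cinf X. \<forall>k\<in>Cinf X.
        dorder X N (\<lambda>f. R [f, h, k]) \<and> dorder X N (\<lambda>f. R [h, f, k]) \<and> dorder X N (\<lambda>f. R [h, k, f])) \<and>
      (\<forall>h\<in>Cinf X. \<forall>k\<in>Cinf X. \<forall>c. R [const_fun X c, h, k] = 0 \<and> R [h, const_fun X c, k] = 0 \<and> R [h, k, const_fun X c] = 0)"
    unfolding HC_def by (simp add: polydiff3_iff multilinear3_iff cong: conj_cong)
  then show ?thesis unfolding cochain2_def by (simp only: ball_conj_distrib conj_ac)
qed

lemma cochain1D:
  assumes "cochain1 D"
  shows "fs \<notin> args X 2 \<Longrightarrow> D fs = 0" "h \<in> Cinf X \<Longrightarrow> linear_op X (\<lambda>f. D [f, h])"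
    "h \<in> Cinf X \<Longrightarrow> linear_op X (\<lambda>f. D [h, f])"
    "h \<in> Cinf X \<Longrightarrow> D [const_fun X c, h] = 0" "h \<in> Cinf X \<Longrightarrow> D [h, const_fun X c] = 0"
  using assms by (simp_all add: cochain1_def)

lemma cochain1_order:
  "cochain1 D \<Longrightarrow> \<exists>N. \<forall>h\<in>Cinf X. dorder X N (\<lambda>f. D [f, h]) \<and> dorder X N (\<lambda>f. D [h, f])"
  unfolding cochain1_def by (elim conjE)

lemma cochain2D:
  assumes "cochain2 R"
  shows "fs \<notin> args X 3 \<Longrightarrow> R fs = 0"
    "h \<in> Cinf X \<Longrightarrow> k \<in> Cinf X \<Longrightarrow> linear_op X (\<lambda>f. R [f, h, k])"
    "h \<in> Cinf X \<Longrightarrow> k \<in> Cinf X \<Longrightarrow> linear_op X (\<lambda>f. R [h, f, k])"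
    "h \<in> Cinf X \<Longrightarrow> k \<in> Cinf X \<Longrightarrow> linear_op X (\<lambda>f. R [h, k, f])"
  using assms by (simp_all add: cochain2_def)

lemma linear_op_add: "linear_op X L \<Longrightarrow> linear_op X L' \<Longrightarrow> linear_op X (\<lambda>f. L f + L' f)"
  by (rule linear_opI) (simp_all add: linear_opD Cinf_add scal_simps algebra_simps)

lemma linear_op_scal: "linear_op X L \<Longrightarrow> linear_op X (\<lambda>f. scal c (L f))"
  by (rule linear_opI) (simp_all add: linear_opD Cinf_scal scal_simps mult.commute)

lemma cochain1_add:
  assumes D: "cochain1 D" and E: "cochain1 E"
  shows "cochain1 (D + E)"
proof -
  obtain N where N: "\<forall>h\<in>Cinf X. dorder X N (\<lambda>f. D [f, h]) \<and> dorder X N (\<lambda>f. D [h, f])"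
    using cochain1_order[OF D] by (elim exE)
  obtain N' where N': "\<forall>h\<in>Cinf X. dorder X N' (\<lambda>f. E [f, h]) \<and> dorder X N' (\<lambda>f. E [h, f])"
    using cochain1_order[OF E] by (elim exE)
  have pl: "(D + E) fs = D fs + E fs" for fs by (rule plus_fun_apply)
  have "\<forall>h\<in>Cinf X. dorder X (max N N') (\<lambda>f. (D + E) [f, h]) \<and> dorder X (max N N') (\<lambda>f. (D + E) [h, f])"
    unfolding pl using N N' by (auto intro!: dorder_add intro: dorder_mono[of N] dorder_mono[of N'])
  then show ?thesis unfolding cochain1_def pl
    using cochain1D[OF D] cochain1D[OF E] by (auto intro!: linear_op_add)
qed

lemma cochain1_scale:
  assumes D: "cochain1 D"
  shows "cochain1 (scale_op c D)"
proof -
  have s: "scale_op c D fs = scal c (D fs)" for fs by (simp add: scale_op_def scal_def)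
  obtain N where N: "\<forall>h\<in>Cinf X. dorder X N (\<lambda>f. D [f, h]) \<and> dorder X N (\<lambda>f. D [h, f])"
    using cochain1_order[OF D] by (elim exE)
  have "\<forall>h\<in>Cinf X. dorder X N (\<lambda>f. scale_op c D [f, h]) \<and> dorder X N (\<lambda>f. scale_op c D [h, f])"
    unfolding s using N by (auto intro!: dorder_scal)
  then show ?thesis unfolding cochain1_def
    using cochain1D[OF D] unfolding s by (auto intro!: linear_op_scal simp: scal_simps)
qed

lemma cochain1_rev:
  assumes D: "cochain1 D"
  shows "cochain1 (\<lambda>fs. D (rev fs))"
proof -
  have "rev fs \<in> args X 2 \<longleftrightarrow> fs \<in> args X 2" for fs by (simp add: args_def)
  then show ?thesis using D unfolding cochain1_def by auto
qed

lemma cochain1_sym_plus: "cochain1 D \<Longrightarrow> cochain1 (sym_plus D)"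
  using cochain1_add[OF _ cochain1_rev, of D D] by (simp add: sym_plus_def plus_fun_def)

lemma bivector_cochain1:
  assumes P: "bivector X (\<lambda>f g. P [f, g])" and out: "\<And>fs. fs \<notin> args X 2 \<Longrightarrow> P fs = 0"
  shows "cochain1 P"
  unfolding cochain1_def
proof (intro conjI ballI allI impI exI[of _ 2])
  fix h :: "'p \<Rightarrow> complex" and c assume h: "h \<in> Cinf X"
  note d = bivectorD(1)[OF P h] bivectorD(2)[OF P h]
  show "linear_op X (\<lambda>f. P [f, h])" "linear_op X (\<lambda>f. P [h, f])"
    by (rule d[THEN derivation_linear_op])+
  show "P [const_fun X c, h] = 0" "P [h, const_fun X c] = 0"
    by (rule derivation_const[OF d(1)], rule derivation_const[OF d(2)])
  show "dorder X 2 (\<lambda>f. P [f, h])" "dorder X 2 (\<lambda>f. P [h, f])"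
    by (rule d[THEN dorder_derivation])+
qed (rule out)

lemma cochain2_add:
  assumes D: "cochain2 D" and E: "cochain2 E"
  shows "cochain2 (D + E)"
proof -
  obtain N where N: "\<And>h k. h \<in> Cinf X \<Longrightarrow> k \<in> Cinf X \<Longrightarrow>
      dorder X N (\<lambda>f. D [f, h, k]) \<and> dorder X N (\<lambda>f. D [h, f, k]) \<and> dorder X N (\<lambda>f. D [h, k, f])"
    using D unfolding cochain2_def by blast
  obtain N' where N': "\<And>h k. h \<in> Cinf X \<Longrightarrow> k \<in> Cinf X \<Longrightarrow>
      dorder X N' (\<lambda>f. E [f, h, k]) \<and> dorder X N' (\<lambda>f. E [h, f, k]) \<and> dorder X N' (\<lambda>f. E [h, k, f])"
    using E unfolding cochain2_def by blast
  have pl: "(D + E) fs = D fs + E fs" for fs by (rule plus_fun_apply)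
  have "\<forall>h\<in>Cinf X. \<forall>k\<in>Cinf X. dorder X (max N N') (\<lambda>f. (D + E) [f, h, k]) \<and>
      dorder X (max N N') (\<lambda>f. (D + E) [h, f, k]) \<and> dorder X (max N N') (\<lambda>f. (D + E) [h, k, f])"
    unfolding pl using N N' by (auto intro!: dorder_add intro: dorder_mono[of N] dorder_mono[of N'])
  then show ?thesis using D E unfolding cochain2_def pl by (auto intro!: linear_op_add)
qed

lemma cochain2_zero: "cochain2 0"
proof -
  have z: "(0 :: 'p oper) fs = 0" for fs by (rule zero_fun_apply)
  have "linear_op X (\<lambda>f. 0)" by (rule linear_opI) (simp_all add: scal_simps)
  moreover have "dorder X 0 (\<lambda>f. 0)" by simp
  ultimately show ?thesis unfolding cochain2_def z by blast
qed

lemma cochain2_sum: "(\<And>i. i \<in> I \<Longrightarrow> cochain2 (u i)) \<Longrightarrow> cochain2 (\<Sum>i\<in>I. u i)"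
  by (induction I rule: infinite_finite_induct) (simp_all add: cochain2_zero cochain2_add)

lemma gcomp_1_1: "gcomp 1 1 D E [f, g, h] = D [E [f, g], h] - D [f, E [g, h]]"
  by (simp add: gcomp_def numeral_2_eq_2 lessThan_Suc scal_minus_1 scal_simps power_int_def)

text \<open>In degrees 1 and 1 all signs collapse to -(D o E + E o D), so the bracket sum of order r
  is -2 times the inner part of the order-r associator.\<close>

lemma gbracket_1_1:
  "gbracket 1 1 D E [f, g, h] =
    - (D [E [f, g], h] - D [f, E [g, h]] + (E [D [f, g], h] - E [f, D [g, h]]))"
  by (simp add: gbracket_def gcomp_1_1 scale_op_def fun_eq_iff pointwise power_int_def)

lemma gbracket_1_2:
  "gbracket 1 2 D R [a, b, c, d] = D [R [a, b, c], d] + D [a, R [b, c, d]] -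
    (R [D [a, b], c, d] - R [a, D [b, c], d] + R [a, b, D [c, d]])"
  by (simp add: gbracket_def gcomp_def numeral_2_eq_2 numeral_3_eq_3 lessThan_Suc scale_op_def scal_def fun_eq_iff pointwise
      power_int_def algebra_simps)

end

section \<open>Reindexing the coefficients of iterated products\<close>

definition triples :: "nat \<Rightarrow> (nat \<times> nat \<times> nat) set"
  where "triples n = {(i, j, l). i + j + l = n}"

lemma finite_triples [simp]: "finite (triples n)"
  by (rule finite_subset[of _ "{..n} \<times> {..n} \<times> {..n}"]) (auto simp: triples_def)

lemma sum_triples_1:
  "(\<Sum>s\<le>r. \<Sum>l\<le>s. F (r - s) l (s - l)) = (\<Sum>(i, j, l)\<in>triples r. F i j l)"
proof -
  have "(\<Sum>s\<le>r. \<Sum>l\<le>s. F (r - s) l (s - l)) = (\<Sum>(s, l)\<in>(SIGMA s:{..r}. {..s}). F (r - s) l (s - l))"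
    by (rule sum.Sigma) auto
  also have "\<dots> = (\<Sum>(i, j, l)\<in>triples r. F i j l)"
    by (rule sum.reindex_bij_witness[where j = "\<lambda>(s, l). (r - s, l, s - l)" and i = "\<lambda>(i, j, l). (j + l, j)"])
       (auto simp: triples_def)
  finally show ?thesis .
qed

lemma sum_triples_2:
  "(\<Sum>s\<le>r. \<Sum>l\<le>s. F l (s - l) (r - s)) = (\<Sum>(i, j, l)\<in>triples r. F i j l)"
proof -
  have "(\<Sum>s\<le>r. \<Sum>l\<le>s. F l (s - l) (r - s)) = (\<Sum>(s, l)\<in>(SIGMA s:{..r}. {..s}). F l (s - l) (r - s))"
    by (rule sum.Sigma) auto
  also have "\<dots> = (\<Sum>(i, j, l)\<in>triples r. F i j l)"
    by (rule sum.reindex_bij_witness[where j = "\<lambda>(s, l). (l, s - l, r - s)" and i = "\<lambda>(i, j, l). (i + j, i)"])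
       (auto simp: triples_def)
  finally show ?thesis .
qed

lemma sum_triples_3:
  "(\<Sum>r\<le>n. \<Sum>i\<le>n - r. F r i (n - r - i)) = (\<Sum>(i, j, l)\<in>triples n. F i j l)"
proof -
  have "(\<Sum>r\<le>n. \<Sum>i\<le>n - r. F r i (n - r - i)) = (\<Sum>(r, i)\<in>(SIGMA r:{..n}. {..n - r}). F r i (n - r - i))"
    by (rule sum.Sigma) auto
  also have "\<dots> = (\<Sum>(i, j, l)\<in>triples n. F i j l)"
    by (rule sum.reindex_bij_witness[where j = "\<lambda>(r, i). (r, i, n - r - i)" and i = "\<lambda>(i, j, l). (i, j)"])
       (auto simp: triples_def)
  finally show ?thesis .
qed

lemma sum_triples_swap: "(\<Sum>(i, j, l)\<in>triples n. F i l j) = (\<Sum>(i, j, l)\<in>triples n. F i j l)"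
  by (rule sum.reindex_bij_witness[where j = "\<lambda>(i, j, l). (i, l, j)" and i = "\<lambda>(i, j, l). (i, l, j)"])
     (auto simp: triples_def)

text \<open>Regroups a coefficient of a product of three series with the brackets to the left: q is
  the joint order r + s of the two operators; i, j, l are the orders of the three functions. With
  these fixed, the sum over r is the first half of the associator of order q.
  \<open>sum_triples_right\<close> brings the other bracketing to the same shape.\<close>

lemma sum_triples_left:
  "(\<Sum>(r, m, l)\<in>triples n. \<Sum>(s, i, j)\<in>triples m. H r s i j l) =
    (\<Sum>(q, i, m)\<in>triples n. \<Sum>(j, l)\<in>{(j, l). j + l = m}. \<Sum>r\<le>q. H r (q - r) i j l)"
proof -
  have fin: "finite {(j, l). j + l = (m::nat)}" for m
    by (rule finite_subset[of _ "{..m} \<times> {..m}"]) auto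
  have "(\<Sum>(r, m, l)\<in>triples n. \<Sum>(s, i, j)\<in>triples m. H r s i j l) =
      (\<Sum>((r, m, l), (s, i, j))\<in>(SIGMA t:triples n. triples (fst (snd t))). H r s i j l)"
    by (subst sum.Sigma[symmetric]) (auto simp: case_prod_beta')
  also have "\<dots> = (\<Sum>((q, i, m), ((j, l), r))\<in>(SIGMA t:triples n. {(j, l). j + l = snd (snd t)} \<times> {..fst t}).
      H r (q - r) i j l)"
    by (rule sum.reindex_bij_witness[where j = "\<lambda>((r, m, l), (s, i, j)). ((r + s, i, j + l), ((j, l), r))"
          and i = "\<lambda>((q, i, m), ((j, l), r)). ((r, (q - r) + i + j, l), (q - r, i, j))"])
       (auto simp: triples_def)
  also have "\<dots> = (\<Sum>(q, i, m)\<in>triples n. \<Sum>(j, l)\<in>{(j, l). j + l = m}. \<Sum>r\<le>q. H r (q - r) i j l)"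
    by (subst sum.Sigma[symmetric]) (auto simp: fin[unfolded case_prod_beta'] case_prod_beta' sum.cartesian_product)
  finally show ?thesis .
qed

lemma sum_triples_right:
  "(\<Sum>(r, i, m)\<in>triples n. \<Sum>(s, j, l)\<in>triples m. H r s i j l) =
    (\<Sum>(q, i, m)\<in>triples n. \<Sum>(j, l)\<in>{(j, l). j + l = m}. \<Sum>r\<le>q. H r (q - r) i j l)"
proof -
  have fin: "finite {(j, l). j + l = (m::nat)}" for m
    by (rule finite_subset[of _ "{..m} \<times> {..m}"]) auto
  have "(\<Sum>(r, i, m)\<in>triples n. \<Sum>(s, j, l)\<in>triples m. H r s i j l) =
      (\<Sum>((r, i, m), (s, j, l))\<in>(SIGMA t:triples n. triples (snd (snd t))). H r s i j l)"
    by (subst sum.Sigma[symmetric]) (auto simp: case_prod_beta')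
  also have "\<dots> = (\<Sum>((q, i, m), ((j, l), r))\<in>(SIGMA t:triples n. {(j, l). j + l = snd (snd t)} \<times> {..fst t}).
      H r (q - r) i j l)"
    by (rule sum.reindex_bij_witness[where j = "\<lambda>((r, i, m), (s, j, l)). ((r + s, i, j + l), ((j, l), r))"
          and i = "\<lambda>((q, i, m), ((j, l), r)). ((r, i, (q - r) + j + l), (q - r, j, l))"])
       (auto simp: triples_def)
  also have "\<dots> = (\<Sum>(q, i, m)\<in>triples n. \<Sum>(j, l)\<in>{(j, l). j + l = m}. \<Sum>r\<le>q. H r (q - r) i j l)"
    by (subst sum.Sigma[symmetric]) (auto simp: fin[unfolded case_prod_beta'] case_prod_beta' sum.cartesian_product)
  finally show ?thesis .
qed

text \<open>s is the order contributed by the scalar power series; pulling it to the front expresses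
  linearity over formal power series by coefficients.\<close>

lemma sum_triples_scale_left:
  "(\<Sum>(r, m, j)\<in>triples n. \<Sum>s\<le>m. H s r (m - s) j) = (\<Sum>s\<le>n. \<Sum>(r, i, j)\<in>triples (n - s). H s r i j)"
proof -
  have "(\<Sum>(r, m, j)\<in>triples n. \<Sum>s\<le>m. H s r (m - s) j) =
      (\<Sum>((r, m, j), s)\<in>(SIGMA t:triples n. {..fst (snd t)}). H s r (m - s) j)"
    by (subst sum.Sigma[symmetric]) (auto simp: case_prod_beta')
  also have "\<dots> = (\<Sum>(s, (r, i, j))\<in>(SIGMA s:{..n}. triples (n - s)). H s r i j)"
    by (rule sum.reindex_bij_witness[where j = "\<lambda>((r, m, j), s). (s, (r, m - s, j))"
          and i = "\<lambda>(s, (r, i, j)). ((r, i + s, j), s)"])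
       (auto simp: triples_def)
  also have "\<dots> = (\<Sum>s\<le>n. \<Sum>(r, i, j)\<in>triples (n - s). H s r i j)"
    by (subst sum.Sigma[symmetric]) (auto simp: case_prod_beta')
  finally show ?thesis .
qed

lemma sum_triples_scale_right:
  "(\<Sum>(r, i, m)\<in>triples n. \<Sum>s\<le>m. H s r i (m - s)) = (\<Sum>s\<le>n. \<Sum>(r, i, j)\<in>triples (n - s). H s r i j)"
proof -
  have "(\<Sum>(r, i, m)\<in>triples n. \<Sum>s\<le>m. H s r i (m - s)) =
      (\<Sum>((r, i, m), s)\<in>(SIGMA t:triples n. {..snd (snd t)}). H s r i (m - s))"
    by (subst sum.Sigma[symmetric]) (auto simp: case_prod_beta')
  also have "\<dots> = (\<Sum>(s, (r, i, j))\<in>(SIGMA s:{..n}. triples (n - s)). H s r i j)"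
    by (rule sum.reindex_bij_witness[where j = "\<lambda>((r, i, m), s). (s, (r, i, m - s))"
          and i = "\<lambda>(s, (r, i, j)). ((r, i, j + s), s)"])
       (auto simp: triples_def)
  also have "\<dots> = (\<Sum>s\<le>n. \<Sum>(r, i, j)\<in>triples (n - s). H s r i j)"
    by (subst sum.Sigma[symmetric]) (auto simp: case_prod_beta')
  finally show ?thesis .
qed

definition bilinear_op :: "'p mfd \<Rightarrow> (('p \<Rightarrow> complex) \<Rightarrow> ('p \<Rightarrow> complex) \<Rightarrow> 'p \<Rightarrow> complex) \<Rightarrow> bool"
  where "bilinear_op X c \<longleftrightarrow> (\<forall>h\<in>Cinf X. linear_op X (\<lambda>f. c f h) \<and> linear_op X (c h))"

text \<open>The coefficient of order s of the difference between the two bracketings of f, g, h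
  under the formal product with coefficients c.\<close>

definition associator ::
  "(nat \<Rightarrow> ('p \<Rightarrow> complex) \<Rightarrow> ('p \<Rightarrow> complex) \<Rightarrow> 'p \<Rightarrow> complex) \<Rightarrow> nat \<Rightarrow>
   ('p \<Rightarrow> complex) \<Rightarrow> ('p \<Rightarrow> complex) \<Rightarrow> ('p \<Rightarrow> complex) \<Rightarrow> 'p \<Rightarrow> complex"
  where "associator c s f g h = (\<Sum>l\<le>s. c l (c (s - l) f g) h - c l f (c (s - l) g h))"

context atlas_mfd
begin

section \<open>Composition of cochains\<close>

text \<open>The two terms of the Gerstenhaber composition in degrees 1 and 1 are kept apart because
  each is, in every slot, a cochain or a composition of two operators of one argument.\<close>

definition left_comp :: "'p oper \<Rightarrow> 'p oper \<Rightarrow> 'p oper"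
  where "left_comp D E fs = (if length fs = 3 then D [E [fs ! 0, fs ! 1], fs ! 2] else 0)"

definition right_comp :: "'p oper \<Rightarrow> 'p oper \<Rightarrow> 'p oper"
  where "right_comp D E fs = (if length fs = 3 then D [fs ! 0, E [fs ! 1, fs ! 2]] else 0)"

text \<open>The other argument is unrestricted: an inner operator returns 0 on anything but an
  argument list, and this 0 has to propagate through the outer operator.\<close>

lemma cochain1_zero_arg:
  assumes D: "cochain1 D"
  shows "D [0, h] = 0" "D [h, 0] = 0"
proof -
  show "D [0, h] = 0"
  proof (cases "h \<in> Cinf X")
    case True
    show ?thesis by (rule linear_op_zero[OF cochain1D(2)[OF D True]])
  next
    case False
    then have "[0, h] \<notin> args X 2" by (simp add: args_def)
    then show ?thesis by (rule cochain1D(1)[OF D])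
  qed
  show "D [h, 0] = 0"
  proof (cases "h \<in> Cinf X")
    case True
    show ?thesis by (rule linear_op_zero[OF cochain1D(3)[OF D True]])
  next
    case False
    then have "[h, 0] \<notin> args X 2" by (simp add: args_def)
    then show ?thesis by (rule cochain1D(1)[OF D])
  qed
qed

lemma cochain1_Cinf: "cochain1 D \<Longrightarrow> f \<in> Cinf X \<Longrightarrow> g \<in> Cinf X \<Longrightarrow> D [f, g] \<in> Cinf X"
  by (rule linear_opD(1)[OF cochain1D(2)])

lemma cochain2_left_comp:
  assumes D: "cochain1 D" and E: "cochain1 E"
  shows "cochain2 (left_comp D E)"
proof -
  obtain N where N: "\<forall>h\<in>Cinf X. dorder X N (\<lambda>f. D [f, h]) \<and> dorder X N (\<lambda>f. D [h, f])"
    using cochain1_order[OF D] by (elim exE)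
  obtain N' where N': "\<forall>h\<in>Cinf X. dorder X N' (\<lambda>f. E [f, h]) \<and> dorder X N' (\<lambda>f. E [h, f])"
    using cochain1_order[OF E] by (elim exE)
  have v: "left_comp D E [f, g, h] = D [E [f, g], h]" for f g h
    by (simp add: left_comp_def numeral_2_eq_2)
  have out: "left_comp D E fs = 0" if "fs \<notin> args X 3" for fs
  proof (cases "length fs = 3")
    case True
    then obtain f g h where fs: "fs = [f, g, h]" by (auto simp: numeral_3_eq_3 length_Suc_conv)
    then have "[f, g] \<notin> args X 2 \<or> h \<notin> Cinf X" using that by (auto simp: args_def)
    then show ?thesis
    proof
      assume "[f, g] \<notin> args X 2"
      then have "E [f, g] = 0" by (rule cochain1D(1)[OF E])
      then show ?thesis unfolding fs v by (simp only: cochain1_zero_arg(1)[OF D])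
    next
      assume "h \<notin> Cinf X"
      then have "[E [f, g], h] \<notin> args X 2" by (simp add: args_def)
      then show ?thesis unfolding fs v by (rule cochain1D(1)[OF D])
    qed
  qed (simp add: left_comp_def)
  show ?thesis
    unfolding cochain2_def v
  proof (intro conjI ballI allI impI exI[of _ "N + N'"])
    fix h k :: "'p \<Rightarrow> complex" and c assume h: "h \<in> Cinf X" and k: "k \<in> Cinf X"
    note hk = cochain1_Cinf[OF E h k]
    show "linear_op X (\<lambda>f. D [E [f, h], k])"
      by (rule linear_op_compose[OF cochain1D(2)[OF D k] cochain1D(2)[OF E h]])
    show "linear_op X (\<lambda>f. D [E [h, f], k])"
      by (rule linear_op_compose[OF cochain1D(2)[OF D k] cochain1D(3)[OF E h]])
    show "linear_op X (\<lambda>f. D [E [h, k], f])" by (rule cochain1D(3)[OF D hk])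
    show "D [E [const_fun X c, h], k] = 0" "D [E [h, const_fun X c], k] = 0" "D [E [h, k], const_fun X c] = 0"
      by (simp_all only: cochain1D(4,5)[OF E h] cochain1D(5)[OF D hk] cochain1_zero_arg[OF D])
    show "dorder X (N + N') (\<lambda>f. D [E [f, h], k])"
      by (rule dorder_compose[OF cochain1D(2)[OF D k] cochain1D(2)[OF E h]]) (use N N' h k in auto)
    show "dorder X (N + N') (\<lambda>f. D [E [h, f], k])"
      by (rule dorder_compose[OF cochain1D(2)[OF D k] cochain1D(3)[OF E h]]) (use N N' h k in auto)
    show "dorder X (N + N') (\<lambda>f. D [E [h, k], f])"
      by (rule dorder_mono[of N]) (use N hk in auto)
  qed (rule out)
qed

lemma cochain2_right_comp:
  assumes D: "cochain1 D" and E: "cochain1 E"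
  shows "cochain2 (right_comp D E)"
proof -
  obtain N where N: "\<forall>h\<in>Cinf X. dorder X N (\<lambda>f. D [f, h]) \<and> dorder X N (\<lambda>f. D [h, f])"
    using cochain1_order[OF D] by (elim exE)
  obtain N' where N': "\<forall>h\<in>Cinf X. dorder X N' (\<lambda>f. E [f, h]) \<and> dorder X N' (\<lambda>f. E [h, f])"
    using cochain1_order[OF E] by (elim exE)
  have v: "right_comp D E [f, g, h] = D [f, E [g, h]]" for f g h
    by (simp add: right_comp_def numeral_2_eq_2)
  have out: "right_comp D E fs = 0" if "fs \<notin> args X 3" for fs
  proof (cases "length fs = 3")
    case True
    then obtain f g h where fs: "fs = [f, g, h]" by (auto simp: numeral_3_eq_3 length_Suc_conv)
    then have "[g, h] \<notin> args X 2 \<or> f \<notin> Cinf X" using that by (auto simp: args_def)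
    then show ?thesis
    proof
      assume "[g, h] \<notin> args X 2"
      then have "E [g, h] = 0" by (rule cochain1D(1)[OF E])
      then show ?thesis unfolding fs v by (simp only: cochain1_zero_arg(2)[OF D])
    next
      assume "f \<notin> Cinf X"
      then have "[f, E [g, h]] \<notin> args X 2" by (simp add: args_def)
      then show ?thesis unfolding fs v by (rule cochain1D(1)[OF D])
    qed
  qed (simp add: right_comp_def)
  show ?thesis
    unfolding cochain2_def v
  proof (intro conjI ballI allI impI exI[of _ "N + N'"])
    fix h k :: "'p \<Rightarrow> complex" and c assume h: "h \<in> Cinf X" and k: "k \<in> Cinf X"
    note hk = cochain1_Cinf[OF E h k]
    show "linear_op X (\<lambda>f. D [f, E [h, k]])" by (rule cochain1D(2)[OF D hk])
    show "linear_op X (\<lambda>f. D [h, E [f, k]])"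
      by (rule linear_op_compose[OF cochain1D(3)[OF D h] cochain1D(2)[OF E k]])
    show "linear_op X (\<lambda>f. D [h, E [k, f]])"
      by (rule linear_op_compose[OF cochain1D(3)[OF D h] cochain1D(3)[OF E k]])
    show "D [const_fun X c, E [h, k]] = 0" "D [h, E [const_fun X c, k]] = 0" "D [h, E [k, const_fun X c]] = 0"
      by (simp_all only: cochain1D(4,5)[OF E k] cochain1D(4)[OF D hk] cochain1_zero_arg[OF D])
    show "dorder X (N + N') (\<lambda>f. D [f, E [h, k]])"
      by (rule dorder_mono[of N]) (use N hk in auto)
    show "dorder X (N + N') (\<lambda>f. D [h, E [f, k]])"
      by (rule dorder_compose[OF cochain1D(3)[OF D h] cochain1D(2)[OF E k]]) (use N N' h k in auto)
    show "dorder X (N + N') (\<lambda>f. D [h, E [k, f]])"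
      by (rule dorder_compose[OF cochain1D(3)[OF D h] cochain1D(3)[OF E k]]) (use N N' h k in auto)
  qed (rule out)
qed

lemma cochain2_minus:
  assumes R: "cochain2 R"
  shows "cochain2 (- R)"
proof -
  have m: "(- R) fs = scal (- 1) (R fs)" for fs by (simp add: scal_minus_1 pointwise)
  obtain N where N: "\<forall>h\<in>Cinf X. \<forall>k\<in>Cinf X.
      dorder X N (\<lambda>f. R [f, h, k]) \<and> dorder X N (\<lambda>f. R [h, f, k]) \<and> dorder X N (\<lambda>f. R [h, k, f])"
    using R unfolding cochain2_def by (elim conjE exE)
  then have "\<forall>h\<in>Cinf X. \<forall>k\<in>Cinf X. dorder X N (\<lambda>f. (- R) [f, h, k]) \<and>
      dorder X N (\<lambda>f. (- R) [h, f, k]) \<and> dorder X N (\<lambda>f. (- R) [h, k, f])"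
    unfolding m by (auto intro!: dorder_scal)
  then show ?thesis using R unfolding cochain2_def m by (auto intro!: linear_op_scal simp: scal_simps)
qed

lemma cochain2_gbracket:
  assumes D: "cochain1 D" and E: "cochain1 E"
  shows "cochain2 (gbracket 1 1 D E)"
proof -
  have "gbracket 1 1 D E = - (left_comp D E + - right_comp D E + (left_comp E D + - right_comp E D))"
  proof
    fix fs
    show "gbracket 1 1 D E fs = (- (left_comp D E + - right_comp D E + (left_comp E D + - right_comp E D))) fs"
    proof (cases "length fs = 3")
      case True
      then obtain f g h where "fs = [f, g, h]" by (auto simp: numeral_3_eq_3 length_Suc_conv)
      then show ?thesis
        by (simp add: gbracket_1_1 left_comp_def right_comp_def fun_eq_iff pointwise numeral_2_eq_2)
    next
      case False
      then show ?thesis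
        by (simp add: gbracket_def gcomp_def scale_op_def left_comp_def right_comp_def fun_eq_iff pointwise)
    qed
  qed
  then show ?thesis
    by (simp only: cochain2_minus cochain2_add cochain2_left_comp cochain2_right_comp D E)
qed

section \<open>The associator is a cocycle\<close>

lemma bilinear_opD:
  assumes "bilinear_op X c" "h \<in> Cinf X"
  shows "linear_op X (\<lambda>f. c f h)" "linear_op X (c h)"
  using assms by (simp_all add: bilinear_op_def)

lemma bilinear_Cinf: "bilinear_op X c \<Longrightarrow> f \<in> Cinf X \<Longrightarrow> g \<in> Cinf X \<Longrightarrow> c f g \<in> Cinf X"
  by (rule linear_opD(1)[OF bilinear_opD(2)])

text \<open>The order-r coefficient of the pentagon identity of associators, valid in every algebra
  whether associative or not: each of the five bracketings of a, b, d, e occurs twice, with opposite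
  signs.\<close>

lemma teichmueller:
  assumes c: "\<And>i. bilinear_op X (c i)"
    and a: "a \<in> Cinf X" and b: "b \<in> Cinf X" and d: "d \<in> Cinf X" and e: "e \<in> Cinf X"
  shows "(\<Sum>s\<le>r. c (r - s) a (associator c s b d e) - associator c s (c (r - s) a b) d e +
    associator c s a (c (r - s) b d) e - associator c s a b (c (r - s) d e) +
    c (r - s) (associator c s a b d) e) = 0"
proof -
  note C = bilinear_Cinf[OF c]
  define p1 where "p1 i j l = c i a (c j (c l b d) e)" for i j l
  define p2 where "p2 i j l = c i a (c j b (c l d e))" for i j l
  define p3 where "p3 i j l = c i (c j (c l a b) d) e" for i j l
  define p4 where "p4 i j l = c i (c j a b) (c l d e)" for i j l
  define p5 where "p5 i j l = c i (c j a (c l b d)) e" for i j l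
  define S where "S F = (\<Sum>(i, j, l)\<in>triples r. F i j l)" for F :: "nat \<Rightarrow> nat \<Rightarrow> nat \<Rightarrow> 'p \<Rightarrow> complex"
  have e1: "c i a (associator c s b d e) = (\<Sum>l\<le>s. p1 i l (s - l)) - (\<Sum>l\<le>s. p2 i l (s - l))" for i s
    unfolding associator_def
    by (subst linear_op_sum[OF bilinear_opD(2)[OF c a]])
       (simp_all add: C a b d e Cinf_diff linear_op_diff[OF bilinear_opD(2)[OF c a]] sum_subtractf p1_def p2_def)
  have e5: "c i (associator c s a b d) e = (\<Sum>l\<le>s. p3 i l (s - l)) - (\<Sum>l\<le>s. p5 i l (s - l))" for i s
    unfolding associator_def
    by (subst linear_op_sum[OF bilinear_opD(1)[OF c e]])
       (simp_all add: C a b d e Cinf_diff linear_op_diff[OF bilinear_opD(1)[OF c e]] sum_subtractf p3_def p5_def)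
  have e2: "associator c s (c i a b) d e = (\<Sum>l\<le>s. p3 l (s - l) i) - (\<Sum>l\<le>s. p4 l i (s - l))" for i s
    by (simp add: associator_def sum_subtractf p3_def p4_def)
  have e3: "associator c s a (c i b d) e = (\<Sum>l\<le>s. p5 l (s - l) i) - (\<Sum>l\<le>s. p1 l (s - l) i)" for i s
    by (simp add: associator_def sum_subtractf p5_def p1_def)
  have e4: "associator c s a b (c i d e) = (\<Sum>l\<le>s. p4 l (s - l) i) - (\<Sum>l\<le>s. p2 l (s - l) i)" for i s
    by (simp add: associator_def sum_subtractf p4_def p2_def)
  have "(\<Sum>s\<le>r. c (r - s) a (associator c s b d e) - associator c s (c (r - s) a b) d e +
      associator c s a (c (r - s) b d) e - associator c s a b (c (r - s) d e) +
      c (r - s) (associator c s a b d) e) =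
    S p1 - S p2 - (S p3 - S (\<lambda>i j l. p4 i l j)) + (S p5 - S p1) - (S p4 - S p2) + (S p3 - S p5)"
    unfolding e1 e2 e3 e4 e5 S_def sum.distrib sum_subtractf sum_triples_1 sum_triples_2
      sum_triples_2[of "\<lambda>i j l. p4 i l j"] by (rule refl)
  \<comment> \<open>In the bracketing (a b)(d e) the two inner products stand side by side, and one
    of its two occurrences lists their orders in the opposite order.\<close>
  also have "S (\<lambda>i j l. p4 i l j) = S p4" unfolding S_def by (rule sum_triples_swap)
  finally show ?thesis by simp
qed

text \<open>In the pentagon identity all terms with s < r vanish by hypothesis; for s = r the other
  operator has order 0 and is the pointwise product, so the identity becomes the Hochschild cocycle
  equation.\<close>

lemma associator_cocycle:
  assumes c: "\<And>i. bilinear_op X (c i)" and c0: "\<And>f g. f \<in> Cinf X \<Longrightarrow> g \<in> Cinf X \<Longrightarrow> c 0 f g = f * g"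
    and low: "\<And>s f g h. s < r \<Longrightarrow> f \<in> Cinf X \<Longrightarrow> g \<in> Cinf X \<Longrightarrow> h \<in> Cinf X \<Longrightarrow> associator c s f g h = 0"
    and a: "a \<in> Cinf X" and b: "b \<in> Cinf X" and d: "d \<in> Cinf X" and e: "e \<in> Cinf X"
  shows "a * associator c r b d e - associator c r (a * b) d e + associator c r a (b * d) e -
    associator c r a b (d * e) + associator c r a b d * e = 0"
proof -
  note C = bilinear_Cinf[OF c]
  have AC: "associator c s f g h \<in> Cinf X" if "f \<in> Cinf X" "g \<in> Cinf X" "h \<in> Cinf X" for s f g h
    unfolding associator_def using that by (intro Cinf_sum Cinf_diff C)
  let ?F = "\<lambda>s. c (r - s) a (associator c s b d e) - associator c s (c (r - s) a b) d e +
    associator c s a (c (r - s) b d) e - associator c s a b (c (r - s) d e) +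
    c (r - s) (associator c s a b d) e"
  have "?F s = 0" if "s < r" for s
    using linear_op_zero[OF bilinear_opD(2)[OF c a]] linear_op_zero[OF bilinear_opD(1)[OF c e]]
    by (simp add: low[OF that] a b d e C)
  then have "(\<Sum>s<r. ?F s) = 0" by simp
  then have "?F r = 0"
    using teichmueller[where c = c and r = r, OF c a b d e] by (simp add: lessThan_Suc_atMost[symmetric])
  then show ?thesis using a b d e AC by (simp add: c0)
qed

section \<open>Formal products\<close>

lemma hcoeff_ext: "(\<And>m. hcoeff F m = hcoeff G m) \<Longrightarrow> F = G"
proof
  fix p assume "\<And>m. hcoeff F m = hcoeff G m"
  then have "hcoeff F m p = hcoeff G m p" for m by simp
  then show "F p = G p" by (intro fps_ext) (simp add: hcoeff_def)
qed

lemma hcoeff_formal_product: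
  "hcoeff (formal_product C F G) m = (\<Sum>(r, i, j)\<in>triples m. C r [hcoeff F i, hcoeff G j])"
proof -
  have "hcoeff (formal_product C F G) m p = (\<Sum>r\<le>m. \<Sum>i\<le>m - r. C r [hcoeff F i, hcoeff G (m - r - i)]) p" for p
    by (simp add: hcoeff_def formal_product_def sum_fun_apply)
  then have "hcoeff (formal_product C F G) m = (\<Sum>r\<le>m. \<Sum>i\<le>m - r. C r [hcoeff F i, hcoeff G (m - r - i)])"
    by (rule ext)
  also have "\<dots> = (\<Sum>(r, i, j)\<in>triples m. C r [hcoeff F i, hcoeff G j])" by (rule sum_triples_3)
  finally show ?thesis .
qed

lemma hcoeff_add: "hcoeff (F + G) m = hcoeff F m + hcoeff G m"
  by (simp add: hcoeff_def fun_eq_iff pointwise)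

lemma hcoeff_scal: "hcoeff (scal a F) m = (\<Sum>s\<le>m. scal (fps_nth a s) (hcoeff F (m - s)))"
  by (simp add: hcoeff_def scal_def fun_eq_iff pointwise sum_fun_apply fps_mult_nth atLeast0AtMost)

lemma hcoeff_one: "hcoeff (const_fun X 1) m = const_fun X (if m = 0 then 1 else 0)"
  by (auto simp: hcoeff_def const_fun_def fun_eq_iff)

lemma formal_functionsD: "F \<in> formal_functions X \<Longrightarrow> hcoeff F m \<in> Cinf X"
  by (simp add: formal_functions_def)

text \<open>All axioms are compared coefficient by coefficient. The unit law uses that cochains
  vanish on constants; associativity is the vanishing of the associators after regrouping by the
  total order of the operators.\<close>

theorem star_productI:
  assumes C0: "C 0 = mu0 X" and coch: "\<And>r. r \<ge> 1 \<Longrightarrow> cochain1 (C r)"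
    and assoc: "\<And>q f g h. f \<in> Cinf X \<Longrightarrow> g \<in> Cinf X \<Longrightarrow> h \<in> Cinf X \<Longrightarrow>
      associator (\<lambda>r f g. C r [f, g]) q f g h = 0"
  shows "star_product X C"
proof -
  let ?star = "formal_product C" and ?A = "formal_functions X"
  note H = hcoeff_formal_product formal_functionsD
  have C0_val: "C 0 [f, g] = f * g" if "f \<in> Cinf X" "g \<in> Cinf X" for f g
    using that unfolding C0 mu0_def by (simp add: args_def)
  have bil: "bilinear_op X (\<lambda>f g. C r [f, g])" for r
  proof (cases "r = 0")
    case True
    have "linear_op X (\<lambda>f. C 0 [f, h])" "linear_op X (\<lambda>f. C 0 [h, f])" if "h \<in> Cinf X" for h
      using that by (auto intro!: linear_opI simp: C0_val Cinf_mult Cinf_scal Cinf_add scal_simps distrib_left distrib_right)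
    then show ?thesis unfolding True bilinear_op_def by blast
  next
    case False
    then have "cochain1 (C r)" by (intro coch) simp
    then show ?thesis unfolding bilinear_op_def using cochain1D(2,3) by blast
  qed
  note lin = bilinear_opD[OF bil]
  have val: "C r [f, g] \<in> Cinf X" if "f \<in> Cinf X" "g \<in> Cinf X" for r f g
    using bilinear_Cinf[OF bil that] .
  have closed: "?star F G \<in> ?A" if "F \<in> ?A" "G \<in> ?A" for F G
    unfolding formal_functions_def using that by (auto simp: H intro!: Cinf_sum val)
  have poly: "C r \<in> polydiff_ops X 2" if "r \<ge> 1" for r
    using coch[OF that] unfolding HC1_iff[symmetric] by (simp add: HC_def)
  have add1: "?star (F + F') G = ?star F G + ?star F' G" and add2: "?star G (F + F') = ?star G F + ?star G F'"
    if "F \<in> ?A" "F' \<in> ?A" "G \<in> ?A" for F F' G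
  proof -
    have "C r [hcoeff F i + hcoeff F' i, hcoeff G j] = C r [hcoeff F i, hcoeff G j] + C r [hcoeff F' i, hcoeff G j]"
      "C r [hcoeff G j, hcoeff F i + hcoeff F' i] = C r [hcoeff G j, hcoeff F i] + C r [hcoeff G j, hcoeff F' i]" for r i j
      using that by (auto intro!: linear_opD(3)[OF lin(1)] linear_opD(3)[OF lin(2)] formal_functionsD)
    then show "?star (F + F') G = ?star F G + ?star F' G" "?star G (F + F') = ?star G F + ?star G F'"
      by (intro hcoeff_ext; simp add: hcoeff_formal_product hcoeff_add sum.distrib case_prod_beta')+
  qed
  have scal1: "?star (scal a F) G = scal a (?star F G)" and scal2: "?star G (scal a F) = scal a (?star G F)"
    if F: "F \<in> ?A" and G: "G \<in> ?A" for F G and a :: "complex fps"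
  proof -
    note FC = formal_functionsD[OF F] and GC = formal_functionsD[OF G]
    have l1: "C r [\<Sum>s\<le>m. scal (fps_nth a s) (hcoeff F (m - s)), hcoeff G j] =
        (\<Sum>s\<le>m. scal (fps_nth a s) (C r [hcoeff F (m - s), hcoeff G j]))" for r m j
      by (subst linear_op_sum[OF lin(1)[OF GC]]) (simp_all add: Cinf_scal FC linear_opD(2)[OF lin(1)[OF GC]])
    have l2: "C r [hcoeff G j, \<Sum>s\<le>m. scal (fps_nth a s) (hcoeff F (m - s))] =
        (\<Sum>s\<le>m. scal (fps_nth a s) (C r [hcoeff G j, hcoeff F (m - s)]))" for r m j
      by (subst linear_op_sum[OF lin(2)[OF GC]]) (simp_all add: Cinf_scal FC linear_opD(2)[OF lin(2)[OF GC]])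
    have sc: "scal c (\<Sum>i\<in>I. u i) = (\<Sum>i\<in>I. scal c (u i))" for c and I :: "(nat \<times> nat \<times> nat) set" and u :: "_ \<Rightarrow> 'p \<Rightarrow> complex"
      by (simp add: scal_def fun_eq_iff sum_fun_apply sum_distrib_left)
    show "?star (scal a F) G = scal a (?star F G)"
    proof (rule hcoeff_ext)
      fix m
      have "hcoeff (?star (scal a F) G) m =
          (\<Sum>(r, m, j)\<in>triples m. \<Sum>s\<le>m. scal (fps_nth a s) (C r [hcoeff F (m - s), hcoeff G j]))"
        unfolding hcoeff_formal_product hcoeff_scal l1 by (rule refl)
      also have "\<dots> = (\<Sum>s\<le>m. \<Sum>(r, i, j)\<in>triples (m - s). scal (fps_nth a s) (C r [hcoeff F i, hcoeff G j]))"
        by (rule sum_triples_scale_left)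
      also have "\<dots> = hcoeff (scal a (?star F G)) m"
        unfolding hcoeff_formal_product hcoeff_scal sc by (simp add: case_prod_beta')
      finally show "hcoeff (?star (scal a F) G) m = hcoeff (scal a (?star F G)) m" .
    qed
    show "?star G (scal a F) = scal a (?star G F)"
    proof (rule hcoeff_ext)
      fix m
      have "hcoeff (?star G (scal a F)) m =
          (\<Sum>(r, j, m)\<in>triples m. \<Sum>s\<le>m. scal (fps_nth a s) (C r [hcoeff G j, hcoeff F (m - s)]))"
        unfolding hcoeff_formal_product hcoeff_scal l2 by (rule refl)
      also have "\<dots> = (\<Sum>s\<le>m. \<Sum>(r, j, i)\<in>triples (m - s). scal (fps_nth a s) (C r [hcoeff G j, hcoeff F i]))"
        by (rule sum_triples_scale_right)
      also have "\<dots> = hcoeff (scal a (?star G F)) m"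
        unfolding hcoeff_formal_product hcoeff_scal sc by (simp add: case_prod_beta')
      finally show "hcoeff (?star G (scal a F)) m = hcoeff (scal a (?star G F)) m" .
    qed
  qed
  have assoc': "?star (?star F G) K = ?star F (?star G K)" if "F \<in> ?A" "G \<in> ?A" "K \<in> ?A" for F G K
  proof (rule hcoeff_ext)
    fix m
    note FC = formal_functionsD[OF that(1)] and GC = formal_functionsD[OF that(2)] and KC = formal_functionsD[OF that(3)]
    have l1: "C r [\<Sum>(s, i, j)\<in>triples m. C s [hcoeff F i, hcoeff G j], hcoeff K l] =
        (\<Sum>(s, i, j)\<in>triples m. C r [C s [hcoeff F i, hcoeff G j], hcoeff K l])" for r m l
      by (subst linear_op_sum[OF lin(1)[OF KC]]) (auto simp: case_prod_beta' val FC GC)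
    have l2: "C r [hcoeff F i, \<Sum>(s, j, l)\<in>triples m. C s [hcoeff G j, hcoeff K l]] =
        (\<Sum>(s, j, l)\<in>triples m. C r [hcoeff F i, C s [hcoeff G j, hcoeff K l]])" for r m i
      by (subst linear_op_sum[OF lin(2)[OF FC]]) (auto simp: case_prod_beta' val GC KC)
    have eq: "(\<Sum>r\<le>q. C r [C (q - r) [hcoeff F i, hcoeff G j], hcoeff K l]) =
        (\<Sum>r\<le>q. C r [hcoeff F i, C (q - r) [hcoeff G j, hcoeff K l]])" for q i j l
      using assoc[OF FC GC KC, of q i j l] by (simp add: associator_def sum_subtractf)
    have "hcoeff (?star (?star F G) K) m =
        (\<Sum>(r, m, l)\<in>triples m. \<Sum>(s, i, j)\<in>triples m. C r [C s [hcoeff F i, hcoeff G j], hcoeff K l])"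
      unfolding hcoeff_formal_product l1 by (rule refl)
    also have "\<dots> = (\<Sum>(r, i, m)\<in>triples m. \<Sum>(s, j, l)\<in>triples m. C r [hcoeff F i, C s [hcoeff G j, hcoeff K l]])"
      unfolding sum_triples_left[where H = "\<lambda>r s i j l. C r [C s [hcoeff F i, hcoeff G j], hcoeff K l]"]
        sum_triples_right[where H = "\<lambda>r s i j l. C r [hcoeff F i, C s [hcoeff G j, hcoeff K l]]"] eq
      by (rule refl)
    also have "\<dots> = hcoeff (?star F (?star G K)) m"
      unfolding hcoeff_formal_product l2 by (rule refl)
    finally show "hcoeff (?star (?star F G) K) m = hcoeff (?star F (?star G K)) m" .
  qed
  have one: "?star F (const_fun X 1) = F" "?star (const_fun X 1) F = F" if F: "F \<in> ?A" for F
  proof -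
    note FC = formal_functionsD[OF F]
    \<comment> \<open>\<open>const_fun X a\<close> acts as the scalar a under pointwise
      multiplication since smooth functions are 0 off the manifold. So only the triple with operator
      order 0 and order 0 in the unit contributes.\<close>
    have c: "C r [f, const_fun X a] = (if r = 0 then scal a f else 0)"
      "C r [const_fun X a, f] = (if r = 0 then scal a f else 0)" if f: "f \<in> Cinf X" for r f a
    proof -
      have "f * const_fun X a = scal a f" "const_fun X a * f = scal a f"
        using Cinf_outside[OF f] by (auto simp: const_fun_def scal_def fun_eq_iff pointwise)
      then show "C r [f, const_fun X a] = (if r = 0 then scal a f else 0)"
        "C r [const_fun X a, f] = (if r = 0 then scal a f else 0)"
        using C0_val[OF f Cinf_const] C0_val[OF Cinf_const f] cochain1D(4,5)[OF coch f] by simp_all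
    qed
    have single: "(\<Sum>(r, i, j)\<in>triples m. u r i j) = u 0 a b"
      if "(0, a, b) \<in> triples m" "\<And>r i j. (r, i, j) \<in> triples m \<Longrightarrow> (r, i, j) \<noteq> (0, a, b) \<Longrightarrow> u r i j = 0"
      for m a b and u :: "nat \<Rightarrow> nat \<Rightarrow> nat \<Rightarrow> 'p \<Rightarrow> complex"
    proof -
      have "(\<Sum>(r, i, j)\<in>triples m. u r i j) = (\<Sum>(r, i, j)\<in>{(0, a, b)}. u r i j)"
        by (rule sum.mono_neutral_right) (use that in auto)
      then show ?thesis by simp
    qed
    show "?star F (const_fun X 1) = F"
    proof (rule hcoeff_ext)
      fix m
      show "hcoeff (?star F (const_fun X 1)) m = hcoeff F m"
        unfolding hcoeff_formal_product hcoeff_one c[OF FC]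
        by (subst single[of m 0]) (auto simp: triples_def scal_simps)
    qed
    show "?star (const_fun X 1) F = F"
    proof (rule hcoeff_ext)
      fix m
      show "hcoeff (?star (const_fun X 1) F) m = hcoeff F m"
        unfolding hcoeff_formal_product hcoeff_one c[OF FC]
        by (subst single[of 0 m]) (auto simp: triples_def scal_simps)
    qed
  qed
  show ?thesis
    unfolding star_product_def Let_def
    using C0 poly closed add1 add2 scal1 scal2 assoc' one by (intro conjI ballI allI impI)
qed

end

section \<open>Coboundaries and total antisymmetrization\<close>

definition coboundary_form :: "'p oper \<Rightarrow> ('p \<Rightarrow> complex) \<Rightarrow> ('p \<Rightarrow> complex) \<Rightarrow> ('p \<Rightarrow> complex) \<Rightarrow> 'p \<Rightarrow> complex"
  where "coboundary_form D f g h = D [f, g] * h - f * D [g, h] + D [f * g, h] - D [f, g * h]"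

text \<open>Without the factor 1/3!, so a trivector field is multiplied by 6, which cancels the 1/3!
  in \<open>hkr\<close>.\<close>

definition alternation ::
  "(('p \<Rightarrow> complex) \<Rightarrow> ('p \<Rightarrow> complex) \<Rightarrow> ('p \<Rightarrow> complex) \<Rightarrow> 'p \<Rightarrow> complex) \<Rightarrow>
   ('p \<Rightarrow> complex) \<Rightarrow> ('p \<Rightarrow> complex) \<Rightarrow> ('p \<Rightarrow> complex) \<Rightarrow> 'p \<Rightarrow> complex"
  where "alternation F f g h = F f g h + F g h f + F h f g - F g f h - F f h g - F h g f"

text \<open>D(f g, h) and D(f, g h) are symmetric in two arguments because the pointwise product
  commutes, and D(f, g) h, f D(g, h) differ by an even permutation.\<close>

lemma alternation_coboundary_form: "alternation (coboundary_form D) f g h = 0"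
  by (simp add: alternation_def coboundary_form_def algebra_simps)

text \<open>Exchanging the arguments of D amounts to reversing f, g, h, again by commutativity of
  the product, at the price of a sign.\<close>

lemma coboundary_form_sym_plus:
  "coboundary_form (sym_plus D) f g h = coboundary_form D f g h - coboundary_form D h g f"
  by (simp add: coboundary_form_def sym_plus_def algebra_simps)

context atlas_mfd
begin

lemma mu0_val: "f \<in> Cinf X \<Longrightarrow> g \<in> Cinf X \<Longrightarrow> mu0 X [f, g] = f * g"
  by (simp add: mu0_def args_def)

lemma mu0_out: "f \<notin> Cinf X \<or> g \<notin> Cinf X \<Longrightarrow> mu0 X [f, g] = 0"
  by (auto simp: mu0_def args_def)

lemma mu0_zero: "mu0 X [0, g] = 0" "mu0 X [g, 0] = 0"
  by (auto simp: mu0_def)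

text \<open>The sign comes from the factor (-1)^(1 * 1) in the bracket;
  \<open>coboundary_form\<close> is normalized to be the part of the associator that is linear in
  D.\<close>

lemma hochschild_diff_1_val:
  "f \<in> Cinf X \<Longrightarrow> g \<in> Cinf X \<Longrightarrow> h \<in> Cinf X \<Longrightarrow> cochain1 D \<Longrightarrow>
    hochschild_diff X 1 D [f, g, h] = - coboundary_form D f g h"
  by (simp add: hochschild_diff_def gbracket_1_1 coboundary_form_def mu0_val Cinf_mult cochain1_Cinf)

lemma cochain2_out: "cochain2 R \<Longrightarrow> f \<notin> Cinf X \<or> g \<notin> Cinf X \<or> h \<notin> Cinf X \<Longrightarrow> R [f, g, h] = 0"
  by (erule cochain2D(1)) (auto simp: args_def)

lemma cochain2_zero_arg:
  assumes R: "cochain2 R"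
  shows "R [0, g, h] = 0" "R [g, 0, h] = 0" "R [g, h, 0] = 0"
proof -
  have "R [0, g, h] = 0 \<and> R [g, 0, h] = 0 \<and> R [g, h, 0] = 0"
  proof (cases "g \<in> Cinf X \<and> h \<in> Cinf X")
    case True
    then have g: "g \<in> Cinf X" and h: "h \<in> Cinf X" by simp_all
    show ?thesis
      using linear_op_zero[OF cochain2D(2)[OF R g h]] linear_op_zero[OF cochain2D(3)[OF R g h]]
        linear_op_zero[OF cochain2D(4)[OF R g h]] by simp
  next
    case False
    then show ?thesis using cochain2_out[OF R] by blast
  qed
  then show "R [0, g, h] = 0" "R [g, 0, h] = 0" "R [g, h, 0] = 0" by simp_all
qed

lemma hochschild_diff_2_eq_0:
  assumes R: "cochain2 R"
    and 0: "\<And>a b c e. a \<in> Cinf X \<Longrightarrow> b \<in> Cinf X \<Longrightarrow> c \<in> Cinf X \<Longrightarrow> e \<in> Cinf X \<Longrightarrow>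
      a * R [b, c, e] - R [a * b, c, e] + R [a, b * c, e] - R [a, b, c * e] + R [a, b, c] * e = 0"
  shows "hochschild_diff X 2 R = 0"
proof
  fix fs
  have "hochschild_diff X 2 R fs = 0"
  proof (cases "length fs = 4")
    case True
    then obtain a b c e where fs: "fs = [a, b, c, e]"
      by (auto simp: numeral_eq_Suc length_Suc_conv)
    have val: "hochschild_diff X 2 R fs = mu0 X [R [a, b, c], e] + mu0 X [a, R [b, c, e]] -
        (R [mu0 X [a, b], c, e] - R [a, mu0 X [b, c], e] + R [a, b, mu0 X [c, e]])"
      unfolding hochschild_diff_def fs by (rule gbracket_1_2)
    show ?thesis
    proof (cases "a \<in> Cinf X \<and> b \<in> Cinf X \<and> c \<in> Cinf X \<and> e \<in> Cinf X")
      case True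
      then have C: "a \<in> Cinf X" "b \<in> Cinf X" "c \<in> Cinf X" "e \<in> Cinf X" by simp_all
      have "R [a, b, c] \<in> Cinf X" "R [b, c, e] \<in> Cinf X"
        using linear_opD(1)[OF cochain2D(2)[OF R]] C by simp_all
      then show ?thesis unfolding val using 0[OF C] C by (simp add: mu0_val algebra_simps)
    next
      case False
      then have "mu0 X [R [a, b, c], e] = 0" "mu0 X [a, R [b, c, e]] = 0" "R [mu0 X [a, b], c, e] = 0"
        "R [a, mu0 X [b, c], e] = 0" "R [a, b, mu0 X [c, e]] = 0"
        using cochain2_out[OF R] mu0_out mu0_zero cochain2_zero_arg[OF R] by metis+
      then show ?thesis unfolding val by simp
    qed
  next
    case False
    then show ?thesis by (simp add: hochschild_diff_def gbracket_def gcomp_def scale_op_def fun_eq_iff pointwise)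
  qed
  then show "hochschild_diff X 2 R fs = (0 :: 'p oper) fs" by (simp add: pointwise)
qed

lemma alternation_multivector3:
  assumes T: "T \<in> multivector_fields X 3" and f: "f \<in> Cinf X" and g: "g \<in> Cinf X" and h: "h \<in> Cinf X"
  shows "alternation (\<lambda>f g h. T [f, g, h]) f g h = scal 6 (T [f, g, h])"
proof -
  have "T [g, f, h] = - T [f, g, h]" "T [f, h, g] = - T [f, g, h]" "T [g, h, f] = - T [g, f, h]"
    "T [h, f, g] = - T [f, h, g]" "T [h, g, f] = - T [g, h, f]"
    using multivector3(4)[OF T g h f] multivector3(5)[OF T g h f] multivector3(5)[OF T f h g]
      multivector3(4)[OF T h g f] multivector3(4)[OF T h f g] by simp_all
  then show ?thesis by (simp add: alternation_def scal_def fun_eq_iff pointwise)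
qed

text \<open>Each of the three cyclic terms occurs four times: antisymmetry of Q doubles it, and
  antisymmetry of P turns the terms P(f, Q(g,h)) into further copies.\<close>

lemma alternation_bivectors:
  assumes P: "bivector X P" and Q: "bivector X Q" and f: "f \<in> Cinf X" and g: "g \<in> Cinf X" and h: "h \<in> Cinf X"
  shows "alternation (\<lambda>f g h. P (Q f g) h - P f (Q g h)) f g h =
    scal 4 (P (Q f g) h + P (Q g h) f + P (Q h f) g)"
proof -
  have m: "P (- u) w = - P u w" if "u \<in> Cinf X" "w \<in> Cinf X" for u w
    by (rule derivation_minus[OF bivectorD(1)[OF P that(2)] that(1)])
  have s: "P v (Q u w) = - P (Q u w) v" if "u \<in> Cinf X" "w \<in> Cinf X" "v \<in> Cinf X" for u v w
    by (rule bivectorD(3)[OF P that(3) bivector_Cinf[OF Q that(1,2)]])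
  have t: "P (Q g f) h = - P (Q f g) h" "P (Q f h) g = - P (Q h f) g" "P (Q h g) f = - P (Q g h) f"
    using m[OF bivector_Cinf[OF Q f g] h] m[OF bivector_Cinf[OF Q h f] g] m[OF bivector_Cinf[OF Q g h] f]
      bivectorD(3)[OF Q g f] bivectorD(3)[OF Q f h] bivectorD(3)[OF Q h g] by simp_all
  show ?thesis
    unfolding alternation_def s[OF g h f] s[OF h f g] s[OF f g h] s[OF f h g] s[OF h g f] s[OF g f h] t
    by (simp add: scal_def fun_eq_iff pointwise)
qed

text \<open>With S inside, antisymmetrizing the two arguments of S gives 0. With S outside, symmetry
  turns S(f, P(g,h)) into S(P(g,h), f), an even permutation of the first term, and the difference
  cancels. This removes the symmetric part of \<open>C 2\<close> from the order-3
  obstruction.\<close>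

lemma alternation_symmetric:
  assumes P: "bivector X P" and S: "\<And>f g. S f g = S g f"
    and f: "f \<in> Cinf X" and g: "g \<in> Cinf X" and h: "h \<in> Cinf X"
    and bil: "bilinear_op X S"
  shows "alternation (\<lambda>f g h. P (S f g) h - P f (S g h)) f g h = 0"
    "alternation (\<lambda>f g h. S (P f g) h - S f (P g h)) f g h = 0"
proof -
  have S': "S f h = S h f" "S g f = S f g" "S h g = S g h" by (rule S)+
  show "alternation (\<lambda>f g h. P (S f g) h - P f (S g h)) f g h = 0"
    unfolding alternation_def S' by (simp add: algebra_simps)
  have m: "S (- u) w = - S u w" if "u \<in> Cinf X" "w \<in> Cinf X" for u w
    by (rule linear_op_uminus[OF bilinear_opD(1)[OF bil that(2)] that(1)])
  have s: "S v (P u w) = S (P u w) v" for u v w by (rule S)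
  have t: "S (P g f) h = - S (P f g) h" "S (P f h) g = - S (P h f) g" "S (P h g) f = - S (P g h) f"
    using m[OF bivector_Cinf[OF P f g] h] m[OF bivector_Cinf[OF P h f] g] m[OF bivector_Cinf[OF P g h] f]
      bivectorD(3)[OF P g f] bivectorD(3)[OF P f h] bivectorD(3)[OF P h g] by simp_all
  show "alternation (\<lambda>f g h. S (P f g) h - S f (P g h)) f g h = 0"
    unfolding alternation_def s[of f] s[of g] s[of h] t by (simp add: algebra_simps)
qed

end

lemma scale_op_scal: "scale_op c D fs = scal c (D fs)"
  by (simp add: scale_op_def scal_def)

context smooth_bundle
begin

section \<open>Homogeneous cochains\<close>

definition homog1 :: "complex \<Rightarrow> ('m \<times> ('v \<Rightarrow> real)) oper \<Rightarrow> bool"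
  where "homog1 a D \<longleftrightarrow> (\<forall>f\<in>Cinf (dual A). \<forall>g\<in>Cinf (dual A).
    euler A (D [f, g]) = D [euler A f, g] + D [f, euler A g] + scal a (D [f, g]))"

definition homog2 :: "complex \<Rightarrow> ('m \<times> ('v \<Rightarrow> real)) oper \<Rightarrow> bool"
  where "homog2 a R \<longleftrightarrow> (\<forall>f\<in>Cinf (dual A). \<forall>g\<in>Cinf (dual A). \<forall>h\<in>Cinf (dual A).
    euler A (R [f, g, h]) = R [euler A f, g, h] + R [f, euler A g, h] + R [f, g, euler A h] + scal a (R [f, g, h]))"

lemma lie_euler_op_val: "f \<in> Cinf (dual A) \<Longrightarrow> lie_euler_op A [f] = euler A f"
  and lie_euler_op_out: "f \<notin> Cinf (dual A) \<Longrightarrow> lie_euler_op A [f] = 0"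
  by (simp_all add: lie_euler_op_def args_def)

lemma euler_zero: "euler A (0 :: _ \<Rightarrow> complex) = 0"
  by (rule d.derivation_zero[OF euler_derivation])

lemma gbracket_0_1: "gbracket 0 1 L D [f, g] = L [D [f, g]] - (D [L [f], g] + D [f, L [g]])"
  by (simp add: gbracket_def gcomp_def numeral_2_eq_2 lessThan_Suc scale_op_def scal_def fun_eq_iff pointwise)

lemma gbracket_0_2:
  "gbracket 0 2 L R [f, g, h] = L [R [f, g, h]] - (R [L [f], g, h] + R [f, L [g], h] + R [f, g, L [h]])"
  by (simp add: gbracket_def gcomp_def numeral_2_eq_2 numeral_3_eq_3 lessThan_Suc scale_op_def scal_def fun_eq_iff
      pointwise algebra_simps)

lemma homogeneous_op_1_iff:
  assumes D: "d.cochain1 D"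
  shows "homogeneous_op A 1 j D \<longleftrightarrow> homog1 (of_int j) D"
proof
  assume h: "homogeneous_op A 1 j D"
  show "homog1 (of_int j) D"
    unfolding homog1_def
  proof (intro ballI)
    fix f g :: "_ \<Rightarrow> complex" assume f: "f \<in> Cinf (dual A)" and g: "g \<in> Cinf (dual A)"
    have "gbracket 0 1 (lie_euler_op A) D [f, g] = scale_op (of_int j) D [f, g]"
      using h unfolding homogeneous_op_def by (rule fun_cong)
    then show "euler A (D [f, g]) = D [euler A f, g] + D [f, euler A g] + scal (of_int j) (D [f, g])"
      unfolding gbracket_0_1 lie_euler_op_val[OF f] lie_euler_op_val[OF g] lie_euler_op_val[OF d.cochain1_Cinf[OF D f g]]
      by (simp add: scale_op_scal algebra_simps)
  qed
next
  assume h: "homog1 (of_int j) D"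
  show "homogeneous_op A 1 j D"
    unfolding homogeneous_op_def
  proof
    fix fs
    show "gbracket 0 1 (lie_euler_op A) D fs = scale_op (of_int j) D fs"
    proof (cases "length fs = 2")
      case True
      then obtain f g where fs: "fs = [f, g]" by (auto simp: numeral_2_eq_2 length_Suc_conv)
      show ?thesis
      proof (cases "f \<in> Cinf (dual A) \<and> g \<in> Cinf (dual A)")
        case True
        then have f: "f \<in> Cinf (dual A)" and g: "g \<in> Cinf (dual A)" by simp_all
        have "euler A (D [f, g]) = D [euler A f, g] + D [f, euler A g] + scal (of_int j) (D [f, g])"
          using h f g unfolding homog1_def by blast
        then show ?thesis
          unfolding fs gbracket_0_1 lie_euler_op_val[OF f] lie_euler_op_val[OF g]
            lie_euler_op_val[OF d.cochain1_Cinf[OF D f g]]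
          by (simp add: scale_op_scal)
      next
        case False
        then have D0: "D [f, g] = 0" by (intro d.cochain1D(1)[OF D]) (auto simp: args_def)
        have "D [lie_euler_op A [f], g] = 0" "D [f, lie_euler_op A [g]] = 0"
        proof -
          show "D [lie_euler_op A [f], g] = 0"
          proof (cases "f \<in> Cinf (dual A)")
            case True
            then show ?thesis using False by (intro d.cochain1D(1)[OF D]) (auto simp: args_def)
          qed (simp add: lie_euler_op_out d.cochain1_zero_arg[OF D])
          show "D [f, lie_euler_op A [g]] = 0"
          proof (cases "g \<in> Cinf (dual A)")
            case True
            then show ?thesis using False by (intro d.cochain1D(1)[OF D]) (auto simp: args_def)
          qed (simp add: lie_euler_op_out d.cochain1_zero_arg[OF D])
        qed
        then show ?thesis unfolding fs gbracket_0_1 D0 lie_euler_op_val[OF d.Cinf_zero] euler_zero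
          by (simp add: scale_op_def D0 fun_eq_iff pointwise)
      qed
    next
      case False
      then have "D fs = 0" by (intro d.cochain1D(1)[OF D]) (auto simp: args_def)
      then show ?thesis using False by (simp add: gbracket_def gcomp_def scale_op_def fun_eq_iff pointwise)
    qed
  qed
qed

lemma homogeneous_op_2I:
  assumes R: "d.cochain2 R" and h: "homog2 (of_int j) R"
  shows "homogeneous_op A 2 j R"
  unfolding homogeneous_op_def
proof
  fix fs
  show "gbracket 0 2 (lie_euler_op A) R fs = scale_op (of_int j) R fs"
  proof (cases "length fs = 3")
    case True
    then obtain f g k where fs: "fs = [f, g, k]" by (auto simp: numeral_3_eq_3 length_Suc_conv)
    show ?thesis
    proof (cases "f \<in> Cinf (dual A) \<and> g \<in> Cinf (dual A) \<and> k \<in> Cinf (dual A)")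
      case True
      then have f: "f \<in> Cinf (dual A)" and g: "g \<in> Cinf (dual A)" and k: "k \<in> Cinf (dual A)" by simp_all
      have RC: "R [f, g, k] \<in> Cinf (dual A)" by (rule linear_opD(1)[OF d.cochain2D(2)[OF R g k] f])
      have "euler A (R [f, g, k]) = R [euler A f, g, k] + R [f, euler A g, k] + R [f, g, euler A k] +
          scal (of_int j) (R [f, g, k])"
        using h f g k unfolding homog2_def by blast
      then show ?thesis
        unfolding fs gbracket_0_2 lie_euler_op_val[OF f] lie_euler_op_val[OF g] lie_euler_op_val[OF k]
          lie_euler_op_val[OF RC]
        by (simp add: scale_op_scal)
    next
      case False
      then have R0: "R [f, g, k] = 0" by (intro d.cochain2_out[OF R]) auto
      have L: "lie_euler_op A [u] = 0 \<or> u \<in> Cinf (dual A)" for u using lie_euler_op_out by blast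
      have "R [lie_euler_op A [f], g, k] = 0" "R [f, lie_euler_op A [g], k] = 0" "R [f, g, lie_euler_op A [k]] = 0"
        using False L[of f] L[of g] L[of k] d.cochain2_zero_arg[OF R] d.cochain2_out[OF R] by metis+
      then show ?thesis unfolding fs gbracket_0_2 R0 lie_euler_op_val[OF d.Cinf_zero] euler_zero
        by (simp add: scale_op_def R0 fun_eq_iff pointwise)
    qed
  next
    case False
    then have "R fs = 0" by (intro d.cochain2D(1)[OF R]) (auto simp: args_def)
    then show ?thesis using False by (simp add: gbracket_def gcomp_def scale_op_def fun_eq_iff pointwise)
  qed
qed

lemma homogeneous_multivector_3D:
  assumes "homogeneous_multivector A j T"
  shows "euler A (T [f, g, h]) - T [euler A f, g, h] - T [f, euler A g, h] - T [f, g, euler A h] =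
    scal (of_int j) (T [f, g, h])"
proof -
  have "lie_euler_multivector A T [f, g, h] = scale_op (of_int j) T [f, g, h]"
    using assms unfolding homogeneous_multivector_def by (rule fun_cong)
  then show ?thesis
    by (simp add: lie_euler_multivector_def scale_op_scal numeral_3_eq_3 numeral_2_eq_2
        lessThan_Suc algebra_simps)
qed

lemma homog1_add: "d.cochain1 D \<Longrightarrow> d.cochain1 E \<Longrightarrow> homog1 a D \<Longrightarrow> homog1 a E \<Longrightarrow> homog1 a (D + E)"
proof -
  assume D: "d.cochain1 D" "homog1 a D" and E: "d.cochain1 E" "homog1 a E"
  have pl: "(D + E) fs = D fs + E fs" for fs by (rule plus_fun_apply)
  show ?thesis
    unfolding homog1_def pl
  proof (intro ballI)
    fix f g :: "_ \<Rightarrow> complex" assume f: "f \<in> Cinf (dual A)" and g: "g \<in> Cinf (dual A)"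
    show "euler A (D [f, g] + E [f, g]) = D [euler A f, g] + E [euler A f, g] + (D [f, euler A g] + E [f, euler A g]) +
        scal a (D [f, g] + E [f, g])"
      using D(2) E(2) f g unfolding homog1_def
      by (simp add: euler_add d.cochain1_Cinf D(1) E(1) scal_simps algebra_simps)
  qed
qed

lemma homog1_scale: "d.cochain1 D \<Longrightarrow> homog1 a D \<Longrightarrow> homog1 a (scale_op c D)"
proof -
  assume D: "d.cochain1 D" "homog1 a D"
  have s: "scale_op c D fs = scal c (D fs)" for fs by (simp add: scale_op_def scal_def)
  show ?thesis
    unfolding homog1_def s
  proof (intro ballI)
    fix f g :: "_ \<Rightarrow> complex" assume f: "f \<in> Cinf (dual A)" and g: "g \<in> Cinf (dual A)"
    show "euler A (scal c (D [f, g])) = scal c (D [euler A f, g]) + scal c (D [f, euler A g]) + scal a (scal c (D [f, g]))"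
      using D(2) f g unfolding homog1_def
      by (simp add: euler_scal d.cochain1_Cinf D(1) scal_simps mult.commute)
  qed
qed

lemma homog1_sym_plus: "d.cochain1 D \<Longrightarrow> homog1 a D \<Longrightarrow> homog1 a (sym_plus D)"
proof -
  assume D: "d.cochain1 D" "homog1 a D"
  have "homog1 a (\<lambda>fs. D (rev fs))"
    using D(2) unfolding homog1_def by (simp add: add_ac)
  then show ?thesis
    using homog1_add[OF D(1) d.cochain1_rev[OF D(1)] D(2)] by (simp add: sym_plus_def plus_fun_def)
qed

text \<open>The Euler field passes through the outer operator with degree a and through the inner
  one with degree c, so every composite has degree a + c.\<close>

lemma homog2_gbracket:
  assumes D: "d.cochain1 D" "homog1 a D" and E: "d.cochain1 E" "homog1 c E"
  shows "homog2 (a + c) (gbracket 1 1 D E)"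
  unfolding homog2_def
proof (intro ballI)
  fix f g h :: "_ \<Rightarrow> complex" assume C: "f \<in> Cinf (dual A)" "g \<in> Cinf (dual A)" "h \<in> Cinf (dual A)"
  note EC = C C[THEN euler_Cinf]
  have left: "euler A (D [E [f, g], h]) = D [E [euler A f, g], h] + D [E [f, euler A g], h] + D [E [f, g], euler A h] +
      scal (a + c) (D [E [f, g], h])"
    and right: "euler A (D [f, E [g, h]]) = D [euler A f, E [g, h]] + D [f, E [euler A g, h]] + D [f, E [g, euler A h]] +
      scal (a + c) (D [f, E [g, h]])"
    if D: "d.cochain1 D" "homog1 a D" and E: "d.cochain1 E" "homog1 c E" for D E a c
  proof -
    have hD: "euler A (D [u, v]) = D [euler A u, v] + D [u, euler A v] + scal a (D [u, v])"
      if "u \<in> Cinf (dual A)" "v \<in> Cinf (dual A)" for u v using D(2) that unfolding homog1_def by blast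
    have hE: "euler A (E [u, v]) = E [euler A u, v] + E [u, euler A v] + scal c (E [u, v])"
      if "u \<in> Cinf (dual A)" "v \<in> Cinf (dual A)" for u v using E(2) that unfolding homog1_def by blast
    note DC = d.cochain1_Cinf[OF D(1)] and EE = d.cochain1_Cinf[OF E(1)]
    note L1 = d.cochain1D(2)[OF D(1) C(3)] and L2 = d.cochain1D(3)[OF D(1) C(1)]
    have s: "scal (a + c) u = scal a u + scal c u" for u :: "'m \<times> ('v \<Rightarrow> real) \<Rightarrow> complex"
      by (simp add: scal_def fun_eq_iff pointwise algebra_simps)
    show "euler A (D [E [f, g], h]) = D [E [euler A f, g], h] + D [E [f, euler A g], h] + D [E [f, g], euler A h] +
      scal (a + c) (D [E [f, g], h])"
      by (simp add: hD hE EC EE d.Cinf_add d.Cinf_scal linear_opD(3)[OF L1] linear_opD(2)[OF L1] s algebra_simps)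
    show "euler A (D [f, E [g, h]]) = D [euler A f, E [g, h]] + D [f, E [euler A g, h]] + D [f, E [g, euler A h]] +
      scal (a + c) (D [f, E [g, h]])"
      by (simp add: hD hE EC EE d.Cinf_add d.Cinf_scal linear_opD(3)[OF L2] linear_opD(2)[OF L2] s algebra_simps)
  qed
  note l1 = left[OF D E] right[OF D E] and l2 = left[OF E D] right[OF E D]
  note DC = d.cochain1_Cinf[OF D(1)] and EE = d.cochain1_Cinf[OF E(1)]
  note E' = d.linear_op_uminus[OF derivation_linear_op[OF euler_derivation]]
    d.linear_op_diff[OF derivation_linear_op[OF euler_derivation]]
  have ac: "c + a = a + c" by simp
  show "euler A (gbracket 1 1 D E [f, g, h]) = gbracket 1 1 D E [euler A f, g, h] + gbracket 1 1 D E [f, euler A g, h] +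
      gbracket 1 1 D E [f, g, euler A h] + scal (a + c) (gbracket 1 1 D E [f, g, h])"
    unfolding d.gbracket_1_1
    by (simp add: E' euler_add C DC EE d.Cinf_add d.Cinf_diff d.Cinf_uminus l1 l2 ac scal_simps algebra_simps)
qed

lemma homog2_sum:
  assumes "\<And>i. i \<in> I \<Longrightarrow> d.cochain2 (u i)" "\<And>i. i \<in> I \<Longrightarrow> homog2 a (u i)"
  shows "homog2 a (\<Sum>i\<in>I. u i)"
  unfolding homog2_def
proof (intro ballI)
  fix f g h :: "_ \<Rightarrow> complex" assume C: "f \<in> Cinf (dual A)" "g \<in> Cinf (dual A)" "h \<in> Cinf (dual A)"
  have "euler A (u i [f, g, h]) = u i [euler A f, g, h] + u i [f, euler A g, h] + u i [f, g, euler A h] +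
      scal a (u i [f, g, h])" if "i \<in> I" for i
    using assms(2)[OF that] C unfolding homog2_def by blast
  moreover have "u i [f, g, h] \<in> Cinf (dual A)" if "i \<in> I" for i
    by (rule linear_opD(1)[OF d.cochain2D(2)[OF assms(1)[OF that] C(2,3)] C(1)])
  moreover have "scal a (\<Sum>i\<in>I. u i [f, g, h]) = (\<Sum>i\<in>I. scal a (u i [f, g, h]))"
    by (simp add: scal_def fun_eq_iff sum_fun_apply sum_distrib_left)
  ultimately show "euler A ((\<Sum>i\<in>I. u i) [f, g, h]) = (\<Sum>i\<in>I. u i) [euler A f, g, h] + (\<Sum>i\<in>I. u i) [f, euler A g, h] +
      (\<Sum>i\<in>I. u i) [f, g, euler A h] + scal a ((\<Sum>i\<in>I. u i) [f, g, h])"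
    by (simp add: sum_fun_apply[of u I "[_, _, _]"] d.linear_op_sum[OF derivation_linear_op[OF euler_derivation]] sum.distrib)
qed

end

section \<open>The recursion\<close>

lemma alternation_add:
  "alternation (\<lambda>f g h. F f g h + G f g h) f g h = alternation F f g h + alternation G f g h"
  by (simp add: alternation_def algebra_simps)

lemma alternation_scal:
  fixes F :: "('p \<Rightarrow> complex) \<Rightarrow> ('p \<Rightarrow> complex) \<Rightarrow> ('p \<Rightarrow> complex) \<Rightarrow> 'p \<Rightarrow> complex"
  shows "alternation (\<lambda>f g h. scal c (F f g h)) f g h = scal c (alternation F f g h)"
  by (simp add: alternation_def scal_simps)

lemma coboundary_form_add: "coboundary_form (D + E) f g h = coboundary_form D f g h + coboundary_form E f g h"
  by (simp add: coboundary_form_def plus_fun_apply[of D E] algebra_simps)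

lemma coboundary_form_scale: "coboundary_form (scale_op c D) f g h = scal c (coboundary_form D f g h)"
  by (simp add: coboundary_form_def scale_op_scal scal_def fun_eq_iff pointwise algebra_simps)

context atlas_mfd
begin

lemma alternation_cong:
  assumes "\<And>f g h. f \<in> Cinf X \<Longrightarrow> g \<in> Cinf X \<Longrightarrow> h \<in> Cinf X \<Longrightarrow> F f g h = G f g h"
    and "f \<in> Cinf X" "g \<in> Cinf X" "h \<in> Cinf X"
  shows "alternation F f g h = alternation G f g h"
  using assms by (simp add: alternation_def)

lemma bivector_scal:
  assumes P: "bivector X P"
  shows "bivector X (\<lambda>f g. scal c (P f g))"
  unfolding bivector_def
proof (intro conjI ballI)
  fix f g :: "'p \<Rightarrow> complex" assume f: "f \<in> Cinf X" and g: "g \<in> Cinf X"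
  show "scal c (P g f) = - scal c (P f g)"
    unfolding bivectorD(3)[OF P g f] by (rule scal_simps(3))
qed (rule derivation_scal[OF bivectorD(1)[OF P]])

lemma bivector_scal_left:
  "bivector X P \<Longrightarrow> f \<in> Cinf X \<Longrightarrow> h \<in> Cinf X \<Longrightarrow> P (scal c f) h = scal c (P f h)"
  by (rule derivationD(2)[OF bivectorD(1)])

text \<open>Expanding both products by Leibniz' rule cancels the outer terms. Thus adding
  \<open>hkr\<close> of a bivector field does not affect the associativity equation at its own
  order.\<close>

lemma coboundary_form_bivector:
  assumes D: "bivector X (\<lambda>f g. D [f, g])" and C: "f \<in> Cinf X" "g \<in> Cinf X" "h \<in> Cinf X"
  shows "coboundary_form D f g h = 0"
  unfolding coboundary_form_def bivector_rules(3)[OF D C] bivector_rules(4)[OF D C(2,3,1)]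
  by (simp add: algebra_simps)

lemma bilinear_op_cochain1: "cochain1 D \<Longrightarrow> bilinear_op X (\<lambda>f g. D [f, g])"
  by (simp add: bilinear_op_def cochain1D(2,3))

lemma bilinear_op_mu0: "bilinear_op X (\<lambda>f g. mu0 X [f, g])"
  unfolding bilinear_op_def
proof (intro ballI conjI)
  fix h :: "_ \<Rightarrow> complex" assume h: "h \<in> Cinf X"
  show "linear_op X (\<lambda>f. mu0 X [f, h])"
    by (rule linear_opI) (simp_all add: mu0_val h Cinf_mult Cinf_scal Cinf_add distrib_left distrib_right,
        simp add: scal_def fun_eq_iff pointwise)
  show "linear_op X (\<lambda>g. mu0 X [h, g])"
    by (rule linear_opI) (simp_all add: mu0_val h Cinf_mult Cinf_scal Cinf_add distrib_left distrib_right,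
        simp add: scal_def fun_eq_iff pointwise)
qed

text \<open>The extreme summands l = 0 and l = r, distinct because r \<ge> 1, pair
  \<open>c r\<close> with the pointwise product and form the coboundary of \<open>c r\<close>; the
  others involve lower orders only.\<close>

lemma associator_split:
  assumes c0: "\<And>f g. f \<in> Cinf X \<Longrightarrow> g \<in> Cinf X \<Longrightarrow> c 0 f g = f * g"
    and cr: "bilinear_op X (c r)" and r: "r \<ge> 1"
    and C: "f \<in> Cinf X" "g \<in> Cinf X" "h \<in> Cinf X"
  shows "associator c r f g h = c r f g * h - f * c r g h + c r (f * g) h - c r f (g * h) +
    (\<Sum>l = 1..r - 1. c l (c (r - l) f g) h - c l f (c (r - l) g h))"
proof -
  have "{..r} = insert 0 (insert r {1..r - 1})" using r by auto
  moreover have "0 \<notin> insert r {1..r - 1}" "r \<notin> {1..r - 1}" using r by auto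
  ultimately show ?thesis
    unfolding associator_def
    by (simp add: c0 C bilinear_Cinf[OF cr] algebra_simps)
qed

end

locale hkr_recursion = lie_algebroid_KKS A P
  for A :: "('m, 'v::real_vector, 'z) algebroid_scheme" and P :: "('m \<times> ('v \<Rightarrow> real)) oper" +
  fixes hi H :: "('m \<times> ('v \<Rightarrow> real)) oper \<Rightarrow> ('m \<times> ('v \<Rightarrow> real)) oper"
    and B :: "'m \<Rightarrow> 'v list \<Rightarrow> complex"
  assumes HKR: "HKR_maps A hi H" and B: "B \<in> forms A 2" and closed: "lie_closed A 2 B"
begin

abbreviation C where "C \<equiv> star_coeff A H P B"

abbreviation c where "c r f g \<equiv> C r [f, g]"

definition bracket_sum where "bracket_sum r = (\<Sum>l = 1..r - 1. gbracket 1 1 (C l) (C (r - l)))"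

lemma C_0: "C 0 = mu0 (dual A)"
  and C_1: "C (Suc 0) = scale_op (\<i> / 2) P"
  and C_2: "C 2 = scale_op (- 1 / 4) (sym_plus (H (bracket_sum 2))) + hkr (multi_vert_lift A 2 B)"
  and C_ge_3: "r \<ge> 3 \<Longrightarrow> C r = scale_op (- 1 / 2) (H (bracket_sum r))"
  by (simp_all add: star_coeff.simps[of A H P B 0] star_coeff.simps[of A H P B "Suc 0"]
      star_coeff.simps[of A H P B 2] star_coeff.simps[of A H P B r] bracket_sum_def)

lemma P_cochain1: "d.cochain1 P"
  by (rule d.bivector_cochain1)
    (use Pb_bivector multilinear_opsD(2)[OF multivector_fieldsD(1)[of P "dual A" 2]] KKS_multivector in
      \<open>simp_all add: Pb_def[abs_def]\<close>)

lemma P_homog1: "homog1 (- 1) P"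
  unfolding homog1_def
proof (intro ballI)
  fix f g :: "_ \<Rightarrow> complex" assume "f \<in> Cinf (dual A)" "g \<in> Cinf (dual A)"
  from Pb_homogeneous[OF this] show "euler A (P [f, g]) = P [euler A f, g] + P [f, euler A g] + scal (- 1) (P [f, g])"
    by (simp add: Pb_def algebra_simps)
qed

lemma hkr_B_val: "hkr (multi_vert_lift A 2 B) [f, g] = scal (1 / 2) (vert2 B f g)"
  by (simp add: hkr_def vert2_def[OF B])

lemma hkr_B_bivector: "bivector (dual A) (\<lambda>f g. hkr (multi_vert_lift A 2 B) [f, g])"
  unfolding hkr_B_val by (rule d.bivector_scal[OF vert2_bivector[OF B]])

lemma hkr_B_cochain1: "d.cochain1 (hkr (multi_vert_lift A 2 B))"
proof (rule d.bivector_cochain1[OF hkr_B_bivector])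
  fix fs assume "fs \<notin> args (dual A) 2"
  then have "multi_vert_lift A 2 B fs = 0" by (simp add: multi_vert_lift_def)
  then show "hkr (multi_vert_lift A 2 B) fs = 0" by (simp add: hkr_def scal_simps)
qed

lemma hkr_B_homog1: "homog1 (- 2) (hkr (multi_vert_lift A 2 B))"
  unfolding homog1_def hkr_B_val
proof (intro ballI)
  fix f g :: "_ \<Rightarrow> complex" assume f: "f \<in> Cinf (dual A)" and g: "g \<in> Cinf (dual A)"
  have "euler A (vert2 B f g) = vert2 B (euler A f) g + vert2 B f (euler A g) + scal (- 2) (vert2 B f g)"
    using vert2_homogeneous[OF B f g] by (simp add: algebra_simps)
  then show "euler A (scal (1 / 2) (vert2 B f g)) = scal (1 / 2) (vert2 B (euler A f) g) +
      scal (1 / 2) (vert2 B f (euler A g)) + scal (- 2) (scal (1 / 2) (vert2 B f g))"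
    unfolding derivationD(2)[OF euler_derivation d.bivector_Cinf[OF vert2_bivector[OF B] f g]]
    by (simp add: scal_simps)
qed

lemma c1_val: "c (Suc 0) f g = scal (\<i> / 2) (Pb f g)"
  by (simp add: C_1 scale_op_scal Pb_def)

lemma c1_bivector: "bivector (dual A) (c (Suc 0))"
  unfolding c1_val[abs_def] by (rule d.bivector_scal[OF Pb_bivector])

text \<open>The homotopy identity for a 2-cocycle R contains H applied to its differential 0, taken
  in degree 3. As H is only linear on each cochain space, 0 is first placed in that space.\<close>

lemma H_zero: "H 0 = 0"
proof -
  have "linear_on_ops (HC (dual A) 3) H"
    by (rule HKR[unfolded HKR_maps_def, THEN spec[of _ 3], THEN mp, THEN conjunct2, THEN conjunct1]) simp
  moreover have "0 \<in> HC (dual A) 3"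
  proof -
    have z: "(0 :: ('m \<times> ('v \<Rightarrow> real)) oper) fs = 0" for fs by (rule zero_fun_apply)
    have "0 \<in> multilinear_ops (dual A) 4"
      unfolding multilinear_ops_def by (simp add: d.Cinf_zero scal_simps z)
    moreover have "dorder (dual A) (Suc 0) (\<lambda>f. (0 :: ('m \<times> ('v \<Rightarrow> real)) oper) (fs[j := f]))" for fs j
      by (rule d.dorder_Suc) (simp add: z)
    ultimately have "0 \<in> polydiff_ops (dual A) 4"
      unfolding d.polydiff_ops_iff by blast
    then show ?thesis by (simp add: HC_def z)
  qed
  ultimately have "H (scale_op 0 0) = scale_op 0 (H 0)"
    unfolding linear_on_ops_def by blast
  moreover have "scale_op 0 D = 0" for D :: "('m \<times> ('v \<Rightarrow> real)) oper"
    by (simp add: scale_op_def fun_eq_iff pointwise)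
  ultimately show ?thesis by simp
qed

text \<open>The homotopy identity evaluated on functions: 1/6 is the factor 1/3! of
  \<open>hkr\<close>, and the minus sign is that between the Hochschild differential and
  \<open>coboundary_form\<close>.\<close>

lemma HKR_cocycle:
  assumes R: "d.cochain2 R" and dR: "hochschild_diff (dual A) 2 R = 0"
  shows "hi R \<in> multivector_fields (dual A) 3" "d.cochain1 (H R)"
    "f \<in> Cinf (dual A) \<Longrightarrow> g \<in> Cinf (dual A) \<Longrightarrow> h \<in> Cinf (dual A) \<Longrightarrow>
      R [f, g, h] = scal (1 / 6) (hi R [f, g, h]) - coboundary_form (H R) f g h"
    "homog2 (of_int j) R \<Longrightarrow> homogeneous_multivector A j (hi R)"
    "homog2 (of_int j) R \<Longrightarrow> homog1 (of_int j) (H R)"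
proof -
  have "R \<in> HC (dual A) 2" using R by (simp add: d.HC2_iff)
  moreover have "\<forall>D\<in>HC (dual A) 2. hi D \<in> multivector_fields (dual A) (2 + 1) \<and> H D \<in> HC (dual A) (2 - 1) \<and>
       hochschild_diff (dual A) (2 - 1) (H D) + H (hochschild_diff (dual A) 2 D) = D - hkr (hi D) \<and>
       (\<forall>j. homogeneous_op A 2 j D \<longrightarrow>
          homogeneous_multivector A j (hi D) \<and> homogeneous_op A (2 - 1) j (H D))"
    by (rule HKR[unfolded HKR_maps_def, THEN spec[of _ 2], THEN mp, THEN conjunct2, THEN conjunct2, THEN conjunct2]) simp
  ultimately have *: "hi R \<in> multivector_fields (dual A) 3 \<and> H R \<in> HC (dual A) 1 \<and>
       hochschild_diff (dual A) 1 (H R) + H (hochschild_diff (dual A) 2 R) = R - hkr (hi R) \<and>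
       (\<forall>j. homogeneous_op A 2 j R \<longrightarrow>
          homogeneous_multivector A j (hi R) \<and> homogeneous_op A 1 j (H R))"
    by simp
  then show "hi R \<in> multivector_fields (dual A) 3" by simp
  show HR: "d.cochain1 (H R)" using * by (simp add: d.HC1_iff)
  have eq: "R = hochschild_diff (dual A) 1 (H R) + hkr (hi R)"
    using * by (simp add: dR H_zero algebra_simps)
  show "R [f, g, h] = scal (1 / 6) (hi R [f, g, h]) - coboundary_form (H R) f g h"
    if "f \<in> Cinf (dual A)" "g \<in> Cinf (dual A)" "h \<in> Cinf (dual A)"
  proof -
    have "R [f, g, h] = hochschild_diff (dual A) 1 (H R) [f, g, h] + hkr (hi R) [f, g, h]"
      by (subst eq) (rule plus_fun_apply)
    also have "hkr (hi R) [f, g, h] = scal (1 / 6) (hi R [f, g, h])"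
      by (simp add: hkr_def fact_numeral)
    finally show ?thesis by (simp add: d.hochschild_diff_1_val[OF that HR])
  qed
  assume "homog2 (of_int j) R"
  then have "homogeneous_op A 2 j R" by (rule homogeneous_op_2I[OF R])
  then have "homogeneous_multivector A j (hi R) \<and> homogeneous_op A 1 j (H R)" using * by blast
  then show "homogeneous_multivector A j (hi R)" "homog1 (of_int j) (H R)"
    by (simp_all add: homogeneous_op_1_iff[OF HR])
qed

text \<open>Antisymmetrization kills the coboundary in the homotopy identity and multiplies the
  trivector part by 6. The obstruction is thereby expressed through R alone, without knowledge of
  \<open>hi\<close> or H.\<close>

lemma cocycle_obstruction:
  assumes R: "d.cochain2 R" and dR: "hochschild_diff (dual A) 2 R = 0"
    and C: "f \<in> Cinf (dual A)" "g \<in> Cinf (dual A)" "h \<in> Cinf (dual A)"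
  shows "hi R [f, g, h] = alternation (\<lambda>f g h. R [f, g, h]) f g h"
proof -
  have "alternation (\<lambda>f g h. R [f, g, h]) f g h =
      alternation (\<lambda>f g h. scal (1 / 6) (hi R [f, g, h]) + scal (- 1) (coboundary_form (H R) f g h)) f g h"
    by (rule d.alternation_cong[OF _ C]) (simp add: HKR_cocycle(3)[OF R dR] scal_minus_1)
  also have "\<dots> = hi R [f, g, h]"
    unfolding alternation_add alternation_scal d.alternation_multivector3[OF HKR_cocycle(1)[OF R dR] C]
      alternation_coboundary_form
    by (simp add: scal_simps)
  finally show ?thesis by simp
qed

definition lower_terms where "lower_terms r f g h = (\<Sum>l = 1..r - 1. c l (c (r - l) f g) h - c l f (c (r - l) g h))"

text \<open>The substitution of r - l for l shows that each composition is counted twice; the minus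
  sign is that of \<open>gbracket_1_1\<close>.\<close>

lemma bracket_sum_val: "bracket_sum r [f, g, h] = scal (- 2) (lower_terms r f g h)"
proof -
  let ?a = "\<lambda>l. c l (c (r - l) f g) h - c l f (c (r - l) g h)"
  have "bracket_sum r [f, g, h] = (\<Sum>l = 1..r - 1. - (?a l + ?a (r - l)))"
    unfolding bracket_sum_def sum_fun_apply[of _ _ "[f, g, h]"] d.gbracket_1_1 by (rule sum.cong) auto
  also have "\<dots> = - (sum ?a {1..r - 1} + (\<Sum>l = 1..r - 1. ?a (r - l)))"
    by (simp only: sum_negf sum.distrib)
  also have "(\<Sum>l = 1..r - 1. ?a (r - l)) = sum ?a {1..r - 1}"
    by (rule sum.reindex_bij_witness[of _ "\<lambda>l. r - l" "\<lambda>l. r - l"]) auto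
  finally show ?thesis unfolding lower_terms_def[symmetric] by (simp add: scal_def fun_eq_iff pointwise)
qed

text \<open>The induction hypothesis at one order. For r = 0 only the associator is required, since
  \<open>mu0\<close> does not vanish on constants and is no cochain of the complex.\<close>

definition admissible where "admissible r \<longleftrightarrow>
  (r \<ge> 1 \<longrightarrow> d.cochain1 (C r) \<and> homog1 (of_int (- int r)) (C r)) \<and>
  (\<forall>f\<in>Cinf (dual A). \<forall>g\<in>Cinf (dual A). \<forall>h\<in>Cinf (dual A). associator c r f g h = 0)"

lemma admissible_bilinear: "admissible r \<Longrightarrow> bilinear_op (dual A) (c r)"
  by (cases "r = 0") (simp_all add: C_0 d.bilinear_op_mu0 admissible_def d.bilinear_op_cochain1)

lemma associator_c:
  assumes "bilinear_op (dual A) (c r)" "r \<ge> 1" "f \<in> Cinf (dual A)" "g \<in> Cinf (dual A)" "h \<in> Cinf (dual A)"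
  shows "associator c r f g h = coboundary_form (C r) f g h + lower_terms r f g h"
  unfolding coboundary_form_def lower_terms_def
  by (rule d.associator_split[where c = c, OF _ assms]) (simp add: C_0 d.mu0_val)

lemma bracket_sum_cochain2:
  assumes "\<And>s. s < r \<Longrightarrow> admissible s"
  shows "d.cochain2 (bracket_sum r)"
  unfolding bracket_sum_def
  by (intro d.cochain2_sum d.cochain2_gbracket) (use assms in \<open>auto simp: admissible_def\<close>)

lemma bracket_sum_homog2:
  assumes "\<And>s. s < r \<Longrightarrow> admissible s"
  shows "homog2 (of_int (- int r)) (bracket_sum r)"
  unfolding bracket_sum_def
proof (rule homog2_sum)
  fix l assume l: "l \<in> {1..r - 1}"
  then have *: "d.cochain1 (C l)" "homog1 (of_int (- int l)) (C l)" "d.cochain1 (C (r - l))"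
    "homog1 (of_int (- int (r - l))) (C (r - l))"
    using assms[of l] assms[of "r - l"] by (auto simp: admissible_def)
  show "d.cochain2 (gbracket 1 1 (C l) (C (r - l)))" by (rule d.cochain2_gbracket[OF *(1,3)])
  have "of_int (- int l) + of_int (- int (r - l)) = (of_int (- int r) :: complex)"
    using l by (auto simp flip: of_int_add)
  then show "homog2 (of_int (- int r)) (gbracket 1 1 (C l) (C (r - l)))"
    using homog2_gbracket[OF *] by simp
qed

text \<open>The bracket sum is -2 times an order-r associator to which
  \<open>associator_cocycle\<close> applies, provided that \<open>C r\<close>, about which nothing
  is known yet, is kept out of it.\<close>

lemma bracket_sum_closed:
  assumes adm: "\<And>s. s < r \<Longrightarrow> admissible s" and r: "r \<ge> 1"
  shows "hochschild_diff (dual A) 2 (bracket_sum r) = 0"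
proof (rule d.hochschild_diff_2_eq_0[OF bracket_sum_cochain2[OF adm]])
  \<comment> \<open>The product truncated at order r: setting its coefficient of order r to 0
    removes the coboundary, so that its associator of order r consists of the lower terms alone,
    while the lower associators are unchanged.\<close>
  define c' where "c' l = (if l < r then c l else (\<lambda>f g. 0))" for l
  have bil: "bilinear_op (dual A) (c' l)" for l
    using admissible_bilinear[OF adm, of l]
    by (auto simp: c'_def bilinear_op_def linear_op_def d.Cinf_zero scal_simps)
  have c'0: "c' 0 f g = f * g" if "f \<in> Cinf (dual A)" "g \<in> Cinf (dual A)" for f g
    using r that by (simp add: c'_def C_0 d.mu0_val)
  have low: "associator c' s f g h = 0"
    if s: "s < r" and C: "f \<in> Cinf (dual A)" "g \<in> Cinf (dual A)" "h \<in> Cinf (dual A)" for s f g h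
  proof -
    have "associator c' s f g h = associator c s f g h"
      unfolding associator_def by (rule sum.cong) (use s in \<open>auto simp: c'_def\<close>)
    then show ?thesis using adm[OF s] C by (simp add: admissible_def)
  qed
  have top: "bracket_sum r [f, g, h] = scal (- 2) (associator c' r f g h)"
    if C: "f \<in> Cinf (dual A)" "g \<in> Cinf (dual A)" "h \<in> Cinf (dual A)" for f g h
  proof -
    have c'r: "c' r = (\<lambda>f g. 0)" by (simp add: c'_def)
    have "associator c' r f g h = (\<Sum>l = 1..r - 1. c' l (c' (r - l) f g) h - c' l f (c' (r - l) g h))"
      using d.associator_split[where c = c', OF _ bil r C] c'0 by (simp add: c'r)
    also have "\<dots> = lower_terms r f g h"
      unfolding lower_terms_def by (rule sum.cong) (auto simp: c'_def)
    finally show ?thesis by (simp add: bracket_sum_val)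
  qed
  fix a b e k :: "_ \<Rightarrow> complex" assume C: "a \<in> Cinf (dual A)" "b \<in> Cinf (dual A)" "e \<in> Cinf (dual A)" "k \<in> Cinf (dual A)"
  have "a * bracket_sum r [b, e, k] - bracket_sum r [a * b, e, k] + bracket_sum r [a, b * e, k] -
      bracket_sum r [a, b, e * k] + bracket_sum r [a, b, e] * k =
    scal (- 2) (a * associator c' r b e k - associator c' r (a * b) e k + associator c' r a (b * e) k -
      associator c' r a b (e * k) + associator c' r a b e * k)"
    by (simp only: top C d.Cinf_mult) (simp add: scal_def fun_eq_iff pointwise algebra_simps)
  also have "a * associator c' r b e k - associator c' r (a * b) e k + associator c' r a (b * e) k -
      associator c' r a b (e * k) + associator c' r a b e * k = 0"
    by (rule d.associator_cocycle[where c = c', OF bil _ _ C]) (simp_all add: c'0 low)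
  also have "scal (- 2) 0 = (0 :: 'm \<times> ('v \<Rightarrow> real) \<Rightarrow> complex)" by (rule scal_simps(9))
  finally show "a * bracket_sum r [b, e, k] - bracket_sum r [a * b, e, k] + bracket_sum r [a, b * e, k] -
      bracket_sum r [a, b, e * k] + bracket_sum r [a, b, e] * k = 0" .
qed

lemma alternation_lower_terms_2:
  assumes C: "f \<in> Cinf (dual A)" "g \<in> Cinf (dual A)" "h \<in> Cinf (dual A)"
  shows "alternation (lower_terms 2) f g h = 0"
proof -
  have m: "lower_terms 2 f g h = c (Suc 0) (c (Suc 0) f g) h - c (Suc 0) f (c (Suc 0) g h)" for f g h
    by (simp add: lower_terms_def)
  have "Pb (Pb f g) h + Pb (Pb g h) f + Pb (Pb h f) g = 0"
  proof -
    have s: "Pb (Pb u v) w = - Pb w (Pb u v)" if "u \<in> Cinf (dual A)" "v \<in> Cinf (dual A)" "w \<in> Cinf (dual A)" for u v w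
      by (rule Pb_swap[OF that(3) d.bivector_Cinf[OF Pb_bivector that(1,2)]])
    have "- Pb h (Pb f g) + - Pb f (Pb g h) + - Pb g (Pb h f) = - (Pb f (Pb g h) + Pb g (Pb h f) + Pb h (Pb f g))"
      by (simp add: algebra_simps)
    also have "\<dots> = 0" using KKS_jacobi[OF C] by (simp add: Pb_def)
    finally show ?thesis unfolding s[OF C] s[OF C(2,3,1)] s[OF C(3,1,2)] .
  qed
  \<comment> \<open>-1/4 is the square of \<i>/2, the normalization of \<open>C 1\<close>.\<close>
  then have "scal (- 1 / 4) (Pb (Pb f g) h + Pb (Pb g h) f + Pb (Pb h f) g) = 0" by (simp add: scal_simps)
  moreover have "alternation (lower_terms 2) f g h = scal 4 (c (Suc 0) (c (Suc 0) f g) h +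
      c (Suc 0) (c (Suc 0) g h) f + c (Suc 0) (c (Suc 0) h f) g)"
    unfolding m[abs_def]
    by (rule d.alternation_bivectors[where P = "c (Suc 0)" and Q = "c (Suc 0)", OF c1_bivector c1_bivector C])
  ultimately show ?thesis
    unfolding c1_val
    by (simp add: d.bivector_scal_left[OF Pb_bivector] d.bivector_Cinf[OF Pb_bivector] C scal_simps)
qed

text \<open>The lower terms are the compositions of \<open>C 1\<close> and \<open>C 2\<close> in
  both orders. After splitting \<open>C 2\<close>, the symmetric part contributes nothing and the
  bivector part yields the Schouten bracket with the lift of B, where closedness is used.\<close>

lemma alternation_lower_terms_3:
  assumes adm: "\<And>s. s < 3 \<Longrightarrow> admissible s"
    and C: "f \<in> Cinf (dual A)" "g \<in> Cinf (dual A)" "h \<in> Cinf (dual A)"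
  shows "alternation (lower_terms 3) f g h = 0"
proof -
  let ?p = "c (Suc 0)"
  \<comment> \<open>\<open>C 2\<close> is S + V with S symmetric by construction and V
    antisymmetric.\<close>
  define S where "S f g = scal (- 1 / 4) (sym_plus (H (bracket_sum 2)) [f, g])" for f g
  define V where "V f g = scal (1 / 2) (vert2 B f g)" for f g
  have V: "bivector (dual A) V" unfolding V_def[abs_def] by (rule d.bivector_scal[OF vert2_bivector[OF B]])
  have "d.cochain1 (H (bracket_sum 2))"
    by (rule HKR_cocycle(2)[OF bracket_sum_cochain2 bracket_sum_closed]) (use adm in auto)
  then have "d.cochain1 (scale_op (- 1 / 4) (sym_plus (H (bracket_sum 2))))"
    by (intro d.cochain1_scale d.cochain1_sym_plus)
  from d.bilinear_op_cochain1[OF this] have Sb: "bilinear_op (dual A) S"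
    by (simp add: scale_op_scal S_def[abs_def])
  have Ss: "S f g = S g f" for f g by (simp add: S_def sym_plus_def add.commute)
  have c2: "c 2 f g = S f g + V f g" for f g
    unfolding C_2 plus_fun_apply S_def V_def scale_op_scal hkr_B_val by (rule refl)
  have "alternation (lower_terms 3) f g h = alternation (\<lambda>f g h. (?p (S f g) h - ?p f (S g h)) + ((S (?p f g) h - S f (?p g h)) +
      ((?p (V f g) h - ?p f (V g h)) + (V (?p f g) h - V f (?p g h))))) f g h"
  proof (rule d.alternation_cong[OF _ C])
    fix f g h :: "_ \<Rightarrow> complex" assume C: "f \<in> Cinf (dual A)" "g \<in> Cinf (dual A)" "h \<in> Cinf (dual A)"
    have "{1..2} = {Suc 0, 2}" by auto
    then have "lower_terms 3 f g h = (?p (c 2 f g) h - ?p f (c 2 g h)) + (c 2 (?p f g) h - c 2 f (?p g h))"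
      by (simp add: lower_terms_def)
    also have "?p (c 2 f g) h = ?p (S f g) h + ?p (V f g) h"
      unfolding c2 by (rule d.bivector_rules(1)[OF c1_bivector])
        (simp_all add: C d.bilinear_Cinf[OF Sb] d.bivector_Cinf[OF V])
    also have "?p f (c 2 g h) = ?p f (S g h) + ?p f (V g h)"
      unfolding c2 by (rule d.bivector_rules(2)[OF c1_bivector])
        (simp_all add: C d.bilinear_Cinf[OF Sb] d.bivector_Cinf[OF V])
    finally show "lower_terms 3 f g h = (?p (S f g) h - ?p f (S g h)) + ((S (?p f g) h - S f (?p g h)) +
      ((?p (V f g) h - ?p f (V g h)) + (V (?p f g) h - V f (?p g h))))"
      unfolding c2 by (simp add: algebra_simps)
  qed
  also have "\<dots> = scal 4 (schouten ?p V f g h)"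
    unfolding alternation_add d.alternation_symmetric[where P = ?p and S = S, OF c1_bivector Ss C Sb]
      d.alternation_bivectors[where P = ?p and Q = V, OF c1_bivector V C]
      d.alternation_bivectors[where P = V and Q = ?p, OF V c1_bivector C]
    by (simp add: schouten_def scal_simps)
  \<comment> \<open>The factor is \<i>/2 from \<open>C 1\<close> times 1/2 = 1/2! from
    \<open>hkr\<close>.\<close>
  also have "schouten ?p V f g h = scal (\<i> / 4) (schouten Pb (vert2 B) f g h)"
    unfolding schouten_def c1_val V_def
    by (simp add: d.bivector_scal_left[OF Pb_bivector] d.bivector_scal_left[OF vert2_bivector[OF B]]
        d.bivector_Cinf[OF Pb_bivector] d.bivector_Cinf[OF vert2_bivector[OF B]] C scal_simps)
  finally show ?thesis by (simp add: schouten_KKS_vert2[OF B closed C] scal_simps)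
qed

lemma obstruction_eq_0:
  assumes adm: "\<And>s. s < r \<Longrightarrow> admissible s" and r: "r \<ge> 2"
    and C: "f \<in> Cinf (dual A)" "g \<in> Cinf (dual A)" "h \<in> Cinf (dual A)"
  shows "hi (bracket_sum r) [f, g, h] = 0"
proof -
  have r1: "r \<ge> 1" using r by simp
  have R: "d.cochain2 (bracket_sum r)" "hochschild_diff (dual A) 2 (bracket_sum r) = 0"
      "homog2 (of_int (- int r)) (bracket_sum r)"
    by (rule bracket_sum_cochain2, erule adm, rule bracket_sum_closed[OF _ r1], erule adm,
        rule bracket_sum_homog2, erule adm)
  have alt: "hi (bracket_sum r) [f, g, h] = scal (- 2) (alternation (lower_terms r) f g h)"
    unfolding cocycle_obstruction[OF R(1,2) C] bracket_sum_val by (rule alternation_scal)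
  consider "r = 2" | "r = 3" | "r \<ge> 4" using r by linarith
  then show ?thesis
  proof cases
    case 1
    then show ?thesis using alt alternation_lower_terms_2[OF C] by (simp add: scal_simps)
  next
    case 2
    then have "alternation (lower_terms r) f g h = 0" using alternation_lower_terms_3[OF _ C] adm by simp
    then show ?thesis using alt by (simp add: scal_simps)
  next
    case 3
    have "homogeneous_multivector A (- int r) (hi (bracket_sum r))"
      by (rule HKR_cocycle(4)[OF R])
    from homogeneous_multivector_3D[OF this] show ?thesis
      by (intro negative_trivector_eq_0[OF HKR_cocycle(1)[OF R(1,2)] 3 _ C]) simp
  qed
qed

text \<open>Without obstruction the homotopy identity makes the bracket sum minus the coboundary
  form of its image under H; dividing by the -2 of \<open>bracket_sum_val\<close> leaves 1/2. The
  factor -1/2 in the recursion is chosen to cancel this.\<close>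

lemma lower_terms_coboundary:
  assumes adm: "\<And>s. s < r \<Longrightarrow> admissible s" and r: "r \<ge> 2"
    and C: "f \<in> Cinf (dual A)" "g \<in> Cinf (dual A)" "h \<in> Cinf (dual A)"
  shows "lower_terms r f g h = scal (1 / 2) (coboundary_form (H (bracket_sum r)) f g h)"
proof -
  have r1: "r \<ge> 1" using r by simp
  have R: "d.cochain2 (bracket_sum r)" "hochschild_diff (dual A) 2 (bracket_sum r) = 0"
    by (rule bracket_sum_cochain2, erule adm, rule bracket_sum_closed[OF _ r1], erule adm)
  have T: "hi (bracket_sum r) [f, g, h] = 0" by (rule obstruction_eq_0[OF _ r C]) (rule adm)
  have "scal (- 2) (lower_terms r f g h) = - coboundary_form (H (bracket_sum r)) f g h"
    using HKR_cocycle(3)[OF R C] by (simp add: bracket_sum_val T scal_simps)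
  then have "scal (- 1 / 2) (scal (- 2) (lower_terms r f g h)) = scal (- 1 / 2) (- coboundary_form (H (bracket_sum r)) f g h)"
    by (rule arg_cong)
  then show ?thesis by (simp add: scal_def fun_eq_iff pointwise)
qed

text \<open>Two applications of antisymmetry of \<open>C 1\<close> turn C1(C1(h,g),f) into
  C1(f,C1(g,h)), which is the other term of the associator.\<close>

lemma lower_terms_2_reverse:
  assumes C: "f \<in> Cinf (dual A)" "g \<in> Cinf (dual A)" "h \<in> Cinf (dual A)"
  shows "lower_terms 2 h g f = - lower_terms 2 f g h"
proof -
  let ?p = "c (Suc 0)"
  note biv = c1_bivector
  have s: "?p v u = - ?p u v" if "u \<in> Cinf (dual A)" "v \<in> Cinf (dual A)" for u v
    by (rule d.bivectorD(3)[where P = ?p, OF biv that(2,1)])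
  note pC = d.bivector_Cinf[where P = ?p, OF biv]
  note neg = d.derivation_minus[OF d.bivectorD(1)[where P = ?p, OF biv]]
    d.derivation_minus[OF d.bivectorD(2)[where P = ?p, OF biv]]
  have "?p (?p h g) f = ?p f (?p g h)"
    unfolding s[OF C(2,3)] s[OF C(1) d.Cinf_uminus[OF pC[OF C(2,3)]]] neg(2)[OF C(1) pC[OF C(2,3)]] by simp
  moreover have "?p h (?p g f) = ?p (?p f g) h"
    unfolding s[OF C(1,2)] s[OF d.Cinf_uminus[OF pC[OF C(1,2)]] C(3)] neg(1)[OF C(3) pC[OF C(1,2)]] by simp
  ultimately show ?thesis by (simp add: lower_terms_def)
qed

lemma admissible_step:
  assumes adm: "\<And>s. s < r \<Longrightarrow> admissible s" and r: "r \<ge> 2"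
  shows "admissible r"
proof -
  have r1: "r \<ge> 1" using r by simp
  have R: "d.cochain2 (bracket_sum r)" "hochschild_diff (dual A) 2 (bracket_sum r) = 0"
      "homog2 (of_int (- int r)) (bracket_sum r)"
    by (rule bracket_sum_cochain2, erule adm, rule bracket_sum_closed[OF _ r1], erule adm,
        rule bracket_sum_homog2, erule adm)
  note HR = HKR_cocycle(2)[OF R(1,2)] HKR_cocycle(5)[OF R]
  have lower_terms: "lower_terms r f g h = scal (1 / 2) (coboundary_form (H (bracket_sum r)) f g h)"
    if "f \<in> Cinf (dual A)" "g \<in> Cinf (dual A)" "h \<in> Cinf (dual A)" for f g h
    by (rule lower_terms_coboundary[OF _ r that]) (rule adm)
  show ?thesis
  proof (cases "r = 2")
    case True
    let ?S = "scale_op (- 1 / 4) (sym_plus (H (bracket_sum r)))" and ?B = "hkr (multi_vert_lift A 2 B)"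
    have C: "C r = ?S + ?B" unfolding True by (rule C_2)
    have S: "d.cochain1 ?S" by (intro d.cochain1_scale d.cochain1_sym_plus HR(1))
    have coch: "d.cochain1 (C r)" unfolding C by (rule d.cochain1_add[OF S hkr_B_cochain1])
    have "homog1 (of_int (- int r)) ?B" using hkr_B_homog1 by (simp add: True)
    then have hom: "homog1 (of_int (- int r)) (C r)"
      unfolding C by (intro homog1_add[OF S hkr_B_cochain1] homog1_scale homog1_sym_plus d.cochain1_sym_plus HR)
    have "associator c r f g h = 0" if D: "f \<in> Cinf (dual A)" "g \<in> Cinf (dual A)" "h \<in> Cinf (dual A)" for f g h
    proof -
      have "lower_terms r h g f = - lower_terms r f g h" unfolding True by (rule lower_terms_2_reverse[OF D])
      then have "scal 2 (lower_terms r h g f) = - scal 2 (lower_terms r f g h)" by (simp add: scal_simps)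
      then have rev: "coboundary_form (H (bracket_sum r)) h g f = - coboundary_form (H (bracket_sum r)) f g h"
        unfolding lower_terms[OF D] lower_terms[OF D(3,2,1)] by (simp add: scal_simps)
      \<comment> \<open>With c the coboundary of the primitive, the symmetrization gives -1/4 (c -
        (-c)) = -1/2 c, the bivector part gives 0, and the lower terms give 1/2 c.\<close>
      show ?thesis
        unfolding associator_c[OF d.bilinear_op_cochain1[OF coch] r1 D] lower_terms[OF D] C coboundary_form_add
          coboundary_form_scale coboundary_form_sym_plus rev d.coboundary_form_bivector[OF hkr_B_bivector D]
        by (simp add: scal_def fun_eq_iff pointwise)
    qed
    then show ?thesis using coch hom by (simp add: admissible_def)
  next
    case False
    have C: "C r = scale_op (- 1 / 2) (H (bracket_sum r))" using r False by (intro C_ge_3) simp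
    have coch: "d.cochain1 (C r)" unfolding C by (rule d.cochain1_scale[OF HR(1)])
    have hom: "homog1 (of_int (- int r)) (C r)" unfolding C by (rule homog1_scale[OF HR])
    have "associator c r f g h = 0" if D: "f \<in> Cinf (dual A)" "g \<in> Cinf (dual A)" "h \<in> Cinf (dual A)" for f g h
      unfolding associator_c[OF d.bilinear_op_cochain1[OF coch] r1 D] lower_terms[OF D] C coboundary_form_scale
      by (simp add: scal_def fun_eq_iff pointwise)
    then show ?thesis using coch hom by (simp add: admissible_def)
  qed
qed

lemma admissible: "admissible r"
proof (induction r rule: less_induct)
  case (less r)
  consider "r = 0" | "r = 1" | "r \<ge> 2" by linarith
  then show ?case
  proof cases
    case 1
    have "associator c 0 f g h = 0" if D: "f \<in> Cinf (dual A)" "g \<in> Cinf (dual A)" "h \<in> Cinf (dual A)" for f g h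
      by (simp add: associator_def C_0 d.mu0_val D d.Cinf_mult mult.assoc)
    then show ?thesis by (simp add: 1 admissible_def)
  next
    case 2
    have coch: "d.cochain1 (C r)" unfolding 2 One_nat_def C_1 by (rule d.cochain1_scale[OF P_cochain1])
    have hom: "homog1 (- 1) (C r)" unfolding 2 One_nat_def C_1 by (rule homog1_scale[OF P_cochain1 P_homog1])
    have r: "r \<ge> 1" by (simp add: 2)
    have biv: "bivector (dual A) (\<lambda>f g. C r [f, g])" unfolding 2 One_nat_def by (rule c1_bivector)
    have "associator c r f g h = 0" if D: "f \<in> Cinf (dual A)" "g \<in> Cinf (dual A)" "h \<in> Cinf (dual A)" for f g h
      unfolding associator_c[OF d.bilinear_op_cochain1[OF coch] r D] d.coboundary_form_bivector[OF biv D]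
      by (simp add: lower_terms_def 2)
    then show ?thesis using coch hom by (simp add: admissible_def 2)
  next
    case 3
    show ?thesis by (rule admissible_step[OF less 3])
  qed
qed

theorem homogeneous_star_product: "homogeneous_star_product A C"
proof -
  have coch: "d.cochain1 (C r)" if "r \<ge> 1" for r using admissible[of r] that by (simp add: admissible_def)
  have "star_product (dual A) C"
    by (rule d.star_productI[where C = C, OF C_0 coch]) (use admissible in \<open>simp_all add: admissible_def\<close>)
  moreover have "homogeneous_op A 1 (- int r) (C r)" if "r \<ge> 1" for r
    using admissible[of r] that by (simp add: homogeneous_op_1_iff[OF coch] admissible_def)
  ultimately show ?thesis by (simp add: homogeneous_star_product_def)
qed

end

theorem proposition3p10:
  fixes A :: "('m, 'v::real_vector) algebroid"
    and nabla :: "('m \<times> ('v \<Rightarrow> real)) connection"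
    and hkr_inv H :: "('m \<times> ('v \<Rightarrow> real)) connection
          \<Rightarrow> ('m \<times> ('v \<Rightarrow> real)) oper \<Rightarrow> ('m \<times> ('v \<Rightarrow> real)) oper"
    and P :: "('m \<times> ('v \<Rightarrow> real)) oper"
    and B :: "'m \<Rightarrow> 'v list \<Rightarrow> complex"
  assumes "lie_algebroid A"
    and "covariant_derivative (dual A) nabla"
    and "torsion_free (dual A) nabla"
    and "homogeneous_connection A nabla"
    and "HKR_maps A (hkr_inv nabla) (H nabla)"
    and "KKS_bracket A P"
    and "B \<in> forms A 2"
    and "lie_closed A 2 B"
  shows "homogeneous_star_product A (star_coeff A (H nabla) P B)"
proof -
  interpret hkr_recursion A P "hkr_inv nabla" "H nabla" B
    by unfold_locales (rule assms)+
  show ?thesis by (rule homogeneous_star_product)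
qed

end
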